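(* Let $M$ be a smooth compact manifold and let $g$ be a smooth non-degenerate symmetric bilinear form on $TM$. Let $$\mathcal{G}_g:=\{\exp(\nabla_g f_n)\circ\dots\circ\exp(\nabla_g f_1)\mid f_1,\dots,f_n\in C^\infty(M,\mathbb{R}),\ n\in\mathbb{Z}_+\}.$$ Then the group $\mathcal{G}_g$ is dense in $\mathrm{Diff}_0(M)$, where $\mathrm{Diff}_0(M)$ is endowed with the compact-open topology.
   Context: The form $g$ is not assumed to be positive definite. For $f\in C^\infty(M,\mathbb{R})$, the gradient $\nabla_g f$ is the smooth vector field defined by $\mathrm{d}f_x(v)=g_x(\nabla_g f(x),v)$ for all $x\in M$ and $v\in T_xM$. For a smooth real vector field $X$ on $M$, $\exp(tX)$ denotes the flow at time $t\in\mathbb{R}$ of the ODE $\dot{x}(t)=X(x(t))$ on $M$, and $\exp(X)$ is the flow at time $1$. $\mathrm{Diff}_0(M)$ denotes the group of $C^\infty$-diffeomorphisms of $M$ connected to the identity (i.e. smoothly isotopic to the identity). $\mathbb{Z}_+=\{0,1,2,\dots\}$. *)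

theory Defs
  imports "HOL-Analysis.Analysis" "HOL-Algebra.Group"
begin

primrec Ck_on :: "nat \<Rightarrow> 'a::real_normed_vector set \<Rightarrow> ('a \<Rightarrow> 'b::real_normed_vector) \<Rightarrow> bool" where
  "Ck_on 0 S f \<longleftrightarrow> continuous_on S f"
| "Ck_on (Suc k) S f \<longleftrightarrow>
     (\<forall>x\<in>S. f differentiable (at x)) \<and> (\<forall>v. Ck_on k S (\<lambda>x. frechet_derivative f (at x) v))"

text \<open>Only meaningful for open \<open>S\<close>.\<close>
definition smooth_on :: "'a::real_normed_vector set \<Rightarrow> ('a \<Rightarrow> 'b::real_normed_vector) \<Rightarrow> bool" where
  "smooth_on S f \<longleftrightarrow> (\<forall>k. Ck_on k S f)"

text \<open>A manifold is a whole type \<open>'m\<close> (Hausdorff and second countable by its type classes) together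
  with an atlas of charts into the model space \<open>'e\<close>. The atlas need not be maximal; notions below
  depend only on the smooth structure it generates. There is no boundary, since charts have open
  images in \<open>'e\<close>, and \<open>'m\<close> need not be connected.\<close>
type_synonym ('m, 'e) chart = "'m set \<times> ('m \<Rightarrow> 'e)"

definition is_chart :: "'m::topological_space set \<Rightarrow> ('m \<Rightarrow> 'e::real_normed_vector) \<Rightarrow> bool" where
  "is_chart U \<phi> \<longleftrightarrow> open U \<and> open (\<phi> ` U) \<and> homeomorphism U (\<phi> ` U) \<phi> (inv_into U \<phi>)"

definition smooth_atlas :: "('m::{t2_space,second_countable_topology}, 'e::euclidean_space) chart set \<Rightarrow> bool" where
  "smooth_atlas A \<longleftrightarrow>
     (\<forall>(U, \<phi>)\<in>A. is_chart U \<phi>) \<and>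
     (\<Union>(U, \<phi>)\<in>A. U) = UNIV \<and>
     (\<forall>(U, \<phi>)\<in>A. \<forall>(V, \<psi>)\<in>A. smooth_on (\<phi> ` (U \<inter> V)) (\<psi> \<circ> inv_into U \<phi>))"

definition std_atlas :: "('e, 'e::euclidean_space) chart set" where
  "std_atlas = {(UNIV, id)}"

definition prod_atlas :: "('m, 'e) chart set \<Rightarrow> ('n, 'f) chart set \<Rightarrow> ('m \<times> 'n, 'e \<times> 'f) chart set" where
  "prod_atlas A B = {(U \<times> V, map_prod \<phi> \<psi>) | U \<phi> V \<psi>. (U, \<phi>) \<in> A \<and> (V, \<psi>) \<in> B}"

text \<open>\<open>S\<close> is meant to be an open subset of the source manifold.\<close>
definition smooth_map_on ::
  "'m::topological_space set \<Rightarrow> ('m, 'e::real_normed_vector) chart set \<Rightarrow>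
   ('n::topological_space, 'f::real_normed_vector) chart set \<Rightarrow> ('m \<Rightarrow> 'n) \<Rightarrow> bool" where
  "smooth_map_on S A B F \<longleftrightarrow>
     continuous_on S F \<and>
     (\<forall>(U, \<phi>)\<in>A. \<forall>(V, \<psi>)\<in>B.
        smooth_on (\<phi> ` (S \<inter> U \<inter> F -` V)) (\<psi> \<circ> F \<circ> inv_into U \<phi>))"

definition smooth_functions :: "('m::topological_space, 'e::euclidean_space) chart set \<Rightarrow> ('m \<Rightarrow> real) set" where
  "smooth_functions A = {f. smooth_map_on UNIV A std_atlas f}"

text \<open>Tangent vectors at \<open>x\<close> are the derivations at \<open>x\<close> of the algebra of smooth functions,
  extended by \<open>0\<close> to non-smooth functions so that equality of derivations is equality in HOL.
  Accordingly the differential of a smooth function is given by \<open>df\<^sub>x(v) = v f\<close>.\<close>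
type_synonym 'm tvector = "('m \<Rightarrow> real) \<Rightarrow> real"

definition tangent_space :: "('m::topological_space, 'e::euclidean_space) chart set \<Rightarrow> 'm \<Rightarrow> 'm tvector set" where
  "tangent_space A x = {v.
     (\<forall>f\<in>smooth_functions A. \<forall>h\<in>smooth_functions A.
        v (\<lambda>y. f y + h y) = v f + v h \<and>
        v (\<lambda>y. f y * h y) = f x * v h + v f * h x) \<and>
     (\<forall>a. \<forall>f\<in>smooth_functions A. v (\<lambda>y. a * f y) = a * v f) \<and>
     (\<forall>f. f \<notin> smooth_functions A \<longrightarrow> v f = 0)}"

definition differential :: "('m \<Rightarrow> real) \<Rightarrow> 'm tvector \<Rightarrow> real" where
  "differential f v = v f"

text \<open>The constant-coefficient coordinate field \<open>\<Sum>\<^sub>i u\<^sub>i \<partial>\<^sub>i\<close> of the chart \<open>(U, \<phi>)\<close>, at the point \<open>x\<close>.\<close>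
definition coord_vector ::
  "('m::topological_space, 'e::euclidean_space) chart set \<Rightarrow> 'm set \<Rightarrow> ('m \<Rightarrow> 'e) \<Rightarrow> 'e \<Rightarrow> 'm \<Rightarrow> 'm tvector" where
  "coord_vector A U \<phi> u x = (\<lambda>f. if f \<in> smooth_functions A
     then frechet_derivative (f \<circ> inv_into U \<phi>) (at (\<phi> x)) u else 0)"

text \<open>Smoothness of the tensor field means smoothness of its components in every chart.\<close>
definition nondegenerate_form ::
  "('m::topological_space, 'e::euclidean_space) chart set \<Rightarrow> ('m \<Rightarrow> 'm tvector \<Rightarrow> 'm tvector \<Rightarrow> real) \<Rightarrow> bool" where
  "nondegenerate_form A g \<longleftrightarrow>
     (\<forall>x. \<forall>v\<in>tangent_space A x. \<forall>w\<in>tangent_space A x. g x v w = g x w v) \<and>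
     (\<forall>x. \<forall>u\<in>tangent_space A x. \<forall>v\<in>tangent_space A x. \<forall>w\<in>tangent_space A x. \<forall>a b.
        g x (\<lambda>f. a * u f + b * v f) w = a * g x u w + b * g x v w) \<and>
     (\<forall>x. \<forall>v\<in>tangent_space A x. (\<forall>w\<in>tangent_space A x. g x v w = 0) \<longrightarrow> v = (\<lambda>f. 0)) \<and>
     (\<forall>(U, \<phi>)\<in>A. \<forall>u w. smooth_on (\<phi> ` U)
        ((\<lambda>x. g x (coord_vector A U \<phi> u x) (coord_vector A U \<phi> w x)) \<circ> inv_into U \<phi>))"

definition gradient ::
  "('m::topological_space, 'e::euclidean_space) chart set \<Rightarrow> ('m \<Rightarrow> 'm tvector \<Rightarrow> 'm tvector \<Rightarrow> real) \<Rightarrow>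
   ('m \<Rightarrow> real) \<Rightarrow> 'm \<Rightarrow> 'm tvector" where
  "gradient A g f x = (THE X. X \<in> tangent_space A x \<and>
     (\<forall>v\<in>tangent_space A x. differential f v = g x X v))"

text \<open>The velocity of a curve \<open>c\<close> at time \<open>t\<close>, as a derivation, is \<open>f \<mapsto> (f \<circ> c)'(t)\<close>.\<close>
definition has_velocity ::
  "('m::topological_space, 'e::euclidean_space) chart set \<Rightarrow> (real \<Rightarrow> 'm) \<Rightarrow> real \<Rightarrow> 'm tvector \<Rightarrow> bool" where
  "has_velocity A c t v \<longleftrightarrow> isCont c t \<and> v \<in> tangent_space A (c t) \<and>
     (\<forall>f\<in>smooth_functions A. ((f \<circ> c) has_real_derivative v f) (at t))"

definition integral_curve ::
  "('m::topological_space, 'e::euclidean_space) chart set \<Rightarrow> ('m \<Rightarrow> 'm tvector) \<Rightarrow> (real \<Rightarrow> 'm) \<Rightarrow> bool" where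
  "integral_curve A X c \<longleftrightarrow> (\<forall>t. has_velocity A c t (X (c t)))"

text \<open>On a compact manifold every smooth vector field is complete, so curves defined on all
  of \<open>\<real>\<close> suffice.\<close>
definition flow ::
  "('m::topological_space, 'e::euclidean_space) chart set \<Rightarrow> ('m \<Rightarrow> 'm tvector) \<Rightarrow> real \<Rightarrow> 'm \<Rightarrow> 'm" where
  "flow A X t x = (THE y. \<exists>c. integral_curve A X c \<and> c 0 = x \<and> c t = y)"

definition gradient_flow_compositions ::
  "('m::topological_space, 'e::euclidean_space) chart set \<Rightarrow> ('m \<Rightarrow> 'm tvector \<Rightarrow> 'm tvector \<Rightarrow> real) \<Rightarrow>
   ('m \<Rightarrow> 'm) set" where
  "gradient_flow_compositions A g =
     {fold (\<lambda>f F. flow A (gradient A g f) 1 \<circ> F) fs id | fs. set fs \<subseteq> smooth_functions A}"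

definition diffeomorphism ::
  "('m::topological_space, 'e::euclidean_space) chart set \<Rightarrow> ('m \<Rightarrow> 'm) \<Rightarrow> bool" where
  "diffeomorphism A F \<longleftrightarrow> smooth_map_on UNIV A A F \<and>
     (\<exists>G. smooth_map_on UNIV A A G \<and> G \<circ> F = id \<and> F \<circ> G = id)"

text \<open>Smoothness on \<open>[0,1] \<times> M\<close> is expressed by a smooth extension to an open neighbourhood \<open>J \<times> M\<close>.\<close>
definition isotopic_to_id ::
  "('m::topological_space, 'e::euclidean_space) chart set \<Rightarrow> ('m \<Rightarrow> 'm) \<Rightarrow> bool" where
  "isotopic_to_id A F \<longleftrightarrow>
     (\<exists>(H :: real \<Rightarrow> 'm \<Rightarrow> 'm) J. open J \<and> {0..1} \<subseteq> J \<and>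
        smooth_map_on (J \<times> UNIV) (prod_atlas std_atlas A) A (\<lambda>(t, x). H t x) \<and>
        (\<forall>t\<in>{0..1}. diffeomorphism A (H t)) \<and> H 0 = id \<and> H 1 = F)"

definition Diff0 :: "('m::topological_space, 'e::euclidean_space) chart set \<Rightarrow> ('m \<Rightarrow> 'm) set" where
  "Diff0 A = {F. diffeomorphism A F \<and> isotopic_to_id A F}"

definition Diff0_group :: "('m::topological_space, 'e::euclidean_space) chart set \<Rightarrow> ('m \<Rightarrow> 'm) monoid" where
  "Diff0_group A = \<lparr>carrier = Diff0 A, mult = (\<circ>), one = id\<rparr>"

definition compact_open_topology :: "('a::topological_space \<Rightarrow> 'b::topological_space) topology" where
  "compact_open_topology = topology_generated_by
     {{f. continuous_on UNIV f \<and> f ` K \<subseteq> U} | K U. compact K \<and> open U}"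

end

theory Submission
  imports Defs
begin

text \<open>
  For a cut-off \<open>b\<close> and a large frequency \<open>n\<close>, the flows of the gradients of \<open>n\<^sup>-\<^sup>3 b sin(n\<xi>)\<close> and \<open>cos(n\<xi>)\<close>
  have a commutator that generates, up to an error that vanishes as \<open>n\<close> grows, the vector field
  \<open>b g(\<nabla>\<xi>, \<nabla>\<xi>) \<nabla>\<xi>\<close>: the oscillating terms combine through \<open>sin\<^sup>2 + cos\<^sup>2 = 1\<close>. By nondegeneracy and
  polarization the vectors \<open>g(w, w) w\<close> span every tangent space, so with a partition of unity every continuous
  tangent vector field is, for short times, followed by elements of the group up to an error small compared
  with the time step. An isotopy \<open>H\<close> is a concatenation of short steps along such fields. Distances are
  measured by \<open>d x y = (\<Sum>f\<in>FF. \<bar>f x - f y\<bar>)\<close> for a finite separating family \<open>FF\<close> of smooth functions, and since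
  \<open>d x y \<le> C * d (H\<^sub>t x) (H\<^sub>t y)\<close> uniformly in \<open>t\<close>, the errors of the steps add up to an arbitrarily small total.
\<close>

section \<open>Calculus of functions of class \<open>C\<^sup>k\<close>\<close>

text \<open>Gradients form a linear space of fields, but a gradient times a function leaves it;
  localising by a partition of unity is therefore paid for by brackets. The power
  \<open>n^-3\<close> is forced: each of the two gradients carries one factor \<open>n\<close>, and
  the bracket differentiates an oscillating coefficient once more. Derivatives of these fields are
  huge, which is harmless because only positions of points are compared: the frequency is fixed
  first, depending on the tolerance, and only then does the time step shrink. The price is that the
  Lipschitz constants of the composed flows are out of control, so an early error cannot be pushed
  forward through later factors; it is pulled back by the isotopy, whose distortion is uniform. As
  \<open>g\<close> may be indefinite, g(w, w) can vanish or be negative; a single non-null vector is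
  enough for the polarization. Since tangent vectors are derivations, and gradients and flows are
  definite descriptions, existence, uniqueness and smooth dependence have to be established for each
  of them, in charts.\<close>

lemma Ck_on_subset: "Ck_on k S f \<Longrightarrow> T \<subseteq> S \<Longrightarrow> Ck_on k T f"
proof (induction k arbitrary: f)
  case 0 then show ?case by (auto intro: continuous_on_subset)
next
  case (Suc k)
  then have "Ck_on k T (\<lambda>x. frechet_derivative f (at x) v)" for v by simp
  with Suc show ?case by auto
qed

lemma Ck_on_cong:
  assumes "open S" "\<And>x. x \<in> S \<Longrightarrow> f x = g x" "Ck_on k S f"
  shows "Ck_on k S g"
  using assms(2,3)
proof (induction k arbitrary: f g)
  case 0 then show ?case using continuous_on_cong by (metis Ck_on.simps(1))
next
  case (Suc k)
  have D: "(g has_derivative frechet_derivative f (at x)) (at x)" if "x \<in> S" for x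
    using has_derivative_transform_within_open[OF _ \<open>open S\<close> that, of f] that Suc.prems
    by (auto simp: frechet_derivative_works)
  have "Ck_on k S (\<lambda>x. frechet_derivative g (at x) v)" for v
  proof (rule Suc.IH)
    show "Ck_on k S (\<lambda>x. frechet_derivative f (at x) v)" using Suc.prems by simp
    fix x assume "x \<in> S"
    from frechet_derivative_at[OF D[OF this]]
    show "frechet_derivative f (at x) v = frechet_derivative g (at x) v" by simp
  qed
  then show ?case using D by (auto simp: differentiable_def)
qed

lemma Ck_on_local:
  assumes "\<And>x. x \<in> S \<Longrightarrow> \<exists>T. open T \<and> x \<in> T \<and> Ck_on k T f"
  shows "Ck_on k S f"
  using assms
proof (induction k arbitrary: f)
  case 0
  show ?case unfolding Ck_on.simps
  proof (rule continuous_at_imp_continuous_on, intro ballI)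
    fix x assume "x \<in> S"
    with 0 show "isCont f x"
      unfolding Ck_on.simps by (metis continuous_on_eq_continuous_at)
  qed
next
  case (Suc k)
  have "Ck_on k S (\<lambda>x. frechet_derivative f (at x) v)" for v
  proof (rule Suc.IH)
    fix x assume "x \<in> S"
    from Suc.prems[OF this] show "\<exists>T. open T \<and> x \<in> T \<and> Ck_on k T (\<lambda>x. frechet_derivative f (at x) v)"
      by auto
  qed
  with Suc.prems show ?case by (metis Ck_on.simps(2))
qed

text \<open>The definition speaks of \<open>frechet_derivative\<close>, a choice operator. This rule
  trades it for an explicit derivative; uniqueness of the derivative identifies the two on the open
  set \<open>S\<close>.\<close>

lemma Ck_on_SucI:
  assumes "open S" "\<And>x. x \<in> S \<Longrightarrow> (f has_derivative f' x) (at x)"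
    "\<And>v. Ck_on k S (\<lambda>x. f' x v)"
  shows "Ck_on (Suc k) S f"
proof -
  have "Ck_on k S (\<lambda>x. frechet_derivative f (at x) v)" for v
    by (rule Ck_on_cong[OF assms(1) _ assms(3)[of v]]) (use frechet_derivative_at[OF assms(2)] in metis)
  with assms(2) show ?thesis by (auto simp: differentiable_def)
qed

lemma Ck_on_Suc_deriv:
  assumes "Ck_on (Suc k) S f" "x \<in> S"
  shows "(f has_derivative frechet_derivative f (at x)) (at x)"
  using assms by (auto simp: frechet_derivative_works)

lemma Ck_on_SucD: "Ck_on (Suc k) S f \<Longrightarrow> Ck_on k S f"
proof (induction k arbitrary: f)
  case 0
  then show ?case
    by (auto intro!: continuous_at_imp_continuous_on differentiable_imp_continuous_within)
next
  case (Suc k) then show ?case by (metis Ck_on.simps(2))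
qed

lemma Ck_on_le: "Ck_on k S f \<Longrightarrow> m \<le> k \<Longrightarrow> Ck_on m S f"
  by (induction k) (auto simp: le_Suc_eq dest: Ck_on_SucD simp del: Ck_on.simps(2))

lemma Ck_on_imp_continuous_on: "Ck_on k S f \<Longrightarrow> continuous_on S f"
  using Ck_on_le[of k S f 0] by simp

lemma Ck_on_const: "Ck_on k S (\<lambda>x. c)"
  by (induction k arbitrary: c) auto

lemma Ck_on_bounded_linear: "bounded_linear L \<Longrightarrow> Ck_on k S L"
proof (cases k)
  case (Suc m)
  assume L: "bounded_linear L"
  have "frechet_derivative L (at x) = L" for x
    using frechet_derivative_at[OF bounded_linear_imp_has_derivative[OF L]] by metis
  then show ?thesis using Suc L by (auto simp: Ck_on_const differentiable_def intro: bounded_linear_imp_has_derivative)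
qed (auto simp: linear_continuous_on)

lemma Ck_on_ident: "Ck_on k S (\<lambda>x. x)"
  by (rule Ck_on_bounded_linear[OF bounded_linear_ident])

lemma Ck_on_linear:
  assumes "open S" "bounded_linear L" "Ck_on k S f"
  shows "Ck_on k S (\<lambda>x. L (f x))"
  using assms(3)
proof (induction k arbitrary: f)
  case 0 then show ?case using bounded_linear.continuous_on[OF assms(2)] by simp
next
  case (Suc k)
  show ?case
    by (rule Ck_on_SucI[OF assms(1)])
      (use Suc in \<open>auto intro!: bounded_linear.has_derivative[OF assms(2)] simp: frechet_derivative_works\<close>)
qed

lemma Ck_on_add:
  assumes "open S" "Ck_on k S f" "Ck_on k S g"
  shows "Ck_on k S (\<lambda>x. f x + g x)"
  using assms(2,3)
proof (induction k arbitrary: f g)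
  case 0 then show ?case by (auto intro: continuous_on_add)
next
  case (Suc k)
  show ?case
    by (rule Ck_on_SucI[OF assms(1) has_derivative_add[OF Ck_on_Suc_deriv Ck_on_Suc_deriv]])
      (use Suc in auto)
qed

lemma Ck_on_bilinear:
  assumes "open S" "bounded_bilinear B" "Ck_on k S f" "Ck_on k S g"
  shows "Ck_on k S (\<lambda>x. B (f x) (g x))"
  using assms(3,4)
proof (induction k arbitrary: f g)
  case 0 then show ?case using bounded_bilinear.continuous_on[OF assms(2)] by auto
next
  case (Suc k)
  show ?case
  proof (rule Ck_on_SucI[OF assms(1) bounded_bilinear.FDERIV[OF assms(2)]])
    show "Ck_on k S (\<lambda>x. B (f x) (frechet_derivative g (at x) v) + B (frechet_derivative f (at x) v) (g x))" for v
      using Suc.prems Suc.prems[THEN Ck_on_SucD] by (intro Ck_on_add[OF assms(1)] Suc.IH) auto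
  qed (use Suc in \<open>auto simp: frechet_derivative_works\<close>)
qed

lemma Ck_on_sum:
  assumes "open S" "\<And>i. i \<in> I \<Longrightarrow> Ck_on k S (f i)"
  shows "Ck_on k S (\<lambda>x. \<Sum>i\<in>I. f i x)"
  using assms(2)
  by (induction I rule: infinite_finite_induct) (auto intro: Ck_on_const Ck_on_add[OF assms(1)])

lemma linear_euclidean_sum:
  assumes "linear L" shows "L v = (\<Sum>b\<in>Basis. (v \<bullet> b) *\<^sub>R L b)"
proof -
  have "L v = L (\<Sum>b\<in>Basis. (v \<bullet> b) *\<^sub>R b)" by (simp add: euclidean_representation)
  then show ?thesis using assms by (simp add: linear_sum linear_cmul)
qed

text \<open>The chain rule differentiates \<open>g\<close> in a direction that varies with
  \<open>x\<close>, while \<open>Ck_on\<close> only controls fixed directions. Expanding along the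
  finite \<open>Basis\<close> of the middle space reduces to fixed directions; this is why that
  space is Euclidean.\<close>

lemma Ck_on_compose:
  fixes f :: "'a::real_normed_vector \<Rightarrow> 'b::euclidean_space"
  assumes "open S" "Ck_on k S f" "Ck_on k T g" "f ` S \<subseteq> T"
  shows "Ck_on k S (\<lambda>x. g (f x))"
  using assms(2-4)
proof (induction k arbitrary: g f)
  case 0 then show ?case by (auto intro: continuous_on_compose2)
next
  case (Suc k)
  show ?case
  proof (rule Ck_on_SucI[OF assms(1)])
    fix x assume x: "x \<in> S"
    let ?D = "\<lambda>v. \<Sum>b\<in>Basis. (frechet_derivative f (at x) v \<bullet> b) *\<^sub>R frechet_derivative g (at (f x)) b"
    have g: "(g has_derivative frechet_derivative g (at (f x))) (at (f x))"
      using x Suc.prems by (intro Ck_on_Suc_deriv) auto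
    have f: "(f has_derivative frechet_derivative f (at x)) (at x)"
      using x Suc.prems by (intro Ck_on_Suc_deriv) auto
    have eq: "frechet_derivative g (at (f x)) w = (\<Sum>b\<in>Basis. (w \<bullet> b) *\<^sub>R frechet_derivative g (at (f x)) b)" for w
      using g by (intro linear_euclidean_sum) (auto simp: has_derivative_def bounded_linear.linear)
    from has_derivative_compose[OF f g] show "((\<lambda>x. g (f x)) has_derivative ?D) (at x)"
      by (rule has_derivative_eq_rhs) (rule ext, rule eq)
  next
    fix v
    have "Ck_on k S (\<lambda>x. frechet_derivative g (at (f x)) b)" for b
      using Suc.prems by (intro Suc.IH Ck_on_SucD[of k S f]) auto
    then show "Ck_on k S (\<lambda>x. \<Sum>b\<in>Basis. (frechet_derivative f (at x) v \<bullet> b) *\<^sub>R frechet_derivative g (at (f x)) b)"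
      using Suc.prems
      by (intro Ck_on_sum Ck_on_bilinear[OF assms(1) bounded_bilinear_scaleR]
          Ck_on_linear[OF assms(1) bounded_linear_inner_left] assms(1)) auto
  qed
qed

lemma Ck_on_Pair:
  assumes "open S" "Ck_on k S f" "Ck_on k S g"
  shows "Ck_on k S (\<lambda>x. (f x, g x))"
proof -
  have "Ck_on k S (\<lambda>x. (f x, 0) + (0, g x))"
    using assms by (intro Ck_on_add Ck_on_linear[of S "\<lambda>x. (x, 0)"] Ck_on_linear[of S "\<lambda>x. (0, x)"])
      (auto intro!: bounded_linear_Pair bounded_linear_ident bounded_linear_zero)
  then show ?thesis by simp
qed

text \<open>A derivative at a moving point in a moving direction loses exactly one order. It is the
  form in which linearised equations and fields acting on functions occur later.\<close>

lemma Ck_on_deriv_dir: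
  fixes f :: "'a::euclidean_space \<Rightarrow> 'c::real_normed_vector" and d :: "'b::real_normed_vector \<Rightarrow> 'a"
  assumes "open S" "Ck_on (Suc k) T f" "Ck_on k S p" "Ck_on k S d" "p ` S \<subseteq> T"
  shows "Ck_on k S (\<lambda>x. frechet_derivative f (at (p x)) (d x))"
proof -
  have "Ck_on k T (\<lambda>x. frechet_derivative f (at x) b)" for b using assms(2) by simp
  from Ck_on_compose[OF assms(1,3) this assms(5)]
  have "Ck_on k S (\<lambda>x. \<Sum>b\<in>Basis. (d x \<bullet> b) *\<^sub>R frechet_derivative f (at (p x)) b)"
    by (intro Ck_on_sum Ck_on_bilinear[OF assms(1) bounded_bilinear_scaleR]
          Ck_on_linear[OF assms(1) bounded_linear_inner_left] assms(1,4))
  moreover have "(\<Sum>b\<in>Basis. (d x \<bullet> b) *\<^sub>R frechet_derivative f (at (p x)) b) = frechet_derivative f (at (p x)) (d x)"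
    if "x \<in> S" for x
  proof -
    have "p x \<in> T" using that assms by auto
    from Ck_on_Suc_deriv[OF assms(2) this] show ?thesis
      by (intro linear_euclidean_sum[symmetric]) (auto simp: has_derivative_def bounded_linear.linear)
  qed
  ultimately show ?thesis by (rule Ck_on_cong[OF assms(1), rotated])
qed

text \<open>Continuous partial derivatives along an orthonormal basis suffice for differentiability;
  the increment is telescoped along the coordinate directions.\<close>

lemma has_derivative_partials:
  fixes f :: "'a::euclidean_space \<Rightarrow> 'b::real_normed_vector"
  assumes S: "open S" "x \<in> S"
    and D: "\<And>y b. y \<in> S \<Longrightarrow> b \<in> Basis \<Longrightarrow> ((\<lambda>h. f (y + h *\<^sub>R b)) has_vector_derivative D b y) (at 0)"
    and C: "\<And>b. b \<in> Basis \<Longrightarrow> continuous_on S (D b)"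
  shows "(f has_derivative (\<lambda>v. \<Sum>b\<in>Basis. (v \<bullet> b) *\<^sub>R D b x)) (at x)"
proof -
  have step: "\<exists>d>0. \<forall>v. norm v < d \<longrightarrow>
      norm (f (x + (\<Sum>b\<in>B. (v \<bullet> b) *\<^sub>R b)) - f x - (\<Sum>b\<in>B. (v \<bullet> b) *\<^sub>R D b x)) \<le> real (card B) * e * norm v"
    if "finite B" "B \<subseteq> Basis" "e > 0" for B e
    using that
  proof (induction B rule: finite_induct)
    case empty then show ?case by (auto intro!: exI[of _ 1])
  next
    case (insert b B)
    then obtain d where d: "d > 0" "\<And>v. norm v < d \<Longrightarrow>
      norm (f (x + (\<Sum>b\<in>B. (v \<bullet> b) *\<^sub>R b)) - f x - (\<Sum>b\<in>B. (v \<bullet> b) *\<^sub>R D b x)) \<le> real (card B) * e * norm v"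
      by auto
    have b: "b \<in> Basis" using insert by auto
    have "isCont (D b) x" using C[OF b] S by (simp add: continuous_on_eq_continuous_at)
    then obtain r1 where r1: "r1 > 0" "\<And>y. dist y x < r1 \<Longrightarrow> dist (D b y) (D b x) < e"
      using \<open>e > 0\<close> unfolding continuous_at_eps_delta by metis
    obtain r2 where r2: "r2 > 0" "ball x r2 \<subseteq> S" using S open_contains_ball by blast
    define r where "r = min r1 r2"
    \<comment> \<open>A sum of \<open>card B\<close> coordinate vectors of \<open>v\<close> and one
      more has norm at most \<open>m * norm v\<close>, so \<open>norm v < r / m\<close> keeps all
      intermediate points within \<open>r\<close> of \<open>x\<close>.\<close>
    define m where "m = real (card B + 1)"
    have m: "m \<ge> 1" by (simp add: m_def)
    show ?case
    proof (intro exI[of _ "min d (r / m)"] conjI allI impI)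
      show "0 < min d (r / m)" using d r1 r2 m by (simp add: r_def)
      fix v :: 'a assume v: "norm v < min d (r / m)"
      define w where "w = (\<Sum>b\<in>B. (v \<bullet> b) *\<^sub>R b)"
      have w: "norm w \<le> real (card B) * norm v"
        unfolding w_def using insert.prems Basis_le_norm[of _ v]
        by (intro sum_norm_bound) (auto simp: subset_iff)
      have inball: "norm (w + t *\<^sub>R b) < r" if "t \<in> closed_segment 0 (v \<bullet> b)" for t
      proof -
        have "\<bar>t\<bar> \<le> \<bar>v \<bullet> b\<bar>" using that by (auto simp: closed_segment_eq_real_ivl split: if_splits)
        also have "\<dots> \<le> norm v" using Basis_le_norm[OF b] by blast
        finally have "norm (w + t *\<^sub>R b) \<le> m * norm v"
          using w b norm_triangle_ineq[of w "t *\<^sub>R b"] by (simp add: m_def algebra_simps)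
        also have "\<dots> < r" using v m by (auto simp: field_simps)
        finally show ?thesis .
      qed
      \<comment> \<open>Mean value inequality on the last coordinate segment, applied to
        \<open>f\<close> minus its expected linear part, so that the derivative there is the small
        difference \<open>D b (...) - D b x\<close>.\<close>
      have "norm ((f (x + w + (v \<bullet> b) *\<^sub>R b) - (v \<bullet> b) *\<^sub>R D b x) - (f (x + w + 0 *\<^sub>R b) - 0 *\<^sub>R D b x))
          \<le> e * norm (v \<bullet> b - 0)"
      proof (rule differentiable_bound[where S="closed_segment 0 (v \<bullet> b)"
            and f="\<lambda>t. f (x + w + t *\<^sub>R b) - t *\<^sub>R D b x"
            and f'="\<lambda>t h. h *\<^sub>R (D b (x + w + t *\<^sub>R b) - D b x)"])
        fix t assume t: "t \<in> closed_segment 0 (v \<bullet> b)"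
        have inS: "x + w + t *\<^sub>R b \<in> ball x r"
          using inball[OF t] unfolding mem_ball by (metis add.assoc add_diff_cancel_left' dist_commute dist_norm)
        then have "((\<lambda>h. f (x + w + t *\<^sub>R b + h *\<^sub>R b)) has_vector_derivative D b (x + w + t *\<^sub>R b)) (at 0)"
          using r2 b by (intro D) (auto simp: r_def)
        then have "(((\<lambda>h. f (x + w + t *\<^sub>R b + h *\<^sub>R b)) \<circ> (\<lambda>s. s - t)) has_vector_derivative 1 *\<^sub>R D b (x + w + t *\<^sub>R b)) (at t)"
          by (intro vector_diff_chain_at) (auto intro!: derivative_eq_intros)
        then have "((\<lambda>s. f (x + w + s *\<^sub>R b)) has_vector_derivative D b (x + w + t *\<^sub>R b)) (at t)"
          by (simp add: o_def algebra_simps)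
        then have "((\<lambda>t. f (x + w + t *\<^sub>R b) - t *\<^sub>R D b x) has_vector_derivative (D b (x + w + t *\<^sub>R b) - D b x)) (at t)"
          by (auto intro!: derivative_eq_intros)
        then show "((\<lambda>t. f (x + w + t *\<^sub>R b) - t *\<^sub>R D b x) has_derivative
           (\<lambda>h. h *\<^sub>R (D b (x + w + t *\<^sub>R b) - D b x))) (at t within closed_segment 0 (v \<bullet> b))"
          by (auto simp: has_vector_derivative_def intro: has_derivative_at_withinI)
        have "norm (D b (x + w + t *\<^sub>R b) - D b x) < e"
          using r1(2)[of "x + w + t *\<^sub>R b"] inS unfolding dist_norm[symmetric] r_def mem_ball
          by (simp add: dist_commute)
        then show "onorm (\<lambda>h. h *\<^sub>R (D b (x + w + t *\<^sub>R b) - D b x)) \<le> e"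
          by (intro onorm_bound) (use \<open>e > 0\<close> in \<open>auto simp: mult.commute[of e] intro!: mult_left_mono\<close>)
      qed auto
      then have "norm (f (x + (w + (v \<bullet> b) *\<^sub>R b)) - f (x + w) - (v \<bullet> b) *\<^sub>R D b x) \<le> e * \<bar>v \<bullet> b\<bar>"
        by (simp add: algebra_simps)
      also have "\<dots> \<le> e * norm v"
        using \<open>e > 0\<close> by (intro mult_left_mono Basis_le_norm b) simp
      finally have A: "norm (f (x + (w + (v \<bullet> b) *\<^sub>R b)) - f (x + w) - (v \<bullet> b) *\<^sub>R D b x) \<le> e * norm v" .
      have Bd: "norm (f (x + w) - f x - (\<Sum>b\<in>B. (v \<bullet> b) *\<^sub>R D b x)) \<le> real (card B) * e * norm v"
        using d(2)[of v] v by (simp add: w_def)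
      have "norm ((f (x + (w + (v \<bullet> b) *\<^sub>R b)) - f (x + w) - (v \<bullet> b) *\<^sub>R D b x) +
          (f (x + w) - f x - (\<Sum>b\<in>B. (v \<bullet> b) *\<^sub>R D b x))) \<le> e * norm v + real (card B) * e * norm v"
        by (rule order_trans[OF norm_triangle_ineq]) (use A Bd in linarith)
      then show "norm (f (x + (\<Sum>b\<in>insert b B. (v \<bullet> b) *\<^sub>R b)) - f x - (\<Sum>b\<in>insert b B. (v \<bullet> b) *\<^sub>R D b x))
          \<le> real (card (insert b B)) * e * norm v"
        unfolding sum.insert[OF insert.hyps(1,2)] card_insert_disjoint[OF insert.hyps(1,2)] w_def[symmetric]
        by (simp add: algebra_simps)
    qed
  qed
  show ?thesis
    unfolding has_derivative_at_alt
  proof (intro conjI allI impI)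
    show "bounded_linear (\<lambda>v. \<Sum>b\<in>Basis. (v \<bullet> b) *\<^sub>R D b x)"
      by (intro bounded_linear_sum bounded_linear_scaleR_const bounded_linear_inner_left)
    fix e :: real assume "e > 0"
    have pos: "e / real DIM('a) > 0" using \<open>e > 0\<close> by simp
    from step[OF finite_Basis order_refl pos] obtain d where d: "d > 0" "\<And>v. norm v < d \<Longrightarrow>
      norm (f (x + v) - f x - (\<Sum>b\<in>Basis. (v \<bullet> b) *\<^sub>R D b x)) \<le> e * norm v"
      unfolding euclidean_representation by fastforce
    show "\<exists>d>0. \<forall>y. norm (y - x) < d \<longrightarrow>
      norm (f y - f x - (\<Sum>b\<in>Basis. ((y - x) \<bullet> b) *\<^sub>R D b x)) \<le> e * norm (y - x)"
    proof (intro exI conjI allI impI)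
      fix y assume "norm (y - x) < d"
      from d(2)[OF this] show "norm (f y - f x - (\<Sum>b\<in>Basis. ((y - x) \<bullet> b) *\<^sub>R D b x)) \<le> e * norm (y - x)"
        by simp
    qed (rule d(1))
  qed
qed

lemma Ck_on_partials:
  fixes f :: "'a::euclidean_space \<Rightarrow> 'b::real_normed_vector"
  assumes S: "open S"
    and D: "\<And>y b. y \<in> S \<Longrightarrow> b \<in> Basis \<Longrightarrow> ((\<lambda>h. f (y + h *\<^sub>R b)) has_vector_derivative D b y) (at 0)"
    and C: "\<And>b. b \<in> Basis \<Longrightarrow> Ck_on k S (D b)"
  shows "Ck_on (Suc k) S f"
proof (rule Ck_on_SucI[OF S has_derivative_partials[OF S _ D]])
  show "Ck_on k S (\<lambda>x. \<Sum>b\<in>Basis. (v \<bullet> b) *\<^sub>R D b x)" for v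
    by (intro Ck_on_sum S Ck_on_linear[OF S bounded_linear_scaleR_right] C)
  show "continuous_on S (D b)" if "b \<in> Basis" for b
    using C[OF that] by (rule Ck_on_imp_continuous_on)
qed auto

lemma Ck_on_field_derivative:
  fixes f :: "real \<Rightarrow> real"
  assumes "open S" "\<And>t. t \<in> S \<Longrightarrow> (f has_field_derivative f' t) (at t)" "Ck_on k S f'"
  shows "Ck_on (Suc k) S f"
  by (rule Ck_on_SucI[OF assms(1), of _ "\<lambda>t v. f' t * v"])
    (use assms in \<open>auto simp: has_field_derivative_def
      intro!: Ck_on_linear[OF assms(1) bounded_linear_mult_left]\<close>)

subsection \<open>Smooth functions\<close>

lemma smooth_on_Ck: "smooth_on S f \<Longrightarrow> Ck_on k S f"
  by (simp add: smooth_on_def)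

lemma smooth_on_subset: "smooth_on S f \<Longrightarrow> T \<subseteq> S \<Longrightarrow> smooth_on T f"
  by (simp add: smooth_on_def Ck_on_subset[of _ S])

lemma smooth_on_cong: "open S \<Longrightarrow> smooth_on S f \<Longrightarrow> (\<And>x. x \<in> S \<Longrightarrow> f x = g x) \<Longrightarrow> smooth_on S g"
  unfolding smooth_on_def
proof
  fix k assume "open S" "\<forall>k. Ck_on k S f" "\<And>x. x \<in> S \<Longrightarrow> f x = g x"
  then show "Ck_on k S g" using Ck_on_cong[of S f g k] by simp
qed

lemma smooth_on_local: "(\<And>x. x \<in> S \<Longrightarrow> \<exists>T. open T \<and> x \<in> T \<and> smooth_on T f) \<Longrightarrow> smooth_on S f"
  unfolding smooth_on_def
proof (intro allI Ck_on_local)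
  fix k x assume "\<And>x. x \<in> S \<Longrightarrow> \<exists>T. open T \<and> x \<in> T \<and> (\<forall>k. Ck_on k T f)" "x \<in> S"
  from this(1)[OF this(2)] show "\<exists>T. open T \<and> x \<in> T \<and> Ck_on k T f" by blast
qed

lemma smooth_on_continuous: "smooth_on S f \<Longrightarrow> continuous_on S f"
  by (rule Ck_on_imp_continuous_on[OF smooth_on_Ck])

lemma smooth_on_const: "smooth_on S (\<lambda>x. c)"
  by (simp add: smooth_on_def Ck_on_const)

lemma smooth_on_bounded_linear: "bounded_linear L \<Longrightarrow> smooth_on S L"
  by (simp add: smooth_on_def Ck_on_bounded_linear)

lemma smooth_on_linear: "open S \<Longrightarrow> bounded_linear L \<Longrightarrow> smooth_on S f \<Longrightarrow> smooth_on S (\<lambda>x. L (f x))"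
  by (simp add: smooth_on_def Ck_on_linear)

lemma smooth_on_add: "open S \<Longrightarrow> smooth_on S f \<Longrightarrow> smooth_on S g \<Longrightarrow> smooth_on S (\<lambda>x. f x + g x)"
  by (simp add: smooth_on_def Ck_on_add)

lemma smooth_on_sum: "open S \<Longrightarrow> (\<And>i. i \<in> I \<Longrightarrow> smooth_on S (f i)) \<Longrightarrow> smooth_on S (\<lambda>x. \<Sum>i\<in>I. f i x)"
  by (simp add: smooth_on_def Ck_on_sum)

lemma smooth_on_bilinear:
  "open S \<Longrightarrow> bounded_bilinear B \<Longrightarrow> smooth_on S f \<Longrightarrow> smooth_on S g \<Longrightarrow> smooth_on S (\<lambda>x. B (f x) (g x))"
  by (simp add: smooth_on_def Ck_on_bilinear)

lemma smooth_on_mult: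
  fixes f g :: "'a::real_normed_vector \<Rightarrow> real"
  shows "open S \<Longrightarrow> smooth_on S f \<Longrightarrow> smooth_on S g \<Longrightarrow> smooth_on S (\<lambda>x. f x * g x)"
  by (rule smooth_on_bilinear[OF _ bounded_bilinear_mult])

lemma smooth_on_scaleR:
  "open S \<Longrightarrow> smooth_on S f \<Longrightarrow> smooth_on S g \<Longrightarrow> smooth_on S (\<lambda>x. f x *\<^sub>R g x)"
  by (rule smooth_on_bilinear[OF _ bounded_bilinear_scaleR])

lemma smooth_on_diff: "open S \<Longrightarrow> smooth_on S f \<Longrightarrow> smooth_on S g \<Longrightarrow> smooth_on S (\<lambda>x. f x - g x)"
  using smooth_on_add[of S f "\<lambda>x. - g x"] smooth_on_linear[OF _ bounded_linear_minus[OF bounded_linear_ident], of S g]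
  by simp

lemma smooth_on_compose:
  fixes f :: "'a::real_normed_vector \<Rightarrow> 'b::euclidean_space"
  shows "open S \<Longrightarrow> smooth_on S f \<Longrightarrow> smooth_on T g \<Longrightarrow> f ` S \<subseteq> T \<Longrightarrow> smooth_on S (\<lambda>x. g (f x))"
  unfolding smooth_on_def by (intro allI Ck_on_compose[of S _ f T g]) simp_all

lemma smooth_on_Pair: "open S \<Longrightarrow> smooth_on S f \<Longrightarrow> smooth_on S g \<Longrightarrow> smooth_on S (\<lambda>x. (f x, g x))"
  by (simp add: smooth_on_def Ck_on_Pair)

lemma smooth_on_has_derivative:
  "smooth_on S f \<Longrightarrow> x \<in> S \<Longrightarrow> (f has_derivative frechet_derivative f (at x)) (at x)"
  by (rule Ck_on_Suc_deriv[OF smooth_on_Ck])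

lemma smooth_on_frechet: "smooth_on S f \<Longrightarrow> smooth_on S (\<lambda>x. frechet_derivative f (at x) v)"
  unfolding smooth_on_def
proof
  fix k assume "\<forall>k. Ck_on k S f"
  then have "Ck_on (Suc k) S f" by blast
  then show "Ck_on k S (\<lambda>x. frechet_derivative f (at x) v)" by simp
qed

lemma smooth_on_frechet_dir:
  fixes f :: "'a::euclidean_space \<Rightarrow> 'c::real_normed_vector" and d :: "'b::real_normed_vector \<Rightarrow> 'a"
  assumes "open S" "smooth_on T f" "smooth_on S p" "smooth_on S d" "p ` S \<subseteq> T"
  shows "smooth_on S (\<lambda>x. frechet_derivative f (at (p x)) (d x))"
  unfolding smooth_on_def
  by (intro allI Ck_on_deriv_dir[OF assms(1) _ _ _ assms(5)] smooth_on_Ck assms)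

lemma smooth_on_sin_cos: "smooth_on UNIV (sin :: real \<Rightarrow> real)" "smooth_on UNIV (cos :: real \<Rightarrow> real)"
proof -
  have "Ck_on k UNIV (sin :: real \<Rightarrow> real) \<and> Ck_on k UNIV (cos :: real \<Rightarrow> real)" for k
  proof (induction k)
    case 0 show ?case by (simp add: continuous_on_sin continuous_on_cos)
  next
    case (Suc k)
    then have "Ck_on (Suc k) UNIV (sin :: real \<Rightarrow> real)"
      by (intro Ck_on_field_derivative[of _ _ cos]) (auto intro: DERIV_sin)
    moreover have "Ck_on (Suc k) UNIV (cos :: real \<Rightarrow> real)"
      using Suc Ck_on_linear[OF open_UNIV bounded_linear_minus[OF bounded_linear_ident], of k "sin :: real \<Rightarrow> real"]
      by (intro Ck_on_field_derivative[of _ _ "\<lambda>x. - sin x"]) (auto intro: DERIV_cos)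
    ultimately show ?case by blast
  qed
  then show "smooth_on UNIV (sin :: real \<Rightarrow> real)" "smooth_on UNIV (cos :: real \<Rightarrow> real)"
    by (auto simp: smooth_on_def)
qed

lemma smooth_on_inverse: "smooth_on (- {0}) (inverse :: real \<Rightarrow> real)"
proof -
  have o: "open (- {0::real})" by auto
  have "Ck_on k (- {0}) (inverse :: real \<Rightarrow> real)" for k
  proof (induction k)
    case 0 show ?case by (auto intro!: continuous_intros)
  next
    case (Suc k)
    show ?case
    proof (rule Ck_on_field_derivative[OF o, of _ "\<lambda>x. - (inverse x * inverse x)"])
      show "(inverse has_field_derivative - (inverse t * inverse t)) (at t)" if "t \<in> - {0}" for t :: real
        using DERIV_inverse[of t UNIV] that by (simp add: power2_eq_square)
      show "Ck_on k (- {0}) (\<lambda>x::real. - (inverse x * inverse x))"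
        by (intro Ck_on_linear[OF o bounded_linear_minus[OF bounded_linear_ident]]
            Ck_on_bilinear[OF o bounded_bilinear_mult] Suc)
    qed
  qed
  then show ?thesis by (simp add: smooth_on_def)
qed

lemma smooth_on_divide:
  fixes f g :: "'a::real_normed_vector \<Rightarrow> real"
  assumes "open S" "smooth_on S f" "smooth_on S g" "\<And>x. x \<in> S \<Longrightarrow> g x \<noteq> 0"
  shows "smooth_on S (\<lambda>x. f x / g x)"
  unfolding divide_inverse
  by (intro smooth_on_mult assms smooth_on_compose[OF _ _ smooth_on_inverse]) (use assms in auto)

subsection \<open>Bump functions\<close>

text \<open>Carrying a polynomial in \<open>1 / t\<close> along makes this family of flat functions
  closed under differentiation; \<open>p = 1\<close> is the classical exp(-1/t).\<close>

definition flat_exp :: "real poly \<Rightarrow> real \<Rightarrow> real" where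
  "flat_exp p t = (if t \<le> 0 then 0 else poly p (1 / t) * exp (- (1 / t)))"

lemma poly_exp_tendsto_0: "((\<lambda>y. y ^ k * poly p y * exp (- y)) \<longlongrightarrow> (0::real)) at_top"
proof (induction p arbitrary: k)
  case 0 then show ?case by simp
next
  case (pCons a p)
  have "((\<lambda>y. a * (y ^ k / exp y) + y ^ Suc k * poly p y * exp (- y)) \<longlongrightarrow> a * 0 + 0) at_top"
    by (intro tendsto_intros tendsto_power_div_exp_0 pCons)
  moreover have "(\<lambda>y. a * (y ^ k / exp y) + y ^ Suc k * poly p y * exp (- y)) = (\<lambda>y. y ^ k * poly (pCons a p) y * exp (- y))"
    by (auto simp: fun_eq_iff algebra_simps exp_minus divide_inverse)
  ultimately show ?case by simp
qed

text \<open>With y = 1/t the derivative of p(y) exp(-y) is y^2 (p(y) - p'(y)) exp(-y), and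
  \<open>[:0, 0, 1:]\<close> is the polynomial y^2. One formula covers both sides of 0 and 0 itself,
  so smoothness follows by a plain induction.\<close>

lemma flat_exp_deriv:
  "(flat_exp p has_field_derivative flat_exp ([:0, 0, 1:] * (p - pderiv p)) t) (at t)"
proof -
  consider "t < 0" | "t > 0" | "t = 0" by linarith
  then show ?thesis
  proof cases
    case 1
    have "((\<lambda>x. 0) has_field_derivative 0) (at t)" by simp
    moreover have "flat_exp ([:0, 0, 1:] * (p - pderiv p)) t = 0" using 1 by (simp add: flat_exp_def)
    ultimately show ?thesis
      using has_field_derivative_transform_within_open[of "\<lambda>x. 0" 0 t "{..<0}" "flat_exp p"] 1
      by (simp add: flat_exp_def)
  next
    case 2
    have d: "((\<lambda>x. - (1 / x)) has_field_derivative 1 / t\<^sup>2) (at t)"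
      using 2 by (auto intro!: derivative_eq_intros simp: power2_eq_square)
    have d': "((\<lambda>x. 1 / x) has_field_derivative - (1 / t\<^sup>2)) (at t)"
      using DERIV_minus[OF d] by simp
    have "((\<lambda>x. poly p (1 / x) * exp (- (1 / x))) has_field_derivative
        poly (pderiv p) (1 / t) * - (1 / t\<^sup>2) * exp (- (1 / t)) + exp (- (1 / t)) * (1 / t\<^sup>2) * poly p (1 / t)) (at t)"
      by (rule DERIV_mult[OF DERIV_chain2[OF poly_DERIV d'] DERIV_chain2[OF DERIV_exp d]])
    moreover have "poly (pderiv p) (1 / t) * - (1 / t\<^sup>2) * exp (- (1 / t)) + exp (- (1 / t)) * (1 / t\<^sup>2) * poly p (1 / t)
        = flat_exp ([:0, 0, 1:] * (p - pderiv p)) t"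
      using 2 by (simp add: flat_exp_def algebra_simps power2_eq_square)
    ultimately have "((\<lambda>x. poly p (1 / x) * exp (- (1 / x))) has_field_derivative
        flat_exp ([:0, 0, 1:] * (p - pderiv p)) t) (at t)" by simp
    then show ?thesis
      by (rule has_field_derivative_transform_within_open[where S="{0<..}"]) (use 2 in \<open>auto simp: flat_exp_def\<close>)
  next
    case 3
    \<comment> \<open>The difference quotient at 0 from the right is y p(y) exp(-y) with y = 1/h
      tending to infinity; the extra factor y is why \<open>poly_exp_tendsto_0\<close> carries a
      power.\<close>
    have "((\<lambda>h. inverse h ^ 1 * poly p (inverse h) * exp (- inverse h)) \<longlongrightarrow> 0) (at_right 0)"
      by (rule filterlim_compose[OF poly_exp_tendsto_0 filterlim_inverse_at_top_right])
    then have "((\<lambda>h. (flat_exp p (0 + h) - flat_exp p 0) / h) \<longlongrightarrow> 0) (at_right 0)"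
      by (rule tendsto_cong[THEN iffD1, rotated])
        (auto simp: eventually_at_filter flat_exp_def field_simps intro!: always_eventually)
    moreover have "((\<lambda>h. (flat_exp p (0 + h) - flat_exp p 0) / h) \<longlongrightarrow> 0) (at_left 0)"
      by (rule tendsto_cong[THEN iffD1, OF _ tendsto_const])
        (auto simp: eventually_at_filter flat_exp_def intro!: always_eventually)
    ultimately have "((\<lambda>h. (flat_exp p (0 + h) - flat_exp p 0) / h) \<longlongrightarrow> 0) (at 0)"
      by (simp add: filterlim_at_split)
    then show ?thesis using 3 by (simp add: DERIV_def flat_exp_def)
  qed
qed

lemma smooth_on_flat_exp: "smooth_on UNIV (flat_exp p)"
proof -
  have "Ck_on k UNIV (flat_exp p)" for k
  proof (induction k arbitrary: p)
    case 0
    show ?case by (auto intro!: continuous_at_imp_continuous_on DERIV_isCont flat_exp_deriv)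
  next
    case (Suc k)
    show ?case by (rule Ck_on_field_derivative[OF open_UNIV flat_exp_deriv Suc])
  qed
  then show ?thesis by (simp add: smooth_on_def)
qed

lemma smooth_bump:
  fixes x :: "'a::euclidean_space"
  assumes "0 < r" "r < R"
  obtains \<beta> :: "'a \<Rightarrow> real" where "smooth_on UNIV \<beta>" "\<And>y. \<beta> y \<ge> 0" "\<And>y. y \<in> cball x r \<Longrightarrow> \<beta> y = 1"
    "\<And>y. y \<notin> ball x R \<Longrightarrow> \<beta> y = 0"
proof
  define e where "e = flat_exp 1"
  have e0: "e t \<ge> 0" and epos: "e t > 0 \<longleftrightarrow> t > 0" and ez: "t \<le> 0 \<Longrightarrow> e t = 0" for t
    by (auto simp: e_def flat_exp_def)
  \<comment> \<open>The squared distance is smooth also at the centre. In the quotient below at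
    least one of the two summands of the denominator is positive because
    \<open>r < R\<close>.\<close>
  define n where "n y = (y - x) \<bullet> (y - x)" for y
  define \<beta> where "\<beta> y = e (R\<^sup>2 - n y) / (e (R\<^sup>2 - n y) + e (n y - r\<^sup>2))" for y
  have "r\<^sup>2 < R\<^sup>2" using assms by (simp add: power_strict_mono)
  have nn: "n y = (dist x y)\<^sup>2" for y by (simp add: n_def dist_norm norm_minus_commute[of x y] dot_square_norm)
  have den: "e (R\<^sup>2 - n y) + e (n y - r\<^sup>2) \<noteq> 0" for y
  proof -
    have "R\<^sup>2 - n y > 0 \<or> n y - r\<^sup>2 > 0" using \<open>r\<^sup>2 < R\<^sup>2\<close> by linarith
    then show ?thesis using e0[of "R\<^sup>2 - n y"] e0[of "n y - r\<^sup>2"] epos by (smt (verit))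
  qed
  have sn: "smooth_on UNIV n"
    unfolding n_def by (intro smooth_on_bilinear[OF _ bounded_bilinear_inner] smooth_on_diff smooth_on_const)
      (auto intro: smooth_on_bounded_linear bounded_linear_ident)
  have se: "smooth_on UNIV (\<lambda>y. e (f y))" if "smooth_on UNIV f" for f :: "'a \<Rightarrow> real"
    unfolding e_def by (rule smooth_on_compose[OF _ that smooth_on_flat_exp]) auto
  show "smooth_on UNIV \<beta>"
    unfolding \<beta>_def by (intro smooth_on_divide smooth_on_add se smooth_on_diff smooth_on_const sn den) auto
  show "\<beta> y \<ge> 0" for y by (simp add: \<beta>_def e0)
  show "\<beta> y = 1" if "y \<in> cball x r" for y
  proof -
    have "n y \<le> r\<^sup>2" using that assms by (simp add: nn power_mono)
    then have "e (n y - r\<^sup>2) = 0" by (intro ez) simp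
    then show ?thesis using den[of y] by (simp add: \<beta>_def)
  qed
  show "\<beta> y = 0" if "y \<notin> ball x R" for y
  proof -
    have "n y \<ge> R\<^sup>2" using that assms by (simp add: nn power_mono)
    then show ?thesis by (simp add: \<beta>_def ez)
  qed
qed

subsection \<open>Integrals depending on a parameter\<close>

lemma has_vector_derivative_chain:
  assumes "(K has_derivative K') (at (p t))" "(p has_vector_derivative p') (at t)"
  shows "((\<lambda>t. K (p t)) has_vector_derivative K' p') (at t)"
  using vector_derivative_diff_chain_within[OF assms(2) has_derivative_at_withinI[OF assms(1)]]
  by (simp add: o_def)

text \<open>Differentiation under the integral sign is applied along one coordinate line at a time,
  and \<open>Ck_on_partials\<close> assembles the result. The open \<open>W\<close> around
  \<open>S \<times> {0..1}\<close> gives meaning to full derivatives of \<open>K\<close> at the end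
  points of the interval.\<close>

lemma Ck_on_integral_param:
  fixes K :: "'a::euclidean_space \<times> real \<Rightarrow> 'b::euclidean_space"
  assumes S: "open S" and W: "open W" "S \<times> {0..1} \<subseteq> W" and K: "Ck_on k W K"
  shows "Ck_on k S (\<lambda>x. integral {0..1} (\<lambda>t. K (x, t)))"
  using K
proof (induction k arbitrary: K)
  case 0
  then have "continuous_on (S \<times> cbox 0 1) (\<lambda>(x, t). K (x, t))"
    using W by (auto intro: continuous_on_subset)
  from integral_continuous_on_param[OF this] show ?case by simp
next
  case (Suc k)
  show ?case
  proof (rule Ck_on_partials[OF S, of _ "\<lambda>b x. integral {0..1} (\<lambda>t. frechet_derivative K (at (x, t)) (b, 0))"])
    show "Ck_on k S (\<lambda>x. integral {0..1} (\<lambda>t. frechet_derivative K (at (x, t)) (b, 0)))" for b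
      using Suc.prems by (intro Suc.IH) auto
    fix y b :: 'a assume y: "y \<in> S" and b: "b \<in> Basis"
    obtain r where r: "r > 0" "ball y r \<subseteq> S" using S y open_contains_ball by blast
    define U where "U = {-r<..<r}"
    have inW: "(y + h *\<^sub>R b, t) \<in> W" if "h \<in> U" "t \<in> {0..1}" for h t
      using r W that b by (auto simp: U_def dist_norm subset_iff)
    have cK: "continuous_on W (\<lambda>z. frechet_derivative K (at z) v)" for v
      by (intro Ck_on_imp_continuous_on[of k], cases v) (use Suc.prems in auto)
    have "((\<lambda>h. integral (cbox 0 1) (\<lambda>t. K (y + h *\<^sub>R b, t))) has_vector_derivative
        integral (cbox 0 1) (\<lambda>t. frechet_derivative K (at (y + 0 *\<^sub>R b, t)) (b, 0))) (at 0 within U)"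
    proof (rule leibniz_rule_vector_derivative[where fx="\<lambda>h t. frechet_derivative K (at (y + h *\<^sub>R b, t)) (b, 0)"])
      fix h t assume h: "h \<in> U" "t \<in> cbox (0::real) 1"
      show "((\<lambda>h. K (y + h *\<^sub>R b, t)) has_vector_derivative frechet_derivative K (at (y + h *\<^sub>R b, t)) (b, 0)) (at h within U)"
      proof (rule has_vector_derivative_at_within[OF has_vector_derivative_chain[where p="\<lambda>h. (y + h *\<^sub>R b, t)"]])
        show "(K has_derivative frechet_derivative K (at (y + h *\<^sub>R b, t))) (at (y + h *\<^sub>R b, t))"
          using inW[of h t] h by (intro Ck_on_Suc_deriv[OF Suc.prems]) auto
        show "((\<lambda>h. (y + h *\<^sub>R b, t)) has_vector_derivative (b, 0)) (at h)"
          by (auto intro!: derivative_eq_intros has_vector_derivative_Pair)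
      qed
    next
      fix h assume h: "h \<in> U"
      have "continuous_on {0..1} (\<lambda>t. K (y + h *\<^sub>R b, t))"
        by (rule continuous_on_compose2[OF Ck_on_imp_continuous_on[OF Suc.prems]])
          (use inW[OF h] in \<open>auto intro!: continuous_intros\<close>)
      then show "(\<lambda>t. K (y + h *\<^sub>R b, t)) integrable_on cbox 0 1"
        by (simp add: integrable_continuous_interval)
    next
      show "continuous_on (U \<times> cbox 0 1) (\<lambda>(h, t). frechet_derivative K (at (y + h *\<^sub>R b, t)) (b, 0))"
        unfolding case_prod_beta
        by (rule continuous_on_compose2[OF cK]) (use inW in \<open>auto intro!: continuous_intros\<close>)
    qed (use r in \<open>auto simp: U_def\<close>)
    then show "((\<lambda>h. integral {0..1} (\<lambda>t. K (y + h *\<^sub>R b, t))) has_vector_derivative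
        integral {0..1} (\<lambda>t. frechet_derivative K (at (y, t)) (b, 0))) (at 0)"
      using r by (subst (asm) at_within_open[of 0 U]) (auto simp: U_def)
  qed
qed

text \<open>Integrating the derivative of \<open>f\<close> along the segment from \<open>x0\<close>
  to \<open>x\<close> splits off the factors \<open>(x - x0) \<bullet> b\<close>; the remaining
  integrals of partial derivatives are smooth in \<open>x\<close>.\<close>

lemma hadamard:
  fixes f :: "'a::euclidean_space \<Rightarrow> real"
  assumes S: "open S" "convex S" "x0 \<in> S" and f: "smooth_on S f"
  obtains h where "\<And>b. b \<in> Basis \<Longrightarrow> smooth_on S (h b)"
    "\<And>x. x \<in> S \<Longrightarrow> f x = f x0 + (\<Sum>b\<in>Basis. ((x - x0) \<bullet> b) * h b x)"
    "\<And>b. h b x0 = frechet_derivative f (at x0) b"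
proof
  define W where "W = {z. x0 + snd z *\<^sub>R (fst z - x0) \<in> S}"
  define K where "K b z = frechet_derivative f (at (x0 + snd z *\<^sub>R (fst z - x0))) b" for b and z :: "'a \<times> real"
  let ?h = "\<lambda>b x. integral {0..1} (\<lambda>t. K b (x, t))"
  have W: "open W"
    using open_vimage[OF S(1), of "\<lambda>z. x0 + snd z *\<^sub>R (fst z - x0)"]
    by (simp add: W_def vimage_def continuous_intros)
  have inS: "x0 + t *\<^sub>R (x - x0) \<in> S" if "x \<in> S" "t \<in> {0..1}" for x t
  proof -
    have "(1 - t) *\<^sub>R x0 + t *\<^sub>R x \<in> S" using that S by (intro convexD_alt) auto
    then show ?thesis by (simp add: algebra_simps)
  qed
  have KW: "smooth_on W (K b)" for b
    unfolding K_def
  proof (rule smooth_on_compose[OF W _ smooth_on_frechet[OF f]])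
    show "smooth_on W (\<lambda>z. x0 + snd z *\<^sub>R (fst z - x0))"
      by (intro smooth_on_add smooth_on_scaleR smooth_on_diff smooth_on_const W
         smooth_on_bounded_linear[OF bounded_linear_fst] smooth_on_bounded_linear[OF bounded_linear_snd])
  qed (auto simp: W_def)
  show "smooth_on S (?h b)" for b
    unfolding smooth_on_def
    by (intro allI Ck_on_integral_param[OF S(1) W] smooth_on_Ck[OF KW]) (use inS in \<open>auto simp: W_def\<close>)
  show "?h b x0 = frechet_derivative f (at x0) b" for b by (simp add: K_def)
  fix x assume x: "x \<in> S"
  have cont: "continuous_on {0..1} (\<lambda>t. K b (x, t))" for b
    by (rule continuous_on_compose2[OF smooth_on_continuous[OF KW[of b]]])
      (use inS[OF x] in \<open>auto simp: W_def intro!: continuous_intros\<close>)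
  have I1: "((\<lambda>t. \<Sum>b\<in>Basis. ((x - x0) \<bullet> b) * K b (x, t)) has_integral
      f (x0 + 1 *\<^sub>R (x - x0)) - f (x0 + 0 *\<^sub>R (x - x0))) {0..1}"
  proof (rule fundamental_theorem_of_calculus)
    fix t :: real assume t: "t \<in> {0..1}"
    let ?D = "frechet_derivative f (at (x0 + t *\<^sub>R (x - x0)))"
    have D: "(f has_derivative ?D) (at (x0 + t *\<^sub>R (x - x0)))"
      by (rule smooth_on_has_derivative[OF f inS[OF x t]])
    have "((\<lambda>t. f (x0 + t *\<^sub>R (x - x0))) has_vector_derivative ?D (x - x0)) (at t)"
      by (rule has_vector_derivative_chain[where p="\<lambda>t. x0 + t *\<^sub>R (x - x0)", OF D]) (auto intro!: derivative_eq_intros)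
    moreover have "?D (x - x0) = (\<Sum>b\<in>Basis. ((x - x0) \<bullet> b) * K b (x, t))"
      using linear_euclidean_sum[of ?D "x - x0"] D
      by (simp add: K_def has_derivative_def bounded_linear.linear)
    ultimately show "((\<lambda>t. f (x0 + t *\<^sub>R (x - x0))) has_vector_derivative (\<Sum>b\<in>Basis. ((x - x0) \<bullet> b) * K b (x, t))) (at t within {0..1})"
      by (simp add: has_vector_derivative_at_within)
  qed simp
  have I2: "((\<lambda>t. \<Sum>b\<in>Basis. ((x - x0) \<bullet> b) * K b (x, t)) has_integral (\<Sum>b\<in>Basis. ((x - x0) \<bullet> b) * ?h b x)) {0..1}"
    by (intro has_integral_sum has_integral_mult_right integrable_integral integrable_continuous_interval cont finite_Basis)
  show "f x = f x0 + (\<Sum>b\<in>Basis. ((x - x0) \<bullet> b) * ?h b x)"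
    using has_integral_unique[OF I1 I2] by simp
qed


subsection \<open>Linear systems with smooth coefficients\<close>

context
  fixes S :: "'p::euclidean_space set" and M :: "'p \<Rightarrow> 'a::euclidean_space \<Rightarrow> 'a"
  assumes S: "open S" and lin: "\<And>y. y \<in> S \<Longrightarrow> linear (M y)" and inj: "\<And>y. y \<in> S \<Longrightarrow> inj (M y)"
    and smooth_M: "\<And>b. smooth_on S (\<lambda>y. M y b)"
begin

lemma solve_smooth_apply: "smooth_on S (\<lambda>y. M y w)"
proof (rule smooth_on_cong[OF S])
  show "smooth_on S (\<lambda>y. \<Sum>b\<in>Basis. (w \<bullet> b) *\<^sub>R M y b)"
    by (intro smooth_on_sum smooth_on_scaleR smooth_on_const smooth_M S)
qed (simp add: linear_euclidean_sum[OF lin, symmetric])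

lemma solve_tendsto: "y0 \<in> S \<Longrightarrow> (\<lambda>y. M y w) \<midarrow>y0\<rightarrow> M y0 w"
  using smooth_on_continuous[OF solve_smooth_apply] S by (auto simp: continuous_on_eq_continuous_at isCont_def)

text \<open>Injectivity at \<open>y0\<close> gives a bound \<open>B\<close> in finite dimension;
  half of it survives a small perturbation of the columns. This uniform bound stands in for
  continuity of the inverse matrix.\<close>

lemma solve_lower_bound:
  assumes "y0 \<in> S"
  obtains c where "c > 0" "\<forall>\<^sub>F y in nhds y0. y \<in> S \<and> (\<forall>w. norm (M y w) \<ge> c * norm w)"
proof -
  obtain B where B: "B > 0" "\<And>w. B * norm w \<le> norm (M y0 w)"
    using linear_inj_bounded_below_pos[OF lin[OF assms] inj[OF assms]] by metis
  have "((\<lambda>y. \<Sum>b\<in>Basis. norm (M y b - M y0 b)) \<longlongrightarrow> (\<Sum>b\<in>Basis. norm (M y0 b - M y0 b))) (nhds y0)"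
    by (intro tendsto_intros) (metis solve_tendsto[OF assms] tendsto_at_iff_tendsto_nhds)
  then have "\<forall>\<^sub>F y in nhds y0. (\<Sum>b\<in>Basis. norm (M y b - M y0 b)) < B / 2"
    using B by (intro order_tendstoD) auto
  moreover have "\<forall>\<^sub>F y in nhds y0. y \<in> S" using S assms by (rule eventually_nhds_in_open)
  ultimately have "\<forall>\<^sub>F y in nhds y0. y \<in> S \<and> (\<forall>w. norm (M y w) \<ge> B / 2 * norm w)"
  proof eventually_elim
    case (elim y)
    have "B / 2 * norm w \<le> norm (M y w)" for w
    proof -
      have "M y w - M y0 w = (\<Sum>b\<in>Basis. (w \<bullet> b) *\<^sub>R (M y b - M y0 b))"
        using linear_euclidean_sum[OF lin, of y w] linear_euclidean_sum[OF lin, of y0 w] elim assms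
        by (simp add: algebra_simps sum_subtractf)
      then have "norm (M y w - M y0 w) \<le> (\<Sum>b\<in>Basis. norm ((w \<bullet> b) *\<^sub>R (M y b - M y0 b)))"
        by (simp only: norm_sum)
      also have "\<dots> \<le> (\<Sum>b\<in>Basis. norm w * norm (M y b - M y0 b))"
        by (auto intro!: sum_mono mult_right_mono Basis_le_norm)
      also have "\<dots> \<le> norm w * (B / 2)"
        unfolding sum_distrib_left[symmetric] using elim by (intro mult_left_mono) auto
      finally have "norm (M y0 w) - norm (M y w) \<le> B / 2 * norm w"
        using norm_triangle_ineq2[of "M y0 w" "M y w"] by (simp add: norm_minus_commute mult.commute)
      then show ?thesis using B(2)[of w] by simp
    qed
    with elim show ?case by blast
  qed
  then show ?thesis using that[of "B / 2"] B by simp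
qed

text \<open>Apply the lower bound to \<open>u y - u y0\<close>: its image under \<open>M y\<close>
  is \<open>d y - M y (u y0)\<close>, which tends to 0.\<close>

lemma solve_continuous:
  assumes d: "continuous_on S d" and u: "\<And>y. y \<in> S \<Longrightarrow> M y (u y) = d y"
  shows "continuous_on S u"
proof (rule continuous_at_imp_continuous_on, intro ballI)
  fix y0 assume y0: "y0 \<in> S"
  obtain c where c: "c > 0" "\<forall>\<^sub>F y in nhds y0. y \<in> S \<and> (\<forall>w. norm (M y w) \<ge> c * norm w)"
    using solve_lower_bound[OF y0] .
  have lim: "((\<lambda>y. norm (d y - M y (u y0)) / c) \<longlongrightarrow> norm (d y0 - M y0 (u y0)) / c) (at y0)"
    using d S y0 c
    by (intro tendsto_intros solve_tendsto) (auto simp: continuous_on_eq_continuous_at isCont_def)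
  have ev: "\<forall>\<^sub>F y in at y0. norm (u y - u y0) \<le> norm (d y - M y (u y0)) / c"
    unfolding eventually_at_filter
  proof (rule eventually_mono[OF c(2)], intro impI)
    fix y assume y: "y \<in> S \<and> (\<forall>w. norm (M y w) \<ge> c * norm w)"
    then have "c * norm (u y - u y0) \<le> norm (d y - M y (u y0))"
      using linear_diff[OF lin, of y] u[of y] by (metis)
    then show "norm (u y - u y0) \<le> norm (d y - M y (u y0)) / c" using c by (simp add: field_simps)
  qed
  have "((\<lambda>y. norm (u y - u y0)) \<longlongrightarrow> 0) (at y0)"
  proof (rule tendsto_sandwich[OF _ ev tendsto_const])
    show "((\<lambda>y. norm (d y - M y (u y0)) / c) \<longlongrightarrow> 0) (at y0)"
      using lim unfolding u[OF y0] by simp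
  qed simp
  then show "isCont u y0"
    by (simp add: isCont_def tendsto_norm_zero_iff LIM_zero_iff)
qed

text \<open>Implicit differentiation of \<open>M y (u y) = d y\<close>, with differentiability of
  \<open>u\<close> proved rather than assumed: the candidate is \<open>M y0\<close> inverted on the
  derivative of the residual.\<close>

lemma solve_derivative:
  assumes d: "(d has_derivative d') (at y0)" and u: "\<And>y. y \<in> S \<Longrightarrow> M y (u y) = d y" and y0: "y0 \<in> S"
  obtains u' where "(u has_derivative u') (at y0)"
    "\<And>v. M y0 (u' v) = d' v - (\<Sum>b\<in>Basis. (u y0 \<bullet> b) *\<^sub>R frechet_derivative (\<lambda>y. M y b) (at y0) v)"
proof -
  obtain c where c: "c > 0" "\<forall>\<^sub>F y in nhds y0. y \<in> S \<and> (\<forall>w. norm (M y w) \<ge> c * norm w)"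
    using solve_lower_bound[OF y0] .
  obtain N where N: "linear N" "\<And>w. M y0 (N w) = w"
    using linear_injective_isomorphism[OF lin[OF y0] inj[OF y0]] by metis
  define R where "R v = d' v - (\<Sum>b\<in>Basis. (u y0 \<bullet> b) *\<^sub>R frechet_derivative (\<lambda>y. M y b) (at y0) v)" for v
  \<comment> \<open>The residual when the solution is frozen at \<open>y0\<close>. It vanishes at
    \<open>y0\<close>, and \<open>M y (u y - u y0) = r y\<close> on \<open>S\<close>.\<close>
  define r where "r y = d y - (\<Sum>b\<in>Basis. (u y0 \<bullet> b) *\<^sub>R M y b)" for y
  have r: "(r has_derivative R) (at y0)"
    unfolding r_def R_def
    by (intro derivative_intros d smooth_on_has_derivative[OF smooth_M y0])
  have linR: "linear R" using r by (simp add: has_derivative_def bounded_linear.linear)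
  define E where "E y = (r y - r y0 - R (y - y0)) - (M y (N (R (y - y0))) - M y0 (N (R (y - y0))))" for y
  have r_eq: "r y = d y - M y (u y0)" if "y \<in> S" for y
    using linear_euclidean_sum[OF lin[OF that], of "u y0"] by (simp add: r_def)
  have blNR: "bounded_linear (\<lambda>v. N (R v))"
    using linear_compose[OF linR N(1)] by (simp add: o_def linear_conv_bounded_linear)
  then obtain Q where Q: "Q > 0" "\<And>v. norm (N (R v)) \<le> norm v * Q"
    using bounded_linear.pos_bounded by blast
  have key: "((\<lambda>y. norm (u y - u y0 - N (R (y - y0))) / norm (y - y0)) \<longlongrightarrow> 0) (at y0)"
  proof (rule tendsto_sandwich[OF _ _ tendsto_const])
    \<comment> \<open>The first summand is the differentiability error of \<open>r\<close>; the
      second is the variation of the columns of \<open>M\<close>, acting on a vector of norm at most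
      \<open>Q * norm (y - y0)\<close>. Both are divided by the lower bound
      \<open>c\<close>.\<close>
    let ?g = "\<lambda>y. (norm (r y - r y0 - R (y - y0)) / norm (y - y0) + Q * (\<Sum>b\<in>Basis. norm (M y b - M y0 b))) / c"
    show "\<forall>\<^sub>F y in at y0. 0 \<le> norm (u y - u y0 - N (R (y - y0))) / norm (y - y0)" by simp
    have "((\<lambda>y. norm (r y - r y0 - R (y - y0)) / norm (y - y0)) \<longlongrightarrow> 0) (at y0)"
      using r unfolding has_derivative_iff_norm by simp
    then have "(?g \<longlongrightarrow> (0 + Q * (\<Sum>b\<in>Basis. norm (M y0 b - M y0 b))) / c) (at y0)"
      using c by (intro tendsto_intros solve_tendsto y0) auto
    then show "(?g \<longlongrightarrow> 0) (at y0)" by simp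
    show "\<forall>\<^sub>F y in at y0. norm (u y - u y0 - N (R (y - y0))) / norm (y - y0) \<le> ?g y"
      unfolding eventually_at_filter
    proof (rule eventually_mono[OF c(2)], intro impI)
      fix y assume y: "y \<in> S \<and> (\<forall>w. norm (M y w) \<ge> c * norm w)" and ne: "y \<noteq> y0"
      let ?z = "N (R (y - y0))"
      have r0: "r y0 = 0" using r_eq[OF y0] u[OF y0] by simp
      have "M y (u y - u y0 - ?z) = r y - M y ?z"
        using linear_diff[OF lin, of y] u[of y] r_eq[of y] y by simp
      also have "\<dots> = (r y - r y0 - R (y - y0)) - (M y ?z - M y0 ?z)" using N(2) r0 by simp
      finally have 1: "M y (u y - u y0 - ?z) = (r y - r y0 - R (y - y0)) - (M y ?z - M y0 ?z)" .
      have "M y ?z - M y0 ?z = (\<Sum>b\<in>Basis. (?z \<bullet> b) *\<^sub>R (M y b - M y0 b))"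
        using linear_euclidean_sum[OF lin, of y ?z] linear_euclidean_sum[OF lin, of y0 ?z] y y0
        by (simp add: algebra_simps sum_subtractf)
      then have "norm (M y ?z - M y0 ?z) \<le> (\<Sum>b\<in>Basis. norm ((?z \<bullet> b) *\<^sub>R (M y b - M y0 b)))"
        by (simp only: norm_sum)
      also have "\<dots> \<le> (\<Sum>b\<in>Basis. norm ?z * norm (M y b - M y0 b))"
        by (auto intro!: sum_mono mult_right_mono Basis_le_norm)
      also have "\<dots> \<le> (norm (y - y0) * Q) * (\<Sum>b\<in>Basis. norm (M y b - M y0 b))"
        unfolding sum_distrib_left[symmetric] using Q by (intro mult_right_mono) (auto intro: sum_nonneg)
      finally have "c * norm (u y - u y0 - ?z) \<le> norm (r y - r y0 - R (y - y0)) + (norm (y - y0) * Q) * (\<Sum>b\<in>Basis. norm (M y b - M y0 b))"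
        using y 1 norm_triangle_ineq4[of "r y - r y0 - R (y - y0)" "M y ?z - M y0 ?z"]
        by (smt (verit))
      then show "norm (u y - u y0 - ?z) / norm (y - y0) \<le> ?g y"
        using c ne by (simp add: field_simps)
    qed
  qed
  have "(u has_derivative (\<lambda>v. N (R v))) (at y0)"
    unfolding has_derivative_iff_norm using blNR key by simp
  then show ?thesis using that N(2) by (simp add: R_def)
qed

text \<open>The derivative of a solution solves the same system with another smooth right-hand side.\<close>

lemma smooth_on_solve:
  assumes d: "smooth_on S d" and u: "\<And>y. y \<in> S \<Longrightarrow> M y (u y) = d y"
  shows "smooth_on S u"
proof -
  have "Ck_on k S u" if "Ck_on k S d" "\<And>y. y \<in> S \<Longrightarrow> M y (u y) = d y" for k d u
    using that
  proof (induction k arbitrary: d u)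
    case 0 then show ?case using solve_continuous[of d u] by simp
  next
    case (Suc k)
    let ?d' = "\<lambda>y v. frechet_derivative d (at y) v -
        (\<Sum>b\<in>Basis. (u y \<bullet> b) *\<^sub>R frechet_derivative (\<lambda>y. M y b) (at y) v)"
    have "\<forall>y\<in>S. \<exists>u'. (u has_derivative u') (at y) \<and> (\<forall>v. M y (u' v) = ?d' y v)"
    proof
      fix y assume "y \<in> S"
      show "\<exists>u'. (u has_derivative u') (at y) \<and> (\<forall>v. M y (u' v) = ?d' y v)"
        by (rule solve_derivative[OF Ck_on_Suc_deriv[OF Suc.prems(1) \<open>y \<in> S\<close>] Suc.prems(2) \<open>y \<in> S\<close>]) auto
    qed
    from bchoice[OF this] obtain u' where u'': "\<forall>y\<in>S. (u has_derivative u' y) (at y) \<and> (\<forall>v. M y (u' y v) = ?d' y v)" ..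
    have u': "\<And>y. y \<in> S \<Longrightarrow> (u has_derivative u' y) (at y)" "\<And>y v. y \<in> S \<Longrightarrow> M y (u' y v) = ?d' y v"
      using u'' by (auto simp only:)
    have Cu: "Ck_on k S u" by (rule Suc.IH[OF Ck_on_SucD[OF Suc.prems(1)] Suc.prems(2)])
    have "Ck_on k S (\<lambda>y. frechet_derivative d (at y) v -
        (\<Sum>b\<in>Basis. (u y \<bullet> b) *\<^sub>R frechet_derivative (\<lambda>y. M y b) (at y) v))" for v
    proof -
      have "Ck_on k S (\<lambda>y. frechet_derivative d (at y) v +
          - (\<Sum>b\<in>Basis. (u y \<bullet> b) *\<^sub>R frechet_derivative (\<lambda>y. M y b) (at y) v))"
        using Suc.prems(1)
        by (intro Ck_on_add[OF S] Ck_on_linear[OF S bounded_linear_minus[OF bounded_linear_ident]] Ck_on_sum[OF S]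
          Ck_on_bilinear[OF S bounded_bilinear_scaleR] Ck_on_linear[OF S bounded_linear_inner_left] Cu
          smooth_on_Ck[OF smooth_on_frechet[OF smooth_M]]) auto
      then show ?thesis by simp
    qed
    then have "Ck_on k S (\<lambda>y. u' y v)" for v
      by (rule Suc.IH) (rule u'(2))
    from Ck_on_SucI[OF S u'(1) this] show ?case .
  qed
  from this[OF smooth_on_Ck[OF d] u] show ?thesis by (simp add: smooth_on_def)
qed

end

section \<open>Ordinary differential equations with parameters\<close>

lemma has_vector_derivative_cmult_ident: "((\<lambda>s. r * s) has_vector_derivative r) (at s within A)"
  for r :: real
  by (rule has_real_derivative_iff_has_vector_derivative[THEN iffD1]) (auto intro!: derivative_eq_intros)

text \<open>The scaled integral equals the oriented integral of \<open>h\<close> from 0 to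
  \<open>t\<close> for either sign of \<open>t\<close>. Writing it over the fixed interval
  \<open>{0..1}\<close> avoids case distinctions and makes it an integral with parameter.\<close>

lemma has_vector_derivative_scaled_integral:
  fixes h :: "real \<Rightarrow> 'e::euclidean_space"
  assumes h: "continuous_on UNIV h"
  shows "((\<lambda>t. t *\<^sub>R integral {0..1} (\<lambda>s. h (t * s))) has_vector_derivative h t) (at t)"
proof -
  define T where "T = \<bar>t\<bar> + 1"
  define H where "H x = integral {-T..x} h" for x
  have H: "(H has_vector_derivative h x) (at x within {-T..T})" if "x \<in> {-T..T}" for x
    unfolding H_def using that continuous_on_subset[OF h] by (intro integral_has_vector_derivative) auto
  have eq: "r *\<^sub>R integral {0..1} (\<lambda>s. h (r * s)) = H r - H 0" if r: "\<bar>r\<bar> \<le> T" for r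
  proof -
    have sub: "r * s \<in> {-T..T}" if "s \<in> {0..1}" for s
    proof -
      have "\<bar>r * s\<bar> \<le> \<bar>r\<bar> * 1" unfolding abs_mult using that by (intro mult_left_mono) auto
      then show ?thesis using r by auto
    qed
    have I1: "((\<lambda>s. r *\<^sub>R h (r * s)) has_integral H (r * 1) - H (r * 0)) {0..1}"
    proof (rule fundamental_theorem_of_calculus)
      fix s :: real assume s: "s \<in> {0..1}"
      have "(H has_vector_derivative h (r * s)) (at (r * s) within (\<lambda>s. r * s) ` {0..1})"
        using sub by (intro has_vector_derivative_within_subset[OF H[OF sub[OF s]]]) auto
      from vector_diff_chain_within[OF _ this, of r]
      show "((\<lambda>s. H (r * s)) has_vector_derivative r *\<^sub>R h (r * s)) (at s within {0..1})"
        by (simp add: o_def has_vector_derivative_cmult_ident)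
    qed simp
    have I2: "((\<lambda>s. r *\<^sub>R h (r * s)) has_integral r *\<^sub>R integral {0..1} (\<lambda>s. h (r * s))) {0..1}"
      by (intro has_integral_cmul integrable_integral integrable_continuous_interval
          continuous_on_compose2[OF h]) (auto intro!: continuous_intros)
    show ?thesis using has_integral_unique[OF I1 I2] by simp
  qed
  have tT: "t \<in> {-T<..<T}" by (auto simp: T_def)
  have "(H has_vector_derivative h t) (at t within {-T<..<T})"
    by (rule has_vector_derivative_within_subset[OF H]) (use tT in auto)
  then have "(H has_vector_derivative h t) (at t)" using tT at_within_open[of t "{-T<..<T}"] by simp
  then have "((\<lambda>r. H r - H 0) has_vector_derivative h t) (at t)"
    using has_vector_derivative_diff[OF _ has_vector_derivative_const, of H "h t" "at t" "H 0"] by simp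
  then show ?thesis
    by (rule has_vector_derivative_transform_within_open[of _ _ _ "{-T<..<T}"]) (use tT eq in auto)
qed

lemma has_integral_power_unit: "((\<lambda>s::real. s ^ n) has_integral 1 / real (Suc n)) {0..1}"
proof -
  have "((\<lambda>s::real. s ^ n) has_integral 1 ^ Suc n / real (Suc n) - 0 ^ Suc n / real (Suc n)) {0..1}"
  proof (rule fundamental_theorem_of_calculus)
    fix s :: real
    have "((\<lambda>s. s ^ Suc n / real (Suc n)) has_field_derivative (real (Suc n) * s ^ n) / real (Suc n)) (at s within {0..1})"
      by (rule derivative_eq_intros refl | simp)+
    then show "((\<lambda>s. s ^ Suc n / real (Suc n)) has_vector_derivative s ^ n) (at s within {0..1})"
      by (simp add: has_real_derivative_iff_has_vector_derivative)
  qed simp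
  then show ?thesis by simp
qed

text \<open>Gronwall: the squared distance times exp(-2 L s) does not increase; negative times
  follow by reversal. Only the derivatives along the two curves are compared, not values of one
  common field, so that difference quotients of solutions can be compared as well.\<close>

lemma ode_unique:
  fixes y1 y2 :: "real \<Rightarrow> 'e::real_inner"
  assumes y1: "\<And>s. s \<in> closed_segment 0 t \<Longrightarrow> (y1 has_vector_derivative D1 s) (at s)"
    and y2: "\<And>s. s \<in> closed_segment 0 t \<Longrightarrow> (y2 has_vector_derivative D2 s) (at s)"
    and L: "\<And>s. s \<in> closed_segment 0 t \<Longrightarrow> norm (D1 s - D2 s) \<le> L * norm (y1 s - y2 s)"
    and 0: "y1 0 = y2 0"
  shows "y1 t = y2 t"
proof -
  have pos: "y1 t = y2 t" if "t \<ge> 0"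
    and y1: "\<And>s. s \<in> {0..t} \<Longrightarrow> (y1 has_vector_derivative D1 s) (at s)"
    and y2: "\<And>s. s \<in> {0..t} \<Longrightarrow> (y2 has_vector_derivative D2 s) (at s)"
    and L: "\<And>s. s \<in> {0..t} \<Longrightarrow> norm (D1 s - D2 s) \<le> L * norm (y1 s - y2 s)"
    and 0: "y1 0 = y2 0" for y1 y2 :: "real \<Rightarrow> 'e" and D1 D2 t
  proof -
    define E where "E s = ((y1 s - y2 s) \<bullet> (y1 s - y2 s)) * exp (- (2 * L) * s)" for s
    have "E t \<le> E 0"
    proof (rule DERIV_nonpos_imp_nonincreasing[OF \<open>t \<ge> 0\<close>])
      fix s assume s: "0 \<le> s" "s \<le> t"
      let ?d = "y1 s - y2 s"
      have d: "((\<lambda>s. y1 s - y2 s) has_vector_derivative D1 s - D2 s) (at s)"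
        using s by (intro has_vector_derivative_diff y1 y2) auto
      have "((\<lambda>s. (y1 s - y2 s) \<bullet> (y1 s - y2 s)) has_vector_derivative (?d \<bullet> (D1 s - D2 s) + (D1 s - D2 s) \<bullet> ?d)) (at s)"
        using bounded_bilinear.has_vector_derivative[OF bounded_bilinear_inner d d] .
      then have "((\<lambda>s. (y1 s - y2 s) \<bullet> (y1 s - y2 s)) has_real_derivative 2 * (?d \<bullet> (D1 s - D2 s))) (at s)"
        by (simp add: has_real_derivative_iff_has_vector_derivative inner_commute)
      moreover have "((\<lambda>s. exp (- (2 * L) * s)) has_real_derivative exp (- (2 * L) * s) * (- (2 * L))) (at s)"
        by (auto intro!: derivative_eq_intros)
      ultimately have "(E has_real_derivative (2 * (?d \<bullet> (D1 s - D2 s))) * exp (- (2 * L) * s)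
          + exp (- (2 * L) * s) * (- (2 * L)) * (?d \<bullet> ?d)) (at s)"
        unfolding E_def by (rule DERIV_mult)
      moreover have "(2 * (?d \<bullet> (D1 s - D2 s))) * exp (- (2 * L) * s) + exp (- (2 * L) * s) * (- (2 * L)) * (?d \<bullet> ?d)
          = 2 * exp (- (2 * L) * s) * (?d \<bullet> (D1 s - D2 s) - L * (?d \<bullet> ?d))"
        by (simp add: algebra_simps)
      moreover have "?d \<bullet> (D1 s - D2 s) \<le> L * (?d \<bullet> ?d)"
      proof -
        have "?d \<bullet> (D1 s - D2 s) \<le> norm ?d * norm (D1 s - D2 s)" by (rule norm_cauchy_schwarz)
        also have "\<dots> \<le> norm ?d * (L * norm ?d)" using L s by (intro mult_left_mono) auto
        finally show ?thesis by (simp add: dot_square_norm power2_eq_square algebra_simps)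
      qed
      ultimately show "\<exists>y. (E has_real_derivative y) (at s) \<and> y \<le> 0"
        by (metis (no_types, lifting) diff_le_0_iff_le exp_ge_zero mult_nonneg_nonpos zero_le_mult_iff zero_le_numeral)
    qed
    then have "(y1 t - y2 t) \<bullet> (y1 t - y2 t) \<le> 0"
      using 0 by (simp add: E_def mult_le_0_iff)
    then show ?thesis by (metis eq_iff_diff_eq_0 inner_eq_zero_iff inner_ge_zero order_antisym)
  qed
  show ?thesis
  proof (cases "t \<ge> 0")
    case True
    then show ?thesis using assms by (intro pos[of t y1 D1 y2 D2]) (auto simp: closed_segment_eq_real_ivl)
  next
    case False
    have d: "((\<lambda>s. y (- s)) has_vector_derivative - D (- s)) (at s)"
      if "(y has_vector_derivative D (- s)) (at (- s))" for y :: "real \<Rightarrow> 'e" and D s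
      using vector_diff_chain_at[of "\<lambda>s. -1 * s" "-1" s y "D (- s)"] that
      by (simp only: has_vector_derivative_cmult_ident) (simp add: o_def)
    have "y1 (- (- t)) = y2 (- (- t))"
    proof (rule pos[of "- t" "\<lambda>s. y1 (- s)" "\<lambda>s. - D1 (- s)" "\<lambda>s. y2 (- s)" "\<lambda>s. - D2 (- s)"])
      fix s assume "s \<in> {0..- t}"
      then have s: "- s \<in> closed_segment 0 t" using False by (auto simp: closed_segment_eq_real_ivl)
      show "((\<lambda>s. y1 (- s)) has_vector_derivative - D1 (- s)) (at s)" by (rule d[where y=y1 and D=D1, OF y1[OF s]])
      show "((\<lambda>s. y2 (- s)) has_vector_derivative - D2 (- s)) (at s)" by (rule d[where y=y2 and D=D2, OF y2[OF s]])
      show "norm (- D1 (- s) - - D2 (- s)) \<le> L * norm (y1 (- s) - y2 (- s))"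
        using L[OF s] by (simp add: norm_minus_commute)
    qed (use False 0 in auto)
    then show ?thesis by simp
  qed
qed

section \<open>Picard iteration with a parameter\<close>

context
  fixes F :: "real \<Rightarrow> 'p::euclidean_space \<Rightarrow> 'e::euclidean_space \<Rightarrow> 'e" and u0 :: "'p \<Rightarrow> 'e" and L :: real
  assumes cF: "continuous_on UNIV (\<lambda>(t, x, w). F t x w)" and L: "L > 0"
    and Lip: "\<And>t x w w'. norm (F t x w - F t x w') \<le> L * norm (w - w')"
    and cu0: "continuous_on UNIV u0"
begin

text \<open>Time and parameter are both arguments of the iterates, so that one uniform limit yields
  a solution that is jointly continuous in them.\<close>

primrec picard :: "nat \<Rightarrow> real \<times> 'p \<Rightarrow> 'e" where
  "picard 0 = (\<lambda>z. u0 (snd z))"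
| "picard (Suc n) = (\<lambda>z. u0 (snd z) +
     fst z *\<^sub>R integral {0..1} (\<lambda>s. F (fst z * s) (snd z) (picard n (fst z * s, snd z))))"

lemma continuous_F_compose:
  assumes "continuous_on S a" "continuous_on S b" "continuous_on S c"
  shows "continuous_on S (\<lambda>z. F (a z) (b z) (c z))"
  using continuous_on_compose2[OF cF, of S "\<lambda>z. (a z, b z, c z)"] assms
  by (simp add: continuous_on_Pair)

lemma continuous_picard: "continuous_on S (picard n)"
proof -
  have "continuous_on UNIV (picard n)"
  proof (induction n)
    case 0 show ?case by (auto intro!: continuous_on_compose2[OF cu0] continuous_intros)
  next
    case (Suc n)
    have "continuous_on (UNIV \<times> cbox 0 1) (\<lambda>(z, s). F (fst z * s) (snd z) (picard n (fst z * s, snd z)))"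
      unfolding case_prod_beta
      by (intro continuous_F_compose continuous_on_compose2[OF Suc]) (auto intro!: continuous_intros)
    from integral_continuous_on_param[OF this] show ?case
      by (auto intro!: continuous_intros continuous_on_compose2[OF cu0])
  qed
  then show ?thesis using continuous_on_subset by blast
qed

lemma continuous_picard_line: "continuous_on S (\<lambda>s. F (t * s) x (picard n (t * s, x)))"
  by (intro continuous_F_compose continuous_on_compose2[OF continuous_picard[of UNIV]])
    (auto intro!: continuous_intros)

text \<open>Compact sets that exhaust time and parameter space and are stable under shrinking the
  time, as required by the integrand at \<open>fst z * s\<close>.\<close>

definition ode_box :: "real \<Rightarrow> (real \<times> 'p) set" where
  "ode_box R = {-R..R} \<times> cball 0 R"

lemma ode_box_scale: "(t, x) \<in> ode_box R \<Longrightarrow> s \<in> {0..1} \<Longrightarrow> (t * s, x) \<in> ode_box R"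
proof -
  assume a: "(t, x) \<in> ode_box R" "s \<in> {0..1}"
  then have "\<bar>t * s\<bar> \<le> \<bar>t\<bar> * 1" unfolding abs_mult by (intro mult_left_mono) auto
  then show ?thesis using a by (auto simp: ode_box_def)
qed

lemma picard_step:
  obtains C where "C \<ge> 0" "\<And>n t x. (t, x) \<in> ode_box R \<Longrightarrow>
    norm (picard (Suc n) (t, x) - picard n (t, x)) \<le> C * \<bar>t\<bar> * (L * \<bar>t\<bar>) ^ n / fact n"
proof -
  have "compact (ode_box R)" unfolding ode_box_def by (intro compact_Times) auto
  moreover have "continuous_on (ode_box R) (\<lambda>z. F (fst z) (snd z) (u0 (snd z)))"
    by (intro continuous_F_compose continuous_on_compose2[OF cu0]) (auto intro!: continuous_intros)
  ultimately have "bounded ((\<lambda>z. F (fst z) (snd z) (u0 (snd z))) ` ode_box R)"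
    by (intro compact_imp_bounded compact_continuous_image)
  then obtain C where C: "C > 0" "\<And>z. z \<in> ode_box R \<Longrightarrow> norm (F (fst z) (snd z) (u0 (snd z))) \<le> C"
    unfolding bounded_pos by auto
  have "norm (picard (Suc n) (t, x) - picard n (t, x)) \<le> C * \<bar>t\<bar> * (L * \<bar>t\<bar>) ^ n / fact n"
    if "(t, x) \<in> ode_box R" for n t x
    using that
  proof (induction n arbitrary: t)
    case 0
    have "norm (integral (cbox 0 1) (\<lambda>s. F (t * s) x (u0 x))) \<le> C * measure lborel (cbox (0::real) 1)"
    proof (rule has_integral_bound[OF _ integrable_integral])
      show "(\<lambda>s. F (t * s) x (u0 x)) integrable_on cbox 0 1"
        by (intro integrable_continuous continuous_F_compose) (auto intro!: continuous_intros)
      show "norm (F (t * s) x (u0 x)) \<le> C" if "s \<in> cbox 0 1" for s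
        using C(2)[OF ode_box_scale[OF 0, of s]] that by simp
    qed (use C in simp)
    then show ?case using C by (simp add: mult.commute[of C] mult_left_mono)
  next
    case (Suc n)
    let ?g = "\<lambda>m s. F (t * s) x (picard m (t * s, x))"
    have int: "?g m integrable_on {0..1}" for m
      by (intro integrable_continuous_interval continuous_picard_line)
    have A: "picard (Suc (Suc n)) (t, x) - picard (Suc n) (t, x) = t *\<^sub>R integral {0..1} (\<lambda>s. ?g (Suc n) s - ?g n s)"
      unfolding integral_diff[OF int int] by (simp add: algebra_simps)
    have B: "norm (integral {0..1} (\<lambda>s. ?g (Suc n) s - ?g n s))
        \<le> integral {0..1} (\<lambda>s. (L * (C * \<bar>t\<bar> * (L * \<bar>t\<bar>) ^ n / fact n)) * s ^ Suc n)"
    proof (rule integral_norm_bound_integral)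
      fix s :: real assume s: "s \<in> {0..1}"
      have "norm (?g (Suc n) s - ?g n s) \<le> L * norm (picard (Suc n) (t * s, x) - picard n (t * s, x))"
        by (rule Lip)
      also have "\<dots> \<le> L * (C * \<bar>t * s\<bar> * (L * \<bar>t * s\<bar>) ^ n / fact n)"
        using L by (intro mult_left_mono Suc.IH ode_box_scale[OF Suc.prems s]) simp
      also have "\<dots> = (L * (C * \<bar>t\<bar> * (L * \<bar>t\<bar>) ^ n / fact n)) * s ^ Suc n"
        using s by (simp add: abs_mult power_mult_distrib)
      finally show "norm (?g (Suc n) s - ?g n s) \<le> (L * (C * \<bar>t\<bar> * (L * \<bar>t\<bar>) ^ n / fact n)) * s ^ Suc n" .
    qed (intro integrable_diff int, intro integrable_continuous_interval continuous_intros)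
    have B': "integral {0..1} (\<lambda>s. (L * (C * \<bar>t\<bar> * (L * \<bar>t\<bar>) ^ n / fact n)) * s ^ Suc n)
        = (L * (C * \<bar>t\<bar> * (L * \<bar>t\<bar>) ^ n / fact n)) * (1 / real (Suc (Suc n)))"
      by (rule integral_unique[OF has_integral_mult_right[OF has_integral_power_unit]])
    \<comment> \<open>The integral yields 1/(n+2); it is weakened to 1/(n+1) so that the factorial
      of the claimed bound reproduces itself.\<close>
    have B'': "(L * (C * \<bar>t\<bar> * (L * \<bar>t\<bar>) ^ n / fact n)) * (1 / real (Suc (Suc n)))
        \<le> (L * (C * \<bar>t\<bar> * (L * \<bar>t\<bar>) ^ n / fact n)) * (1 / real (Suc n))"
      using L C by (intro mult_left_mono) (auto simp: field_simps)
    have "norm (picard (Suc (Suc n)) (t, x) - picard (Suc n) (t, x))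
        \<le> \<bar>t\<bar> * ((L * (C * \<bar>t\<bar> * (L * \<bar>t\<bar>) ^ n / fact n)) * (1 / real (Suc n)))"
      unfolding A norm_scaleR by (rule mult_left_mono[OF order_trans[OF B[unfolded B'] B'']]) simp
    also have "\<dots> = C * \<bar>t\<bar> * (L * \<bar>t\<bar>) ^ Suc n / fact (Suc n)"
      by (simp add: field_simps)
    finally show ?case .
  qed
  then show ?thesis using that C by (metis less_imp_le)
qed

lemma picard_uniform_limit:
  obtains u where "\<And>R. uniform_limit (ode_box R) picard u sequentially"
proof
  fix R
  \<comment> \<open>The limit is written as a telescoping series to make the Weierstrass test
    applicable, with an exponential series as majorant.\<close>
  define l where "l z = u0 (snd z) + (\<Sum>n. picard (Suc n) z - picard n z)" for z
  obtain C where C: "C \<ge> 0" "\<And>n t x. (t, x) \<in> ode_box R \<Longrightarrow>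
    norm (picard (Suc n) (t, x) - picard n (t, x)) \<le> C * \<bar>t\<bar> * (L * \<bar>t\<bar>) ^ n / fact n"
    by (rule picard_step[of R]) blast
  let ?M = "\<lambda>n. C * \<bar>R\<bar> * (L * \<bar>R\<bar>) ^ n / fact n"
  have "uniform_limit (ode_box R) (\<lambda>n z. \<Sum>i<n. picard (Suc i) z - picard i z)
      (\<lambda>z. \<Sum>i. picard (Suc i) z - picard i z) sequentially"
  proof (rule Weierstrass_m_test)
    fix n and z :: "real \<times> 'p" assume z: "z \<in> ode_box R"
    then have "\<bar>fst z\<bar> \<le> \<bar>R\<bar>" by (auto simp: ode_box_def)
    then have "C * \<bar>fst z\<bar> * (L * \<bar>fst z\<bar>) ^ n / fact n \<le> ?M n"
      using C L by (intro divide_right_mono mult_mono power_mono mult_nonneg_nonneg zero_le_power) auto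
    then show "norm (picard (Suc n) z - picard n z) \<le> ?M n"
      using C(2)[of "fst z" "snd z" n] z by (simp del: picard.simps)
  next
    have "summable (\<lambda>n. C * \<bar>R\<bar> * (inverse (fact n) * (L * \<bar>R\<bar>) ^ n))"
      by (intro summable_mult summable_exp)
    then show "summable ?M" by (simp add: divide_inverse mult_ac)
  qed
  then have "uniform_limit (ode_box R) (\<lambda>n z. u0 (snd z) + (\<Sum>i<n. picard (Suc i) z - picard i z)) l sequentially"
    unfolding l_def by (intro uniform_limit_intros)
  moreover have "u0 (snd z) + (\<Sum>i<n. picard (Suc i) z - picard i z) = picard n z" for n z
    by (simp only: sum_lessThan_telescope[of "\<lambda>i. picard i z"]) simp
  ultimately have "uniform_limit (ode_box R) picard l sequentially" by simp
  then show "uniform_limit (ode_box R) picard (\<lambda>z. u0 (snd z) + (\<Sum>n. picard (Suc n) z - picard n z)) sequentially"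
    unfolding l_def .
qed

text \<open>The Lipschitz constant is global, so the iteration converges for all times at once and
  no maximal interval of existence appears.\<close>

theorem param_ode_exists:
  obtains u :: "real \<times> 'p \<Rightarrow> 'e" where "continuous_on UNIV u" "\<And>x. u (0, x) = u0 x"
    "\<And>t x. ((\<lambda>t. u (t, x)) has_vector_derivative F t x (u (t, x))) (at t)"
proof -
  obtain u where u: "\<And>R. uniform_limit (ode_box R) picard u sequentially"
    by (rule picard_uniform_limit) blast
  have in_box: "z \<in> ode_box (norm (fst z) + norm (snd z))" for z
    using norm_ge_zero[of "snd z"] by (auto simp: ode_box_def mem_Times_iff simp del: norm_ge_zero)
  have cont: "continuous_on UNIV u"
  proof (rule continuous_at_imp_continuous_on, intro ballI)
    fix z :: "real \<times> 'p"
    \<comment> \<open>The summand 1 puts \<open>z\<close> into the interior of the box, so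
      continuity on the box gives continuity at \<open>z\<close>.\<close>
    define R where "R = norm (fst z) + norm (snd z) + 1"
    have "continuous_on (ode_box R) u"
      by (rule uniform_limit_theorem[OF _ u]) (auto intro!: always_eventually continuous_picard)
    then have "continuous_on ({-R<..<R} \<times> ball 0 R) u" if "{-R<..<R} \<times> ball 0 R \<subseteq> ode_box R"
      using that continuous_on_subset by blast
    moreover have "open ({-R<..<R} \<times> ball 0 R)" "{-R<..<R} \<times> ball 0 R \<subseteq> ode_box R" "z \<in> {-R<..<R} \<times> ball 0 R"
      using norm_ge_zero[of "snd z"]
      by (auto simp: ode_box_def R_def mem_Times_iff open_Times add_strict_increasing2 simp del: norm_ge_zero)
    ultimately show "isCont u z"
      using continuous_on_eq_continuous_at by blast
  qed
  have lim: "(\<lambda>n. picard n z) \<longlonglongrightarrow> u z" for z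
    using tendsto_uniform_limitI[OF u in_box] .
  have eq: "u (t, x) = u0 x + t *\<^sub>R integral {0..1} (\<lambda>s. F (t * s) x (u (t * s, x)))" for t x
  proof -
    define R where "R = norm t + norm x"
    have tx: "(t, x) \<in> ode_box R" using in_box[of "(t, x)"] by (simp add: R_def)
    \<comment> \<open>The iterates are uniformly close on the time segment, and \<open>Lip\<close>
      turns closeness \<open>e / L\<close> into closeness \<open>e\<close> of the integrands; so the
      limit passes through the integral and yields the fixed point equation.\<close>
    have "uniform_limit (cbox 0 1) (\<lambda>n s. F (t * s) x (picard n (t * s, x))) (\<lambda>s. F (t * s) x (u (t * s, x))) sequentially"
    proof (rule uniform_limitI)
      fix e :: real assume "e > 0"
      then have "\<forall>\<^sub>F n in sequentially. \<forall>z\<in>ode_box R. dist (picard n z) (u z) < e / L"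
        using L by (intro uniform_limitD[OF u]) auto
      then show "\<forall>\<^sub>F n in sequentially. \<forall>s\<in>cbox 0 1. dist (F (t * s) x (picard n (t * s, x))) (F (t * s) x (u (t * s, x))) < e"
      proof eventually_elim
        case (elim n)
        show ?case
        proof
          fix s :: real assume "s \<in> cbox 0 1"
          then have "dist (picard n (t * s, x)) (u (t * s, x)) < e / L"
            using elim ode_box_scale[OF tx, of s] by auto
          then have "L * norm (picard n (t * s, x) - u (t * s, x)) < e"
            using L by (simp add: dist_norm field_simps)
          then show "dist (F (t * s) x (picard n (t * s, x))) (F (t * s) x (u (t * s, x))) < e"
            using Lip[of "t * s" x "picard n (t * s, x)" "u (t * s, x)"] by (simp add: dist_norm)
        qed
      qed
    qed
    then obtain I J where I: "\<And>n. ((\<lambda>s. F (t * s) x (picard n (t * s, x))) has_integral I n) (cbox 0 1)"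
      and J: "((\<lambda>s. F (t * s) x (u (t * s, x))) has_integral J) (cbox 0 1)" and IJ: "I \<longlonglongrightarrow> J"
      by (rule uniform_limit_integral_cbox) (auto intro: continuous_picard_line)
    have "(\<lambda>n. u0 x + t *\<^sub>R I n) \<longlonglongrightarrow> u0 x + t *\<^sub>R J" by (intro tendsto_intros IJ)
    moreover have "picard (Suc n) (t, x) = u0 x + t *\<^sub>R I n" for n
      using integral_unique[OF I[of n]] by simp
    ultimately have "(\<lambda>n. picard (Suc n) (t, x)) \<longlonglongrightarrow> u0 x + t *\<^sub>R J" by (simp only:)
    then have "u (t, x) = u0 x + t *\<^sub>R J"
      using LIMSEQ_unique[OF LIMSEQ_Suc[OF lim]] by blast
    then show ?thesis using integral_unique[OF J] by simp
  qed
  have "((\<lambda>t. u (t, x)) has_vector_derivative F t x (u (t, x))) (at t)" for t x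
  proof -
    have "continuous_on UNIV (\<lambda>s. F s x (u (s, x)))"
      by (intro continuous_F_compose continuous_on_compose2[OF cont]) (auto intro!: continuous_intros)
    from has_vector_derivative_add[OF has_vector_derivative_const[of "u0 x"] has_vector_derivative_scaled_integral[OF this, of t]]
    have "((\<lambda>t. u0 x + t *\<^sub>R integral {0..1} (\<lambda>s. F (t * s) x (u (t * s, x)))) has_vector_derivative
        F t x (u (t, x))) (at t)" by simp
    then show ?thesis by (simp flip: eq)
  qed
  moreover have "u (0, x) = u0 x" for x using eq[of 0 x] by simp
  ultimately show ?thesis using that cont by blast
qed

end


section \<open>Differentiable dependence of solutions on parameters\<close>

lemma Ck_on_ftc_segment:
  fixes f :: "'a::euclidean_space \<Rightarrow> 'b::euclidean_space"
  assumes f: "Ck_on (Suc k) UNIV f"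
  shows "((\<lambda>\<theta>. frechet_derivative f (at (a + \<theta> *\<^sub>R d)) d) has_integral f (a + d) - f a) {0..1}"
proof -
  have "((\<lambda>\<theta>. frechet_derivative f (at (a + \<theta> *\<^sub>R d)) d) has_integral f (a + 1 *\<^sub>R d) - f (a + 0 *\<^sub>R d)) {0..1}"
  proof (rule fundamental_theorem_of_calculus)
    fix \<theta> :: real
    have D: "(f has_derivative frechet_derivative f (at (a + \<theta> *\<^sub>R d))) (at (a + \<theta> *\<^sub>R d))"
      by (rule Ck_on_Suc_deriv[OF f]) simp
    have p: "((\<lambda>\<theta>. a + \<theta> *\<^sub>R d) has_vector_derivative d) (at \<theta>)"
      by (auto intro!: derivative_eq_intros)
    show "((\<lambda>\<theta>. f (a + \<theta> *\<^sub>R d)) has_vector_derivative frechet_derivative f (at (a + \<theta> *\<^sub>R d)) d) (at \<theta> within {0..1})"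
      by (rule has_vector_derivative_at_within[OF has_vector_derivative_chain[where p="\<lambda>\<theta>. a + \<theta> *\<^sub>R d", OF D p]])
  qed simp
  then show ?thesis by simp
qed

lemma has_vector_derivative_norm_le:
  assumes "(f has_vector_derivative d) (at 0)" "\<And>h. norm (f h - f 0) \<le> C * \<bar>h\<bar>"
  shows "norm d \<le> C"
proof -
  have "((\<lambda>h. C + norm (f h - f 0 - (h - 0) *\<^sub>R d) / norm (h - 0)) \<longlongrightarrow> C + 0) (at 0)"
    using assms(1) unfolding has_vector_derivative_def has_derivative_iff_norm by (intro tendsto_intros) auto
  moreover have "norm d \<le> C + norm (f h - f 0 - (h - 0) *\<^sub>R d) / norm (h - 0)" if "h \<noteq> 0" for h
  proof -
    have "norm (h *\<^sub>R d) \<le> norm (f h - f 0) + norm (f h - f 0 - h *\<^sub>R d)"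
      using norm_triangle_ineq4[of "f h - f 0" "f h - f 0 - h *\<^sub>R d"] by simp
    then have "\<bar>h\<bar> * norm d \<le> C * \<bar>h\<bar> + norm (f h - f 0 - h *\<^sub>R d)" using assms(2)[of h] by simp
    then show ?thesis using that by (simp add: field_simps)
  qed
  ultimately have "norm d \<le> C + 0"
    by (intro tendsto_lowerbound[of _ _ "at (0::real)"]) (auto simp: eventually_at_filter intro!: always_eventually)
  then show ?thesis by simp
qed

text \<open>Transfers the Lipschitz constant of the right-hand side to its linearisation, which is
  thus solvable with the same constant.\<close>

lemma frechet_Lipschitz_bound:
  assumes f: "(f has_derivative f') (at z)" and lip: "\<And>h. norm (f (z + h *\<^sub>R r) - f z) \<le> C * \<bar>h\<bar>"
  shows "norm (f' r) \<le> C"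
proof (rule has_vector_derivative_norm_le)
  show "((\<lambda>h. f (z + h *\<^sub>R r)) has_vector_derivative f' r) (at 0)"
    by (rule has_vector_derivative_chain[where p="\<lambda>h. z + h *\<^sub>R r"]) (use f in \<open>auto intro!: derivative_eq_intros\<close>)
qed (use lip in simp)

text \<open>The difference quotient at 0 is \<open>q h\<close> itself, so continuity of
  \<open>q\<close> at 0 already is differentiability.\<close>

lemma has_vector_derivative_scaleR_at_0:
  assumes "isCont q 0"
  shows "((\<lambda>h. c + h *\<^sub>R q h) has_vector_derivative q 0) (at 0)"
proof -
  have "((\<lambda>h. norm (q h - q 0)) \<longlongrightarrow> 0) (at 0)"
    using assms unfolding isCont_def by (metis LIM_zero tendsto_norm_zero)
  then have "((\<lambda>h. norm (c + h *\<^sub>R q h - (c + 0 *\<^sub>R q 0) - (h - 0) *\<^sub>R q 0) / norm (h - 0)) \<longlongrightarrow> 0) (at 0)"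
    by (rule Lim_transform_eventually)
      (auto simp: eventually_at_filter algebra_simps simp flip: scaleR_diff_right intro!: always_eventually)
  then show ?thesis
    unfolding has_vector_derivative_def has_derivative_iff_norm
    by (simp add: bounded_linear_scaleR_left)
qed

lemma ode_solution_unique:
  fixes F :: "real \<Rightarrow> 'p \<Rightarrow> 'e::real_inner \<Rightarrow> 'e"
  assumes Lip: "\<And>t x w w'. norm (F t x w - F t x w') \<le> L * norm (w - w')"
    and u: "u (0, x) = u0 x" "\<And>t. ((\<lambda>t. u (t, x)) has_vector_derivative F t x (u (t, x))) (at t)"
    and u': "u' (0, x) = u0 x" "\<And>t. ((\<lambda>t. u' (t, x)) has_vector_derivative F t x (u' (t, x))) (at t)"
  shows "u (t, x) = u' (t, x)"
  by (rule ode_unique[where ?D1.0="\<lambda>t. F t x (u (t, x))" and ?D2.0="\<lambda>t. F t x (u' (t, x))" and L=L])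
    (use assms in auto)

text \<open>Writing \<open>u(t, x + h v) = u(t, x) + h q(t, x, h)\<close>, the difference quotient \<open>q\<close> solves a linear equation
  whose coefficients depend continuously on \<open>h\<close>, up to \<open>h = 0\<close>; so continuous dependence on parameters
  yields the derivative in \<open>x\<close>.\<close>

lemma param_ode_directional:
  fixes F :: "real \<Rightarrow> 'p::euclidean_space \<Rightarrow> 'e::euclidean_space \<Rightarrow> 'e" and u0 :: "'p \<Rightarrow> 'e"
  assumes F: "Ck_on (Suc k) UNIV (\<lambda>(t, x, w). F t x w)" and u0: "Ck_on (Suc k) UNIV u0" and L: "L > 0"
    and Lip: "\<And>t x w w'. norm (F t x w - F t x w') \<le> L * norm (w - w')"
    and cu: "continuous_on UNIV u" and u_0: "\<And>x. u (0, x) = u0 x"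
    and u: "\<And>t x. ((\<lambda>t. u (t, x)) has_vector_derivative F t x (u (t, x))) (at t)"
  defines "DF \<equiv> \<lambda>z. frechet_derivative (\<lambda>(t, x, w). F t x w) (at z)"
  obtains z where "\<And>t x. ((\<lambda>h. u (t, x + h *\<^sub>R v)) has_vector_derivative z (t, x)) (at 0)"
    "\<And>x. z (0, x) = frechet_derivative u0 (at x) v"
    "\<And>t x. ((\<lambda>t. z (t, x)) has_vector_derivative DF (t, x, u (t, x)) (0, v, z (t, x))) (at t)"
    "\<And>t x w w'. norm (DF (t, x, u (t, x)) (0, v, w) - DF (t, x, u (t, x)) (0, v, w')) \<le> L * norm (w - w')"
proof -
  let ?F = "\<lambda>(t, x, w). F t x w"
  have DF: "(?F has_derivative DF z) (at z)" for z
    unfolding DF_def by (rule Ck_on_Suc_deriv[OF F]) simp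
  have lin: "linear (DF z)" for z using DF by (simp add: has_derivative_def bounded_linear.linear)
  have cDF: "continuous_on S (\<lambda>y. DF (a y) (d y))" if "continuous_on S a" "continuous_on S d"
    for S :: "'y::t2_space set" and a d
  proof -
    have "Ck_on 0 UNIV (\<lambda>y. DF (fst y) (snd y))"
      unfolding DF_def using Ck_on_le[OF F, of "Suc 0"]
      by (intro Ck_on_deriv_dir[of UNIV 0 UNIV]) (auto intro!: continuous_intros simp del: Ck_on.simps(2))
    from continuous_on_compose2[OF this[simplified], of S "\<lambda>y. (a y, d y)"] that
    show ?thesis by (simp add: continuous_on_Pair)
  qed
  have DF_le: "norm (DF z (0, 0, r)) \<le> L * norm r" for z r
  proof (rule frechet_Lipschitz_bound[OF DF])
    fix h
    show "norm (?F (z + h *\<^sub>R (0, 0, r)) - ?F z) \<le> L * norm r * \<bar>h\<bar>"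
      using Lip[of "fst z" "fst (snd z)" "snd (snd z) + h *\<^sub>R r" "snd (snd z)"]
      by (cases z) (simp add: mult_ac)
  qed
  have DF_diff: "norm (DF z (a, b, r) - DF z (a, b, r')) \<le> L * norm (r - r')" for z a b r r'
    using DF_le[of z "r - r'"] by (simp flip: linear_diff[OF lin])
  \<comment> \<open>With the enlarged parameter \<open>y = (x, h)\<close>, this is the segment from
    the graph point over \<open>x\<close> to the one over \<open>x + h v\<close>. Averaging
    \<open>DF\<close> over it in \<open>G\<close> turns the increment of \<open>F\<close> into a
    linear expression; at \<open>h = 0\<close> the segment degenerates and \<open>G\<close> is the
    linearisation along the solution.\<close>
  define p where "p t y \<theta> = (t, fst y + (\<theta> * snd y) *\<^sub>R v, u (t, fst y) + \<theta> *\<^sub>R (u (t, fst y + snd y *\<^sub>R v) - u (t, fst y)))"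
    for t \<theta> :: real and y :: "'p \<times> real"
  define G where "G t y w = integral {0..1} (\<lambda>\<theta>. DF (p t y \<theta>) (0, v, w))" for t y w
  have cp: "continuous_on S (\<lambda>s. p (a s) (b s) (c s))" if "continuous_on S a" "continuous_on S b" "continuous_on S c"
    for S :: "'y::t2_space set" and a b c
    unfolding p_def using that by (intro continuous_intros continuous_on_compose2[OF cu]) auto
  have int: "(\<lambda>\<theta>. DF (p t y \<theta>) d) integrable_on {0..1}" for t y d
    by (intro integrable_continuous_interval cDF cp continuous_intros)
  have cG: "continuous_on UNIV (\<lambda>(t, y, w). G t y w)"
  proof -
    have "continuous_on (UNIV \<times> cbox 0 1) (\<lambda>(s, \<theta>). DF (p (fst s) (fst (snd s)) \<theta>) (0, v, snd (snd s)))"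
      unfolding case_prod_beta by (intro cDF cp continuous_intros)
    from integral_continuous_on_param[OF this] show ?thesis
      by (simp add: G_def case_prod_beta)
  qed
  have GLip: "norm (G t y w - G t y w') \<le> L * norm (w - w')" for t y w w'
  proof -
    have "norm (integral {0..1} (\<lambda>\<theta>. DF (p t y \<theta>) (0, v, w) - DF (p t y \<theta>) (0, v, w'))) \<le> integral {0..1} (\<lambda>\<theta>::real. L * norm (w - w'))"
      by (rule integral_norm_bound_integral) (auto intro: integrable_diff int DF_diff)
    then show ?thesis unfolding G_def integral_diff[OF int int] by simp
  qed
  define q0 where "q0 y = integral {0..1} (\<lambda>\<theta>. frechet_derivative u0 (at (fst y + (\<theta> * snd y) *\<^sub>R v)) v)" for y
  have cq0: "continuous_on UNIV q0"
  proof -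
    have "continuous_on UNIV (\<lambda>x. frechet_derivative u0 (at x) v)"
      using u0 by (intro Ck_on_imp_continuous_on[of k]) simp
    then have "continuous_on (UNIV \<times> cbox 0 1) (\<lambda>(y, \<theta>). frechet_derivative u0 (at (fst y + (\<theta> * snd y) *\<^sub>R v)) v)"
      unfolding case_prod_beta by (rule continuous_on_compose2) (auto intro!: continuous_intros)
    from integral_continuous_on_param[OF this] show ?thesis by (simp add: q0_def[abs_def])
  qed
  \<comment> \<open>The quotient is constructed as a solution and never as a division by
    \<open>h\<close>, so it exists and is continuous across \<open>h = 0\<close>.\<close>
  obtain q where cq: "continuous_on UNIV q" and q_0: "\<And>y. q (0, y) = q0 y"
    and q: "\<And>t y. ((\<lambda>t. q (t, y)) has_vector_derivative G t y (q (t, y))) (at t)"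
    by (rule param_ode_exists[OF cG L GLip cq0]) blast
  have uq: "u (t, x + h *\<^sub>R v) = u (t, x) + h *\<^sub>R q (t, x, h)" for t x h
  proof -
    have "h *\<^sub>R q (t, x, h) = u (t, x + h *\<^sub>R v) - u (t, x)"
    \<comment> \<open>Both sides start from the same value, and both derivatives are integrals of
      \<open>DF\<close> along the segment, in directions that differ only in the last component;
      hence the Lipschitz comparison.\<close>
    proof (rule ode_unique[where t=t and L=L and ?D1.0="\<lambda>t. h *\<^sub>R G t (x, h) (q (t, x, h))"
          and ?D2.0="\<lambda>t. F t (x + h *\<^sub>R v) (u (t, x + h *\<^sub>R v)) - F t x (u (t, x))" and ?y1.0="\<lambda>t. h *\<^sub>R q (t, x, h)"
          and ?y2.0="\<lambda>t. u (t, x + h *\<^sub>R v) - u (t, x)"])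
      fix s
      show "((\<lambda>t. h *\<^sub>R q (t, x, h)) has_vector_derivative h *\<^sub>R G s (x, h) (q (s, x, h))) (at s)"
        using has_vector_derivative_scaleR[OF DERIV_const q[of "(x, h)" s], of h] by simp
      show "((\<lambda>t. u (t, x + h *\<^sub>R v) - u (t, x)) has_vector_derivative
          F s (x + h *\<^sub>R v) (u (s, x + h *\<^sub>R v)) - F s x (u (s, x))) (at s)"
        by (intro has_vector_derivative_diff u)
      let ?d = "u (s, x + h *\<^sub>R v) - u (s, x)"
      let ?p = "p s (x, h)"
      have p_eq: "?p \<theta> = (s, x, u (s, x)) + \<theta> *\<^sub>R (0, h *\<^sub>R v, ?d)" for \<theta> by (simp add: p_def)
      have I2: "((\<lambda>\<theta>. DF (?p \<theta>) (0, h *\<^sub>R v, ?d)) has_integral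
          F s (x + h *\<^sub>R v) (u (s, x + h *\<^sub>R v)) - F s x (u (s, x))) {0..1}"
        using Ck_on_ftc_segment[OF F, of "(s, x, u (s, x))" "(0, h *\<^sub>R v, ?d)"] by (simp only: p_eq DF_def) simp
      have "((\<lambda>\<theta>. h *\<^sub>R DF (?p \<theta>) (0, v, q (s, x, h))) has_integral h *\<^sub>R G s (x, h) (q (s, x, h))) {0..1}"
        unfolding G_def by (intro has_integral_cmul integrable_integral int)
      then have I1: "((\<lambda>\<theta>. DF (?p \<theta>) (0, h *\<^sub>R v, h *\<^sub>R q (s, x, h))) has_integral h *\<^sub>R G s (x, h) (q (s, x, h))) {0..1}"
        by (simp flip: linear_cmul[OF lin])
      have "norm (integral {0..1} (\<lambda>\<theta>. DF (?p \<theta>) (0, h *\<^sub>R v, h *\<^sub>R q (s, x, h)) - DF (?p \<theta>) (0, h *\<^sub>R v, ?d)))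
          \<le> integral {0..1} (\<lambda>\<theta>::real. L * norm (h *\<^sub>R q (s, x, h) - ?d))"
        by (rule integral_norm_bound_integral) (auto intro: integrable_diff int DF_diff)
      then show "norm (h *\<^sub>R G s (x, h) (q (s, x, h)) - (F s (x + h *\<^sub>R v) (u (s, x + h *\<^sub>R v)) - F s x (u (s, x))))
          \<le> L * norm (h *\<^sub>R q (s, x, h) - ?d)"
        using integral_unique[OF has_integral_diff[OF I1 I2]] by simp
    next
      have "((\<lambda>\<theta>. h *\<^sub>R frechet_derivative u0 (at (x + (\<theta> * h) *\<^sub>R v)) v) has_integral h *\<^sub>R q0 (x, h)) {0..1}"
      proof -
        have "continuous_on UNIV (\<lambda>x. frechet_derivative u0 (at x) v)"
          using u0 by (intro Ck_on_imp_continuous_on[of k]) simp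
        then have "continuous_on {0..1} (\<lambda>\<theta>. frechet_derivative u0 (at (x + (\<theta> * h) *\<^sub>R v)) v)"
          by (rule continuous_on_compose2) (auto intro!: continuous_intros)
        then show ?thesis
          unfolding q0_def fst_conv snd_conv
          by (intro has_integral_cmul integrable_integral integrable_continuous_interval)
      qed
      moreover have "frechet_derivative u0 (at y) (h *\<^sub>R v) = h *\<^sub>R frechet_derivative u0 (at y) v" for y
        using Ck_on_Suc_deriv[OF u0] by (intro linear_cmul) (auto simp: has_derivative_def bounded_linear.linear)
      ultimately have "((\<lambda>\<theta>. frechet_derivative u0 (at (x + \<theta> *\<^sub>R h *\<^sub>R v)) (h *\<^sub>R v)) has_integral h *\<^sub>R q0 (x, h)) {0..1}"
        by simp
      from has_integral_unique[OF this Ck_on_ftc_segment[OF u0]]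
      show "h *\<^sub>R q (0, x, h) = u (0, x + h *\<^sub>R v) - u (0, x)" by (simp add: q_0 u_0)
    qed
    then show ?thesis by simp
  qed
  have p0: "p t (x, 0) \<theta> = (t, x, u (t, x))" for t x \<theta> by (simp add: p_def)
  show ?thesis
  proof (rule that[of "\<lambda>(t, x). q (t, x, 0)"])
    fix t x
    have "isCont (\<lambda>h. q (t, x, h)) 0"
      by (rule continuous_on_interior[of UNIV], rule continuous_on_compose2[OF cq]) (auto intro!: continuous_intros)
    from has_vector_derivative_scaleR_at_0[OF this, of "u (t, x)"]
    show "((\<lambda>h. u (t, x + h *\<^sub>R v)) has_vector_derivative (case (t, x) of (t, x) \<Rightarrow> q (t, x, 0))) (at 0)"
      by (simp flip: uq)
    show "((\<lambda>t. case (t, x) of (t, x) \<Rightarrow> q (t, x, 0)) has_vector_derivative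
        DF (t, x, u (t, x)) (0, v, case (t, x) of (t, x) \<Rightarrow> q (t, x, 0))) (at t)"
      using q[of "(x, 0)" t] by (simp add: G_def p0)
  qed (simp_all add: q_0 q0_def DF_diff)
qed

text \<open>The \<open>x\<close>-derivatives solve the linearised equation, whose coefficients
  contain \<open>u\<close> and are of class C^k by the induction hypothesis; the
  \<open>t\<close>-derivative is \<open>F\<close> along \<open>u\<close>. The linearised equation is
  again of the assumed form with the same \<open>L\<close>, so the induction ranges over all
  \<open>F\<close>, \<open>u0\<close> and \<open>u\<close>.\<close>

theorem param_ode_Ck:
  fixes F :: "real \<Rightarrow> 'p::euclidean_space \<Rightarrow> 'e::euclidean_space \<Rightarrow> 'e" and u0 :: "'p \<Rightarrow> 'e"
  assumes "Ck_on k UNIV (\<lambda>(t, x, w). F t x w)" "Ck_on k UNIV u0" and L: "L > 0"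
    and "\<And>t x w w'. norm (F t x w - F t x w') \<le> L * norm (w - w')"
    and "\<And>x. u (0, x) = u0 x"
    and "\<And>t x. ((\<lambda>t. u (t, x)) has_vector_derivative F t x (u (t, x))) (at t)"
  shows "Ck_on k UNIV u"
  using assms(1,2,4-)
proof (induction k arbitrary: F u0 u)
  case 0
  from 0(1,2) have c: "continuous_on UNIV (\<lambda>(t, x, w). F t x w)" "continuous_on UNIV u0" by simp_all
  obtain v where v: "continuous_on UNIV v" "\<And>x. v (0, x) = u0 x"
    "\<And>t x. ((\<lambda>t. v (t, x)) has_vector_derivative F t x (v (t, x))) (at t)"
    by (rule param_ode_exists[OF c(1) L 0(3) c(2)]) blast
  have "u = v"
  proof
    fix z :: "real \<times> 'p"
    have "u (fst z, snd z) = v (fst z, snd z)"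
      by (rule ode_solution_unique[where F=F and ?u0.0=u0 and L=L]) (use 0 v in auto)
    then show "u z = v z" by simp
  qed
  with v show ?case by simp
next
  case (Suc k)
  note F = Suc.prems(1) and u0 = Suc.prems(2) and Lip = Suc.prems(3) and u_0 = Suc.prems(4) and u = Suc.prems(5)
  have Cu: "Ck_on k UNIV u"
    by (rule Suc.IH[OF Ck_on_SucD[OF F] Ck_on_SucD[OF u0] Lip u_0 u])
  define DF where "DF z = frechet_derivative (\<lambda>(t, x, w). F t x w) (at z)" for z
  have "\<exists>z. Ck_on k UNIV z \<and> (\<forall>t x. ((\<lambda>h. u (t, x + h *\<^sub>R v)) has_vector_derivative z (t, x)) (at 0))" for v
  proof -
    obtain z where z: "\<And>t x. ((\<lambda>h. u (t, x + h *\<^sub>R v)) has_vector_derivative z (t, x)) (at 0)"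
      "\<And>x. z (0, x) = frechet_derivative u0 (at x) v"
      "\<And>t x. ((\<lambda>t. z (t, x)) has_vector_derivative DF (t, x, u (t, x)) (0, v, z (t, x))) (at t)"
      "\<And>t x w w'. norm (DF (t, x, u (t, x)) (0, v, w) - DF (t, x, u (t, x)) (0, v, w')) \<le> L * norm (w - w')"
      unfolding DF_def
      by (rule param_ode_directional[OF F u0 L Lip Ck_on_imp_continuous_on[OF Cu] u_0 u]) blast
    have "Ck_on k UNIV z"
    proof (rule Suc.IH[where F="\<lambda>t x w. DF (t, x, u (t, x)) (0, v, w)"])
      have fst_snd: "Ck_on k UNIV (\<lambda>y::real \<times> 'p \<times> 'e. fst y)" "Ck_on k UNIV (\<lambda>y::real \<times> 'p \<times> 'e. fst (snd y))"
        "Ck_on k UNIV (\<lambda>y::real \<times> 'p \<times> 'e. snd (snd y))"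
        by (intro Ck_on_bounded_linear bounded_linear_intros)+
      have eq: "(\<lambda>(t, x, w). DF (t, x, u (t, x)) (0, v, w)) = (\<lambda>y. frechet_derivative (\<lambda>(t, x, w). F t x w)
          (at (fst y, fst (snd y), u (fst y, fst (snd y)))) (0, v, snd (snd y)))"
        by (auto simp: DF_def fun_eq_iff)
      show "Ck_on k UNIV (\<lambda>(t, x, w). DF (t, x, u (t, x)) (0, v, w))"
        unfolding eq
        by (intro Ck_on_deriv_dir[OF open_UNIV F] Ck_on_Pair[OF open_UNIV] fst_snd Ck_on_const
            Ck_on_compose[OF open_UNIV Ck_on_Pair[OF open_UNIV fst_snd(1,2)] Cu]) auto
      show "Ck_on k UNIV (\<lambda>x. frechet_derivative u0 (at x) v)" using u0 by simp
    qed (fact z(4) z(2) z(3))+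
    with z(1) show ?thesis by blast
  qed
  then obtain z where z: "\<And>v. Ck_on k UNIV (z v)"
    "\<And>v t x. ((\<lambda>h. u (t, x + h *\<^sub>R v)) has_vector_derivative z v (t, x)) (at 0)"
    by metis
  show ?case
  \<comment> \<open>The basis vectors of the product are the time direction \<open>(1, 0)\<close>
    and the vectors \<open>(0, c)\<close> with \<open>c\<close> nonzero; the test
    \<open>snd b = 0\<close> tells them apart.\<close>
  proof (rule Ck_on_partials[OF open_UNIV,
        where D="\<lambda>b y. if snd b = 0 then F (fst y) (snd y) (u y) else z (snd b) y"])
    fix y b :: "real \<times> 'p" assume "b \<in> Basis"
    then consider "b = (1, 0)" | c where "c \<in> Basis" "b = (0, c)" by (auto simp: Basis_prod_def)
    then show "((\<lambda>h. u (y + h *\<^sub>R b)) has_vector_derivative (if snd b = 0 then F (fst y) (snd y) (u y) else z (snd b) y)) (at 0)"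
    proof cases
      case 1
      obtain t x where y: "y = (t, x)" by (cases y)
      have "((\<lambda>h. t + h) has_vector_derivative 1) (at 0)"
        by (rule has_real_derivative_iff_has_vector_derivative[THEN iffD1]) (auto intro!: derivative_eq_intros)
      moreover have "((\<lambda>t. u (t, x)) has_vector_derivative F t x (u (t, x))) (at (t + 0))"
        using u[of x t] by simp
      ultimately have "((\<lambda>t. u (t, x)) \<circ> (\<lambda>h. t + h) has_vector_derivative 1 *\<^sub>R F t x (u (t, x))) (at 0)"
        by (rule vector_diff_chain_at)
      then have "((\<lambda>h. u (t + h, x)) has_vector_derivative F t x (u (t, x))) (at 0)"
        by (simp add: o_def)
      then show ?thesis using 1 by (simp add: y)
    next
      case 2
      then show ?thesis using z(2)[of "fst y" "snd y" c] by (cases y) (auto simp: nonzero_Basis)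
    qed
  next
    fix b :: "real \<times> 'p"
    have "Ck_on k UNIV (\<lambda>y. (\<lambda>(t, x, w). F t x w) (fst y, snd y, u y))"
      by (rule Ck_on_compose[OF open_UNIV _ Ck_on_SucD[OF F]])
        (intro Ck_on_Pair open_UNIV Cu Ck_on_bounded_linear bounded_linear_fst bounded_linear_snd, simp)
    then show "Ck_on k UNIV (\<lambda>y. if snd b = 0 then F (fst y) (snd y) (u y) else z (snd b) y)"
      using z(1)[of "snd b"] by (cases "snd b = 0") simp_all
  qed
qed

text \<open>Supplies the global Lipschitz constant for vector fields read in a chart and cut off
  there.\<close>

lemma compact_support_Lipschitz:
  fixes f :: "'a::euclidean_space \<Rightarrow> 'b::real_normed_vector"
  assumes f: "smooth_on UNIV f" and K: "compact K" "\<And>x. x \<notin> K \<Longrightarrow> f x = 0"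
  obtains L where "L > 0" "\<And>x y. norm (f x - f y) \<le> L * norm (x - y)"
proof -
  have D: "(f has_derivative frechet_derivative f (at x)) (at x)" for x
    by (rule smooth_on_has_derivative[OF f]) simp
  have Z: "frechet_derivative f (at x) v = 0" if "x \<notin> K" for x v
  proof -
    have "(f has_derivative (\<lambda>v. 0)) (at x)"
      by (rule has_derivative_transform_within_open[of "\<lambda>x. 0" _ x UNIV "- K"])
        (use that K compact_imp_closed[OF K(1)] in auto)
    from frechet_derivative_at[OF this] show ?thesis by metis
  qed
  have "\<exists>C. \<forall>x. norm (frechet_derivative f (at x) b) \<le> C" for b
  proof -
    have "continuous_on K (\<lambda>x. frechet_derivative f (at x) b)"
      using smooth_on_continuous[OF smooth_on_frechet[OF f]] continuous_on_subset by blast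
    then have "bounded ((\<lambda>x. frechet_derivative f (at x) b) ` K)"
      by (intro compact_imp_bounded compact_continuous_image K)
    then obtain C where "C > 0" "\<forall>x\<in>K. norm (frechet_derivative f (at x) b) \<le> C"
      unfolding bounded_pos by auto
    then show ?thesis using Z by (metis less_imp_le norm_zero)
  qed
  then obtain C where C: "\<And>b x. norm (frechet_derivative f (at x) b) \<le> C b" by metis
  define L where "L = (\<Sum>b\<in>Basis. C b) + 1"
  have C0: "C b \<ge> 0" for b using C norm_ge_zero order_trans by blast
  have "norm (f x - f y) \<le> L * norm (x - y)" for x y
  proof (rule differentiable_bound[OF convex_UNIV])
    fix x :: 'a
    show "(f has_derivative frechet_derivative f (at x)) (at x within UNIV)" by (rule D)
    show "onorm (frechet_derivative f (at x)) \<le> L"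
    proof (rule onorm_bound)
      fix v
      have "frechet_derivative f (at x) v = (\<Sum>b\<in>Basis. (v \<bullet> b) *\<^sub>R frechet_derivative f (at x) b)"
        using D by (intro linear_euclidean_sum) (auto simp: has_derivative_def bounded_linear.linear)
      also have "norm \<dots> \<le> (\<Sum>b\<in>Basis. norm ((v \<bullet> b) *\<^sub>R frechet_derivative f (at x) b))" by (rule norm_sum)
      also have "\<dots> \<le> (\<Sum>b\<in>Basis. norm v * C b)"
        unfolding norm_scaleR by (intro sum_mono mult_mono C) (auto intro: Basis_le_norm)
      also have "\<dots> \<le> L * norm v" by (simp add: L_def sum_distrib_left algebra_simps)
      finally show "norm (frechet_derivative f (at x) v) \<le> L * norm v" .
    qed (use C0 in \<open>auto simp: L_def sum_nonneg\<close>)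
  qed auto
  moreover have "L > 0" using C0 by (simp add: L_def sum_nonneg add_nonneg_pos)
  ultimately show ?thesis using that by blast
qed

text \<open>The parameter is now the initial point, entering only through the initial value;
  smoothness in \<open>(t, x)\<close> jointly is smooth dependence on initial data.\<close>

theorem smooth_flow:
  fixes f :: "'e::euclidean_space \<Rightarrow> 'e"
  assumes f: "smooth_on UNIV f" and L: "L > 0" "\<And>x y. norm (f x - f y) \<le> L * norm (x - y)"
  obtains u where "smooth_on UNIV u" "\<And>x. u (0, x) = x"
    "\<And>t x. ((\<lambda>t. u (t, x)) has_vector_derivative f (u (t, x))) (at t)"
proof -
  have F: "Ck_on k UNIV (\<lambda>(t::real, x::'e, w). f w)" for k
  proof -
    have "Ck_on k UNIV (\<lambda>y::real \<times> 'e \<times> 'e. snd (snd y))"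
      by (intro Ck_on_bounded_linear bounded_linear_intros)
    from Ck_on_compose[OF open_UNIV this smooth_on_Ck[OF f]] show ?thesis by (simp add: case_prod_unfold)
  qed
  have I: "Ck_on k UNIV (\<lambda>x::'e. x)" for k by (rule Ck_on_ident)
  obtain u where u: "continuous_on UNIV u" "\<And>x. u (0, x) = x"
    "\<And>t x. ((\<lambda>t. u (t, x)) has_vector_derivative f (u (t, x))) (at t)"
    by (rule param_ode_exists[OF Ck_on_imp_continuous_on[OF F[of 0]] L(1) L(2) continuous_on_id]) blast
  have "Ck_on k UNIV u" for k
    by (rule param_ode_Ck[OF F I L(1) L(2) u(2) u(3)])
  then have "smooth_on UNIV u" by (simp add: smooth_on_def)
  then show ?thesis by (rule that[OF _ u(2) u(3)])
qed

section \<open>Smooth maps between manifolds\<close>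

lemma chart_open: "is_chart U \<phi> \<Longrightarrow> open U"
  and chart_image_open: "is_chart U \<phi> \<Longrightarrow> open (\<phi> ` U)"
  and chart_continuous: "is_chart U \<phi> \<Longrightarrow> continuous_on U \<phi>"
  and chart_inv_continuous: "is_chart U \<phi> \<Longrightarrow> continuous_on (\<phi> ` U) (inv_into U \<phi>)"
  and chart_inv: "is_chart U \<phi> \<Longrightarrow> x \<in> U \<Longrightarrow> inv_into U \<phi> (\<phi> x) = x"
  by (auto simp: is_chart_def homeomorphism_def)

lemma chart_inj: "is_chart U \<phi> \<Longrightarrow> inj_on \<phi> U"
  by (metis chart_inv inj_on_def)

lemma chart_open_image:
  assumes c: "is_chart U \<phi>" and W: "open W" "W \<subseteq> U"
  shows "open (\<phi> ` W)"
proof -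
  have "\<phi> ` W = \<phi> ` U \<inter> inv_into U \<phi> -` W"
    using W chart_inv[OF c] by force
  then show ?thesis
    using continuous_open_preimage[OF chart_inv_continuous[OF c] chart_image_open[OF c] W(1)] by simp
qed

lemma atlas_chart: "smooth_atlas A \<Longrightarrow> (U, \<phi>) \<in> A \<Longrightarrow> is_chart U \<phi>"
  by (auto simp: smooth_atlas_def)

lemma atlas_cover:
  assumes "smooth_atlas A" obtains U \<phi> where "(U, \<phi>) \<in> A" "x \<in> U"
proof -
  have "x \<in> (\<Union>(U, \<phi>)\<in>A. U)" using assms unfolding smooth_atlas_def by blast
  then show ?thesis using that by auto
qed

lemma atlas_transition:
  "smooth_atlas A \<Longrightarrow> (U, \<phi>) \<in> A \<Longrightarrow> (V, \<psi>) \<in> A \<Longrightarrow> smooth_on (\<phi> ` (U \<inter> V)) (\<psi> \<circ> inv_into U \<phi>)"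
  unfolding smooth_atlas_def by blast

text \<open>The definition quantifies over all pairs of charts. One pair around each point suffices:
  any other expression differs from the given one by transition maps, and continuity comes with the
  expression.\<close>

lemma smooth_map_onI:
  fixes A :: "('m::{t2_space,second_countable_topology}, 'e::euclidean_space) chart set"
    and B :: "('n::{t2_space,second_countable_topology}, 'f::euclidean_space) chart set"
  assumes A: "smooth_atlas A" and B: "smooth_atlas B"
    and loc: "\<And>x. x \<in> S \<Longrightarrow> \<exists>U \<phi> V \<psi> W. (U, \<phi>) \<in> A \<and> (V, \<psi>) \<in> B \<and> open W \<and> x \<in> W \<and> W \<subseteq> U \<and> F ` W \<subseteq> V \<and>
      smooth_on (\<phi> ` W) (\<psi> \<circ> F \<circ> inv_into U \<phi>)"
  shows "smooth_map_on S A B F"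
proof -
  have cont: "continuous_on W F"
    if "(U, \<phi>) \<in> A" "(V, \<psi>) \<in> B" "W \<subseteq> U" "F ` W \<subseteq> V" "smooth_on (\<phi> ` W) (\<psi> \<circ> F \<circ> inv_into U \<phi>)"
    for U \<phi> V \<psi> W
  proof -
    note c = atlas_chart[OF A that(1)] and d = atlas_chart[OF B that(2)]
    have "continuous_on W (\<lambda>x. inv_into V \<psi> ((\<psi> \<circ> F \<circ> inv_into U \<phi>) (\<phi> x)))"
    proof (rule continuous_on_compose2[OF chart_inv_continuous[OF d]])
      show "continuous_on W (\<lambda>x. (\<psi> \<circ> F \<circ> inv_into U \<phi>) (\<phi> x))"
        by (rule continuous_on_compose2[OF smooth_on_continuous[OF that(5)] continuous_on_subset[OF chart_continuous[OF c] that(3)]]) auto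
      show "(\<lambda>x. (\<psi> \<circ> F \<circ> inv_into U \<phi>) (\<phi> x)) ` W \<subseteq> \<psi> ` V"
        using that(3,4) chart_inv[OF c] by force
    qed
    moreover have "inv_into V \<psi> ((\<psi> \<circ> F \<circ> inv_into U \<phi>) (\<phi> x)) = F x" if "x \<in> W" for x
      using that \<open>W \<subseteq> U\<close> \<open>F ` W \<subseteq> V\<close> chart_inv[OF c] chart_inv[OF d] by (auto simp: image_subset_iff subset_iff)
    ultimately show ?thesis by (metis (no_types, lifting) continuous_on_cong)
  qed
  have 1: "continuous_on S F"
    proof (rule continuous_at_imp_continuous_on, intro ballI)
      fix x assume "x \<in> S"
      from loc[OF this] cont show "isCont F x" by (metis continuous_on_eq_continuous_at)
    qed
  have 2: "smooth_on (\<phi>' ` (S \<inter> U' \<inter> F -` V')) (\<psi>' \<circ> F \<circ> inv_into U' \<phi>')"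
    if c: "(U', \<phi>') \<in> A" and c': "(V', \<psi>') \<in> B" for U' \<phi>' V' \<psi>'
  proof -
    note cU' = atlas_chart[OF A c]
    show "smooth_on (\<phi>' ` (S \<inter> U' \<inter> F -` V')) (\<psi>' \<circ> F \<circ> inv_into U' \<phi>')"
    proof (rule smooth_on_local)
      fix y assume "y \<in> \<phi>' ` (S \<inter> U' \<inter> F -` V')"
      then obtain x where x: "x \<in> S" "x \<in> U'" "F x \<in> V'" "y = \<phi>' x" by auto
      from loc[OF x(1)] obtain U \<phi> V \<psi> W where W: "(U, \<phi>) \<in> A" "(V, \<psi>) \<in> B" "open W" "x \<in> W" "W \<subseteq> U" "F ` W \<subseteq> V"
        "smooth_on (\<phi> ` W) (\<psi> \<circ> F \<circ> inv_into U \<phi>)" by blast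
      note cU = atlas_chart[OF A W(1)] and cV = atlas_chart[OF B W(2)] and cV' = atlas_chart[OF B c']
      \<comment> \<open>On this set all four charts are available, and the new coordinate expression
        is transition, old expression, transition.\<close>
      define X where "X = W \<inter> F -` V' \<inter> U'"
      have "open (W \<inter> F -` V')"
        by (rule continuous_open_preimage[OF cont[OF W(1,2,5,6,7)] W(3) chart_open[OF cV']])
      then have X: "open X" "X \<subseteq> U'" "x \<in> X" using chart_open[OF cU'] W x by (auto simp: X_def)
      have oX: "open (\<phi>' ` X)" by (rule chart_open_image[OF cU' X(1,2)])
      have s1: "smooth_on (\<phi>' ` X) (\<phi> \<circ> inv_into U' \<phi>')"
        by (rule smooth_on_subset[OF atlas_transition[OF A c W(1)]]) (use W in \<open>auto simp: X_def\<close>)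
      have s2: "smooth_on (\<phi>' ` X) (\<lambda>y. (\<psi> \<circ> F \<circ> inv_into U \<phi>) ((\<phi> \<circ> inv_into U' \<phi>') y))"
        by (rule smooth_on_compose[OF oX s1 W(7)]) (auto simp: X_def chart_inv[OF cU'])
      have im: "(\<psi> \<circ> F \<circ> inv_into U \<phi>) ((\<phi> \<circ> inv_into U' \<phi>') (\<phi>' z)) = \<psi> (F z)" "F z \<in> V \<inter> V'" if "z \<in> X" for z
        using that W by (auto simp: X_def chart_inv[OF cU'] chart_inv[OF cU] subset_iff)
      have s3: "smooth_on (\<phi>' ` X) (\<lambda>y. (\<psi>' \<circ> inv_into V \<psi>) ((\<psi> \<circ> F \<circ> inv_into U \<phi>) ((\<phi> \<circ> inv_into U' \<phi>') y)))"
        by (rule smooth_on_compose[OF oX s2 atlas_transition[OF B W(2) c']]) (use im in auto)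
      have "smooth_on (\<phi>' ` X) (\<psi>' \<circ> F \<circ> inv_into U' \<phi>')"
      proof (rule smooth_on_cong[OF oX s3])
        fix y assume "y \<in> \<phi>' ` X"
        then obtain z where z: "z \<in> X" "y = \<phi>' z" by auto
        then show "(\<psi>' \<circ> inv_into V \<psi>) ((\<psi> \<circ> F \<circ> inv_into U \<phi>) ((\<phi> \<circ> inv_into U' \<phi>') y)) = (\<psi>' \<circ> F \<circ> inv_into U' \<phi>') y"
          unfolding z(2) im(1)[OF z(1)] using im(2)[OF z(1)] X(2) chart_inv[OF cU'] chart_inv[OF cV] by (auto simp: subset_iff)
      qed
      then show "\<exists>T. open T \<and> y \<in> T \<and> smooth_on T (\<psi>' \<circ> F \<circ> inv_into U' \<phi>')"
        using oX X x by (intro exI[of _ "\<phi>' ` X"]) auto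
    qed
  qed
  show ?thesis using 1 2 by (auto simp: smooth_map_on_def)
qed

lemma smooth_map_on_continuous: "smooth_map_on S A B F \<Longrightarrow> continuous_on S F"
  by (simp add: smooth_map_on_def)

lemma smooth_map_on_chart:
  "smooth_map_on S A B F \<Longrightarrow> (U, \<phi>) \<in> A \<Longrightarrow> (V, \<psi>) \<in> B \<Longrightarrow> smooth_on (\<phi> ` (S \<inter> U \<inter> F -` V)) (\<psi> \<circ> F \<circ> inv_into U \<phi>)"
  unfolding smooth_map_on_def by blast

lemma smooth_map_on_subset: "smooth_map_on S A B F \<Longrightarrow> T \<subseteq> S \<Longrightarrow> smooth_map_on T A B F"
proof -
  assume F: "smooth_map_on S A B F" and T: "T \<subseteq> S"
  have "smooth_on (\<phi> ` (T \<inter> U \<inter> F -` V)) (\<psi> \<circ> F \<circ> inv_into U \<phi>)" if "(U, \<phi>) \<in> A" "(V, \<psi>) \<in> B" for U \<phi> V \<psi>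
    by (rule smooth_on_subset[OF smooth_map_on_chart[OF F that]]) (use T in auto)
  then show ?thesis
    using continuous_on_subset[OF smooth_map_on_continuous[OF F] T] by (auto simp: smooth_map_on_def)
qed

lemma smooth_map_on_nbhd:
  assumes A: "smooth_atlas A" and B: "smooth_atlas B" and F: "smooth_map_on S A B F" and S: "open S" "x \<in> S"
    and U: "(U, \<phi>) \<in> A" "x \<in> U" and V: "(V, \<psi>) \<in> B" "F x \<in> V"
  obtains W where "open W" "x \<in> W" "W \<subseteq> U" "W \<subseteq> S" "F ` W \<subseteq> V" "smooth_on (\<phi> ` W) (\<psi> \<circ> F \<circ> inv_into U \<phi>)"
proof (rule that[of "S \<inter> U \<inter> F -` V"])
  have "open (S \<inter> F -` V)"
    by (rule continuous_open_preimage[OF smooth_map_on_continuous[OF F] S(1) chart_open[OF atlas_chart[OF B V(1)]]])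
  then have "open ((S \<inter> F -` V) \<inter> U)" using chart_open[OF atlas_chart[OF A U(1)]] by blast
  then show "open (S \<inter> U \<inter> F -` V)" by (simp add: Int_ac)
  show "smooth_on (\<phi> ` (S \<inter> U \<inter> F -` V)) (\<psi> \<circ> F \<circ> inv_into U \<phi>)" by (rule smooth_map_on_chart[OF F U(1) V(1)])
qed (use assms in auto)

lemma smooth_map_on_compose:
  assumes A: "smooth_atlas A" and B: "smooth_atlas B" and C: "smooth_atlas C"
    and F: "smooth_map_on S A B F" and G: "smooth_map_on T B C G" and S: "open S" "open T" "F ` S \<subseteq> T"
  shows "smooth_map_on S A C (\<lambda>x. G (F x))"
proof (rule smooth_map_onI[OF A C])
  fix x assume x: "x \<in> S"
  obtain U \<phi> where U: "(U, \<phi>) \<in> A" "x \<in> U" using atlas_cover[OF A] by metis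
  obtain V \<psi> where V: "(V, \<psi>) \<in> B" "F x \<in> V" using atlas_cover[OF B] by metis
  obtain X \<zeta> where X: "(X, \<zeta>) \<in> C" "G (F x) \<in> X" using atlas_cover[OF C] by metis
  obtain W1 where W1: "open W1" "x \<in> W1" "W1 \<subseteq> U" "W1 \<subseteq> S" "F ` W1 \<subseteq> V" "smooth_on (\<phi> ` W1) (\<psi> \<circ> F \<circ> inv_into U \<phi>)"
    by (rule smooth_map_on_nbhd[OF A B F S(1) x U V])
  have Fx: "F x \<in> T" using S x by auto
  obtain W2 where W2: "open W2" "F x \<in> W2" "W2 \<subseteq> V" "W2 \<subseteq> T" "G ` W2 \<subseteq> X" "smooth_on (\<psi> ` W2) (\<zeta> \<circ> G \<circ> inv_into V \<psi>)"
    by (rule smooth_map_on_nbhd[OF B C G S(2) Fx V X])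
  define W where "W = W1 \<inter> F -` W2"
  have oW: "open W" unfolding W_def
    by (rule continuous_open_preimage[OF continuous_on_subset[OF smooth_map_on_continuous[OF F] W1(4)] W1(1) W2(1)])
  have WU: "W \<subseteq> U" using W1 by (auto simp: W_def)
  note cU = atlas_chart[OF A U(1)] and cV = atlas_chart[OF B V(1)]
  have o: "open (\<phi> ` W)" by (rule chart_open_image[OF cU oW WU])
  have s1: "smooth_on (\<phi> ` W) (\<psi> \<circ> F \<circ> inv_into U \<phi>)" by (rule smooth_on_subset[OF W1(6)]) (auto simp: W_def)
  have "smooth_on (\<phi> ` W) (\<lambda>y. (\<zeta> \<circ> G \<circ> inv_into V \<psi>) ((\<psi> \<circ> F \<circ> inv_into U \<phi>) y))"
    by (rule smooth_on_compose[OF o s1 W2(6)]) (use WU in \<open>auto simp: W_def subset_iff chart_inv[OF cU]\<close>)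
  then have "smooth_on (\<phi> ` W) (\<zeta> \<circ> (\<lambda>x. G (F x)) \<circ> inv_into U \<phi>)"
  proof (rule smooth_on_cong[OF o])
    fix y assume "y \<in> \<phi> ` W"
    then obtain z where z: "z \<in> W" "y = \<phi> z" by auto
    then have "F z \<in> V" "z \<in> U" using W1 by (auto simp: W_def)
    then show "(\<zeta> \<circ> G \<circ> inv_into V \<psi>) ((\<psi> \<circ> F \<circ> inv_into U \<phi>) y) = (\<zeta> \<circ> (\<lambda>x. G (F x)) \<circ> inv_into U \<phi>) y"
      by (simp add: z(2) chart_inv[OF cU] chart_inv[OF cV])
  qed
  moreover have "(\<lambda>x. G (F x)) ` W \<subseteq> X" "x \<in> W" using W1 W2 by (auto simp: W_def)
  ultimately show "\<exists>U \<phi> V \<psi> W. (U, \<phi>) \<in> A \<and> (V, \<psi>) \<in> C \<and> open W \<and> x \<in> W \<and> W \<subseteq> U \<and> (\<lambda>x. G (F x)) ` W \<subseteq> V \<and>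
      smooth_on (\<phi> ` W) (\<psi> \<circ> (\<lambda>x. G (F x)) \<circ> inv_into U \<phi>)"
    using U X oW WU by blast
qed

subsection \<open>The standard atlas and functions with values in a Euclidean space\<close>

lemma smooth_atlas_std: "smooth_atlas (std_atlas :: ('e::euclidean_space, 'e) chart set)"
proof -
  have "is_chart UNIV (id :: 'e \<Rightarrow> 'e)"
    by (auto simp: is_chart_def homeomorphism_def inv_id[unfolded id_def] id_def intro: continuous_on_id)
  moreover have "smooth_on UNIV (\<lambda>x::'e. x)" using smooth_on_bounded_linear[OF bounded_linear_ident] .
  ultimately show ?thesis by (simp add: smooth_atlas_def std_atlas_def inv_id id_def o_def)
qed

lemma smooth_map_on_std_iff:
  "smooth_map_on S A std_atlas f \<longleftrightarrow>
     continuous_on S f \<and> (\<forall>(U, \<phi>)\<in>A. smooth_on (\<phi> ` (S \<inter> U)) (\<lambda>y. f (inv_into U \<phi> y)))"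
  by (simp add: smooth_map_on_def std_atlas_def o_def)

lemma smooth_fun_onI:
  fixes A :: "('m::{t2_space,second_countable_topology}, 'e::euclidean_space) chart set"
    and f :: "'m \<Rightarrow> 'f::euclidean_space"
  assumes A: "smooth_atlas A"
    and loc: "\<And>x. x \<in> S \<Longrightarrow> \<exists>U \<phi> W. (U, \<phi>) \<in> A \<and> open W \<and> x \<in> W \<and> W \<subseteq> U \<and> smooth_on (\<phi> ` W) (\<lambda>y. f (inv_into U \<phi> y))"
  shows "smooth_map_on S A std_atlas f"
proof (rule smooth_map_onI[OF A smooth_atlas_std])
  fix x assume "x \<in> S"
  from loc[OF this] show "\<exists>U \<phi> V \<psi> W. (U, \<phi>) \<in> A \<and> (V, \<psi>) \<in> std_atlas \<and> open W \<and> x \<in> W \<and> W \<subseteq> U \<and> f ` W \<subseteq> V \<and>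
      smooth_on (\<phi> ` W) (\<psi> \<circ> f \<circ> inv_into U \<phi>)"
    by (auto simp: std_atlas_def o_def)
qed

lemma smooth_map_on_union:
  fixes f :: "'m::{t2_space,second_countable_topology} \<Rightarrow> 'n::{t2_space,second_countable_topology}"
    and A :: "('m, 'e::euclidean_space) chart set" and B :: "('n, 'f::euclidean_space) chart set"
  assumes A: "smooth_atlas A" and B: "smooth_atlas B"
    and loc: "\<And>x. x \<in> S \<Longrightarrow> \<exists>T. open T \<and> x \<in> T \<and> smooth_map_on T A B f"
  shows "smooth_map_on S A B f"
proof (rule smooth_map_onI[OF A B])
  fix x assume x: "x \<in> S"
  obtain T where T: "open T" "x \<in> T" "smooth_map_on T A B f" using loc[OF x] by blast
  obtain U \<phi> where U: "(U, \<phi>) \<in> A" "x \<in> U" using atlas_cover[OF A] by metis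
  obtain V \<psi> where V: "(V, \<psi>) \<in> B" "f x \<in> V" using atlas_cover[OF B] by metis
  obtain W where "open W" "x \<in> W" "W \<subseteq> U" "W \<subseteq> T" "f ` W \<subseteq> V" "smooth_on (\<phi> ` W) (\<psi> \<circ> f \<circ> inv_into U \<phi>)"
    by (rule smooth_map_on_nbhd[OF A B T(3) T(1,2) U V])
  then show "\<exists>U \<phi> V \<psi> W. (U, \<phi>) \<in> A \<and> (V, \<psi>) \<in> B \<and> open W \<and> x \<in> W \<and> W \<subseteq> U \<and> f ` W \<subseteq> V \<and>
      smooth_on (\<phi> ` W) (\<psi> \<circ> f \<circ> inv_into U \<phi>)" using U V by blast
qed

lemma smooth_map_on_cong:
  assumes "\<And>x. x \<in> S \<Longrightarrow> f x = g x" "smooth_map_on S A B f" "open S" "smooth_atlas A" "smooth_atlas B"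
  shows "smooth_map_on S A B g"
proof (rule smooth_map_onI[OF assms(4,5)])
  fix x assume x: "x \<in> S"
  obtain U \<phi> where U: "(U, \<phi>) \<in> A" "x \<in> U" using atlas_cover[OF assms(4)] by metis
  obtain V \<psi> where V: "(V, \<psi>) \<in> B" "f x \<in> V" using atlas_cover[OF assms(5)] by metis
  obtain W where W: "open W" "x \<in> W" "W \<subseteq> U" "W \<subseteq> S" "f ` W \<subseteq> V" "smooth_on (\<phi> ` W) (\<psi> \<circ> f \<circ> inv_into U \<phi>)"
    by (rule smooth_map_on_nbhd[OF assms(4,5,2,3) x U V])
  have "smooth_on (\<phi> ` W) (\<psi> \<circ> g \<circ> inv_into U \<phi>)"
    by (rule smooth_on_cong[OF chart_open_image[OF atlas_chart[OF assms(4) U(1)] W(1,3)] W(6)])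
      (use W assms(1) chart_inv[OF atlas_chart[OF assms(4) U(1)]] in \<open>auto simp: subset_iff\<close>)
  moreover have "g ` W \<subseteq> V" using W assms(1) by force
  ultimately show "\<exists>U \<phi> V \<psi> W. (U, \<phi>) \<in> A \<and> (V, \<psi>) \<in> B \<and> open W \<and> x \<in> W \<and> W \<subseteq> U \<and> g ` W \<subseteq> V \<and>
      smooth_on (\<phi> ` W) (\<psi> \<circ> g \<circ> inv_into U \<phi>)" using U V W by blast
qed

lemma smooth_fun_chart:
  "smooth_map_on S A std_atlas f \<Longrightarrow> (U, \<phi>) \<in> A \<Longrightarrow> smooth_on (\<phi> ` (S \<inter> U)) (\<lambda>y. f (inv_into U \<phi> y))"
  unfolding smooth_map_on_std_iff by blast

lemma smooth_fun_bilinear: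
  assumes A: "smooth_atlas A" and S: "open S" and B: "bounded_bilinear B"
    and f: "smooth_map_on S A std_atlas f" and g: "smooth_map_on S A std_atlas g"
  shows "smooth_map_on S A std_atlas (\<lambda>x. B (f x) (g x))"
  unfolding smooth_map_on_std_iff
proof (intro conjI ballI, goal_cases)
  case 1
  from f g show ?case by (simp add: smooth_map_on_std_iff bounded_bilinear.continuous_on[OF B])
next
  case (2 c)
  obtain U \<phi> where c: "c = (U, \<phi>)" by (cases c)
  have cU: "is_chart U \<phi>" using 2 A by (auto simp: c atlas_chart)
  have "open (\<phi> ` (S \<inter> U))" using S chart_open[OF cU] by (intro chart_open_image[OF cU]) auto
  then show ?case
    using smooth_on_bilinear[OF _ B smooth_fun_chart[OF f] smooth_fun_chart[OF g]] 2 by (simp add: c)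
qed

lemma smooth_fun_add:
  assumes A: "smooth_atlas A" and S: "open S"
    and f: "smooth_map_on S A std_atlas f" and g: "smooth_map_on S A std_atlas g"
  shows "smooth_map_on S A std_atlas (\<lambda>x. f x + g x)"
  unfolding smooth_map_on_std_iff
proof (intro conjI ballI, goal_cases)
  case 1
  from f g show ?case by (simp add: smooth_map_on_std_iff continuous_on_add)
next
  case (2 c)
  obtain U \<phi> where c: "c = (U, \<phi>)" by (cases c)
  have cU: "is_chart U \<phi>" using 2 A by (auto simp: c atlas_chart)
  have "open (\<phi> ` (S \<inter> U))" using S chart_open[OF cU] by (intro chart_open_image[OF cU]) auto
  then show ?case
    using smooth_on_add[OF _ smooth_fun_chart[OF f] smooth_fun_chart[OF g]] 2 by (simp add: c)
qed

lemma smooth_fun_compose: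
  assumes A: "smooth_atlas A" and S: "open S"
    and f: "smooth_map_on S A std_atlas f" and g: "smooth_on T g" "f ` S \<subseteq> T"
  shows "smooth_map_on S A std_atlas (\<lambda>x. g (f x))"
  unfolding smooth_map_on_std_iff
proof (intro conjI ballI, goal_cases)
  case 1
  from f show ?case by (simp add: smooth_map_on_std_iff continuous_on_compose2[OF smooth_on_continuous[OF g(1)] _ g(2)])
next
  case (2 c)
  obtain U \<phi> where c: "c = (U, \<phi>)" by (cases c)
  have cU: "is_chart U \<phi>" using 2 A by (auto simp: c atlas_chart)
  have o: "open (\<phi> ` (S \<inter> U))" using S chart_open[OF cU] by (intro chart_open_image[OF cU]) auto
  have "smooth_on (\<phi> ` (S \<inter> U)) (\<lambda>y. g (f (inv_into U \<phi> y)))"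
    by (rule smooth_on_compose[OF o smooth_fun_chart[OF f] g(1)]) (use 2 g(2) in \<open>auto simp: c chart_inv[OF cU]\<close>)
  then show ?case by (simp add: c)
qed

lemma smooth_fun_const: "smooth_map_on S A std_atlas (\<lambda>x. c)"
  by (auto simp: smooth_map_on_std_iff smooth_on_const)

lemma smooth_fun_mult:
  fixes f g :: "'m::{t2_space,second_countable_topology} \<Rightarrow> real"
  shows "smooth_atlas A \<Longrightarrow> open S \<Longrightarrow> smooth_map_on S A std_atlas f \<Longrightarrow> smooth_map_on S A std_atlas g \<Longrightarrow>
    smooth_map_on S A std_atlas (\<lambda>x. f x * g x)"
  by (rule smooth_fun_bilinear[OF _ _ bounded_bilinear_mult])

lemma smooth_fun_sum:
  assumes A: "smooth_atlas A" "open S" and "\<And>i. i \<in> I \<Longrightarrow> smooth_map_on S A std_atlas (f i)"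
  shows "smooth_map_on S A std_atlas (\<lambda>x. \<Sum>i\<in>I. f i x)"
  using assms(3)
  by (induction I rule: infinite_finite_induct) (auto intro: smooth_fun_const smooth_fun_add[OF A])

lemma smooth_fun_chart_map:
  assumes A: "smooth_atlas A" and U: "(U, \<phi>) \<in> A"
  shows "smooth_map_on U A std_atlas \<phi>"
proof (rule smooth_fun_onI[OF A])
  fix x assume "x \<in> U"
  note cU = atlas_chart[OF A U]
  have "smooth_on (\<phi> ` U) (\<lambda>y. \<phi> (inv_into U \<phi> y))"
    by (rule smooth_on_cong[OF chart_image_open[OF cU] smooth_on_bounded_linear[OF bounded_linear_ident]])
      (auto simp: chart_inv[OF cU])
  then show "\<exists>V \<psi> W. (V, \<psi>) \<in> A \<and> open W \<and> x \<in> W \<and> W \<subseteq> V \<and> smooth_on (\<psi> ` W) (\<lambda>y. \<phi> (inv_into V \<psi> y))"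
    using U \<open>x \<in> U\<close> chart_open[OF cU] by blast
qed

lemma smooth_map_on_const: "smooth_atlas A \<Longrightarrow> smooth_atlas B \<Longrightarrow> smooth_map_on S A B (\<lambda>x. c)"
  unfolding smooth_map_on_def by (auto simp: o_def smooth_on_const)

lemma smooth_map_on_id: "smooth_atlas A \<Longrightarrow> smooth_map_on S A A (\<lambda>x. x)"
proof -
  assume A: "smooth_atlas A"
  have "smooth_on (\<phi> ` (S \<inter> U \<inter> V)) (\<psi> \<circ> inv_into U \<phi>)" if "(U, \<phi>) \<in> A" "(V, \<psi>) \<in> A" for U \<phi> V \<psi>
    by (rule smooth_on_subset[OF atlas_transition[OF A that]]) auto
  then show ?thesis by (auto simp: smooth_map_on_def o_def continuous_on_id)
qed

subsection \<open>Products\<close>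

text \<open>The inverse is computed only on the image, since \<open>inv_into\<close> is unspecified
  elsewhere.\<close>

lemma prod_chart:
  assumes c: "is_chart U \<phi>" and d: "is_chart V \<psi>"
  shows "is_chart (U \<times> V) (map_prod \<phi> \<psi>)"
    and "z \<in> \<phi> ` U \<times> \<psi> ` V \<Longrightarrow> inv_into (U \<times> V) (map_prod \<phi> \<psi>) z = (inv_into U \<phi> (fst z), inv_into V \<psi> (snd z))"
proof -
  have im: "map_prod \<phi> \<psi> ` (U \<times> V) = \<phi> ` U \<times> \<psi> ` V" by auto
  have inj: "inj_on (map_prod \<phi> \<psi>) (U \<times> V)" by (rule map_prod_inj_on[OF chart_inj[OF c] chart_inj[OF d]])
  have inv: "inv_into (U \<times> V) (map_prod \<phi> \<psi>) z = (inv_into U \<phi> (fst z), inv_into V \<psi> (snd z))"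
    if z: "z \<in> \<phi> ` U \<times> \<psi> ` V" for z
  proof -
    obtain x y where "x \<in> U" "y \<in> V" "z = map_prod \<phi> \<psi> (x, y)" using z by auto
    then show ?thesis using inv_into_f_f[OF inj, of "(x, y)"] by (simp add: chart_inv[OF c] chart_inv[OF d])
  qed
  then show "z \<in> \<phi> ` U \<times> \<psi> ` V \<Longrightarrow> inv_into (U \<times> V) (map_prod \<phi> \<psi>) z = (inv_into U \<phi> (fst z), inv_into V \<psi> (snd z))" .
  have "continuous_on (\<phi> ` U \<times> \<psi> ` V) (\<lambda>z. (inv_into U \<phi> (fst z), inv_into V \<psi> (snd z)))"
    by (intro continuous_on_Pair continuous_on_compose2[OF chart_inv_continuous[OF c]]
      continuous_on_compose2[OF chart_inv_continuous[OF d]] continuous_intros) auto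
  then have "continuous_on (\<phi> ` U \<times> \<psi> ` V) (inv_into (U \<times> V) (map_prod \<phi> \<psi>))"
    using inv by (metis (no_types, lifting) continuous_on_cong)
  moreover have "continuous_on (U \<times> V) (map_prod \<phi> \<psi>)"
    unfolding map_prod_def case_prod_beta
    by (intro continuous_on_Pair continuous_on_compose2[OF chart_continuous[OF c]]
      continuous_on_compose2[OF chart_continuous[OF d]] continuous_intros) auto
  moreover have "inv_into (U \<times> V) (map_prod \<phi> \<psi>) ` (\<phi> ` U \<times> \<psi> ` V) = U \<times> V"
    using inv_into_image_cancel[OF inj subset_refl] unfolding im .
  ultimately show "is_chart (U \<times> V) (map_prod \<phi> \<psi>)"
    unfolding is_chart_def homeomorphism_def im
    using inj by (auto simp: open_Times chart_open[OF c] chart_open[OF d] chart_image_open[OF c] chart_image_open[OF d]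
        inv_into_f_f inv chart_inv[OF c] chart_inv[OF d])
qed

lemma smooth_atlas_prod:
  assumes A: "smooth_atlas A" and B: "smooth_atlas B"
  shows "smooth_atlas (prod_atlas A B)"
  unfolding smooth_atlas_def
proof (intro conjI)
  show "\<forall>(U, \<phi>)\<in>prod_atlas A B. is_chart U \<phi>"
    by (auto simp: prod_atlas_def intro!: prod_chart(1) atlas_chart[OF A] atlas_chart[OF B])
  show "(\<Union>(U, \<phi>)\<in>prod_atlas A B. U) = UNIV"
  proof -
    have "(x, y) \<in> (\<Union>(U, \<phi>)\<in>prod_atlas A B. U)" for x y
    proof -
      obtain U \<phi> where "(U, \<phi>) \<in> A" "x \<in> U" using atlas_cover[OF A] by metis
      moreover obtain V \<psi> where "(V, \<psi>) \<in> B" "y \<in> V" using atlas_cover[OF B] by metis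
      ultimately show ?thesis by (intro UN_I[of "(U \<times> V, map_prod \<phi> \<psi>)"]) (auto simp: prod_atlas_def)
    qed
    then show ?thesis by auto
  qed
  have "smooth_on (map_prod \<phi> \<psi> ` (U \<times> V \<inter> U' \<times> V')) (map_prod \<phi>' \<psi>' \<circ> inv_into (U \<times> V) (map_prod \<phi> \<psi>))"
    if c: "(U, \<phi>) \<in> A" "(V, \<psi>) \<in> B" "(U', \<phi>') \<in> A" "(V', \<psi>') \<in> B" for U \<phi> V \<psi> U' \<phi>' V' \<psi>'
  proof -
    have im: "map_prod \<phi> \<psi> ` (U \<times> V \<inter> U' \<times> V') = \<phi> ` (U \<inter> U') \<times> \<psi> ` (V \<inter> V')" by auto
    have o1: "open (\<phi> ` (U \<inter> U'))" "open (\<psi> ` (V \<inter> V'))"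
      by (intro chart_open_image[OF atlas_chart[OF A c(1)]] chart_open_image[OF atlas_chart[OF B c(2)]] open_Int
          chart_open[OF atlas_chart[OF A c(1)]] chart_open[OF atlas_chart[OF A c(3)]]
          chart_open[OF atlas_chart[OF B c(2)]] chart_open[OF atlas_chart[OF B c(4)]] Int_lower1)+
    then have o: "open (\<phi> ` (U \<inter> U') \<times> \<psi> ` (V \<inter> V'))" by (rule open_Times)
    have "smooth_on (\<phi> ` (U \<inter> U') \<times> \<psi> ` (V \<inter> V')) (\<lambda>z. ((\<phi>' \<circ> inv_into U \<phi>) (fst z), (\<psi>' \<circ> inv_into V \<psi>) (snd z)))"
      by (intro smooth_on_Pair o smooth_on_compose[OF o _ atlas_transition[OF A c(1,3)]]
          smooth_on_compose[OF o _ atlas_transition[OF B c(2,4)]] smooth_on_bounded_linear bounded_linear_fst bounded_linear_snd) auto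
    then show ?thesis
      unfolding im by (rule smooth_on_cong[OF o])
        (use prod_chart(2)[OF atlas_chart[OF A c(1)] atlas_chart[OF B c(2)]] in auto)
  qed
  then show "\<forall>(U, \<phi>)\<in>prod_atlas A B. \<forall>(V, \<psi>)\<in>prod_atlas A B. smooth_on (\<phi> ` (U \<inter> V)) (\<psi> \<circ> inv_into U \<phi>)"
    by (fastforce simp: prod_atlas_def)
qed

lemma prod_atlasI: "(U, \<phi>) \<in> A \<Longrightarrow> (V, \<psi>) \<in> B \<Longrightarrow> (U \<times> V, map_prod \<phi> \<psi>) \<in> prod_atlas A B"
  by (auto simp: prod_atlas_def)

lemma smooth_map_on_fst_snd:
  assumes A: "smooth_atlas A" and B: "smooth_atlas B"
  shows "smooth_map_on S (prod_atlas A B) A fst" "smooth_map_on S (prod_atlas A B) B snd"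
proof -
  have *: "\<exists>U \<phi> V \<psi>. (U, \<phi>) \<in> A \<and> (V, \<psi>) \<in> B \<and> fst z \<in> U \<and> snd z \<in> V \<and> open (U \<times> V) \<and>
    smooth_on (map_prod \<phi> \<psi> ` (U \<times> V)) (\<phi> \<circ> fst \<circ> inv_into (U \<times> V) (map_prod \<phi> \<psi>)) \<and>
    smooth_on (map_prod \<phi> \<psi> ` (U \<times> V)) (\<psi> \<circ> snd \<circ> inv_into (U \<times> V) (map_prod \<phi> \<psi>))" for z
  proof -
    obtain U \<phi> where U: "(U, \<phi>) \<in> A" "fst z \<in> U" using atlas_cover[OF A] by metis
    obtain V \<psi> where V: "(V, \<psi>) \<in> B" "snd z \<in> V" using atlas_cover[OF B] by metis
    note cU = atlas_chart[OF A U(1)] and cV = atlas_chart[OF B V(1)]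
    have im: "map_prod \<phi> \<psi> ` (U \<times> V) = \<phi> ` U \<times> \<psi> ` V" by auto
    have o: "open (map_prod \<phi> \<psi> ` (U \<times> V))" by (rule chart_image_open[OF prod_chart(1)[OF cU cV]])
    have "smooth_on (map_prod \<phi> \<psi> ` (U \<times> V)) (\<phi> \<circ> fst \<circ> inv_into (U \<times> V) (map_prod \<phi> \<psi>))"
      by (rule smooth_on_cong[OF o smooth_on_bounded_linear[OF bounded_linear_fst]])
        (auto simp: im prod_chart(2)[OF cU cV] chart_inv[OF cU])
    moreover have "smooth_on (map_prod \<phi> \<psi> ` (U \<times> V)) (\<psi> \<circ> snd \<circ> inv_into (U \<times> V) (map_prod \<phi> \<psi>))"
      by (rule smooth_on_cong[OF o smooth_on_bounded_linear[OF bounded_linear_snd]])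
        (auto simp: im prod_chart(2)[OF cU cV] chart_inv[OF cV])
    ultimately show ?thesis using U V chart_open[OF prod_chart(1)[OF cU cV]] by blast
  qed
  show "smooth_map_on S (prod_atlas A B) A fst"
  proof (rule smooth_map_onI[OF smooth_atlas_prod[OF A B] A])
    fix x
    from *[of x] obtain U \<phi> V \<psi> where c: "(U, \<phi>) \<in> A" "(V, \<psi>) \<in> B" "fst x \<in> U" "snd x \<in> V" "open (U \<times> V)"
      "smooth_on (map_prod \<phi> \<psi> ` (U \<times> V)) (\<phi> \<circ> fst \<circ> inv_into (U \<times> V) (map_prod \<phi> \<psi>))" by blast
    show "\<exists>U \<phi> V \<psi> W. (U, \<phi>) \<in> prod_atlas A B \<and> (V, \<psi>) \<in> A \<and> open W \<and> x \<in> W \<and> W \<subseteq> U \<and> fst ` W \<subseteq> V \<and>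
      smooth_on (\<phi> ` W) (\<psi> \<circ> fst \<circ> inv_into U \<phi>)"
      by (intro exI[of _ "U \<times> V"] exI[of _ "map_prod \<phi> \<psi>"] exI[of _ U] exI[of _ \<phi>] exI[of _ "U \<times> V"] conjI prod_atlasI c)
        (use c in \<open>auto simp: mem_Times_iff\<close>)
  qed
  show "smooth_map_on S (prod_atlas A B) B snd"
  proof (rule smooth_map_onI[OF smooth_atlas_prod[OF A B] B])
    fix x
    from *[of x] obtain U \<phi> V \<psi> where c: "(U, \<phi>) \<in> A" "(V, \<psi>) \<in> B" "fst x \<in> U" "snd x \<in> V" "open (U \<times> V)"
      "smooth_on (map_prod \<phi> \<psi> ` (U \<times> V)) (\<psi> \<circ> snd \<circ> inv_into (U \<times> V) (map_prod \<phi> \<psi>))" by blast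
    show "\<exists>U \<phi> V \<psi> W. (U, \<phi>) \<in> prod_atlas A B \<and> (V, \<psi>) \<in> B \<and> open W \<and> x \<in> W \<and> W \<subseteq> U \<and> snd ` W \<subseteq> V \<and>
      smooth_on (\<phi> ` W) (\<psi> \<circ> snd \<circ> inv_into U \<phi>)"
      by (intro exI[of _ "U \<times> V"] exI[of _ "map_prod \<phi> \<psi>"] exI[of _ V] exI[of _ \<psi>] exI[of _ "U \<times> V"] conjI prod_atlasI c)
        (use c in \<open>auto simp: mem_Times_iff\<close>)
  qed
qed

lemma smooth_map_on_Pair:
  assumes A: "smooth_atlas A" and B: "smooth_atlas B" and C: "smooth_atlas C" and S: "open S"
    and F: "smooth_map_on S C A F" and G: "smooth_map_on S C B G"
  shows "smooth_map_on S C (prod_atlas A B) (\<lambda>x. (F x, G x))"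
proof (rule smooth_map_onI[OF C smooth_atlas_prod[OF A B]])
  fix x assume x: "x \<in> S"
  obtain X \<zeta> where X: "(X, \<zeta>) \<in> C" "x \<in> X" using atlas_cover[OF C] by metis
  obtain U \<phi> where U: "(U, \<phi>) \<in> A" "F x \<in> U" using atlas_cover[OF A] by metis
  obtain V \<psi> where V: "(V, \<psi>) \<in> B" "G x \<in> V" using atlas_cover[OF B] by metis
  obtain W1 where W1: "open W1" "x \<in> W1" "W1 \<subseteq> X" "W1 \<subseteq> S" "F ` W1 \<subseteq> U" "smooth_on (\<zeta> ` W1) (\<phi> \<circ> F \<circ> inv_into X \<zeta>)"
    by (rule smooth_map_on_nbhd[OF C A F S x X U])
  obtain W2 where W2: "open W2" "x \<in> W2" "W2 \<subseteq> X" "W2 \<subseteq> S" "G ` W2 \<subseteq> V" "smooth_on (\<zeta> ` W2) (\<psi> \<circ> G \<circ> inv_into X \<zeta>)"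
    by (rule smooth_map_on_nbhd[OF C B G S x X V])
  have W: "open (W1 \<inter> W2)" "x \<in> W1 \<inter> W2" "W1 \<inter> W2 \<subseteq> X" using W1 W2 by auto
  have o: "open (\<zeta> ` (W1 \<inter> W2))" by (rule chart_open_image[OF atlas_chart[OF C X(1)] W(1,3)])
  have "smooth_on (\<zeta> ` (W1 \<inter> W2)) (\<lambda>y. ((\<phi> \<circ> F \<circ> inv_into X \<zeta>) y, (\<psi> \<circ> G \<circ> inv_into X \<zeta>) y))"
    by (intro smooth_on_Pair o smooth_on_subset[OF W1(6)] smooth_on_subset[OF W2(6)]) auto
  then have s: "smooth_on (\<zeta> ` (W1 \<inter> W2)) (map_prod \<phi> \<psi> \<circ> (\<lambda>x. (F x, G x)) \<circ> inv_into X \<zeta>)"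
    by (simp add: o_def)
  show "\<exists>U \<phi> V \<psi> W. (U, \<phi>) \<in> C \<and> (V, \<psi>) \<in> prod_atlas A B \<and> open W \<and> x \<in> W \<and> W \<subseteq> U \<and> (\<lambda>x. (F x, G x)) ` W \<subseteq> V \<and>
      smooth_on (\<phi> ` W) (\<psi> \<circ> (\<lambda>x. (F x, G x)) \<circ> inv_into U \<phi>)"
    by (intro exI[of _ X] exI[of _ \<zeta>] exI[of _ "U \<times> V"] exI[of _ "map_prod \<phi> \<psi>"] exI[of _ "W1 \<inter> W2"] conjI s X(1) W
        prod_atlasI U(1) V(1)) (use W1(5) W2(5) in auto)
qed

subsection \<open>Cut-off functions and local coordinates\<close>

text \<open>A Euclidean bump is transported by the chart and extended by 0. The preimage
  \<open>K\<close> of a closed ball is compact, hence closed because the manifold is Hausdorff, and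
  so \<open>W\<close> and the complement of \<open>K\<close> form an open cover on which smoothness
  is evident.\<close>

lemma manifold_bump:
  fixes A :: "('m::{t2_space,second_countable_topology}, 'e::euclidean_space) chart set"
  assumes A: "smooth_atlas A" and U: "(U, \<phi>) \<in> A" and W: "open W" "x \<in> W" "W \<subseteq> U"
  obtains \<beta> :: "'m \<Rightarrow> real" and V K where "smooth_map_on UNIV A std_atlas \<beta>" "open V" "x \<in> V" "V \<subseteq> K" "closed K" "K \<subseteq> W"
    "\<And>y. y \<in> V \<Longrightarrow> \<beta> y = 1" "\<And>y. y \<notin> K \<Longrightarrow> \<beta> y = 0" "\<And>y. \<beta> y \<ge> 0"
proof -
  note cU = atlas_chart[OF A U]
  have "open (\<phi> ` W)" "\<phi> x \<in> \<phi> ` W" using chart_open_image[OF cU W(1,3)] W by auto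
  then obtain R where R: "R > 0" "cball (\<phi> x) R \<subseteq> \<phi> ` W" using open_contains_cball by blast
  have R2: "0 < R / 2" "R / 2 < R" using R by auto
  obtain \<rho> :: "'e \<Rightarrow> real" where \<rho>: "smooth_on UNIV \<rho>" "\<And>y. \<rho> y \<ge> 0" "\<And>y. y \<in> cball (\<phi> x) (R / 2) \<Longrightarrow> \<rho> y = 1"
    "\<And>y. y \<notin> ball (\<phi> x) R \<Longrightarrow> \<rho> y = 0" by (rule smooth_bump[OF R2, of "\<phi> x"]) blast
  define K where "K = inv_into U \<phi> ` cball (\<phi> x) R"
  define \<beta> where "\<beta> y = (if y \<in> W then \<rho> (\<phi> y) else 0)" for y
  define V where "V = W \<inter> \<phi> -` ball (\<phi> x) (R / 2)"
  have "cball (\<phi> x) R \<subseteq> \<phi> ` U" using R W by blast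
  then have "compact K"
    unfolding K_def by (intro compact_continuous_image continuous_on_subset[OF chart_inv_continuous[OF cU]]) auto
  then have K: "closed K" by (rule compact_imp_closed)
  have KW: "K \<subseteq> W"
  proof
    fix y assume "y \<in> K"
    then obtain z where "z \<in> cball (\<phi> x) R" "y = inv_into U \<phi> z" by (auto simp: K_def)
    moreover from this R(2) obtain w where "w \<in> W" "z = \<phi> w" by blast
    ultimately show "y \<in> W" using W chart_inv[OF cU, of w] by auto
  qed
  have inK: "y \<in> K" if "y \<in> W" "\<phi> y \<in> cball (\<phi> x) R" for y
    using that W chart_inv[OF cU, of y] unfolding K_def by (metis image_eqI subsetD)
  have z: "\<beta> y = 0" if "y \<notin> K" for y
    using inK[of y] that by (auto simp: \<beta>_def intro!: \<rho>(4))
  have sW: "smooth_map_on W A std_atlas \<beta>"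
  proof (rule smooth_map_on_cong[OF _ _ W(1) A smooth_atlas_std])
    show "smooth_map_on W A std_atlas (\<lambda>y. \<rho> (\<phi> y))"
      by (rule smooth_fun_compose[OF A W(1) smooth_map_on_subset[OF smooth_fun_chart_map[OF A U] W(3)] \<rho>(1)]) auto
  qed (simp add: \<beta>_def)
  have s0: "smooth_map_on (- K) A std_atlas \<beta>"
    by (rule smooth_map_on_cong[OF _ smooth_fun_const[of _ _ 0] _ A smooth_atlas_std]) (use K z in auto)
  have "smooth_map_on UNIV A std_atlas \<beta>"
  proof (rule smooth_map_on_union[OF A smooth_atlas_std])
    fix y
    show "\<exists>T. open T \<and> y \<in> T \<and> smooth_map_on T A std_atlas \<beta>"
    proof (cases "y \<in> K")
      case True
      then show ?thesis using sW W KW by blast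
    next
      case False
      then show ?thesis using s0 K by (intro exI[of _ "- K"]) auto
    qed
  qed
  moreover have "open V"
    unfolding V_def by (rule continuous_open_preimage[OF continuous_on_subset[OF chart_continuous[OF cU] W(3)] W(1)]) simp
  moreover have "x \<in> V" "V \<subseteq> K" using R W inK by (auto simp: V_def)
  moreover have "\<beta> y = 1" if "y \<in> V" for y using that by (auto simp: V_def \<beta>_def intro!: \<rho>(3))
  moreover have "\<beta> y \<ge> 0" for y by (simp add: \<beta>_def \<rho>)
  ultimately show ?thesis using that z K KW by metis
qed

text \<open>Outside \<open>W\<close> the function \<open>k\<close> is arbitrary; the factor
  vanishing off the closed set \<open>K\<close> makes the product globally smooth.\<close>

lemma smooth_cutoff:
  fixes A :: "('m::{t2_space,second_countable_topology}, 'e::euclidean_space) chart set" and k :: "'m \<Rightarrow> 'f::euclidean_space"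
  assumes A: "smooth_atlas A" and b: "smooth_map_on UNIV A std_atlas \<beta>" "closed K" "K \<subseteq> W" "open W" "\<And>y. y \<notin> K \<Longrightarrow> \<beta> y = 0"
    and k: "smooth_map_on W A std_atlas k"
  shows "smooth_map_on UNIV A std_atlas (\<lambda>y. \<beta> y *\<^sub>R k y)"
proof (rule smooth_map_on_union[OF A smooth_atlas_std])
  fix y
  have 1: "smooth_map_on W A std_atlas (\<lambda>y. \<beta> y *\<^sub>R k y)"
    by (rule smooth_fun_bilinear[OF A b(4) bounded_bilinear_scaleR smooth_map_on_subset[OF b(1)] k]) auto
  have 2: "smooth_map_on (- K) A std_atlas (\<lambda>y. \<beta> y *\<^sub>R k y)"
    by (rule smooth_map_on_cong[OF _ smooth_fun_const[of _ _ 0] _ A smooth_atlas_std]) (use b in auto)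
  show "\<exists>T. open T \<and> y \<in> T \<and> smooth_map_on T A std_atlas (\<lambda>y. \<beta> y *\<^sub>R k y)"
  proof (cases "y \<in> K")
    case True
    then show ?thesis using 1 b(3,4) by blast
  next
    case False
    then show ?thesis using 2 b(2) by (intro exI[of _ "- K"]) auto
  qed
qed

text \<open>Derivations act on globally smooth functions, whereas chart coordinates are local. The
  cut-off coordinates are global and agree with the chart near \<open>x\<close>.\<close>

lemma local_coordinates:
  fixes A :: "('m::{t2_space,second_countable_topology}, 'e::euclidean_space) chart set"
  assumes A: "smooth_atlas A" and U: "(U, \<phi>) \<in> A" "x \<in> U"
  obtains \<beta> :: "'m \<Rightarrow> real" and V where "smooth_map_on UNIV A std_atlas \<beta>" "smooth_map_on UNIV A std_atlas (\<lambda>y. \<beta> y *\<^sub>R \<phi> y)"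
    "open V" "x \<in> V" "V \<subseteq> U" "\<And>y. y \<in> V \<Longrightarrow> \<beta> y = 1" "\<And>y. y \<notin> U \<Longrightarrow> \<beta> y = 0"
proof -
  have o: "open U" by (rule chart_open[OF atlas_chart[OF A U(1)]])
  obtain \<beta> :: "'m \<Rightarrow> real" and V K where b: "smooth_map_on UNIV A std_atlas \<beta>" "open V" "x \<in> V" "V \<subseteq> K" "closed K" "K \<subseteq> U"
    "\<And>y. y \<in> V \<Longrightarrow> \<beta> y = 1" "\<And>y. y \<notin> K \<Longrightarrow> \<beta> y = 0" "\<And>y. \<beta> y \<ge> 0"
    by (rule manifold_bump[OF A U(1) o U(2) subset_refl]) blast
  show ?thesis
    by (rule that[OF b(1) smooth_cutoff[OF A b(1,5,6) o b(8) smooth_fun_chart_map[OF A U(1)]] b(2,3)]) (use b in auto)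
qed

subsection \<open>Tangent vectors\<close>

lemma smooth_functions_iff: "f \<in> smooth_functions A \<longleftrightarrow> smooth_map_on UNIV A std_atlas f"
  by (simp add: smooth_functions_def)

lemma smooth_functions_component:
  assumes A: "smooth_atlas A" and "smooth_map_on UNIV A std_atlas k"
  shows "(\<lambda>y. k y \<bullet> c) \<in> smooth_functions A"
  unfolding smooth_functions_iff
  by (rule smooth_fun_compose[OF A open_UNIV assms(2) smooth_on_bounded_linear[OF bounded_linear_inner_left]]) auto

context
  fixes A :: "('m::{t2_space,second_countable_topology}, 'e::euclidean_space) chart set"
  assumes A: "smooth_atlas A"
begin

lemma smooth_functions_add: "f \<in> smooth_functions A \<Longrightarrow> h \<in> smooth_functions A \<Longrightarrow> (\<lambda>y. f y + h y) \<in> smooth_functions A"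
  unfolding smooth_functions_iff by (rule smooth_fun_add[OF A open_UNIV])

lemma smooth_functions_mult: "f \<in> smooth_functions A \<Longrightarrow> h \<in> smooth_functions A \<Longrightarrow> (\<lambda>y. f y * h y) \<in> smooth_functions A"
  unfolding smooth_functions_iff by (rule smooth_fun_mult[OF A open_UNIV])

lemma smooth_functions_const: "(\<lambda>y. c) \<in> smooth_functions A"
  unfolding smooth_functions_iff by (rule smooth_fun_const)

lemma smooth_functions_cmult: "f \<in> smooth_functions A \<Longrightarrow> (\<lambda>y. c * f y) \<in> smooth_functions A"
  by (rule smooth_functions_mult[OF smooth_functions_const])

lemma smooth_functions_sum: "(\<And>i. i \<in> I \<Longrightarrow> f i \<in> smooth_functions A) \<Longrightarrow> (\<lambda>y. \<Sum>i\<in>I. f i y) \<in> smooth_functions A"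
  unfolding smooth_functions_iff by (rule smooth_fun_sum[OF A open_UNIV])

lemma smooth_functions_compose: "f \<in> smooth_functions A \<Longrightarrow> smooth_on UNIV k \<Longrightarrow> (\<lambda>y. k (f y)) \<in> smooth_functions A"
  unfolding smooth_functions_iff by (rule smooth_fun_compose[OF A open_UNIV]) auto

lemma smooth_functions_continuous: "f \<in> smooth_functions A \<Longrightarrow> continuous_on S f"
  unfolding smooth_functions_iff using smooth_map_on_continuous continuous_on_subset by blast

lemma smooth_functions_chart:
  assumes "f \<in> smooth_functions A" "(U, \<phi>) \<in> A"
  shows "smooth_on (\<phi> ` U) (\<lambda>y. f (inv_into U \<phi> y))"
  using smooth_fun_chart[of UNIV A f U \<phi>] assms by (simp add: smooth_functions_iff)

lemma smooth_functions_chart_derivative: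
  assumes "f \<in> smooth_functions A" "(U, \<phi>) \<in> A" "x \<in> U"
  shows "((\<lambda>y. f (inv_into U \<phi> y)) has_derivative frechet_derivative (f \<circ> inv_into U \<phi>) (at (\<phi> x))) (at (\<phi> x))"
  using smooth_on_has_derivative[OF smooth_functions_chart[OF assms(1,2)], of "\<phi> x"] assms(3) by (simp add: o_def)

lemma tangent_add: "v \<in> tangent_space A x \<Longrightarrow> f \<in> smooth_functions A \<Longrightarrow> h \<in> smooth_functions A \<Longrightarrow> v (\<lambda>y. f y + h y) = v f + v h"
  and tangent_mult: "v \<in> tangent_space A x \<Longrightarrow> f \<in> smooth_functions A \<Longrightarrow> h \<in> smooth_functions A \<Longrightarrow>
    v (\<lambda>y. f y * h y) = f x * v h + v f * h x"
  and tangent_cmult: "v \<in> tangent_space A x \<Longrightarrow> f \<in> smooth_functions A \<Longrightarrow> v (\<lambda>y. a * f y) = a * v f"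
  and tangent_nonsmooth: "v \<in> tangent_space A x \<Longrightarrow> f \<notin> smooth_functions A \<Longrightarrow> v f = 0"
  by (simp_all add: tangent_space_def)

text \<open>The Leibniz rule for 1 = 1 * 1 reads v(1) = 2 v(1).\<close>

lemma tangent_const: "v \<in> tangent_space A x \<Longrightarrow> v (\<lambda>y. c) = 0"
  using tangent_mult[OF _ smooth_functions_const[of 1] smooth_functions_const[of 1], of v x]
    tangent_cmult[OF _ smooth_functions_const[of 1], of v x c] by simp

lemma tangent_sum:
  assumes "v \<in> tangent_space A x" "\<And>i. i \<in> I \<Longrightarrow> f i \<in> smooth_functions A"
  shows "v (\<lambda>y. \<Sum>i\<in>I. f i y) = (\<Sum>i\<in>I. v (f i))"
  using assms(2)
proof (induction I rule: infinite_finite_induct)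
  case (insert i I)
  have "v (\<lambda>y. f i y + (\<Sum>i\<in>I. f i y)) = v (f i) + v (\<lambda>y. \<Sum>i\<in>I. f i y)"
    by (rule tangent_add[OF assms(1)]) (use insert in \<open>auto intro: smooth_functions_sum\<close>)
  then show ?case using insert by simp
qed (use tangent_const[OF assms(1)] in auto)

lemma tangent_lincomb:
  assumes "v \<in> tangent_space A x" "w \<in> tangent_space A x"
  shows "(\<lambda>f. a * v f + b * w f) \<in> tangent_space A x"
  using assms unfolding tangent_space_def by (auto simp: algebra_simps)

lemma coord_vector_smooth: "f \<in> smooth_functions A \<Longrightarrow> coord_vector A U \<phi> u x f = frechet_derivative (f \<circ> inv_into U \<phi>) (at (\<phi> x)) u"
  by (simp add: coord_vector_def)

lemma coord_vector_tangent:
  assumes U: "(U, \<phi>) \<in> A" "x \<in> U"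
  shows "coord_vector A U \<phi> u x \<in> tangent_space A x"
  unfolding tangent_space_def mem_Collect_eq
proof (intro conjI ballI allI impI)
  note D = smooth_functions_chart_derivative[OF _ U]
  have inv: "inv_into U \<phi> (\<phi> x) = x" by (rule chart_inv[OF atlas_chart[OF A U(1)] U(2)])
  fix f h assume f: "f \<in> smooth_functions A" and h: "h \<in> smooth_functions A"
  from frechet_derivative_at[OF has_derivative_add[OF D[OF f] D[OF h]]]
  show "coord_vector A U \<phi> u x (\<lambda>y. f y + h y) = coord_vector A U \<phi> u x f + coord_vector A U \<phi> u x h"
    by (simp add: coord_vector_smooth f h smooth_functions_add o_def fun_eq_iff)
  from frechet_derivative_at[OF has_derivative_mult[OF D[OF f] D[OF h]]]
  show "coord_vector A U \<phi> u x (\<lambda>y. f y * h y) = f x * coord_vector A U \<phi> u x h + coord_vector A U \<phi> u x f * h x"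
    by (simp add: coord_vector_smooth f h smooth_functions_mult o_def fun_eq_iff inv)
next
  note D = smooth_functions_chart_derivative[OF _ U]
  fix a f assume f: "f \<in> smooth_functions A"
  from frechet_derivative_at[OF has_derivative_mult_right[OF D[OF f], of a]]
  show "coord_vector A U \<phi> u x (\<lambda>y. a * f y) = a * coord_vector A U \<phi> u x f"
    by (simp add: coord_vector_smooth f smooth_functions_cmult o_def fun_eq_iff)
qed (simp add: coord_vector_def)

lemma coord_vector_lincomb:
  assumes U: "(U, \<phi>) \<in> A" "x \<in> U"
  shows "coord_vector A U \<phi> (a *\<^sub>R u + b *\<^sub>R w) x = (\<lambda>f. a * coord_vector A U \<phi> u x f + b * coord_vector A U \<phi> w x f)"
proof
  fix f
  show "coord_vector A U \<phi> (a *\<^sub>R u + b *\<^sub>R w) x f = a * coord_vector A U \<phi> u x f + b * coord_vector A U \<phi> w x f"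
  proof (cases "f \<in> smooth_functions A")
    case True
    have "linear (frechet_derivative (f \<circ> inv_into U \<phi>) (at (\<phi> x)))"
      using smooth_functions_chart_derivative[OF True U] by (simp add: has_derivative_def bounded_linear.linear)
    then show ?thesis by (simp add: coord_vector_smooth True linear_add linear_cmul)
  qed (simp add: coord_vector_def)
qed

lemma coord_vector_coordinate:
  assumes U: "(U, \<phi>) \<in> A" and V: "open V" "x \<in> V" "V \<subseteq> U"
    and k: "k \<in> smooth_functions A" "\<And>y. y \<in> V \<Longrightarrow> k y = \<phi> y \<bullet> c"
  shows "coord_vector A U \<phi> u x k = u \<bullet> c"
proof -
  note cU = atlas_chart[OF A U]
  have "((\<lambda>y. y \<bullet> c) has_derivative (\<lambda>v. v \<bullet> c)) (at (\<phi> x))"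
    by (rule bounded_linear_imp_has_derivative[OF bounded_linear_inner_left])
  then have "(k \<circ> inv_into U \<phi> has_derivative (\<lambda>v. v \<bullet> c)) (at (\<phi> x))"
    by (rule has_derivative_transform_within_open[OF _ chart_open_image[OF cU V(1,3)]])
      (use V k chart_inv[OF cU] in \<open>auto simp: subset_iff\<close>)
  from frechet_derivative_at[OF this] show ?thesis by (metis coord_vector_smooth[OF k(1)])
qed

text \<open>The components of \<open>u\<close> are recovered by applying the derivation to cut-off
  coordinates.\<close>

lemma coord_vector_inject:
  assumes U: "(U, \<phi>) \<in> A" "x \<in> U" and eq: "coord_vector A U \<phi> u x = coord_vector A U \<phi> w x"
  shows "u = w"
proof (rule euclidean_eqI)
  fix c :: 'e
  obtain \<beta> :: "'m \<Rightarrow> real" and V where b: "smooth_map_on UNIV A std_atlas \<beta>" "smooth_map_on UNIV A std_atlas (\<lambda>y. \<beta> y *\<^sub>R \<phi> y)"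
    "open V" "x \<in> V" "V \<subseteq> U" "\<And>y. y \<in> V \<Longrightarrow> \<beta> y = 1" "\<And>y. y \<notin> U \<Longrightarrow> \<beta> y = 0"
    by (rule local_coordinates[OF A U]) blast
  have "coord_vector A U \<phi> u x (\<lambda>y. (\<beta> y *\<^sub>R \<phi> y) \<bullet> c) = u \<bullet> c" for u
    by (rule coord_vector_coordinate[OF U(1) b(3-5) smooth_functions_component[OF A b(2)]]) (simp add: b)
  then show "u \<bullet> c = w \<bullet> c" using eq by metis
qed

text \<open>By Hadamard's lemma a derivation is determined by its values on local coordinates.\<close>

lemma tangent_is_coord_vector:
  assumes U: "(U, \<phi>) \<in> A" "x \<in> U" and v: "v \<in> tangent_space A x"
  obtains u where "v = coord_vector A U \<phi> u x"
proof -
  note cU = atlas_chart[OF A U(1)]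
  obtain r where r: "r > 0" "ball (\<phi> x) r \<subseteq> \<phi> ` U"
    using chart_image_open[OF cU] U open_contains_ball by blast
  define S where "S = ball (\<phi> x) r"
  define W where "W = U \<inter> \<phi> -` S"
  have W: "open W" "x \<in> W" "W \<subseteq> U"
    unfolding W_def S_def using continuous_open_preimage[OF chart_continuous[OF cU] chart_open[OF cU] open_ball] U r by auto
  obtain \<beta> :: "'m \<Rightarrow> real" and V K where b: "smooth_map_on UNIV A std_atlas \<beta>" "open V" "x \<in> V" "V \<subseteq> K" "closed K" "K \<subseteq> W"
    "\<And>y. y \<in> V \<Longrightarrow> \<beta> y = 1" "\<And>y. y \<notin> K \<Longrightarrow> \<beta> y = 0" "\<And>y. \<beta> y \<ge> 0"
    by (rule manifold_bump[OF A U(1) W]) blast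
  have b': "\<beta> \<in> smooth_functions A" "\<beta> x = 1" using b by (auto simp: smooth_functions_iff)
  have s\<phi>: "smooth_map_on W A std_atlas \<phi>" by (rule smooth_map_on_subset[OF smooth_fun_chart_map[OF A U(1)] W(3)])
  define k where "k c = (\<lambda>y. \<beta> y * ((\<phi> y - \<phi> x) \<bullet> c))" for c
  have k: "k c \<in> smooth_functions A" for c
  proof -
    have "smooth_on UNIV (\<lambda>y. (y - \<phi> x) \<bullet> c)"
      by (intro smooth_on_linear[OF _ bounded_linear_inner_left] smooth_on_diff smooth_on_const
          smooth_on_bounded_linear[OF bounded_linear_ident]) auto
    from smooth_fun_compose[OF A W(1) s\<phi> this]
    have "smooth_map_on UNIV A std_atlas (\<lambda>y. \<beta> y *\<^sub>R ((\<phi> y - \<phi> x) \<bullet> c))"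
      by (intro smooth_cutoff[OF A b(1,5,6) W(1) b(8)]) auto
    then show ?thesis by (simp add: smooth_functions_iff k_def)
  qed
  define u where "u = (\<Sum>c\<in>Basis. v (k c) *\<^sub>R c)"
  have uc: "u \<bullet> c = v (k c)" if "c \<in> Basis" for c
    using that by (simp add: u_def)
  have "v h = coord_vector A U \<phi> u x h" if h: "h \<in> smooth_functions A" for h
  proof -
    let ?f = "\<lambda>y. h (inv_into U \<phi> y)"
    have sf: "smooth_on S ?f" by (rule smooth_on_subset[OF smooth_functions_chart[OF h U(1)]]) (use r in \<open>auto simp: S_def\<close>)
    have S: "open S" "convex S" "\<phi> x \<in> S" using r by (auto simp: S_def)
    obtain H where H: "\<And>c. c \<in> Basis \<Longrightarrow> smooth_on S (H c)"
      "\<And>y. y \<in> S \<Longrightarrow> ?f y = ?f (\<phi> x) + (\<Sum>c\<in>Basis. ((y - \<phi> x) \<bullet> c) * H c y)"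
      "\<And>c. H c (\<phi> x) = frechet_derivative ?f (at (\<phi> x)) c"
      by (rule hadamard[OF S sf]) blast
    have inv: "inv_into U \<phi> (\<phi> x) = x" by (rule chart_inv[OF cU U(2)])
    have sH: "(\<lambda>y. \<beta> y * H c (\<phi> y)) \<in> smooth_functions A" if "c \<in> Basis" for c
    proof -
      have "smooth_map_on W A std_atlas (\<lambda>y. H c (\<phi> y))"
        by (rule smooth_fun_compose[OF A W(1) s\<phi> H(1)[OF that]]) (auto simp: W_def)
      from smooth_cutoff[OF A b(1,5,6) W(1) b(8) this] show ?thesis by (simp add: smooth_functions_iff)
    qed
    \<comment> \<open>Hadamard's identity holds on the chart ball only; the squared cut-off turns it
      into an identity of global smooth functions, one factor going to each of \<open>k c\<close>
      and \<open>H c\<close>. Applied to it, \<open>v\<close> sees just \<open>v h\<close> on the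
      left, as \<open>\<beta> x = 1\<close> and \<open>h y - h x\<close> vanishes at
      \<open>x\<close>, and only the terms differentiating \<open>k c\<close> on the right.\<close>
    have eq: "(\<beta> y * \<beta> y) * (h y + (- h x)) = (\<Sum>c\<in>Basis. k c y * (\<beta> y * H c (\<phi> y)))" for y
    proof (cases "y \<in> W")
      case True
      then have "h y = h x + (\<Sum>c\<in>Basis. ((\<phi> y - \<phi> x) \<bullet> c) * H c (\<phi> y))"
        using H(2)[of "\<phi> y"] inv chart_inv[OF cU, of y] by (auto simp: W_def)
      then have "h y + (- h x) = (\<Sum>c\<in>Basis. ((\<phi> y - \<phi> x) \<bullet> c) * H c (\<phi> y))" by linarith
      then show ?thesis by (simp add: k_def sum_distrib_left mult_ac)
    next
      case False
      then have "\<beta> y = 0" using b by auto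
      then show ?thesis by (simp add: k_def)
    qed
    have "v (\<lambda>y. (\<beta> y * \<beta> y) * (h y + (- h x))) = (\<beta> x * \<beta> x) * v (\<lambda>y. h y + (- h x)) + v (\<lambda>y. \<beta> y * \<beta> y) * (h x + (- h x))"
      by (rule tangent_mult[OF v]) (intro smooth_functions_mult smooth_functions_add smooth_functions_const b' h)+
    also have "v (\<lambda>y. h y + (- h x)) = v h"
      using tangent_add[OF v h smooth_functions_const[of "- h x"]] tangent_const[OF v] by simp
    finally have 1: "v (\<lambda>y. (\<beta> y * \<beta> y) * (h y + (- h x))) = v h" using b' by simp
    have "v (\<lambda>y. \<Sum>c\<in>Basis. k c y * (\<beta> y * H c (\<phi> y))) = (\<Sum>c\<in>Basis. v (\<lambda>y. k c y * (\<beta> y * H c (\<phi> y))))"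
      by (rule tangent_sum[OF v]) (intro smooth_functions_mult[OF k sH])
    also have "\<dots> = (\<Sum>c\<in>Basis. (u \<bullet> c) * frechet_derivative ?f (at (\<phi> x)) c)"
    proof (rule sum.cong[OF refl])
      fix c :: 'e assume c: "c \<in> Basis"
      have "v (\<lambda>y. k c y * (\<beta> y * H c (\<phi> y))) = k c x * v (\<lambda>y. \<beta> y * H c (\<phi> y)) + v (k c) * (\<beta> x * H c (\<phi> x))"
        by (rule tangent_mult[OF v k sH[OF c]])
      then show "v (\<lambda>y. k c y * (\<beta> y * H c (\<phi> y))) = (u \<bullet> c) * frechet_derivative ?f (at (\<phi> x)) c"
        by (simp add: uc[OF c] b' H(3)) (simp add: k_def)
    qed
    also have "\<dots> = frechet_derivative ?f (at (\<phi> x)) u"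
    proof -
      have "linear (frechet_derivative ?f (at (\<phi> x)))"
        using smooth_functions_chart_derivative[OF h U] by (simp add: has_derivative_def bounded_linear.linear o_def)
      from linear_euclidean_sum[OF this, of u] show ?thesis by simp
    qed
    finally show ?thesis using 1 unfolding eq coord_vector_smooth[OF h] o_def by simp
  qed
  moreover have "v h = coord_vector A U \<phi> u x h" if "h \<notin> smooth_functions A" for h
    using tangent_nonsmooth[OF v that] that by (simp add: coord_vector_def)
  ultimately show ?thesis using that[of u] by blast
qed

text \<open>Tangent vectors are velocities, hence obey the chain rule.\<close>

lemma tangent_chain:
  assumes v: "v \<in> tangent_space A x" and f: "f \<in> smooth_functions A"
    and k: "smooth_on UNIV k" "(k has_real_derivative k') (at (f x))"
  shows "v (\<lambda>y. k (f y)) = k' * v f"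
proof -
  obtain U \<phi> where U: "(U, \<phi>) \<in> A" "x \<in> U" using atlas_cover[OF A] by metis
  obtain u where u: "v = coord_vector A U \<phi> u x" using tangent_is_coord_vector[OF U v] .
  have "((\<lambda>y. k (f (inv_into U \<phi> y))) has_derivative (\<lambda>w. k' * frechet_derivative (f \<circ> inv_into U \<phi>) (at (\<phi> x)) w)) (at (\<phi> x))"
    using has_derivative_compose[OF smooth_functions_chart_derivative[OF f U], of k "\<lambda>w. k' * w"] k(2)
    by (simp add: has_field_derivative_def chart_inv[OF atlas_chart[OF A U(1)] U(2)])
  from frechet_derivative_at[OF this] show ?thesis
    by (simp add: u coord_vector_smooth f smooth_functions_compose[OF f k(1)] o_def fun_eq_iff)
qed

end

subsection \<open>Gradients\<close>

locale pseudo_riemannian =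
  fixes A :: "('m::{t2_space,second_countable_topology}, 'e::euclidean_space) chart set"
    and g :: "'m \<Rightarrow> 'm tvector \<Rightarrow> 'm tvector \<Rightarrow> real"
  assumes A: "smooth_atlas A" and compact_UNIV: "compact (UNIV :: 'm set)" and g: "nondegenerate_form A g"
begin

lemma g_sym: "v \<in> tangent_space A x \<Longrightarrow> w \<in> tangent_space A x \<Longrightarrow> g x v w = g x w v"
  and g_lin: "u \<in> tangent_space A x \<Longrightarrow> v \<in> tangent_space A x \<Longrightarrow> w \<in> tangent_space A x \<Longrightarrow>
    g x (\<lambda>f. a * u f + b * v f) w = a * g x u w + b * g x v w"
  and g_nondeg: "v \<in> tangent_space A x \<Longrightarrow> (\<And>w. w \<in> tangent_space A x \<Longrightarrow> g x v w = 0) \<Longrightarrow> v = (\<lambda>f. 0)"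
  and g_smooth: "(U, \<phi>) \<in> A \<Longrightarrow> smooth_on (\<phi> ` U)
        ((\<lambda>x. g x (coord_vector A U \<phi> u' x) (coord_vector A U \<phi> w' x)) \<circ> inv_into U \<phi>)"
  using g unfolding nondegenerate_form_def by blast+

lemma g_lin_right: "u \<in> tangent_space A x \<Longrightarrow> v \<in> tangent_space A x \<Longrightarrow> w \<in> tangent_space A x \<Longrightarrow>
    g x w (\<lambda>f. a * u f + b * v f) = a * g x w u + b * g x w v"
  using g_lin[of u x v w a b] g_sym tangent_lincomb[OF A, of u x v a b] by metis

text \<open>The Gram matrix of the form in a chart, encoded as a linear map at the point
  \<open>y\<close> of the chart image, the shape demanded by \<open>smooth_on_solve\<close>.\<close>

definition gram :: "'m set \<Rightarrow> ('m \<Rightarrow> 'e) \<Rightarrow> 'e \<Rightarrow> 'e \<Rightarrow> 'e" where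
  "gram U \<phi> y u = (\<Sum>c\<in>Basis. g (inv_into U \<phi> y) (coord_vector A U \<phi> u (inv_into U \<phi> y)) (coord_vector A U \<phi> c (inv_into U \<phi> y)) *\<^sub>R c)"

lemma gram_linear:
  assumes U: "(U, \<phi>) \<in> A" "y \<in> \<phi> ` U"
  shows "linear (gram U \<phi> y)"
proof -
  have x: "inv_into U \<phi> y \<in> U" using U inv_into_into by metis
  note cv = coord_vector_tangent[OF A U(1) x]
  have "gram U \<phi> y (a *\<^sub>R u + b *\<^sub>R w) = a *\<^sub>R gram U \<phi> y u + b *\<^sub>R gram U \<phi> y w" for a b u w
    unfolding gram_def coord_vector_lincomb[OF A U(1) x] g_lin[OF cv cv cv]
    by (simp add: algebra_simps sum.distrib scaleR_sum_right)
  from this[of 1 _ 1] this[of _ _ 0 0] show ?thesis by (intro linearI) simp_all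
qed

text \<open>A kernel vector is orthogonal to all coordinate vectors, and these exhaust the tangent
  space; nondegeneracy then applies.\<close>

lemma gram_inj:
  assumes U: "(U, \<phi>) \<in> A" "y \<in> \<phi> ` U"
  shows "inj (gram U \<phi> y)"
  unfolding linear_injective_0[OF gram_linear[OF assms]]
proof (intro allI impI)
  fix u assume 0: "gram U \<phi> y u = 0"
  let ?x = "inv_into U \<phi> y"
  have x: "?x \<in> U" using U inv_into_into by metis
  note cv = coord_vector_tangent[OF A U(1) x]
  let ?G = "\<lambda>w. g ?x (coord_vector A U \<phi> u ?x) (coord_vector A U \<phi> w ?x)"
  have Gc: "?G c = 0" if "c \<in> Basis" for c
  proof -
    have "gram U \<phi> y u \<bullet> c = ?G c" using that by (simp add: gram_def)
    then show ?thesis using 0 by simp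
  qed
  have "?G (a *\<^sub>R v + b *\<^sub>R w) = a * ?G v + b * ?G w" for a b v w
    unfolding coord_vector_lincomb[OF A U(1) x] by (rule g_lin_right[OF cv cv cv])
  from this[of 1 _ 1] this[of _ _ 0 0] have "linear ?G" by (intro linearI) simp_all
  from linear_euclidean_sum[OF this] have G0: "?G w = 0" for w using Gc by simp
  have "coord_vector A U \<phi> u ?x = (\<lambda>f. 0)"
  proof (rule g_nondeg[OF cv])
    fix w assume "w \<in> tangent_space A ?x"
    then obtain w' where "w = coord_vector A U \<phi> w' ?x" using tangent_is_coord_vector[OF A U(1) x] by metis
    then show "g ?x (coord_vector A U \<phi> u ?x) w = 0" using G0 by simp
  qed
  moreover have "coord_vector A U \<phi> 0 ?x = (\<lambda>f. 0)"
    using coord_vector_lincomb[OF A U(1) x, of 0 0 0 0] by simp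
  ultimately show "u = 0" using coord_vector_inject[OF A U(1) x] by metis
qed

lemma gradient_unique:
  assumes X: "X \<in> tangent_space A x" "\<And>v. v \<in> tangent_space A x \<Longrightarrow> v f = g x X v"
  shows "gradient A g f x = X"
  unfolding gradient_def differential_def
proof (rule the_equality)
  fix Y assume Y: "Y \<in> tangent_space A x \<and> (\<forall>v\<in>tangent_space A x. v f = g x Y v)"
  have "(\<lambda>f. 1 * Y f + (-1) * X f) = (\<lambda>f. 0)"
  proof (rule g_nondeg)
    show "(\<lambda>f. 1 * Y f + (-1) * X f) \<in> tangent_space A x" using X Y by (intro tangent_lincomb[OF A]) auto
    fix w assume w: "w \<in> tangent_space A x"
    show "g x (\<lambda>f. 1 * Y f + (-1) * X f) w = 0"
      using g_lin[of Y x X w 1 "-1"] X(1) X(2)[OF w] Y w by auto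
  qed
  then show "Y = X" by (simp add: fun_eq_iff)
qed (use assms in auto)

text \<open>In finite dimension the injective Gram map is onto, so the gradient exists and its
  components solve a linear system with the partial derivatives of \<open>f\<close> on the
  right.\<close>

lemma gradient_chart:
  assumes U: "(U, \<phi>) \<in> A" "x \<in> U" and f: "f \<in> smooth_functions A"
  obtains u where "gradient A g f x = coord_vector A U \<phi> u x" "\<And>v. v \<in> tangent_space A x \<Longrightarrow> v f = g x (coord_vector A U \<phi> u x) v"
    "gram U \<phi> (\<phi> x) u = (\<Sum>c\<in>Basis. frechet_derivative (f \<circ> inv_into U \<phi>) (at (\<phi> x)) c *\<^sub>R c)"
proof -
  have y: "\<phi> x \<in> \<phi> ` U" using U by auto
  have inv: "inv_into U \<phi> (\<phi> x) = x" by (rule chart_inv[OF atlas_chart[OF A U(1)] U(2)])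
  note lin = gram_linear[OF U(1) y]
  let ?D = "frechet_derivative (f \<circ> inv_into U \<phi>) (at (\<phi> x))"
  let ?cv = "\<lambda>u. coord_vector A U \<phi> u x"
  note cv = coord_vector_tangent[OF A U]
  have "surj (gram U \<phi> (\<phi> x))" by (rule linear_injective_imp_surjective[OF lin gram_inj[OF U(1) y]]) simp
  from surjD[OF this, of "\<Sum>c\<in>Basis. ?D c *\<^sub>R c"] obtain u
    where u: "gram U \<phi> (\<phi> x) u = (\<Sum>c\<in>Basis. ?D c *\<^sub>R c)" by (auto dest: sym)
  have c: "g x (?cv u) (?cv c) = ?D c" if "c \<in> Basis" for c
  proof -
    have "gram U \<phi> (\<phi> x) u \<bullet> c = g x (?cv u) (?cv c)" using that by (simp add: gram_def inv)
    moreover have "(\<Sum>c\<in>Basis. ?D c *\<^sub>R c) \<bullet> c = ?D c" using that by simp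
    ultimately show ?thesis using u by simp
  qed
  have "g x (?cv u) (?cv (a *\<^sub>R v + b *\<^sub>R w)) = a * g x (?cv u) (?cv v) + b * g x (?cv u) (?cv w)" for a b v w
    unfolding coord_vector_lincomb[OF A U] by (rule g_lin_right[OF cv cv cv])
  from this[of 1 _ 1] this[of _ _ 0 0] have l1: "linear (\<lambda>w. g x (?cv u) (?cv w))" by (intro linearI) simp_all
  have l2: "linear ?D"
    using smooth_functions_chart_derivative[OF A f U] by (simp add: has_derivative_def bounded_linear.linear)
  have w: "g x (?cv u) (?cv w) = ?D w" for w
    using linear_euclidean_sum[OF l1, of w] linear_euclidean_sum[OF l2, of w] c by simp
  have v: "v f = g x (?cv u) v" if vT: "v \<in> tangent_space A x" for v
  proof -
    obtain w' where "v = ?cv w'" using tangent_is_coord_vector[OF A U vT] .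
    then show ?thesis using w by (simp add: coord_vector_smooth[OF A f])
  qed
  show ?thesis by (rule that[OF gradient_unique[OF cv v] v u])
qed

lemma gradient_tangent: "f \<in> smooth_functions A \<Longrightarrow> gradient A g f x \<in> tangent_space A x"
  and gradient_eq: "f \<in> smooth_functions A \<Longrightarrow> v \<in> tangent_space A x \<Longrightarrow> g x (gradient A g f x) v = v f"
proof -
  assume f: "f \<in> smooth_functions A"
  obtain U \<phi> where U: "(U, \<phi>) \<in> A" "x \<in> U" using atlas_cover[OF A] by metis
  obtain u where u: "gradient A g f x = coord_vector A U \<phi> u x" "\<And>v. v \<in> tangent_space A x \<Longrightarrow> v f = g x (coord_vector A U \<phi> u x) v"
    by (rule gradient_chart[OF U f]) blast
  show "gradient A g f x \<in> tangent_space A x" unfolding u(1) by (rule coord_vector_tangent[OF A U])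
  show "g x (gradient A g f x) v = v f" if "v \<in> tangent_space A x" using u that by simp
qed

text \<open>The pairing g(grad f, grad h), a carre du champ of indefinite signature. As a derivation
  in \<open>h\<close> it inherits Leibniz and chain rules, and symmetry transfers them to
  \<open>f\<close>; brackets then become iterated pairings of functions.\<close>

definition \<Gamma> :: "('m \<Rightarrow> real) \<Rightarrow> ('m \<Rightarrow> real) \<Rightarrow> 'm \<Rightarrow> real" where
  "\<Gamma> f h = (\<lambda>x. gradient A g f x h)"

text \<open>In a chart the components of the gradient solve the Gram system with smooth
  coefficients, so \<open>smooth_on_solve\<close> makes them smooth; the pairing is a derivative of
  \<open>h\<close> in that direction.\<close>

lemma \<Gamma>_smooth:
  assumes f: "f \<in> smooth_functions A" and h: "h \<in> smooth_functions A"
  shows "\<Gamma> f h \<in> smooth_functions A"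
  unfolding smooth_functions_iff
proof (rule smooth_fun_onI[OF A])
  fix x
  obtain U \<phi> where U: "(U, \<phi>) \<in> A" "x \<in> U" using atlas_cover[OF A] by metis
  note cU = atlas_chart[OF A U(1)]
  let ?i = "inv_into U \<phi>"
  have i: "?i y \<in> U" "\<phi> (?i y) = y" if "y \<in> \<phi> ` U" for y
    using that inv_into_into[of y \<phi> U] f_inv_into_f[of y \<phi> U] by auto
  let ?P = "\<lambda>y u. gradient A g f (?i y) = coord_vector A U \<phi> u (?i y) \<and>
      gram U \<phi> y u = (\<Sum>c\<in>Basis. frechet_derivative (f \<circ> ?i) (at y) c *\<^sub>R c)"
  have "\<forall>y\<in>\<phi> ` U. \<exists>u. ?P y u"
  proof
    fix y assume y: "y \<in> \<phi> ` U"
    show "\<exists>u. ?P y u" by (rule gradient_chart[OF U(1) i(1)[OF y] f]) (auto simp: i(2)[OF y])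
  qed
  from bchoice[OF this] obtain u where u': "\<forall>y\<in>\<phi> ` U. ?P y (u y)" ..
  have u: "\<And>y. y \<in> \<phi> ` U \<Longrightarrow> gradient A g f (?i y) = coord_vector A U \<phi> (u y) (?i y)"
      "\<And>y. y \<in> \<phi> ` U \<Longrightarrow> gram U \<phi> y (u y) = (\<Sum>c\<in>Basis. frechet_derivative (f \<circ> ?i) (at y) c *\<^sub>R c)"
    by (rule conjunct1[OF bspec[OF u']], assumption) (rule conjunct2[OF bspec[OF u']], assumption)
  have o: "open (\<phi> ` U)" by (rule chart_image_open[OF cU])
  have sf: "smooth_on (\<phi> ` U) (f \<circ> ?i)" "smooth_on (\<phi> ` U) (h \<circ> ?i)"
    using smooth_functions_chart[OF A f U(1)] smooth_functions_chart[OF A h U(1)] by (simp_all add: o_def)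
  have su: "smooth_on (\<phi> ` U) u"
  proof (rule smooth_on_solve[where M="gram U \<phi>" and d="\<lambda>y. \<Sum>c\<in>Basis. frechet_derivative (f \<circ> ?i) (at y) c *\<^sub>R c"])
    show "smooth_on (\<phi> ` U) (\<lambda>y. gram U \<phi> y c)" for c
      unfolding gram_def using g_smooth[OF U(1)]
      by (intro smooth_on_sum smooth_on_scaleR smooth_on_const o) (simp add: o_def)
    show "smooth_on (\<phi> ` U) (\<lambda>y. \<Sum>c\<in>Basis. frechet_derivative (f \<circ> ?i) (at y) c *\<^sub>R c)"
      by (intro smooth_on_sum smooth_on_scaleR smooth_on_const o smooth_on_frechet sf)
  qed (use o gram_linear[OF U(1)] gram_inj[OF U(1)] u in auto)
  have "smooth_on (\<phi> ` U) (\<lambda>y. frechet_derivative (h \<circ> ?i) (at y) (u y))"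
    by (rule smooth_on_frechet_dir[OF o sf(2) smooth_on_bounded_linear[OF bounded_linear_ident] su]) auto
  then have "smooth_on (\<phi> ` U) (\<lambda>y. \<Gamma> f h (?i y))"
    by (rule smooth_on_cong[OF o]) (simp add: \<Gamma>_def u(1) coord_vector_smooth[OF A h] i(2))
  then show "\<exists>U \<phi> W. (U, \<phi>) \<in> A \<and> open W \<and> x \<in> W \<and> W \<subseteq> U \<and> smooth_on (\<phi> ` W) (\<lambda>y. \<Gamma> f h (inv_into U \<phi> y))"
    using U chart_open[OF cU] by blast
qed

lemma \<Gamma>_sym: "f \<in> smooth_functions A \<Longrightarrow> h \<in> smooth_functions A \<Longrightarrow> \<Gamma> f h = \<Gamma> h f"
  unfolding \<Gamma>_def using gradient_eq[of f "gradient A g h x" x for x] gradient_eq[of h "gradient A g f x" x for x]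
    gradient_tangent g_sym by (metis (no_types, lifting))

lemma \<Gamma>_g: "f \<in> smooth_functions A \<Longrightarrow> h \<in> smooth_functions A \<Longrightarrow> \<Gamma> f h x = g x (gradient A g f x) (gradient A g h x)"
  by (metis \<Gamma>_def \<Gamma>_sym gradient_eq gradient_tangent)

lemma gradient_cmult:
  assumes f: "f \<in> smooth_functions A"
  shows "gradient A g (\<lambda>y. a * f y) x = (\<lambda>h. a * gradient A g f x h)"
proof (rule gradient_unique)
  have *: "(\<lambda>h. a * gradient A g f x h + 0 * gradient A g f x h) \<in> tangent_space A x"
    by (intro tangent_lincomb[OF A] gradient_tangent f)
  then show "(\<lambda>h. a * gradient A g f x h) \<in> tangent_space A x" by simp
  fix v assume v: "v \<in> tangent_space A x"
  have "g x (\<lambda>h. a * gradient A g f x h + 0 * gradient A g f x h) v = a * v f"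
    using g_lin[OF gradient_tangent[OF f] gradient_tangent[OF f] v, of a 0] gradient_eq[OF f v] by simp
  then show "v (\<lambda>y. a * f y) = g x (\<lambda>h. a * gradient A g f x h) v"
    using tangent_cmult[OF A v f] by simp
qed

text \<open>The functional g(v, .) on the tangent space is represented by a coordinate vector
  \<open>c\<close>; the cut-off linear coordinate function with this slope has \<open>v\<close> as
  gradient at \<open>x\<close>.\<close>

lemma tangent_is_gradient:
  assumes v: "v \<in> tangent_space A x"
  obtains f where "f \<in> smooth_functions A" "gradient A g f x = v"
proof -
  obtain U \<phi> where U: "(U, \<phi>) \<in> A" "x \<in> U" using atlas_cover[OF A] by metis
  note cv = coord_vector_tangent[OF A U]
  obtain \<beta> :: "'m \<Rightarrow> real" and V where b: "smooth_map_on UNIV A std_atlas \<beta>" "smooth_map_on UNIV A std_atlas (\<lambda>y. \<beta> y *\<^sub>R \<phi> y)"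
    "open V" "x \<in> V" "V \<subseteq> U" "\<And>y. y \<in> V \<Longrightarrow> \<beta> y = 1" "\<And>y. y \<notin> U \<Longrightarrow> \<beta> y = 0"
    by (rule local_coordinates[OF A U]) blast
  let ?G = "\<lambda>w. g x v (coord_vector A U \<phi> w x)"
  have "?G (a *\<^sub>R w + b *\<^sub>R w') = a * ?G w + b * ?G w'" for a b w w'
    unfolding coord_vector_lincomb[OF A U] by (rule g_lin_right[OF cv cv v])
  from this[of 1 _ 1] this[of _ _ 0 0] have lin: "linear ?G" by (intro linearI) simp_all
  define c where "c = (\<Sum>b\<in>Basis. ?G b *\<^sub>R b)"
  have Gc: "?G w = w \<bullet> c" for w
    using linear_euclidean_sum[OF lin, of w] by (simp add: c_def inner_sum_right mult.commute)
  let ?f = "\<lambda>y. (\<beta> y *\<^sub>R \<phi> y) \<bullet> c"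
  have f: "?f \<in> smooth_functions A" by (rule smooth_functions_component[OF A b(2)])
  have "gradient A g ?f x = v"
  proof (rule gradient_unique[OF v])
    fix w assume "w \<in> tangent_space A x"
    then obtain w' where w: "w = coord_vector A U \<phi> w' x" using tangent_is_coord_vector[OF A U] by metis
    have "coord_vector A U \<phi> w' x ?f = w' \<bullet> c"
      by (rule coord_vector_coordinate[OF A U(1) b(3-5) f]) (simp add: b)
    then show "w ?f = g x v w" by (simp add: w Gc)
  qed
  then show ?thesis using that f by blast
qed

end

section \<open>Flows on compact manifolds\<close>

lemma has_velocity_transform:
  assumes "has_velocity A c t v" "open I" "t \<in> I" "\<And>s. s \<in> I \<Longrightarrow> c s = c' s"
  shows "has_velocity A c' t v"
proof -
  have ev: "\<forall>\<^sub>F s in nhds t. c s = c' s"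
    using eventually_nhds_in_open[OF assms(2,3)] by (rule eventually_mono) (rule assms(4))
  have ct: "c' t = c t" using assms(3,4) by simp
  have "isCont c' t" using assms(1) isCont_cong[OF ev] by (simp add: has_velocity_def)
  moreover have "((h \<circ> c') has_real_derivative v h) (at t)" if "h \<in> smooth_functions A" for h
    by (rule has_field_derivative_transform_within_open[of "h \<circ> c" _ t I])
      (use assms that in \<open>auto simp: has_velocity_def\<close>)
  ultimately show ?thesis using assms(1) by (simp add: has_velocity_def ct)
qed

lemma has_velocity_scale:
  assumes v: "has_velocity A c (k * t + a) v" and v': "(\<lambda>f. k * v f) \<in> tangent_space A (c (k * t + a))"
  shows "has_velocity A (\<lambda>s. c (k * s + a)) t (\<lambda>f. k * v f)"
  unfolding has_velocity_def
proof (intro conjI ballI v')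
  show "isCont (\<lambda>s. c (k * s + a)) t"
    using v by (intro isCont_o2[of t "\<lambda>s. k * s + a" c]) (auto simp: has_velocity_def)
  fix h assume "h \<in> smooth_functions A"
  then have d: "((h \<circ> c) has_real_derivative v h) (at (k * t + a))" using v by (simp add: has_velocity_def)
  have "((\<lambda>s. k * s + a) has_real_derivative k) (at t)" by (auto intro!: derivative_eq_intros)
  from DERIV_chain2[OF d this] show "((h \<circ> (\<lambda>s. c (k * s + a))) has_real_derivative k * v h) (at t)"
    by (simp add: o_def mult.commute)
qed

lemma has_velocity_shift:
  assumes v: "has_velocity A c (t + a) v"
  shows "has_velocity A (\<lambda>s. c (s + a)) t v"
  using has_velocity_scale[of A c 1 t a v] v by (simp add: has_velocity_def)

lemma has_velocity_glue:
  assumes "open I" "open J" "\<And>t. t \<in> I \<Longrightarrow> has_velocity A c1 t (X (c1 t))" "\<And>t. t \<in> J \<Longrightarrow> has_velocity A c2 t (X (c2 t))"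
    and eq: "\<And>t. t \<in> I \<inter> J \<Longrightarrow> c1 t = c2 t"
  defines "c \<equiv> \<lambda>t. if t \<in> I then c1 t else c2 t"
  shows "t \<in> I \<union> J \<Longrightarrow> has_velocity A c t (X (c t))"
proof -
  assume t: "t \<in> I \<union> J"
  have J: "c s = c2 s" if "s \<in> J" for s using that eq by (auto simp: c_def)
  show ?thesis
  proof (cases "t \<in> I")
    case True
    then have "c t = c1 t" by (simp add: c_def)
    then show ?thesis using has_velocity_transform[OF assms(3)[OF True] assms(1) True, of c] by (simp add: c_def)
  next
    case False
    then have "t \<in> J" using t by simp
    then show ?thesis using has_velocity_transform[OF assms(4) assms(2), of t c] J by simp
  qed
qed

section \<open>Integral curves and flows of a smooth field: uniqueness, completeness,
  smoothness\<close>

context pseudo_riemannian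
begin

context
  fixes X :: "'m \<Rightarrow> 'm tvector"
  assumes X: "\<And>x. X x \<in> tangent_space A x" "\<And>h. h \<in> smooth_functions A \<Longrightarrow> (\<lambda>x. X x h) \<in> smooth_functions A"
begin

text \<open>The components of \<open>X\<close> are its values on cut-off coordinates
  \<open>\<kappa>\<close>. A second cut-off in the model space gives a globally smooth and Lipschitz
  field that still represents \<open>X\<close> near \<open>p\<close>, so that Euclidean flow theory
  applies.\<close>

lemma chart_field:
  obtains U \<phi> V f L \<kappa> where "(U, \<phi>) \<in> A" "open V" "p \<in> V" "V \<subseteq> U" "smooth_on UNIV f" "(L::real) > 0"
    "\<And>y z. norm (f y - f z) \<le> L * norm (y - z)"
    "\<And>x. x \<in> V \<Longrightarrow> X x = coord_vector A U \<phi> (f (\<phi> x)) x"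
    "\<And>c. (\<lambda>x. \<kappa> x \<bullet> c) \<in> smooth_functions A" "\<And>x. x \<in> V \<Longrightarrow> \<kappa> x = \<phi> x"
proof -
  obtain U \<phi> where U: "(U, \<phi>) \<in> A" "p \<in> U" using atlas_cover[OF A] by metis
  note cU = atlas_chart[OF A U(1)]
  obtain \<beta> :: "'m \<Rightarrow> real" and V where b: "smooth_map_on UNIV A std_atlas \<beta>" "smooth_map_on UNIV A std_atlas (\<lambda>y. \<beta> y *\<^sub>R \<phi> y)"
    "open V" "p \<in> V" "V \<subseteq> U" "\<And>y. y \<in> V \<Longrightarrow> \<beta> y = 1" "\<And>y. y \<notin> U \<Longrightarrow> \<beta> y = 0"
    by (rule local_coordinates[OF A U]) blast
  define \<kappa> where "\<kappa> x = \<beta> x *\<^sub>R \<phi> x" for x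
  have \<kappa>: "(\<lambda>x. \<kappa> x \<bullet> c) \<in> smooth_functions A" for c unfolding \<kappa>_def by (rule smooth_functions_component[OF A b(2)])
  have \<kappa>V: "\<kappa> x = \<phi> x" if "x \<in> V" for x using b(6)[OF that] by (simp add: \<kappa>_def)
  define \<xi> where "\<xi> x = (\<Sum>c\<in>Basis. X x (\<lambda>x. \<kappa> x \<bullet> c) *\<^sub>R c)" for x
  have X\<xi>: "X x = coord_vector A U \<phi> (\<xi> x) x" if x: "x \<in> V" for x
  proof -
    have xU: "x \<in> U" using x b by auto
    obtain u where u: "X x = coord_vector A U \<phi> u x" using tangent_is_coord_vector[OF A U(1) xU X(1)] .
    have "u = \<xi> x"
    proof (rule euclidean_eqI)
      fix c :: 'e assume "c \<in> Basis"
      then have "\<xi> x \<bullet> c = X x (\<lambda>x. \<kappa> x \<bullet> c)" by (simp add: \<xi>_def)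
      also have "\<dots> = u \<bullet> c" unfolding u
        by (rule coord_vector_coordinate[OF A U(1) b(3) x b(5) \<kappa>]) (simp add: \<kappa>V)
      finally show "u \<bullet> c = \<xi> x \<bullet> c" by simp
    qed
    then show ?thesis using u by simp
  qed
  have oV: "open (\<phi> ` V)" by (rule chart_open_image[OF cU b(3,5)])
  then obtain R where R: "R > 0" "cball (\<phi> p) R \<subseteq> \<phi> ` V" using open_contains_cball b(4) by blast
  have R2: "0 < R / 2" "R / 2 < R" using R by auto
  obtain \<rho> :: "'e \<Rightarrow> real" where \<rho>: "smooth_on UNIV \<rho>" "\<And>y. \<rho> y \<ge> 0" "\<And>y. y \<in> cball (\<phi> p) (R / 2) \<Longrightarrow> \<rho> y = 1"
    "\<And>y. y \<notin> ball (\<phi> p) R \<Longrightarrow> \<rho> y = 0" by (rule smooth_bump[OF R2, of "\<phi> p"]) blast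
  define f where "f y = \<rho> y *\<^sub>R \<xi> (inv_into U \<phi> y)" for y
  have s1: "smooth_on (\<phi> ` V) f"
    unfolding f_def \<xi>_def
    by (intro smooth_on_scaleR smooth_on_sum smooth_on_const oV smooth_on_subset[OF \<rho>(1)]
        smooth_on_subset[OF smooth_functions_chart[OF A X(2)[OF \<kappa>] U(1)]]) (use b in auto)
  have s2: "smooth_on (- cball (\<phi> p) R) f"
    by (rule smooth_on_cong[OF _ smooth_on_const[of _ 0]]) (use \<rho>(4) in \<open>auto simp: f_def\<close>)
  have sf: "smooth_on UNIV f"
  proof (rule smooth_on_local)
    fix y
    show "\<exists>T. open T \<and> y \<in> T \<and> smooth_on T f"
    proof (cases "y \<in> cball (\<phi> p) R")
      case True
      then show ?thesis using s1 oV R by blast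
    next
      case False
      then show ?thesis using s2 by (intro exI[of _ "- cball (\<phi> p) R"]) auto
    qed
  qed
  have supp: "f y = 0" if "y \<notin> cball (\<phi> p) R" for y
    using that \<rho>(4)[of y] by (auto simp: f_def)
  obtain L where L: "L > 0" "\<And>y z. norm (f y - f z) \<le> L * norm (y - z)"
    by (rule compact_support_Lipschitz[OF sf compact_cball supp]) blast+
  define V' where "V' = V \<inter> \<phi> -` ball (\<phi> p) (R / 2)"
  have V': "open V'" "p \<in> V'" "V' \<subseteq> V"
    unfolding V'_def using continuous_open_preimage[OF continuous_on_subset[OF chart_continuous[OF cU] b(5)] b(3) open_ball] b R
    by auto
  have "X x = coord_vector A U \<phi> (f (\<phi> x)) x" if "x \<in> V'" for x
  proof -
    have "x \<in> U" "\<rho> (\<phi> x) = 1" using that V' b by (auto simp: V'_def intro!: \<rho>(3))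
    then have "f (\<phi> x) = \<xi> x" by (simp add: f_def chart_inv[OF cU])
    then show ?thesis using X\<xi> that V' by auto
  qed
  then show ?thesis
    using V' b(5) \<kappa>V by (intro that[OF U(1) V'(1,2) _ sf L _ \<kappa>]) auto
qed

lemma velocity_from_chart:
  assumes U: "(U, \<phi>) \<in> A" and y: "y t \<in> \<phi> ` U" "(y has_vector_derivative d) (at t)"
  shows "has_velocity A (\<lambda>s. inv_into U \<phi> (y s)) t (coord_vector A U \<phi> d (inv_into U \<phi> (y t)))"
  unfolding has_velocity_def
proof (intro conjI ballI)
  note cU = atlas_chart[OF A U]
  have x: "inv_into U \<phi> (y t) \<in> U" "\<phi> (inv_into U \<phi> (y t)) = y t"
    using y inv_into_into[of "y t" \<phi> U] f_inv_into_f[of "y t" \<phi> U] by auto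
  have "isCont (inv_into U \<phi>) (y t)"
    by (rule continuous_on_interior[OF chart_inv_continuous[OF cU]]) (simp add: interior_open chart_image_open[OF cU] y(1))
  then show "isCont (\<lambda>s. inv_into U \<phi> (y s)) t"
    by (rule isCont_o2[OF has_vector_derivative_continuous[OF y(2)]])
  show "coord_vector A U \<phi> d (inv_into U \<phi> (y t)) \<in> tangent_space A (inv_into U \<phi> (y t))"
    by (rule coord_vector_tangent[OF A U x(1)])
  fix h assume h: "h \<in> smooth_functions A"
  have "((\<lambda>z. h (inv_into U \<phi> z)) has_derivative frechet_derivative (h \<circ> inv_into U \<phi>) (at (y t))) (at (y t))"
    using smooth_functions_chart_derivative[OF A h U x(1)] by (simp add: x(2))
  from has_vector_derivative_chain[OF this y(2)]
  show "((h \<circ> (\<lambda>s. inv_into U \<phi> (y s))) has_real_derivative coord_vector A U \<phi> d (inv_into U \<phi> (y t)) h) (at t)"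
    by (simp add: coord_vector_smooth[OF A h] x(2) o_def has_real_derivative_iff_has_vector_derivative)
qed

text \<open>A velocity is tested on global functions only, so the chart is replaced by the globally
  defined \<open>\<kappa>\<close>; by continuity the curve stays in \<open>V\<close> for nearby
  times, where the two agree.\<close>

lemma velocity_to_chart:
  assumes U: "(U, \<phi>) \<in> A" "open V" "V \<subseteq> U" and Xf: "X (c t) = coord_vector A U \<phi> w (c t)"
    and \<kappa>: "\<And>b. (\<lambda>x. \<kappa> x \<bullet> b) \<in> smooth_functions A" "\<And>x. x \<in> V \<Longrightarrow> \<kappa> x = \<phi> x"
    and c: "has_velocity A c t (X (c t))" "c t \<in> V"
  shows "((\<lambda>s. \<phi> (c s)) has_vector_derivative w) (at t)"
proof -
  have comp: "((\<lambda>s. (\<kappa> (c s) \<bullet> b) *\<^sub>R b) has_vector_derivative (w \<bullet> b) *\<^sub>R b) (at t)" for b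
  proof -
    have "((\<lambda>s. \<kappa> (c s) \<bullet> b) has_real_derivative X (c t) (\<lambda>x. \<kappa> x \<bullet> b)) (at t)"
      using c(1) \<kappa>(1)[of b] by (auto simp: has_velocity_def o_def)
    moreover have "X (c t) (\<lambda>x. \<kappa> x \<bullet> b) = w \<bullet> b"
      unfolding Xf by (rule coord_vector_coordinate[OF A U(1,2) c(2) U(3) \<kappa>(1)]) (simp add: \<kappa>)
    ultimately have "((\<lambda>s. \<kappa> (c s) \<bullet> b) has_vector_derivative w \<bullet> b) (at t)"
      by (simp add: has_real_derivative_iff_has_vector_derivative)
    from bounded_linear.has_vector_derivative[OF bounded_linear_scaleR_left this, of b] show ?thesis .
  qed
  have "((\<lambda>s. \<Sum>b\<in>Basis. (\<kappa> (c s) \<bullet> b) *\<^sub>R b) has_vector_derivative (\<Sum>b\<in>Basis. (w \<bullet> b) *\<^sub>R b)) (at t)"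
    by (rule has_vector_derivative_sum) (rule comp)
  then have d: "((\<lambda>s. \<kappa> (c s)) has_vector_derivative w) (at t)" by (simp add: euclidean_representation)
  have "\<forall>\<^sub>F s in nhds t. c s \<in> V"
    using c U(2) unfolding has_velocity_def
    by (metis isContD tendsto_at_iff_tendsto_nhds topological_tendstoD)
  then obtain I where I: "open I" "t \<in> I" "\<And>s. s \<in> I \<Longrightarrow> c s \<in> V" unfolding eventually_nhds by blast
  show ?thesis
    by (rule has_vector_derivative_transform_within_open[OF d I(1,2)]) (use I \<kappa> in auto)
qed

text \<open>The set of agreement is closed in \<open>I\<close> by the Hausdorff property and open by
  \<open>ode_unique\<close> in a chart; it contains \<open>t0\<close>, and \<open>I\<close> is
  connected.\<close>

lemma integral_curve_unique:
  assumes I: "open I" "connected I" and t0: "t0 \<in> I" "c1 t0 = c2 t0" and t: "t \<in> I"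
    and c1: "\<And>t. t \<in> I \<Longrightarrow> has_velocity A c1 t (X (c1 t))" and c2: "\<And>t. t \<in> I \<Longrightarrow> has_velocity A c2 t (X (c2 t))"
  shows "c1 t = c2 t"
proof -
  define Z where "Z = I \<inter> (\<lambda>t. (c1 t, c2 t)) -` {z. fst z = snd z}"
  have cont: "continuous_on I c1" "continuous_on I c2"
    using c1 c2 by (auto intro!: continuous_at_imp_continuous_on simp: has_velocity_def)
  have "{z::'m \<times> 'm. fst z = snd z} = {y. \<exists>x. y = (x, x)}" by auto
  then have "closed {z::'m \<times> 'm. fst z = snd z}" by (simp only: closed_diagonal)
  then have "closedin (top_of_set I) Z"
    unfolding Z_def by (intro continuous_closedin_preimage continuous_on_Pair cont)
  moreover have "open Z"
    unfolding open_dist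
  proof
    fix t assume "t \<in> Z"
    then have t: "t \<in> I" "c1 t = c2 t" by (auto simp: Z_def)
    obtain U \<phi> V f L \<kappa> where f: "(U, \<phi>) \<in> A" "open V" "c1 t \<in> V" "V \<subseteq> U" "smooth_on UNIV f" "(L::real) > 0"
      "\<And>y z. norm (f y - f z) \<le> L * norm (y - z)" "\<And>x. x \<in> V \<Longrightarrow> X x = coord_vector A U \<phi> (f (\<phi> x)) x"
      "\<And>c. (\<lambda>x. \<kappa> x \<bullet> c) \<in> smooth_functions A" "\<And>x. x \<in> V \<Longrightarrow> \<kappa> x = \<phi> x"
      by (rule chart_field[of "c1 t"]) blast
    have "open (I \<inter> c1 -` V \<inter> (I \<inter> c2 -` V))"
      by (intro open_Int continuous_open_preimage cont I f)
    then obtain e where e: "e > 0" "\<And>s. dist s t < e \<Longrightarrow> s \<in> I \<and> c1 s \<in> V \<and> c2 s \<in> V"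
      using t f(3) unfolding open_dist by (metis IntE IntI vimageE vimageI2)
    have "s \<in> Z" if s: "dist s t < e" for s
    proof -
      have seg: "dist (t + r) t < e" if "r \<in> closed_segment 0 (s - t)" for r
        using that s by (auto simp: closed_segment_eq_real_ivl dist_real_def split: if_splits)
      have d: "((\<lambda>r. \<phi> (c (t + r))) has_vector_derivative f (\<phi> (c (t + r)))) (at r)"
        if c: "\<And>t. t \<in> I \<Longrightarrow> has_velocity A c t (X (c t))" and r: "t + r \<in> I" "c (t + r) \<in> V" for c r
      proof -
        have "((\<lambda>s. \<phi> (c s)) has_vector_derivative f (\<phi> (c (t + r)))) (at (t + r))"
          by (rule velocity_to_chart[OF f(1,2,4) f(8)[OF r(2)] f(9,10) c[OF r(1)] r(2)])
        moreover have "((\<lambda>r. t + r) has_vector_derivative 1) (at r)"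
          by (rule has_real_derivative_iff_has_vector_derivative[THEN iffD1]) (auto intro!: derivative_eq_intros)
        ultimately have "((\<lambda>s. \<phi> (c s)) \<circ> (\<lambda>r. t + r) has_vector_derivative 1 *\<^sub>R f (\<phi> (c (t + r)))) (at r)"
          by (intro vector_diff_chain_at)
        then show ?thesis by (simp add: o_def)
      qed
      have "\<phi> (c1 (t + (s - t))) = \<phi> (c2 (t + (s - t)))"
      proof (rule ode_unique[where t="s - t" and L=L])
        fix r assume r: "r \<in> closed_segment 0 (s - t)"
        note e' = e(2)[OF seg[OF r]]
        show "((\<lambda>r. \<phi> (c1 (t + r))) has_vector_derivative f (\<phi> (c1 (t + r)))) (at r)" using e' by (intro d[of c1] c1) auto
        show "((\<lambda>r. \<phi> (c2 (t + r))) has_vector_derivative f (\<phi> (c2 (t + r)))) (at r)" using e' by (intro d[of c2] c2) auto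
        show "norm (f (\<phi> (c1 (t + r))) - f (\<phi> (c2 (t + r)))) \<le> L * norm (\<phi> (c1 (t + r)) - \<phi> (c2 (t + r)))" by (rule f(7))
      qed (simp add: t)
      then have "c1 s = c2 s"
        using e(2)[OF s] f(4) chart_inj[OF atlas_chart[OF A f(1)]] by (auto simp: inj_on_def)
      then show ?thesis using e(2)[OF s] by (simp add: Z_def)
    qed
    then show "\<exists>e>0. \<forall>s. dist s t < e \<longrightarrow> s \<in> Z" using e(1) by blast
  qed
  then have "openin (top_of_set I) Z" by (rule open_subset[rotated]) (simp add: Z_def)
  ultimately have "Z = {} \<or> Z = I" using I(2) unfolding connected_clopen by blast
  moreover have "t0 \<in> Z" using t0 by (simp add: Z_def)
  ultimately have "t \<in> Z" using t by blast
  then show ?thesis by (simp add: Z_def)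
qed

lemma local_flow:
  obtains V \<tau> u where "open V" "p \<in> V" "\<tau> > 0" "\<And>x. x \<in> V \<Longrightarrow> u (0, x) = x"
    "\<And>t x. x \<in> V \<Longrightarrow> \<bar>t\<bar> < \<tau> \<Longrightarrow> has_velocity A (\<lambda>t. u (t, x)) t (X (u (t, x)))"
    "smooth_map_on ({-\<tau><..<\<tau>} \<times> V) (prod_atlas std_atlas A) A u"
proof -
  obtain U \<phi> V f L \<kappa> where f: "(U, \<phi>) \<in> A" "open V" "p \<in> V" "V \<subseteq> U" "smooth_on UNIV f" "(L::real) > 0"
    "\<And>y z. norm (f y - f z) \<le> L * norm (y - z)" "\<And>x. x \<in> V \<Longrightarrow> X x = coord_vector A U \<phi> (f (\<phi> x)) x"
    "\<And>c. (\<lambda>x. \<kappa> x \<bullet> c) \<in> smooth_functions A" "\<And>x. x \<in> V \<Longrightarrow> \<kappa> x = \<phi> x"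
    by (rule chart_field[of p]) blast
  note cU = atlas_chart[OF A f(1)]
  obtain w where w: "smooth_on UNIV w" "\<And>y. w (0, y) = y"
    "\<And>t y. ((\<lambda>t. w (t, y)) has_vector_derivative f (w (t, y))) (at t)"
    by (rule smooth_flow[OF f(5-7)]) blast
  have oV: "open (\<phi> ` V)" by (rule chart_open_image[OF cU f(2,4)])
  have ow: "open (w -` (\<phi> ` V))" by (rule open_vimage[OF oV smooth_on_continuous[OF w(1)]])
  have w0: "(0, \<phi> p) \<in> w -` (\<phi> ` V)" using f(3) by (simp add: w(2))
  \<comment> \<open>A product neighbourhood of \<open>(0, \<phi> p)\<close> whose trajectories
    remain in the region where the cut-off field represents \<open>X\<close>; beyond it the
    Euclidean flow says nothing about \<open>X\<close>.\<close>
  obtain I B where IB: "open I" "open B" "0 \<in> I" "\<phi> p \<in> B" "I \<times> B \<subseteq> w -` (\<phi> ` V)"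
    by (rule open_prod_elim[OF ow w0]) blast
  obtain \<tau> where \<tau>: "\<tau> > 0" "ball 0 \<tau> \<subseteq> I" using IB(1,3) open_contains_ball by blast
  define V' where "V' = V \<inter> \<phi> -` B"
  have V': "open V'" "p \<in> V'" "V' \<subseteq> U" "V' \<subseteq> V"
    unfolding V'_def using continuous_open_preimage[OF continuous_on_subset[OF chart_continuous[OF cU] f(4)] f(2) IB(2)] f IB by auto
  define u where "u z = inv_into U \<phi> (w (fst z, \<phi> (snd z)))" for z
  have wV: "w (t, \<phi> x) \<in> \<phi> ` V" if "x \<in> V'" "\<bar>t\<bar> < \<tau>" for t x
  proof -
    have "t \<in> I" using that(2) \<tau>(2) by (auto simp: dist_real_def)
    then show ?thesis using that(1) IB(5) by (auto simp: V'_def)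
  qed
  have uV: "u (t, x) \<in> V" "\<phi> (u (t, x)) = w (t, \<phi> x)" if "x \<in> V'" "\<bar>t\<bar> < \<tau>" for t x
    using wV[OF that] f(4) chart_inv[OF cU] by (auto simp: u_def subset_iff)
  have vel: "has_velocity A (\<lambda>t. u (t, x)) t (X (u (t, x)))" if "x \<in> V'" "\<bar>t\<bar> < \<tau>" for t x
  proof -
    have "has_velocity A (\<lambda>t. inv_into U \<phi> (w (t, \<phi> x))) t (coord_vector A U \<phi> (f (w (t, \<phi> x))) (inv_into U \<phi> (w (t, \<phi> x))))"
      by (rule velocity_from_chart[OF f(1) _ w(3)]) (use wV[OF that] f(4) in auto)
    then show ?thesis using f(8)[OF uV(1)[OF that]] uV(2)[OF that] by (simp add: u_def)
  qed
  have "smooth_map_on ({-\<tau><..<\<tau>} \<times> V') (prod_atlas std_atlas A) A u"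
  proof (rule smooth_map_onI[OF smooth_atlas_prod[OF smooth_atlas_std A] A])
    fix z assume z: "z \<in> {-\<tau><..<\<tau>} \<times> V'"
    let ?W = "{-\<tau><..<\<tau>} \<times> V'"
    have cid: "is_chart UNIV (id :: real \<Rightarrow> real)" by (rule atlas_chart[OF smooth_atlas_std]) (simp add: std_atlas_def)
    note pc = prod_chart[OF cid cU]
    have o: "open (map_prod id \<phi> ` ?W)"
      by (rule chart_open_image[OF pc(1)]) (use V' in \<open>auto intro: open_Times\<close>)
    have "smooth_on (map_prod id \<phi> ` ?W) (\<phi> \<circ> u \<circ> inv_into (UNIV \<times> U) (map_prod id \<phi>))"
    proof (rule smooth_on_cong[OF o smooth_on_subset[OF w(1)]])
      fix y assume "y \<in> map_prod id \<phi> ` ?W"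
      then obtain t x where tx: "x \<in> V'" "\<bar>t\<bar> < \<tau>" "y = (t, \<phi> x)" by (auto simp: abs_less_iff)
      have "inv_into (UNIV \<times> U) (map_prod id \<phi>) y = (t, x)"
        using tx V' pc(2)[of y] chart_inv[OF cU, of x] chart_inv[OF cid, of t] by (auto simp: subset_iff)
      then show "w y = (\<phi> \<circ> u \<circ> inv_into (UNIV \<times> U) (map_prod id \<phi>)) y" using uV(2)[OF tx(1,2)] tx(3) by simp
    qed auto
    then show "\<exists>U \<phi> V \<psi> W. (U, \<phi>) \<in> prod_atlas std_atlas A \<and> (V, \<psi>) \<in> A \<and> open W \<and> z \<in> W \<and> W \<subseteq> U \<and> u ` W \<subseteq> V \<and>
      smooth_on (\<phi> ` W) (\<psi> \<circ> u \<circ> inv_into U \<phi>)"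
      using z V' uV(1) f(1,4)
      by (intro exI[of _ "UNIV \<times> U"] exI[of _ "map_prod id \<phi>"] exI[of _ U] exI[of _ \<phi>] exI[of _ ?W] conjI
          prod_atlasI open_Times) (auto simp: std_atlas_def abs_less_iff)
  qed
  moreover have "u (0, x) = x" if "x \<in> V'" for x
    using that V' by (auto simp: u_def w(2) chart_inv[OF cU])
  ultimately show ?thesis using that[OF V'(1,2) \<tau>(1)] vel by blast
qed

text \<open>A finite subcover gives one existence time for all starting points. This is where
  compactness makes fields complete.\<close>

lemma uniform_local_flow:
  obtains \<tau> where "\<tau> > 0"
    "\<And>p. \<exists>V u. open V \<and> p \<in> V \<and> (\<forall>x\<in>V. u (0, x) = x) \<and>
      (\<forall>x\<in>V. \<forall>t. \<bar>t\<bar> < \<tau> \<longrightarrow> has_velocity A (\<lambda>t. u (t, x)) t (X (u (t, x)))) \<and>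
      smooth_map_on ({-\<tau><..<\<tau>} \<times> V) (prod_atlas std_atlas A) A u"
proof -
  let ?P = "\<lambda>\<tau> V. \<exists>u. (\<forall>x\<in>V. u (0, x) = x) \<and>
      (\<forall>x\<in>V. \<forall>t. \<bar>t\<bar> < \<tau> \<longrightarrow> has_velocity A (\<lambda>t. u (t, x)) t (X (u (t, x)))) \<and>
      smooth_map_on ({-\<tau><..<\<tau>} \<times> V) (prod_atlas std_atlas A) A u"
  have mono: "?P \<tau>' V" if "?P \<tau> V" "\<tau>' \<le> \<tau>" for \<tau> \<tau>' :: real and V
  proof -
    from that(1) obtain u where u: "\<forall>x\<in>V. u (0, x) = x"
      "\<forall>x\<in>V. \<forall>t. \<bar>t\<bar> < \<tau> \<longrightarrow> has_velocity A (\<lambda>t. u (t, x)) t (X (u (t, x)))"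
      "smooth_map_on ({-\<tau><..<\<tau>} \<times> V) (prod_atlas std_atlas A) A u" by blast
    have "smooth_map_on ({-\<tau>'<..<\<tau>'} \<times> V) (prod_atlas std_atlas A) A u"
      by (rule smooth_map_on_subset[OF u(3)]) (use that(2) in auto)
    then show ?thesis using u that(2) by (intro exI[of _ u]) auto
  qed
  have "\<exists>V \<tau>. open V \<and> p \<in> V \<and> \<tau> > 0 \<and> ?P \<tau> V" for p
    by (rule local_flow[of p]) blast
  then have "\<forall>p. \<exists>V \<tau>. open V \<and> p \<in> V \<and> \<tau> > 0 \<and> ?P \<tau> V" by (rule allI)
  from choice[OF this] obtain V where "\<forall>p. \<exists>\<tau>. open (V p) \<and> p \<in> V p \<and> \<tau> > 0 \<and> ?P \<tau> (V p)" ..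
  from choice[OF this] obtain \<tau> where "\<forall>p. open (V p) \<and> p \<in> V p \<and> \<tau> p > 0 \<and> ?P (\<tau> p) (V p)" ..
  then have V: "\<And>p. open (V p)" "\<And>p. p \<in> V p" "\<And>p. \<tau> p > 0" "\<And>p. ?P (\<tau> p) (V p)"
    by (simp_all only:)
  obtain F where F: "finite F" "UNIV \<subseteq> (\<Union>p\<in>F. V p)"
    by (rule compactE_image[OF compact_UNIV, of UNIV V]) (use V in auto)
  define \<sigma> where "\<sigma> = Min (\<tau> ` F)"
  have F0: "F \<noteq> {}" using F(2) by auto
  have "\<sigma> > 0" unfolding \<sigma>_def using F(1) F0 V(3) by (subst Min_gr_iff) auto
  moreover have "\<exists>V. open V \<and> p \<in> V \<and> ?P \<sigma> V" for p
  proof -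
    obtain q where q: "q \<in> F" "p \<in> V q" using F(2) by auto
    then have "\<sigma> \<le> \<tau> q" unfolding \<sigma>_def using F(1) by simp
    then have "?P \<sigma> (V q)" by (rule mono[OF V(4)])
    with V(1)[of q] q(2) show ?thesis by (intro exI[of _ "V q"] conjI)
  qed
  ultimately show ?thesis
    by (intro that[of \<sigma>]) (simp_all only: ex_simps conj_assoc)
qed

text \<open>Restarting from points near both ends of the interval always buys the same extra time;
  uniqueness makes the pieces agree on overlaps.\<close>

lemma extend_integral_curve:
  assumes \<sigma>: "\<sigma> > 0" and loc: "\<And>x. \<exists>c. c 0 = x \<and> (\<forall>t. \<bar>t\<bar> < 2 * \<sigma> \<longrightarrow> has_velocity A c t (X (c t)))"
  shows "\<exists>c. c 0 = x \<and> (\<forall>t. \<bar>t\<bar> < real (Suc n) * \<sigma> \<longrightarrow> has_velocity A c t (X (c t)))"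
proof (induction n)
  case 0
  obtain c where "c 0 = x" "\<And>t. \<bar>t\<bar> < 2 * \<sigma> \<Longrightarrow> has_velocity A c t (X (c t))" using loc[of x] by blast
  then show ?case using \<sigma> by (intro exI[of _ c]) auto
next
  case (Suc n)
  have step: "\<exists>c'. (\<forall>t\<in>{l<..<r}. c' t = c t) \<and> (\<forall>t\<in>{l<..<r} \<union> {a - 2 * \<sigma><..<a + 2 * \<sigma>}. has_velocity A c' t (X (c' t)))"
    if c: "\<And>t. t \<in> {l<..<r} \<Longrightarrow> has_velocity A c t (X (c t))" and a: "a \<in> {l<..<r}" for c l r a
  proof -
    obtain d where d: "d 0 = c a" "\<And>t. \<bar>t\<bar> < 2 * \<sigma> \<Longrightarrow> has_velocity A d t (X (d t))" using loc[of "c a"] by blast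
    let ?d = "\<lambda>t. d (t + - a)"
    let ?I = "{l<..<r}" and ?J = "{a - 2 * \<sigma><..<a + 2 * \<sigma>}"
    have d': "has_velocity A ?d t (X (?d t))" if "t \<in> ?J" for t
      using has_velocity_shift[OF d(2), of t "- a"] that by (auto simp: abs_less_iff)
    have "?I \<inter> ?J = {max l (a - 2 * \<sigma>)<..<min r (a + 2 * \<sigma>)}" by auto
    then have co: "open (?I \<inter> ?J)" "connected (?I \<inter> ?J)" by (simp_all add: convex_connected)
    have "c t = ?d t" if "t \<in> ?I \<inter> ?J" for t
      by (rule integral_curve_unique[OF co, of a]) (use a \<sigma> d d' c that in auto)
    from has_velocity_glue[of ?I ?J A c X ?d, OF _ _ c d' this]
    show ?thesis by (intro exI[of _ "\<lambda>t. if t \<in> ?I then c t else ?d t"]) auto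
  qed
  \<comment> \<open>Half a unit before the end: a restart lasting \<open>2 * \<sigma>\<close>
    reaches one and a half units beyond the end, more than the required one.\<close>
  define a where "a = real (Suc n) * \<sigma> - \<sigma> / 2"
  have a: "0 < a" "a < real (Suc n) * \<sigma>" using \<sigma> by (auto simp: a_def field_simps add_pos_nonneg)
  obtain c where c: "c 0 = x" "\<And>t. \<bar>t\<bar> < real (Suc n) * \<sigma> \<Longrightarrow> has_velocity A c t (X (c t))" using Suc by blast
  have c': "t \<in> {- (real (Suc n) * \<sigma>)<..<real (Suc n) * \<sigma>} \<Longrightarrow> has_velocity A c t (X (c t))" for t by (rule c(2)) auto
  obtain c1 where c1: "\<forall>t\<in>{- (real (Suc n) * \<sigma>)<..<real (Suc n) * \<sigma>}. c1 t = c t"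
    "\<forall>t\<in>{- (real (Suc n) * \<sigma>)<..<real (Suc n) * \<sigma>} \<union> {a - 2 * \<sigma><..<a + 2 * \<sigma>}. has_velocity A c1 t (X (c1 t))"
    by (rule exE[OF step[where a=a and l="- (real (Suc n) * \<sigma>)" and r="real (Suc n) * \<sigma>", OF c']]) (use a in auto)
  have c1': "has_velocity A c1 t (X (c1 t))" if "t \<in> {- (real (Suc n) * \<sigma>)<..<a + 2 * \<sigma>}" for t
    using c1(2) that a \<sigma> by (auto simp: a_def not_less)
  obtain c2 where c2: "\<forall>t\<in>{- (real (Suc n) * \<sigma>)<..<a + 2 * \<sigma>}. c2 t = c1 t"
    "\<forall>t\<in>{- (real (Suc n) * \<sigma>)<..<a + 2 * \<sigma>} \<union> {- a - 2 * \<sigma><..<- a + 2 * \<sigma>}. has_velocity A c2 t (X (c2 t))"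
    by (rule exE[OF step[where a="- a" and l="- (real (Suc n) * \<sigma>)" and r="a + 2 * \<sigma>", OF c1']]) (use a \<sigma> in auto)
  have "has_velocity A c2 t (X (c2 t))" if "\<bar>t\<bar> < real (Suc (Suc n)) * \<sigma>" for t
    using c2(2) that a \<sigma> by (auto simp: a_def not_less abs_less_iff algebra_simps)
  moreover have "c2 0 = x" using c1(1) c2(1) c(1) a \<sigma> by auto
  ultimately show ?case by blast
qed

lemma global_integral_curve: "\<exists>c. integral_curve A X c \<and> c 0 = x"
proof -
  obtain \<tau> where \<tau>: "\<tau> > 0"
    "\<And>p. \<exists>V u. open V \<and> p \<in> V \<and> (\<forall>x\<in>V. u (0, x) = x) \<and>
      (\<forall>x\<in>V. \<forall>t. \<bar>t\<bar> < \<tau> \<longrightarrow> has_velocity A (\<lambda>t. u (t, x)) t (X (u (t, x)))) \<and>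
      smooth_map_on ({-\<tau><..<\<tau>} \<times> V) (prod_atlas std_atlas A) A u"
    by (rule uniform_local_flow) blast
  define \<sigma> where "\<sigma> = \<tau> / 2"
  have \<sigma>: "\<sigma> > 0" "2 * \<sigma> = \<tau>" using \<tau>(1) by (auto simp: \<sigma>_def)
  have "\<exists>c. c 0 = x \<and> (\<forall>t. \<bar>t\<bar> < 2 * \<sigma> \<longrightarrow> has_velocity A c t (X (c t)))" for x
  proof -
    obtain V u where u: "x \<in> V" "\<forall>x\<in>V. u (0, x) = x"
      "\<forall>x\<in>V. \<forall>t. \<bar>t\<bar> < \<tau> \<longrightarrow> has_velocity A (\<lambda>t. u (t, x)) t (X (u (t, x)))" using \<tau>(2)[of x] by blast
    then show ?thesis unfolding \<sigma>(2) by (intro exI[of _ "\<lambda>t. u (t, x)"]) auto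
  qed
  from extend_integral_curve[OF \<sigma>(1) this]
  have "\<forall>n. \<exists>c. c 0 = x \<and> (\<forall>t. \<bar>t\<bar> < real (Suc n) * \<sigma> \<longrightarrow> has_velocity A c t (X (c t)))" by blast
  from choice[OF this] obtain c where c: "\<And>n. c n 0 = x"
    "\<And>n t. \<bar>t\<bar> < real (Suc n) * \<sigma> \<Longrightarrow> has_velocity A (c n) t (X (c n t))" by blast
  \<comment> \<open>At each time, a curve of index large enough to live there; by
    \<open>agree\<close> the choice of index does not influence the value.\<close>
  define d where "d t = c (nat \<lceil>\<bar>t\<bar> / \<sigma>\<rceil>) t" for t
  have N: "\<bar>t\<bar> < real (Suc (nat \<lceil>\<bar>t\<bar> / \<sigma>\<rceil>)) * \<sigma>" for t
  proof -
    have "\<bar>t\<bar> / \<sigma> \<le> real (nat \<lceil>\<bar>t\<bar> / \<sigma>\<rceil>)" by (rule real_nat_ceiling_ge)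
    then have "\<bar>t\<bar> / \<sigma> < real (Suc (nat \<lceil>\<bar>t\<bar> / \<sigma>\<rceil>))" by simp
    then show ?thesis using \<sigma>(1) by (simp add: field_simps)
  qed
  have agree: "c m t = c n t" if "\<bar>t\<bar> < real (Suc m) * \<sigma>" "\<bar>t\<bar> < real (Suc n) * \<sigma>" for m n t
  proof -
    define r where "r = min (real (Suc m) * \<sigma>) (real (Suc n) * \<sigma>)"
    have r: "r > 0" "\<bar>t\<bar> < r" using that \<sigma>(1) by (auto simp: r_def)
    show ?thesis
    proof (rule integral_curve_unique[of "{-r<..<r}" 0])
      fix s assume "s \<in> {-r<..<r}"
      then have "\<bar>s\<bar> < real (Suc m) * \<sigma>" "\<bar>s\<bar> < real (Suc n) * \<sigma>" by (auto simp: r_def)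
      then show "has_velocity A (c m) s (X (c m s))" "has_velocity A (c n) s (X (c n s))" by (simp_all only: c(2))
    qed (use r c(1) in \<open>auto simp: abs_less_iff\<close>)
  qed
  have "has_velocity A d t (X (d t))" for t
  proof -
    let ?n = "nat \<lceil>\<bar>t\<bar> / \<sigma>\<rceil>"
    let ?I = "{- (real (Suc ?n) * \<sigma>)<..<real (Suc ?n) * \<sigma>}"
    have t: "t \<in> ?I" using N[of t] by (auto simp: abs_less_iff)
    have eq: "c ?n s = d s" if "s \<in> ?I" for s
      unfolding d_def by (rule agree[OF _ N]) (use that in \<open>auto simp: abs_less_iff\<close>)
    have "has_velocity A (c ?n) t (X (c ?n t))" by (rule c(2)[OF N])
    from has_velocity_transform[where c'=d, OF this _ t eq] show ?thesis by (simp add: d_def)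
  qed
  moreover have "d 0 = x" by (simp add: d_def c(1))
  ultimately show ?thesis by (auto simp: integral_curve_def)
qed

lemma flow_eqI:
  assumes "integral_curve A X c" "c 0 = x"
  shows "flow A X t x = c t"
  unfolding flow_def
proof (rule the_equality)
  show "\<exists>c'. integral_curve A X c' \<and> c' 0 = x \<and> c' t = c t" using assms by blast
  fix y assume "\<exists>c. integral_curve A X c \<and> c 0 = x \<and> c t = y"
  then obtain c' where c': "integral_curve A X c'" "c' 0 = x" "c' t = y" by blast
  have "c' t = c t"
    by (rule integral_curve_unique[of UNIV 0]) (use assms c' in \<open>auto simp: integral_curve_def\<close>)
  then show "y = c t" using c' by simp
qed

lemma flow_integral_curve: "integral_curve A X (\<lambda>t. flow A X t x)" and flow_0: "flow A X 0 x = x"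
proof -
  obtain c where c: "integral_curve A X c" "c 0 = x" using global_integral_curve by blast
  have "(\<lambda>t. flow A X t x) = c" using flow_eqI[OF c] by (simp add: fun_eq_iff)
  then show "integral_curve A X (\<lambda>t. flow A X t x)" "flow A X 0 x = x" using c flow_eqI[OF c] by simp_all
qed

lemma flow_add: "flow A X (s + t) x = flow A X s (flow A X t x)"
proof (rule sym, rule flow_eqI[where c="\<lambda>s. flow A X (s + t) x"])
  show "integral_curve A X (\<lambda>s. flow A X (s + t) x)"
    unfolding integral_curve_def
  proof
    fix r
    have "has_velocity A (\<lambda>t. flow A X t x) (r + t) (X (flow A X (r + t) x))"
      using flow_integral_curve[of x] by (simp add: integral_curve_def)
    from has_velocity_shift[OF this]
    show "has_velocity A (\<lambda>s. flow A X (s + t) x) r (X (flow A X (r + t) x))" .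
  qed
qed simp

lemma flow_derivative:
  "h \<in> smooth_functions A \<Longrightarrow> ((\<lambda>t. h (flow A X t x)) has_real_derivative X (flow A X t x) h) (at t)"
  using flow_integral_curve[of x] by (simp add: integral_curve_def has_velocity_def o_def)

text \<open>For short times the flow agrees with the local ones. Every time-t map is an iterate of a
  short-time map, hence smooth in the point; near a time \<open>t0\<close> the flow is a short-time
  flow after the map at time \<open>t0\<close>.\<close>

theorem flow_smooth: "smooth_map_on UNIV (prod_atlas std_atlas A) A (\<lambda>(t, x). flow A X t x)"
proof -
  note AP = smooth_atlas_prod[OF smooth_atlas_std A]
  let ?F = "\<lambda>z. flow A X (fst z) (snd z)"
  obtain \<tau> where \<tau>: "\<tau> > 0"
    "\<And>p. \<exists>V u. open V \<and> p \<in> V \<and> (\<forall>x\<in>V. u (0, x) = x) \<and>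
      (\<forall>x\<in>V. \<forall>t. \<bar>t\<bar> < \<tau> \<longrightarrow> has_velocity A (\<lambda>t. u (t, x)) t (X (u (t, x)))) \<and>
      smooth_map_on ({-\<tau><..<\<tau>} \<times> V) (prod_atlas std_atlas A) A u"
    by (rule uniform_local_flow) blast
  have 1: "smooth_map_on ({-\<tau><..<\<tau>} \<times> UNIV) (prod_atlas std_atlas A) A ?F"
  proof (rule smooth_map_on_union[OF AP A])
    fix z :: "real \<times> 'm" assume z: "z \<in> {-\<tau><..<\<tau>} \<times> UNIV"
    obtain V u where u: "open V" "snd z \<in> V" "\<forall>x\<in>V. u (0, x) = x"
      "\<forall>x\<in>V. \<forall>t. \<bar>t\<bar> < \<tau> \<longrightarrow> has_velocity A (\<lambda>t. u (t, x)) t (X (u (t, x)))"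
      "smooth_map_on ({-\<tau><..<\<tau>} \<times> V) (prod_atlas std_atlas A) A u" using \<tau>(2)[of "snd z"] by blast
    have o: "open ({-\<tau><..<\<tau>} \<times> V)" using u by (intro open_Times) auto
    have "u y = ?F y" if "y \<in> {-\<tau><..<\<tau>} \<times> V" for y
    proof -
      have "u (fst y, snd y) = flow A X (fst y) (snd y)"
        by (rule integral_curve_unique[of "{-\<tau><..<\<tau>}" 0])
          (use that u \<tau>(1) flow_0 flow_integral_curve[of "snd y"] in \<open>auto simp: integral_curve_def abs_less_iff\<close>)
      then show ?thesis by simp
    qed
    from smooth_map_on_cong[OF this u(5) o AP A]
    show "\<exists>T. open T \<and> z \<in> T \<and> smooth_map_on T (prod_atlas std_atlas A) A ?F"
      using o u z by (intro exI[of _ "{-\<tau><..<\<tau>} \<times> V"]) (auto simp: mem_Times_iff)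
  qed
  have o1: "open ({-\<tau><..<\<tau>} \<times> (UNIV :: 'm set))" by (intro open_Times) auto
  have 2: "smooth_map_on UNIV A A (flow A X t)" if "\<bar>t\<bar> < \<tau>" for t
  proof -
    have "smooth_map_on UNIV A (prod_atlas std_atlas A) (\<lambda>x. (t, x))"
      by (intro smooth_map_on_Pair smooth_atlas_std A smooth_map_on_const smooth_map_on_id) auto
    moreover have "(\<lambda>x. (t, x)) ` UNIV \<subseteq> {-\<tau><..<\<tau>} \<times> (UNIV :: 'm set)" using that by (auto simp: abs_less_iff)
    ultimately show ?thesis using smooth_map_on_compose[OF A AP A _ 1 open_UNIV o1, of "\<lambda>x. (t, x)"] by simp
  qed
  have pow: "flow A X (real n * t) = flow A X t ^^ n" for n t
  proof (induction n)
    case (Suc n)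
    have "flow A X (t + real n * t) x = flow A X t (flow A X (real n * t) x)" for x by (rule flow_add)
    then show ?case using Suc by (simp add: algebra_simps fun_eq_iff)
  qed (simp add: fun_eq_iff flow_0)
  have 3: "smooth_map_on UNIV A A (flow A X t)" for t
  proof -
    obtain n :: nat where n: "\<bar>t\<bar> / \<tau> < real n" using reals_Archimedean2 by blast
    have "real n > 0" using n \<tau>(1) by (smt (verit) divide_nonneg_pos)
    then have s: "\<bar>t / real n\<bar> < \<tau>" using n \<tau>(1) by (simp add: field_simps)
    have "smooth_map_on UNIV A A (flow A X (t / real n) ^^ m)" for m
    proof (induction m)
      case 0 show ?case using smooth_map_on_id[OF A] by (simp add: id_def)
    next
      case (Suc m)
      from smooth_map_on_compose[OF A A A Suc 2[OF s]] show ?case by (simp add: o_def)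
    qed
    from this[of n] show ?thesis using \<open>real n > 0\<close> by (simp flip: pow)
  qed
  have "smooth_map_on UNIV (prod_atlas std_atlas A) A ?F"
  proof (rule smooth_map_on_union[OF AP A])
    fix z :: "real \<times> 'm"
    define t0 where "t0 = fst z"
    let ?T = "{t0 - \<tau><..<t0 + \<tau>} \<times> (UNIV :: 'm set)"
    have o: "open ?T" by (intro open_Times) auto
    have s1: "smooth_map_on ?T (prod_atlas std_atlas A) std_atlas (\<lambda>z. fst z - t0)"
    proof -
      have "smooth_on UNIV (\<lambda>t::real. t - t0)"
        by (intro smooth_on_diff smooth_on_const smooth_on_bounded_linear[OF bounded_linear_ident]) auto
      from smooth_fun_compose[OF AP o smooth_map_on_fst_snd(1)[OF smooth_atlas_std A] this] show ?thesis by auto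
    qed
    have s2: "smooth_map_on ?T (prod_atlas std_atlas A) A (\<lambda>z. flow A X t0 (snd z))"
      by (rule smooth_map_on_compose[OF AP A A smooth_map_on_fst_snd(2)[OF smooth_atlas_std A] 3 o open_UNIV]) auto
    have "smooth_map_on ?T (prod_atlas std_atlas A) A (\<lambda>z. ?F (fst z - t0, flow A X t0 (snd z)))"
      by (rule smooth_map_on_compose[OF AP AP A smooth_map_on_Pair[OF smooth_atlas_std A AP o s1 s2] 1 o o1]) auto
    moreover have "?F (fst z - t0, flow A X t0 (snd z)) = ?F z" for z
      using flow_add[of "fst z - t0" t0 "snd z"] by simp
    ultimately have "smooth_map_on ?T (prod_atlas std_atlas A) A ?F" by simp
    then show "\<exists>T. open T \<and> z \<in> T \<and> smooth_map_on T (prod_atlas std_atlas A) A ?F"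
      using o \<tau>(1) by (intro exI[of _ ?T]) (auto simp: t0_def mem_Times_iff)
  qed
  then show ?thesis by (simp add: case_prod_unfold)
qed

lemma flow_smooth_map: "smooth_map_on UNIV A A (flow A X t)"
proof -
  have "smooth_map_on UNIV A (prod_atlas std_atlas A) (\<lambda>x. (t, x))"
    by (intro smooth_map_on_Pair smooth_atlas_std A smooth_map_on_const smooth_map_on_id) auto
  from smooth_map_on_compose[OF A smooth_atlas_prod[OF smooth_atlas_std A] A this flow_smooth]
  show ?thesis by auto
qed

lemma flow_inverse: "flow A X t \<circ> flow A X (- t) = id"
  using flow_add[of t "- t"] flow_0 by (simp add: fun_eq_iff)

lemma flow_diffeomorphism: "diffeomorphism A (flow A X t)"
  unfolding diffeomorphism_def
  using flow_smooth_map flow_inverse[of t] flow_inverse[of "- t"] by (auto intro!: exI[of _ "flow A X (- t)"])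

end

subsection \<open>The group generated by gradient flows\<close>

lemma gradient_field:
  assumes "f \<in> smooth_functions A"
  shows "gradient A g f x \<in> tangent_space A x" "h \<in> smooth_functions A \<Longrightarrow> (\<lambda>x. gradient A g f x h) \<in> smooth_functions A"
  using gradient_tangent[OF assms] \<Gamma>_smooth[OF assms] by (auto simp: \<Gamma>_def)

text \<open>Scaling the potential rescales time. Hence time-one flows already comprise the flows at
  all real times, inverses included.\<close>

lemma flow_gradient_cmult:
  assumes f: "f \<in> smooth_functions A"
  shows "flow A (gradient A g (\<lambda>y. a * f y)) t x = flow A (gradient A g f) (a * t) x"
proof (rule flow_eqI[OF gradient_field[OF smooth_functions_cmult[OF A f]], where c="\<lambda>t. flow A (gradient A g f) (a * t) x"])
  show "integral_curve A (gradient A g (\<lambda>y. a * f y)) (\<lambda>t. flow A (gradient A g f) (a * t) x)"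
    unfolding integral_curve_def
  proof
    fix t
    let ?c = "\<lambda>t. flow A (gradient A g f) t x"
    have v: "has_velocity A ?c (a * t + 0) (gradient A g f (?c (a * t)))"
      using flow_integral_curve[OF gradient_field[OF f], of x] by (simp add: integral_curve_def)
    have "(\<lambda>h. a * gradient A g f (?c (a * t + 0)) h) \<in> tangent_space A (?c (a * t + 0))"
      using gradient_tangent[OF smooth_functions_cmult[OF A f, of a], of "?c (a * t + 0)"] by (simp add: gradient_cmult[OF f])
    from has_velocity_scale[OF v] this
    show "has_velocity A (\<lambda>t. ?c (a * t)) t (gradient A g (\<lambda>y. a * f y) (?c (a * t)))"
      by (simp add: gradient_cmult[OF f])
  qed
  show "flow A (gradient A g f) (a * 0) x = x" using flow_0[OF gradient_field[OF f], where x=x] by simp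
qed

abbreviation "GG \<equiv> gradient_flow_compositions A g"

lemma GG_id: "id \<in> GG"
  unfolding gradient_flow_compositions_def by (auto intro!: exI[of _ "[]"])

lemma GG_flow: "f \<in> smooth_functions A \<Longrightarrow> flow A (gradient A g f) t \<in> GG"
proof -
  assume f: "f \<in> smooth_functions A"
  have "flow A (gradient A g f) t = fold (\<lambda>f F. flow A (gradient A g f) 1 \<circ> F) [\<lambda>y. t * f y] id"
    by (simp add: fun_eq_iff flow_gradient_cmult[OF f])
  then show ?thesis
    unfolding gradient_flow_compositions_def using smooth_functions_cmult[OF A f] by (intro CollectI exI[of _ "[\<lambda>y. t * f y]"]) auto
qed

lemma fold_comp_init: "fold (\<lambda>f F. h f \<circ> F) fs F = fold (\<lambda>f F. h f \<circ> F) fs id \<circ> F"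
  for h :: "'a \<Rightarrow> 'b \<Rightarrow> 'b" and F :: "'b \<Rightarrow> 'b"
proof (induction fs arbitrary: F)
  case (Cons f fs)
  from Cons[of "h f \<circ> F"] Cons[of "h f"] show ?case by (simp add: o_assoc)
qed simp

lemma GG_comp:
  assumes "P \<in> GG" "Q \<in> GG"
  shows "P \<circ> Q \<in> GG"
proof -
  let ?h = "\<lambda>f. flow A (gradient A g f) 1"
  obtain ps qs where ps: "set ps \<subseteq> smooth_functions A" "P = fold (\<lambda>f F. ?h f \<circ> F) ps id"
    and qs: "set qs \<subseteq> smooth_functions A" "Q = fold (\<lambda>f F. ?h f \<circ> F) qs id"
    using assms by (auto simp: gradient_flow_compositions_def)
  \<comment> \<open>\<open>fold\<close> composes later list elements on the outside, so the list of
    the inner factor \<open>Q\<close> comes first.\<close>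
  have "fold (\<lambda>f F. ?h f \<circ> F) (qs @ ps) id = fold (\<lambda>f F. ?h f \<circ> F) ps (fold (\<lambda>f F. ?h f \<circ> F) qs id)" by simp
  also have "\<dots> = P \<circ> Q" unfolding ps(2) qs(2) by (rule fold_comp_init)
  finally have "fold (\<lambda>f F. ?h f \<circ> F) (qs @ ps) id = P \<circ> Q" .
  then show ?thesis
    unfolding gradient_flow_compositions_def using ps qs by (intro CollectI exI[of _ "qs @ ps"]) auto
qed

lemma GG_induct [consumes 1, case_names id flow]:
  assumes "P \<in> GG" "Q id" "\<And>f F. f \<in> smooth_functions A \<Longrightarrow> F \<in> GG \<Longrightarrow> Q F \<Longrightarrow> Q (flow A (gradient A g f) 1 \<circ> F)"
  shows "Q P"
proof -
  obtain fs where "set fs \<subseteq> smooth_functions A" "P = fold (\<lambda>f F. flow A (gradient A g f) 1 \<circ> F) fs id"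
    using assms(1) by (auto simp: gradient_flow_compositions_def)
  moreover have "fold (\<lambda>f F. flow A (gradient A g f) 1 \<circ> F) fs id \<in> GG \<and> Q (fold (\<lambda>f F. flow A (gradient A g f) 1 \<circ> F) fs id)"
    if "set fs \<subseteq> smooth_functions A" for fs
    using that
  proof (induction fs rule: rev_induct)
    case Nil then show ?case using assms(2) GG_id by (simp add: id_def)
  next
    case (snoc f fs)
    let ?h = "\<lambda>f. flow A (gradient A g f) 1"
    let ?F = "fold (\<lambda>f F. ?h f \<circ> F) fs id"
    have s: "f \<in> smooth_functions A" "set fs \<subseteq> smooth_functions A" using snoc.prems by auto
    have F: "f \<in> smooth_functions A" "?F \<in> GG" "Q ?F" using s(1) snoc.IH[OF s(2)] by blast+
    have "fold (\<lambda>f F. ?h f \<circ> F) (fs @ [f]) id = ?h f \<circ> ?F" by (simp add: comp_def)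
    with assms(3)[OF F] GG_comp[OF GG_flow[OF F(1)] F(2)] show ?case by (simp only:)
  qed
  ultimately show ?thesis by blast
qed

lemma GG_inverse: "P \<in> GG \<Longrightarrow> \<exists>Q\<in>GG. P \<circ> Q = id \<and> Q \<circ> P = id"
proof (induction rule: GG_induct)
  case id
  show ?case by (rule bexI[OF _ GG_id]) simp
next
  case (flow f F)
  then obtain Q where Q: "Q \<in> GG" "F \<circ> Q = id" "Q \<circ> F = id" by blast
  let ?p = "flow A (gradient A g f) 1" and ?m = "flow A (gradient A g f) (- 1)"
  have pm: "?p \<circ> ?m = id" "?m \<circ> ?p = id"
    using flow_inverse[OF gradient_field[OF flow(1)], of 1] flow_inverse[OF gradient_field[OF flow(1)], of "- 1"] by auto
  have "(?p \<circ> F) \<circ> (Q \<circ> ?m) = ?p \<circ> (F \<circ> Q) \<circ> ?m" "(Q \<circ> ?m) \<circ> (?p \<circ> F) = Q \<circ> (?m \<circ> ?p) \<circ> F" by (simp_all add: o_assoc)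
  then have "(?p \<circ> F) \<circ> (Q \<circ> ?m) = id" "(Q \<circ> ?m) \<circ> (?p \<circ> F) = id" using Q pm by simp_all
  then show ?case using GG_comp[OF Q(1) GG_flow[OF flow(1)]] by blast
qed

lemma diffeomorphism_comp:
  assumes "diffeomorphism A F" "diffeomorphism A G"
  shows "diffeomorphism A (F \<circ> G)"
proof -
  obtain F' G' where F: "smooth_map_on UNIV A A F" "smooth_map_on UNIV A A F'" "F' \<circ> F = id" "F \<circ> F' = id"
    and G: "smooth_map_on UNIV A A G" "smooth_map_on UNIV A A G'" "G' \<circ> G = id" "G \<circ> G' = id"
    using assms unfolding diffeomorphism_def by blast
  have "smooth_map_on UNIV A A (F \<circ> G)" "smooth_map_on UNIV A A (G' \<circ> F')"
    using smooth_map_on_compose[OF A A A G(1) F(1)] smooth_map_on_compose[OF A A A F(2) G(2)] by (auto simp: o_def)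
  moreover have "(G' \<circ> F') \<circ> (F \<circ> G) = id" "(F \<circ> G) \<circ> (G' \<circ> F') = id"
    using F(3,4) G(3,4) by (auto simp: fun_eq_iff)
  ultimately show ?thesis unfolding diffeomorphism_def by blast
qed

text \<open>All factors are run simultaneously up to time \<open>t\<close>, that is, the flow at
  time \<open>t\<close> is composed with the isotopy already built. It is defined for all real
  \<open>t\<close>.\<close>

lemma GG_isotopy:
  assumes "P \<in> GG"
  shows "\<exists>H :: real \<Rightarrow> 'm \<Rightarrow> 'm. smooth_map_on UNIV (prod_atlas std_atlas A) A (\<lambda>(t, x). H t x) \<and> (\<forall>t. diffeomorphism A (H t)) \<and> H 0 = id \<and> H 1 = P"
  using assms
proof (induction rule: GG_induct)
  case id
  have "smooth_map_on UNIV (prod_atlas std_atlas A) A (\<lambda>(t, x). id x)"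
    using smooth_map_on_fst_snd(2)[OF smooth_atlas_std A, of UNIV] by (simp add: case_prod_unfold)
  moreover have "diffeomorphism A id" unfolding diffeomorphism_def using smooth_map_on_id[OF A, of UNIV] by (auto simp: id_def o_def)
  ultimately show ?case by (intro exI[of _ "\<lambda>t. id"]) (auto simp: id_def)
next
  case (flow f F)
  note AP = smooth_atlas_prod[OF smooth_atlas_std A]
  note field = gradient_field[OF flow(1)]
  obtain H :: "real \<Rightarrow> 'm \<Rightarrow> 'm" where H: "smooth_map_on UNIV (prod_atlas std_atlas A) A (\<lambda>(t, x). H t x)" "\<And>t. diffeomorphism A (H t)" "H 0 = id" "H 1 = F"
    using flow(3) by blast
  let ?K = "\<lambda>t. flow A (gradient A g f) t \<circ> H t"
  have "smooth_map_on UNIV (prod_atlas std_atlas A) (prod_atlas std_atlas A) (\<lambda>z. (fst z, (\<lambda>(t, x). H t x) z))"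
    by (rule smooth_map_on_Pair[OF smooth_atlas_std A AP open_UNIV smooth_map_on_fst_snd(1)[OF smooth_atlas_std A] H(1)])
  from smooth_map_on_compose[OF AP AP A this flow_smooth[OF field]]
  have "smooth_map_on UNIV (prod_atlas std_atlas A) A (\<lambda>(t, x). ?K t x)" by (simp add: case_prod_unfold)
  moreover have "diffeomorphism A (?K t)" for t by (intro diffeomorphism_comp flow_diffeomorphism[OF field] H(2))
  moreover have "?K 0 = id" using flow_0[OF field] H(3) by (auto simp: fun_eq_iff)
  moreover have "?K 1 = flow A (gradient A g f) 1 \<circ> F" using H(4) by simp
  ultimately show ?case by blast
qed

lemma GG_Diff0: "GG \<subseteq> Diff0 A"
proof
  fix P assume "P \<in> GG"
  from GG_isotopy[OF this] obtain H :: "real \<Rightarrow> 'm \<Rightarrow> 'm" where H: "smooth_map_on UNIV (prod_atlas std_atlas A) A (\<lambda>(t, x). H t x)"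
    "\<And>t. diffeomorphism A (H t)" "H 0 = id" "H 1 = P" by blast
  have "isotopic_to_id A P"
    unfolding isotopic_to_id_def using H by (intro exI[of _ H] exI[of _ UNIV]) auto
  then show "P \<in> Diff0 A" using H(2)[of 1] H(4) by (simp add: Diff0_def)
qed

lemma GG_subgroup: "subgroup GG (Diff0_group A)"
proof
  show "GG \<subseteq> carrier (Diff0_group A)" using GG_Diff0 by (simp add: Diff0_group_def)
  show "\<one>\<^bsub>Diff0_group A\<^esub> \<in> GG" by (simp add: Diff0_group_def GG_id)
  show "P \<otimes>\<^bsub>Diff0_group A\<^esub> Q \<in> GG" if "P \<in> GG" "Q \<in> GG" for P Q
    using GG_comp[OF that] by (simp add: Diff0_group_def)
  fix P assume P: "P \<in> GG"
  obtain Q where Q: "Q \<in> GG" "P \<circ> Q = id" "Q \<circ> P = id" using GG_inverse[OF P] by blast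
  \<comment> \<open>The inverse is computed from the description in \<open>m_inv_def\<close>; a left
    inverse \<open>R\<close> must equal \<open>Q\<close> because \<open>Q\<close> is a right inverse
    of \<open>P\<close>.\<close>
  have "inv\<^bsub>Diff0_group A\<^esub> P = Q"
    unfolding m_inv_def
  proof (rule the_equality)
    show "Q \<in> carrier (Diff0_group A) \<and> P \<otimes>\<^bsub>Diff0_group A\<^esub> Q = \<one>\<^bsub>Diff0_group A\<^esub> \<and> Q \<otimes>\<^bsub>Diff0_group A\<^esub> P = \<one>\<^bsub>Diff0_group A\<^esub>"
      using Q GG_Diff0 by (auto simp: Diff0_group_def)
    fix R assume "R \<in> carrier (Diff0_group A) \<and> P \<otimes>\<^bsub>Diff0_group A\<^esub> R = \<one>\<^bsub>Diff0_group A\<^esub> \<and> R \<otimes>\<^bsub>Diff0_group A\<^esub> P = \<one>\<^bsub>Diff0_group A\<^esub>"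
    then have "R \<circ> P = id" by (simp add: Diff0_group_def)
    then have "R \<circ> (P \<circ> Q) = Q" by (simp add: o_assoc)
    then show "R = Q" using Q by simp
  qed
  then show "inv\<^bsub>Diff0_group A\<^esub> P \<in> GG" using Q by simp
qed

end

section \<open>Density\<close>

context pseudo_riemannian
begin

subsection \<open>A finite family of coordinate functions\<close>

text \<open>Functions of a Whitney embedding. They take the place of a metric on the manifold; the
  last clause says that the distance they induce locally dominates the distance in some
  chart.\<close>

lemma separating_family:
  obtains FF where "finite FF" "FF \<subseteq> smooth_functions A" "\<forall>x y. (\<forall>f\<in>FF. f x = f y) \<longrightarrow> x = y"
    "\<And>x. \<exists>U \<phi> V. (U, \<phi>) \<in> A \<and> open V \<and> x \<in> V \<and> V \<subseteq> U \<and>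
      (\<forall>y\<in>V. \<forall>z\<in>V. norm (\<phi> y - \<phi> z) \<le> real DIM('e) * (\<Sum>f\<in>FF. \<bar>f y - f z\<bar>))"
proof -
  let ?P = "\<lambda>p c \<beta> V. c \<in> A \<and> smooth_map_on UNIV A std_atlas (\<beta> :: 'm \<Rightarrow> real) \<and> smooth_map_on UNIV A std_atlas (\<lambda>y. \<beta> y *\<^sub>R snd c y) \<and>
    open V \<and> p \<in> V \<and> V \<subseteq> fst c \<and> (\<forall>y\<in>V. \<beta> y = 1) \<and> (\<forall>y. y \<notin> fst c \<longrightarrow> \<beta> y = 0)"
  have "\<exists>c \<beta> V. ?P p c \<beta> V" for p
  proof -
    obtain U \<phi> where U: "(U, \<phi>) \<in> A" "p \<in> U" using atlas_cover[OF A] by metis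
    show ?thesis by (rule local_coordinates[OF A U], rule exI[of _ "(U, \<phi>)"]) (use U in auto)
  qed
  then have "\<forall>p. \<exists>c \<beta> V. ?P p c \<beta> V" by blast
  from choice[OF this] obtain c where "\<forall>p. \<exists>\<beta> V. ?P p (c p) \<beta> V" ..
  from choice[OF this] obtain \<beta> where "\<forall>p. \<exists>V. ?P p (c p) (\<beta> p) V" ..
  from choice[OF this] obtain V where *: "\<forall>p. ?P p (c p) (\<beta> p) (V p)" ..
  define U where "U p = fst (c p)" for p
  define \<phi> where "\<phi> p = snd (c p)" for p
  have P: "(U p, \<phi> p) \<in> A" "smooth_map_on UNIV A std_atlas (\<beta> p)" "smooth_map_on UNIV A std_atlas (\<lambda>y. \<beta> p y *\<^sub>R \<phi> p y)"
    "open (V p)" "p \<in> V p" "V p \<subseteq> U p" "y \<in> V p \<Longrightarrow> \<beta> p y = 1" "y \<notin> U p \<Longrightarrow> \<beta> p y = 0" for p y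
    using *[rule_format, of p] by (simp_all add: U_def \<phi>_def)
  obtain D where D: "finite D" "UNIV \<subseteq> (\<Union>p\<in>D. V p)"
    by (rule compactE_image[OF compact_UNIV, of UNIV V]) (use P in auto)
  define k where "k p b = (\<lambda>y. (\<beta> p y *\<^sub>R \<phi> p y) \<bullet> b)" for p b
  \<comment> \<open>The cut-offs themselves belong to the family: if \<open>\<beta> p\<close> equals
    1 at \<open>x\<close> and takes the same value at \<open>y\<close>, then \<open>y\<close> lies
    in the same chart domain, where the coordinates decide.\<close>
  define FF where "FF = \<beta> ` D \<union> (\<lambda>(p, b). k p b) ` (D \<times> (Basis :: 'e set))"
  have fin: "finite FF" using D(1) by (simp add: FF_def)
  have "FF \<subseteq> smooth_functions A"
    using P(2) smooth_functions_component[OF A P(3)] by (auto simp: FF_def k_def smooth_functions_iff)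
  moreover have "\<forall>x y. (\<forall>f\<in>FF. f x = f y) \<longrightarrow> x = y"
  proof (intro allI impI)
    fix x y assume that: "\<forall>f\<in>FF. f x = f y"
    note eq = bspec[OF that]
    obtain p where p: "p \<in> D" "x \<in> V p" using D(2) by auto
    have b: "\<beta> p x = 1" "\<beta> p y = \<beta> p x" using P(7) p eq[of "\<beta> p"] by (auto simp: FF_def)
    then have U: "x \<in> U p" "y \<in> U p" using P(8)[of y p] P(6)[of p] p by auto
    have "\<phi> p x = \<phi> p y"
    proof (rule euclidean_eqI)
      fix c :: 'e assume "c \<in> Basis"
      then have "k p c \<in> FF" using p by (auto simp: FF_def)
      from eq[OF this] show "\<phi> p x \<bullet> c = \<phi> p y \<bullet> c" using b by (simp add: k_def)
    qed
    then show "x = y" using U chart_inj[OF atlas_chart[OF A P(1)]] by (auto simp: inj_on_def)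
  qed
  moreover have "\<exists>U \<phi> V. (U, \<phi>) \<in> A \<and> open V \<and> x \<in> V \<and> V \<subseteq> U \<and>
      (\<forall>y\<in>V. \<forall>z\<in>V. norm (\<phi> y - \<phi> z) \<le> real DIM('e) * (\<Sum>f\<in>FF. \<bar>f y - f z\<bar>))" for x
  proof -
    obtain p where p: "p \<in> D" "x \<in> V p" using D(2) by auto
    have "norm (\<phi> p y - \<phi> p z) \<le> real DIM('e) * (\<Sum>f\<in>FF. \<bar>f y - f z\<bar>)" if "y \<in> V p" "z \<in> V p" for y z
    proof -
      have "norm (\<phi> p y - \<phi> p z) \<le> (\<Sum>b\<in>Basis. \<bar>(\<phi> p y - \<phi> p z) \<bullet> b\<bar>)" by (rule norm_le_l1)
      also have "\<dots> \<le> (\<Sum>b\<in>(Basis :: 'e set). \<Sum>f\<in>FF. \<bar>f y - f z\<bar>)"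
      proof (rule sum_mono)
        fix b :: 'e assume b: "b \<in> Basis"
        have "\<bar>(\<phi> p y - \<phi> p z) \<bullet> b\<bar> = \<bar>k p b y - k p b z\<bar>" using P(7) that by (simp add: k_def inner_diff_left)
        also have "\<dots> \<le> (\<Sum>f\<in>FF. \<bar>f y - f z\<bar>)"
          by (rule member_le_sum[OF _ _ fin]) (use p b in \<open>auto simp: FF_def\<close>)
        finally show "\<bar>(\<phi> p y - \<phi> p z) \<bullet> b\<bar> \<le> (\<Sum>f\<in>FF. \<bar>f y - f z\<bar>)" .
      qed
      finally show ?thesis by simp
    qed
    then show ?thesis using P(1)[of p] P(4)[of p] P(6)[of p] p(2)
      by (intro exI[of _ "U p"] exI[of _ "\<phi> p"] exI[of _ "V p"] conjI) simp_all
  qed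
  ultimately show ?thesis by (rule that[OF fin])
qed

lemma smooth_functions_bounded:
  assumes "f \<in> smooth_functions A"
  obtains M where "M > 0" "\<And>x. \<bar>f x\<bar> \<le> M"
proof -
  have "bounded (range f)"
    by (intro compact_imp_bounded compact_continuous_image smooth_functions_continuous[OF A assms] compact_UNIV)
  then show ?thesis using that unfolding bounded_pos by auto
qed

subsection \<open>Algebra of the gradient pairing\<close>

lemma \<Gamma>_add: "f \<in> smooth_functions A \<Longrightarrow> h \<in> smooth_functions A \<Longrightarrow> k \<in> smooth_functions A \<Longrightarrow>
    \<Gamma> f (\<lambda>y. h y + k y) x = \<Gamma> f h x + \<Gamma> f k x"
  and \<Gamma>_cmult: "f \<in> smooth_functions A \<Longrightarrow> h \<in> smooth_functions A \<Longrightarrow> \<Gamma> f (\<lambda>y. a * h y) x = a * \<Gamma> f h x"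
  and \<Gamma>_mult: "f \<in> smooth_functions A \<Longrightarrow> h \<in> smooth_functions A \<Longrightarrow> k \<in> smooth_functions A \<Longrightarrow>
    \<Gamma> f (\<lambda>y. h y * k y) x = h x * \<Gamma> f k x + \<Gamma> f h x * k x"
  and \<Gamma>_cmult_left: "f \<in> smooth_functions A \<Longrightarrow> \<Gamma> (\<lambda>y. a * f y) h x = a * \<Gamma> f h x"
  unfolding \<Gamma>_def
  by (simp_all add: tangent_add[OF A gradient_tangent] tangent_cmult[OF A gradient_tangent]
    tangent_mult[OF A gradient_tangent] gradient_cmult)

lemma \<Gamma>_mult_left:
  assumes f: "f \<in> smooth_functions A" and k: "k \<in> smooth_functions A" and h: "h \<in> smooth_functions A"
  shows "\<Gamma> (\<lambda>y. f y * k y) h x = f x * \<Gamma> k h x + \<Gamma> f h x * k x"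
  using \<Gamma>_mult[OF h f k, of x] \<Gamma>_sym[OF smooth_functions_mult[OF A f k] h] \<Gamma>_sym[OF h f] \<Gamma>_sym[OF h k] by simp

lemma smooth_sin_cos:
  assumes "\<xi> \<in> smooth_functions A"
  shows "(\<lambda>y. sin (n * \<xi> y)) \<in> smooth_functions A" "(\<lambda>y. cos (n * \<xi> y)) \<in> smooth_functions A"
  using smooth_functions_compose[OF A smooth_functions_cmult[OF A assms] smooth_on_sin_cos(1), of n]
    smooth_functions_compose[OF A smooth_functions_cmult[OF A assms] smooth_on_sin_cos(2), of n] by auto

lemma \<Gamma>_sin_cos:
  assumes \<xi>: "\<xi> \<in> smooth_functions A" and f: "f \<in> smooth_functions A"
  shows "\<Gamma> f (\<lambda>y. sin (n * \<xi> y)) x = n * cos (n * \<xi> x) * \<Gamma> f \<xi> x"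
    "\<Gamma> f (\<lambda>y. cos (n * \<xi> y)) x = - (n * sin (n * \<xi> x) * \<Gamma> f \<xi> x)"
proof -
  have n: "(\<lambda>y. n * \<xi> y) \<in> smooth_functions A" by (rule smooth_functions_cmult[OF A \<xi>])
  show "\<Gamma> f (\<lambda>y. sin (n * \<xi> y)) x = n * cos (n * \<xi> x) * \<Gamma> f \<xi> x"
    using tangent_chain[OF A gradient_tangent[OF f] n smooth_on_sin_cos(1) DERIV_sin] \<Gamma>_cmult[OF f \<xi>, of n x]
    by (simp add: \<Gamma>_def mult_ac)
  show "\<Gamma> f (\<lambda>y. cos (n * \<xi> y)) x = - (n * sin (n * \<xi> x) * \<Gamma> f \<xi> x)"
    using tangent_chain[OF A gradient_tangent[OF f] n smooth_on_sin_cos(2) DERIV_cos] \<Gamma>_cmult[OF f \<xi>, of n x]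
    by (simp add: \<Gamma>_def mult_ac)
qed

text \<open>The commutator of two rapidly oscillating gradient fields has order \<open>n\<^sup>3\<close>, and its leading part
  does not oscillate, because \<open>sin\<^sup>2 + cos\<^sup>2 = 1\<close>.\<close>

lemma bracket_oscillating:
  fixes n :: real
  assumes b: "b \<in> smooth_functions A" and \<xi>: "\<xi> \<in> smooth_functions A" and h: "h \<in> smooth_functions A"
  defines "s \<equiv> \<lambda>y. sin (n * \<xi> y)" and "c \<equiv> \<lambda>y. cos (n * \<xi> y)"
  defines "f \<equiv> \<lambda>y. b y * s y"
  shows "\<Gamma> c (\<Gamma> f h) x - \<Gamma> f (\<Gamma> c h) x =
    n ^ 3 * (b x * \<Gamma> \<xi> \<xi> x * \<Gamma> \<xi> h x) - n ^ 2 * (s x * c x * \<Gamma> \<xi> \<xi> x * \<Gamma> b h x)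
    - n * (s x * s x * (\<Gamma> \<xi> (\<Gamma> b h) x - \<Gamma> b (\<Gamma> \<xi> h) x))"
proof -
  note sc = smooth_sin_cos[OF \<xi>, of n, folded s_def c_def]
  note G = \<Gamma>_smooth
  have f: "f \<in> smooth_functions A" unfolding f_def by (rule smooth_functions_mult[OF A b sc(1)])
  have cl: "\<Gamma> c k x = - (n * s x * \<Gamma> \<xi> k x)" if "k \<in> smooth_functions A" for k x
    using \<Gamma>_sin_cos(2)[OF \<xi> that, of n x] \<Gamma>_sym[OF sc(2) that] \<Gamma>_sym[OF that \<xi>] by (simp add: s_def c_def)
  have sl: "\<Gamma> s k x = n * c x * \<Gamma> \<xi> k x" if "k \<in> smooth_functions A" for k x
    using \<Gamma>_sin_cos(1)[OF \<xi> that, of n x] \<Gamma>_sym[OF sc(1) that] \<Gamma>_sym[OF that \<xi>] by (simp add: s_def c_def)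
  have fl: "\<Gamma> f k x = n * b x * c x * \<Gamma> \<xi> k x + s x * \<Gamma> b k x" if "k \<in> smooth_functions A" for k x
    unfolding f_def using \<Gamma>_mult_left[OF b sc(1) that, of x] sl[OF that, of x] by (simp add: algebra_simps)
  note S = sc b \<xi> h G[OF b h] G[OF \<xi> h] smooth_functions_mult[OF A] smooth_functions_cmult[OF A]
  have e1: "\<Gamma> f h = (\<lambda>y. n * (b y * (c y * \<Gamma> \<xi> h y)) + s y * \<Gamma> b h y)" using fl[OF h] by (simp add: fun_eq_iff mult_ac)
  have e2: "\<Gamma> c h = (\<lambda>y. (- n) * (s y * \<Gamma> \<xi> h y))" using cl[OF h] by (simp add: fun_eq_iff)
  have "\<Gamma> c (\<Gamma> f h) x = - (n * s x * \<Gamma> \<xi> (\<Gamma> f h) x)" by (rule cl[OF G[OF f h]])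
  also have "\<Gamma> \<xi> (\<Gamma> f h) x = n * (b x * (c x * \<Gamma> \<xi> (\<Gamma> \<xi> h) x + \<Gamma> \<xi> c x * \<Gamma> \<xi> h x) + \<Gamma> \<xi> b x * (c x * \<Gamma> \<xi> h x))
      + (s x * \<Gamma> \<xi> (\<Gamma> b h) x + \<Gamma> \<xi> s x * \<Gamma> b h x)"
    unfolding e1 by (simp add: \<Gamma>_add \<Gamma>_cmult \<Gamma>_mult S)
  finally have t1: "\<Gamma> c (\<Gamma> f h) x = - (n * s x * (n * (b x * (c x * \<Gamma> \<xi> (\<Gamma> \<xi> h) x + \<Gamma> \<xi> c x * \<Gamma> \<xi> h x)
      + \<Gamma> \<xi> b x * (c x * \<Gamma> \<xi> h x)) + (s x * \<Gamma> \<xi> (\<Gamma> b h) x + \<Gamma> \<xi> s x * \<Gamma> b h x)))" .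
  have t2: "\<Gamma> f (\<Gamma> c h) x = - n * (s x * \<Gamma> f (\<Gamma> \<xi> h) x + \<Gamma> f s x * \<Gamma> \<xi> h x)"
    unfolding e2 \<Gamma>_cmult[OF f smooth_functions_mult[OF A sc(1) G[OF \<xi> h]]] \<Gamma>_mult[OF f sc(1) G[OF \<xi> h]] by simp
  \<comment> \<open>Each oscillating factor that gets differentiated contributes another
    \<open>n\<close>; these are the sources of the cubic order.\<close>
  have q: "\<Gamma> \<xi> c x = - (n * s x * \<Gamma> \<xi> \<xi> x)" "\<Gamma> \<xi> s x = n * c x * \<Gamma> \<xi> \<xi> x"
    using cl[OF \<xi>, of x] sl[OF \<xi>, of x] \<Gamma>_sym[OF \<xi> sc(1)] \<Gamma>_sym[OF \<xi> sc(2)] by simp_all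
  have bs: "\<Gamma> b s x = n * c x * \<Gamma> \<xi> b x" using sl[OF b, of x] \<Gamma>_sym[OF b sc(1)] by simp
  have one: "s x * s x = 1 - c x * c x"
    using sin_squared_eq[of "n * \<xi> x"] by (simp add: s_def c_def power2_eq_square)
  \<comment> \<open>The terms with second derivatives of \<open>h\<close> along \<open>\<xi>\<close>
    cancel, and so do those with \<open>\<Gamma> \<xi> b\<close>. In the cubic term the square of
    \<open>s\<close> stems from \<open>t1\<close> and the square of \<open>c\<close> from
    \<open>t2\<close>.\<close>
  have E: "\<Gamma> c (\<Gamma> f h) x - \<Gamma> f (\<Gamma> c h) x =
    n ^ 3 * ((s x * s x + c x * c x) * (b x * \<Gamma> \<xi> \<xi> x * \<Gamma> \<xi> h x)) - n ^ 2 * (s x * c x * \<Gamma> \<xi> \<xi> x * \<Gamma> b h x)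
    - n * (s x * s x * (\<Gamma> \<xi> (\<Gamma> b h) x - \<Gamma> b (\<Gamma> \<xi> h) x))"
    unfolding t1 t2 fl[OF G[OF \<xi> h]] fl[OF sc(1)] q bs
    by (simp add: algebra_simps power3_eq_cube power2_eq_square)
  show ?thesis unfolding E by (simp add: one)
qed

subsection \<open>Taylor expansion along gradient flows\<close>

text \<open>Along the flow of the gradient of \<open>f\<close>, differentiating \<open>h\<close> in
  time means applying \<open>\<Gamma> f\<close>. Compactness bounds the Lagrange remainder uniformly
  in the starting point.\<close>

lemma flow_taylor:
  assumes f: "f \<in> smooth_functions A" and h: "h \<in> smooth_functions A"
  obtains C where "C \<ge> 0" "\<And>s x. s \<in> {0..1} \<Longrightarrow>
    \<bar>h (flow A (gradient A g f) s x) - (\<Sum>m<n. (s ^ m / fact m) * (\<Gamma> f ^^ m) h x)\<bar> \<le> C * s ^ n"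
proof -
  have sm: "(\<Gamma> f ^^ m) h \<in> smooth_functions A" for m
    by (induction m) (simp_all add: h \<Gamma>_smooth[OF f])
  obtain M where M: "M > 0" "\<And>x. \<bar>(\<Gamma> f ^^ n) h x\<bar> \<le> M" by (rule smooth_functions_bounded[OF sm[of n]]) blast
  let ?\<psi> = "\<lambda>s x. flow A (gradient A g f) s x"
  have "\<bar>h (?\<psi> s x) - (\<Sum>m<n. (s ^ m / fact m) * (\<Gamma> f ^^ m) h x)\<bar> \<le> M * s ^ n" if s: "s \<in> {0..1}" for s x
  \<comment> \<open>\<open>Maclaurin\<close> requires positive time and positive order; the
    degenerate cases are checked by hand.\<close>
  proof (cases "s = 0 \<or> n = 0")
    case True
    then show ?thesis
    proof
      assume 0: "s = 0"
      show ?thesis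
      proof (cases n)
        case 0
        then show ?thesis using M by simp
      next
        case (Suc m)
        have "(\<Sum>j<Suc m. (0 ^ j / fact j) * (\<Gamma> f ^^ j) h x) = h x" unfolding sum.lessThan_Suc_shift by simp
        then show ?thesis using 0 flow_0[OF gradient_field[OF f], where x=x] by (simp add: Suc del: sum.lessThan_Suc)
      qed
    next
      assume "n = 0"
      then show ?thesis using M(2)[of "?\<psi> s x"] by simp
    qed
  next
    case False
    then have "0 < s" "0 < n" using s by auto
    have "\<forall>m t. m < n \<and> 0 \<le> t \<and> t \<le> s \<longrightarrow> DERIV (\<lambda>t. (\<Gamma> f ^^ m) h (?\<psi> t x)) t :> (\<Gamma> f ^^ Suc m) h (?\<psi> t x)"
      using flow_derivative[OF gradient_field[OF f] sm, where x=x] by (simp add: \<Gamma>_def)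
    from Maclaurin[OF \<open>0 < s\<close> \<open>0 < n\<close> _ this, of "\<lambda>t. h (?\<psi> t x)"] obtain t where
      t: "h (?\<psi> s x) = (\<Sum>m<n. ((\<Gamma> f ^^ m) h (?\<psi> 0 x) / fact m) * s ^ m) + ((\<Gamma> f ^^ n) h (?\<psi> t x) / fact n) * s ^ n"
      by (auto simp del: funpow.simps)
    have "\<bar>((\<Gamma> f ^^ n) h (?\<psi> t x) / fact n) * s ^ n\<bar> \<le> M * s ^ n"
    proof -
      have "\<bar>(\<Gamma> f ^^ n) h (?\<psi> t x)\<bar> / fact n \<le> M / 1"
        using M by (intro frac_le) auto
      then have "\<bar>(\<Gamma> f ^^ n) h (?\<psi> t x)\<bar> / fact n * s ^ n \<le> M * s ^ n" using s by (intro mult_right_mono) auto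
      then show ?thesis using s by (simp add: abs_mult)
    qed
    moreover have "(\<Sum>m<n. ((\<Gamma> f ^^ m) h (?\<psi> 0 x) / fact m) * s ^ m) = (\<Sum>m<n. (s ^ m / fact m) * (\<Gamma> f ^^ m) h x)"
      using flow_0[OF gradient_field[OF f], where x=x] by (intro sum.cong) auto
    ultimately show ?thesis using t by simp
  qed
  then show ?thesis using that[of M] M(1) by simp
qed

text \<open>Second order with cubic error, uniformly in the point: the bracket appears at order
  \<open>s ^ 2\<close>, so its error has to be of higher order.\<close>

definition expands :: "(real \<Rightarrow> 'm \<Rightarrow> real) \<Rightarrow> ('m \<Rightarrow> real) \<Rightarrow> ('m \<Rightarrow> real) \<Rightarrow> ('m \<Rightarrow> real) \<Rightarrow> bool" where
  "expands w w0 w1 w2 \<longleftrightarrow> (\<exists>C. \<forall>s\<in>{0..1}. \<forall>x. \<bar>w s x - (w0 x + s * w1 x + s ^ 2 * w2 x)\<bar> \<le> C * s ^ 3)"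

text \<open>Inserting one more flow on the inside. The coefficients are expanded along it to orders
  3, 2 and 1, which together with their powers of \<open>s\<close> makes every error cubic.\<close>

lemma expands_flow:
  assumes f: "f \<in> smooth_functions A" and w: "expands w w0 w1 w2"
    and s: "w0 \<in> smooth_functions A" "w1 \<in> smooth_functions A" "w2 \<in> smooth_functions A"
  shows "expands (\<lambda>s x. w s (flow A (gradient A g f) s x)) w0 (\<lambda>x. w1 x + \<Gamma> f w0 x)
    (\<lambda>x. w2 x + \<Gamma> f w1 x + \<Gamma> f (\<Gamma> f w0) x / 2)"
proof -
  let ?\<psi> = "\<lambda>s x. flow A (gradient A g f) s x"
  obtain C where C: "\<And>s x. s \<in> {0..1} \<Longrightarrow> \<bar>w s x - (w0 x + s * w1 x + s ^ 2 * w2 x)\<bar> \<le> C * s ^ 3"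
    using w unfolding expands_def by blast
  obtain C0 where C0: "\<And>s x. s \<in> {0..1} \<Longrightarrow> \<bar>w0 (?\<psi> s x) - (\<Sum>m<3. (s ^ m / fact m) * (\<Gamma> f ^^ m) w0 x)\<bar> \<le> C0 * s ^ 3"
    by (rule flow_taylor[OF f s(1), of 3]) blast
  obtain C1 where C1: "\<And>s x. s \<in> {0..1} \<Longrightarrow> \<bar>w1 (?\<psi> s x) - (\<Sum>m<2. (s ^ m / fact m) * (\<Gamma> f ^^ m) w1 x)\<bar> \<le> C1 * s ^ 2"
    by (rule flow_taylor[OF f s(2), of 2]) blast
  obtain C2 where C2: "\<And>s x. s \<in> {0..1} \<Longrightarrow> \<bar>w2 (?\<psi> s x) - (\<Sum>m<1. (s ^ m / fact m) * (\<Gamma> f ^^ m) w2 x)\<bar> \<le> C2 * s ^ 1"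
    by (rule flow_taylor[OF f s(3), of 1]) blast
  have "\<bar>w s (?\<psi> s x) - (w0 x + s * (w1 x + \<Gamma> f w0 x) + s ^ 2 * (w2 x + \<Gamma> f w1 x + \<Gamma> f (\<Gamma> f w0) x / 2))\<bar>
      \<le> (C + C0 + C1 + C2) * s ^ 3" if s: "s \<in> {0..1}" for s x
  proof -
    let ?y = "?\<psi> s x"
    have 0: "\<bar>w0 ?y - (w0 x + s * \<Gamma> f w0 x + s ^ 2 / 2 * \<Gamma> f (\<Gamma> f w0) x)\<bar> \<le> C0 * s ^ 3"
      using C0[OF s, of x] by (simp add: eval_nat_numeral)
    have "s * \<bar>w1 ?y - (w1 x + s * \<Gamma> f w1 x)\<bar> \<le> s * (C1 * s ^ 2)"
      using C1[OF s, of x] s by (intro mult_left_mono) (auto simp: eval_nat_numeral)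
    then have 1: "\<bar>s * (w1 ?y - (w1 x + s * \<Gamma> f w1 x))\<bar> \<le> C1 * s ^ 3"
      using s by (simp add: abs_mult eval_nat_numeral mult_ac)
    have "s ^ 2 * \<bar>w2 ?y - w2 x\<bar> \<le> s ^ 2 * (C2 * s)"
      using C2[OF s, of x] s by (intro mult_left_mono) auto
    then have 2: "\<bar>s ^ 2 * (w2 ?y - w2 x)\<bar> \<le> C2 * s ^ 3"
      using s by (simp add: abs_mult eval_nat_numeral mult_ac)
    have "w s ?y - (w0 x + s * (w1 x + \<Gamma> f w0 x) + s ^ 2 * (w2 x + \<Gamma> f w1 x + \<Gamma> f (\<Gamma> f w0) x / 2))
      = (w s ?y - (w0 ?y + s * w1 ?y + s ^ 2 * w2 ?y)) + (w0 ?y - (w0 x + s * \<Gamma> f w0 x + s ^ 2 / 2 * \<Gamma> f (\<Gamma> f w0) x))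
        + s * (w1 ?y - (w1 x + s * \<Gamma> f w1 x)) + s ^ 2 * (w2 ?y - w2 x)"
      by (simp add: algebra_simps power2_eq_square)
    then show ?thesis using C[OF s, of ?y] 0 1 2 unfolding distrib_right by linarith
  qed
  then show ?thesis unfolding expands_def by blast
qed

text \<open>The group commutator of the two flows. The first-order terms cancel in pairs and the
  second-order terms leave the Lie bracket, here as a difference of iterated pairings; the factors
  are inserted from the outermost to the innermost.\<close>

lemma bracket_expansion:
  assumes f: "f \<in> smooth_functions A" and k: "k \<in> smooth_functions A" and h: "h \<in> smooth_functions A"
  shows "expands (\<lambda>s x. h (flow A (gradient A g f) s (flow A (gradient A g k) s
      (flow A (gradient A g (\<lambda>y. -1 * f y)) s (flow A (gradient A g (\<lambda>y. -1 * k y)) s x)))))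
    h (\<lambda>x. 0) (\<lambda>x. \<Gamma> k (\<Gamma> f h) x - \<Gamma> f (\<Gamma> k h) x)"
proof -
  note G = \<Gamma>_smooth
  have nf: "(\<lambda>y. -1 * f y) \<in> smooth_functions A" and nk: "(\<lambda>y. -1 * k y) \<in> smooth_functions A"
    by (rule smooth_functions_cmult[OF A f], rule smooth_functions_cmult[OF A k])
  have dv: "(\<lambda>x. u x / 2) \<in> smooth_functions A" if "u \<in> smooth_functions A" for u
    using smooth_functions_cmult[OF A that, of "1 / 2"] by simp
  have sub: "(\<lambda>x. u x - v x) \<in> smooth_functions A" if "u \<in> smooth_functions A" "v \<in> smooth_functions A" for u v
    using smooth_functions_add[OF A that(1) smooth_functions_cmult[OF A that(2), of "-1"]] by simp
  note S = f k h nf nk G[OF f] G[OF k] smooth_functions_add[OF A] smooth_functions_const[OF A] dv sub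
  have "expands (\<lambda>s x. h x) h (\<lambda>x. 0) (\<lambda>x. 0)" by (auto simp: expands_def intro!: exI[of _ 0])
  from expands_flow[OF f this h smooth_functions_const[OF A] smooth_functions_const[OF A]]
  have 1: "expands (\<lambda>s x. h (flow A (gradient A g f) s x)) h (\<Gamma> f h) (\<lambda>x. \<Gamma> f (\<Gamma> f h) x / 2)"
    using tangent_const[OF A gradient_tangent[OF f]] by (simp add: \<Gamma>_def)
  have 2: "expands (\<lambda>s x. h (flow A (gradient A g f) s (flow A (gradient A g k) s x))) h (\<lambda>x. \<Gamma> f h x + \<Gamma> k h x)
      (\<lambda>x. \<Gamma> f (\<Gamma> f h) x / 2 + \<Gamma> k (\<Gamma> f h) x + \<Gamma> k (\<Gamma> k h) x / 2)"
    by (rule expands_flow[OF k 1]) (simp_all add: S)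
  have "expands (\<lambda>s x. h (flow A (gradient A g f) s (flow A (gradient A g k) s (flow A (gradient A g (\<lambda>y. -1 * f y)) s x))))
    h (\<lambda>x. (\<Gamma> f h x + \<Gamma> k h x) + \<Gamma> (\<lambda>y. -1 * f y) h x)
    (\<lambda>x. (\<Gamma> f (\<Gamma> f h) x / 2 + \<Gamma> k (\<Gamma> f h) x + \<Gamma> k (\<Gamma> k h) x / 2) + \<Gamma> (\<lambda>y. -1 * f y) (\<lambda>x. \<Gamma> f h x + \<Gamma> k h x) x
      + \<Gamma> (\<lambda>y. -1 * f y) (\<Gamma> (\<lambda>y. -1 * f y) h) x / 2)"
    by (rule expands_flow[OF nf 2]) (simp_all add: S)
  moreover have "\<Gamma> (\<lambda>y. -1 * f y) u = (\<lambda>x. -1 * \<Gamma> f u x)" "\<Gamma> (\<lambda>y. -1 * k y) u = (\<lambda>x. -1 * \<Gamma> k u x)" for u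
    using \<Gamma>_cmult_left[OF f, of "-1" u] \<Gamma>_cmult_left[OF k, of "-1" u] by (simp_all add: fun_eq_iff)
  note neg = this
  ultimately have 3: "expands (\<lambda>s x. h (flow A (gradient A g f) s (flow A (gradient A g k) s (flow A (gradient A g (\<lambda>y. -1 * f y)) s x))))
    h (\<Gamma> k h) (\<lambda>x. \<Gamma> k (\<Gamma> f h) x + \<Gamma> k (\<Gamma> k h) x / 2 - \<Gamma> f (\<Gamma> k h) x)"
    unfolding neg \<Gamma>_cmult[OF f G[OF f h]] \<Gamma>_add[OF f G[OF f h] G[OF k h]] by (simp add: algebra_simps)
  have "expands (\<lambda>s x. h (flow A (gradient A g f) s (flow A (gradient A g k) s
      (flow A (gradient A g (\<lambda>y. -1 * f y)) s (flow A (gradient A g (\<lambda>y. -1 * k y)) s x)))))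
    h (\<lambda>x. \<Gamma> k h x + \<Gamma> (\<lambda>y. -1 * k y) h x)
    (\<lambda>x. (\<Gamma> k (\<Gamma> f h) x + \<Gamma> k (\<Gamma> k h) x / 2 - \<Gamma> f (\<Gamma> k h) x) + \<Gamma> (\<lambda>y. -1 * k y) (\<Gamma> k h) x
      + \<Gamma> (\<lambda>y. -1 * k y) (\<Gamma> (\<lambda>y. -1 * k y) h) x / 2)"
    by (rule expands_flow[OF nk 3]) (simp_all add: S)
  then show ?thesis
    unfolding neg \<Gamma>_cmult[OF k G[OF k h]] by (simp add: algebra_simps)
qed

subsection \<open>Admissible infinitesimal displacements\<close>

context
  fixes FF :: "('m \<Rightarrow> real) set"
  assumes FF: "finite FF" "FF \<subseteq> smooth_functions A" "\<forall>x y. (\<forall>f\<in>FF. f x = f y) \<longrightarrow> x = y"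
begin

definition d :: "'m \<Rightarrow> 'm \<Rightarrow> real" where
  "d x y = (\<Sum>f\<in>FF. \<bar>f x - f y\<bar>)"

lemma d_nonneg: "d x y \<ge> 0" and d_same: "d x x = 0" and d_commute: "d x y = d y x"
  by (simp_all add: d_def sum_nonneg abs_minus_commute)

lemma d_triangle: "d x z \<le> d x y + d y z"
  unfolding d_def sum.distrib[symmetric] by (rule sum_mono) simp

lemma d_zero: "d x y = 0 \<Longrightarrow> x = y"
  by (rule FF(3)[rule_format]) (simp add: d_def sum_nonneg_eq_0_iff FF(1))

lemma FF_continuous: "f \<in> FF \<Longrightarrow> continuous_on S f"
  using FF(2) smooth_functions_continuous[OF A] by blast

lemma d_continuous:
  fixes a b :: "'z::topological_space \<Rightarrow> 'm"
  assumes "continuous_on S a" "continuous_on S b"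
  shows "continuous_on S (\<lambda>z. d (a z) (b z))"
  unfolding d_def
  by (intro continuous_on_sum continuous_on_rabs continuous_on_diff
      continuous_on_compose2[OF FF_continuous[of _ UNIV] assms(1)] continuous_on_compose2[OF FF_continuous[of _ UNIV] assms(2)]) auto

lemma d_lower_bound:
  assumes "compact K" "\<And>x y. (x, y) \<in> K \<Longrightarrow> x \<noteq> y"
  obtains e where "e > 0" "\<And>x y. (x, y) \<in> K \<Longrightarrow> e \<le> d x y"
proof (cases "K = {}")
  case True
  then show ?thesis using that[of 1] by simp
next
  case False
  have "continuous_on K (\<lambda>z. d (fst z) (snd z))" by (intro d_continuous continuous_intros)
  from continuous_attains_inf[OF assms(1) False this] obtain z where z: "z \<in> K"
    "\<And>y. y \<in> K \<Longrightarrow> d (fst z) (snd z) \<le> d (fst y) (snd y)" by blast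
  have "d (fst z) (snd z) \<noteq> 0" using d_zero assms(2)[of "fst z" "snd z"] z(1) by auto
  then have "d (fst z) (snd z) > 0" using d_nonneg[of "fst z" "snd z"] by linarith
  then show ?thesis using that[of "d (fst z) (snd z)"] z(2) by auto
qed

text \<open>Uniform continuity expressed through \<open>d\<close>: on the compact set where
  \<open>\<rho>\<close> is at least \<open>e\<close> no diagonal point occurs, so \<open>d\<close>
  has a positive minimum there.\<close>

lemma d_uniform:
  fixes \<rho> :: "'m \<times> 'm \<Rightarrow> real"
  assumes \<rho>: "continuous_on UNIV \<rho>" "\<And>x. \<rho> (x, x) = 0" and e: "e > 0"
  obtains \<epsilon> where "\<epsilon> > 0" "\<And>x y. d x y < \<epsilon> \<Longrightarrow> \<rho> (x, y) < e"
proof -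
  let ?K = "\<rho> -` {e..}"
  have "closed ?K" by (rule closed_vimage[OF closed_atLeast \<rho>(1)])
  moreover have "compact (UNIV :: ('m \<times> 'm) set)" using compact_Times[OF compact_UNIV compact_UNIV] by simp
  ultimately have "compact ?K" using compact_Int_closed[of UNIV ?K] by simp
  moreover have "x \<noteq> y" if "(x, y) \<in> ?K" for x y using that \<rho>(2)[of x] e by auto
  ultimately obtain \<epsilon> where "\<epsilon> > 0" "\<And>x y. (x, y) \<in> ?K \<Longrightarrow> \<epsilon> \<le> d x y" using d_lower_bound[of ?K] by metis
  then show ?thesis by (intro that[of \<epsilon>]) (auto simp: not_le[symmetric])
qed

text \<open>Displacements by \<open>\<delta> Y\<close> are imitated up to a fraction of
  \<open>\<delta>\<close>, tested on \<open>FF\<close>. The map \<open>P\<close> may depend on both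
  the tolerance and the step and need not come from a one-parameter family; so the frequency may be
  tuned to \<open>\<eta>\<close>.\<close>

definition admissible :: "('m \<Rightarrow> 'm tvector) \<Rightarrow> bool" where
  "admissible Y \<longleftrightarrow> (\<forall>\<eta>>0. \<exists>\<delta>0>0. \<forall>\<delta>. 0 < \<delta> \<and> \<delta> < \<delta>0 \<longrightarrow>
     (\<exists>P\<in>GG. \<forall>x. \<forall>f\<in>FF. \<bar>f (P x) - f x - \<delta> * Y x f\<bar> \<le> \<eta> * \<delta>))"

lemma admissibleD:
  assumes "admissible Y" "\<eta> > 0"
  obtains \<delta>0 where "\<delta>0 > 0" "\<And>\<delta>. 0 < \<delta> \<and> \<delta> < \<delta>0 \<Longrightarrow> \<exists>P\<in>GG. \<forall>x. \<forall>f\<in>FF. \<bar>f (P x) - f x - \<delta> * Y x f\<bar> \<le> \<eta> * \<delta>"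
proof -
  from assms have "\<exists>\<delta>0>0. \<forall>\<delta>. 0 < \<delta> \<and> \<delta> < \<delta>0 \<longrightarrow> (\<exists>P\<in>GG. \<forall>x. \<forall>f\<in>FF. \<bar>f (P x) - f x - \<delta> * Y x f\<bar> \<le> \<eta> * \<delta>)"
    by (simp only: admissible_def)
  then show ?thesis using that by (elim exE conjE) (simp only:)
qed

definition cfield :: "('m \<Rightarrow> 'm tvector) \<Rightarrow> bool" where
  "cfield Y \<longleftrightarrow> (\<forall>f\<in>FF. continuous_on UNIV (\<lambda>x. Y x f))"

text \<open>Since the tolerance is fixed before the step, half of it can be spent on replacing
  \<open>Y\<close> by a uniformly close field. The high-frequency limit and the partition of unity
  both enter through this rule.\<close>

lemma admissible_limit:
  assumes "\<And>\<eta>. \<eta> > 0 \<Longrightarrow> \<exists>Z. admissible Z \<and> (\<forall>x. \<forall>f\<in>FF. \<bar>Y x f - Z x f\<bar> \<le> \<eta>)"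
  shows "admissible Y"
  unfolding admissible_def
proof (intro allI impI)
  fix \<eta> :: real assume "\<eta> > 0"
  then have e: "\<eta> / 2 > 0" by simp
  obtain Z where Z: "admissible Z" "\<And>x f. f \<in> FF \<Longrightarrow> \<bar>Y x f - Z x f\<bar> \<le> \<eta> / 2" using assms[OF e] by blast
  obtain \<delta>0 where \<delta>0: "\<delta>0 > 0" "\<And>\<delta>. 0 < \<delta> \<and> \<delta> < \<delta>0 \<Longrightarrow> \<exists>P\<in>GG. \<forall>x. \<forall>f\<in>FF. \<bar>f (P x) - f x - \<delta> * Z x f\<bar> \<le> \<eta> / 2 * \<delta>"
    by (rule admissibleD[OF Z(1) e]) blast
  have "\<exists>P\<in>GG. \<forall>x. \<forall>f\<in>FF. \<bar>f (P x) - f x - \<delta> * Y x f\<bar> \<le> \<eta> * \<delta>" if \<delta>: "0 < \<delta> \<and> \<delta> < \<delta>0" for \<delta>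
  proof -
    obtain P where P: "P \<in> GG" "\<And>x f. f \<in> FF \<Longrightarrow> \<bar>f (P x) - f x - \<delta> * Z x f\<bar> \<le> \<eta> / 2 * \<delta>" using \<delta>0(2)[OF \<delta>] by blast
    have "\<bar>f (P x) - f x - \<delta> * Y x f\<bar> \<le> \<eta> * \<delta>" if f: "f \<in> FF" for x f
    proof -
      have "\<bar>\<delta> * (Y x f - Z x f)\<bar> \<le> \<delta> * (\<eta> / 2)" unfolding abs_mult using \<delta> Z(2)[OF f, of x] by (intro mult_mono) auto
      moreover have "f (P x) - f x - \<delta> * Y x f = (f (P x) - f x - \<delta> * Z x f) - \<delta> * (Y x f - Z x f)"
        by (simp add: algebra_simps)
      moreover have "\<eta> * \<delta> = \<eta> / 2 * \<delta> + \<delta> * (\<eta> / 2)" by simp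
      ultimately show ?thesis using P(2)[OF f, of x] by linarith
    qed
    then show ?thesis using P(1) by blast
  qed
  then show "\<exists>\<delta>0>0. \<forall>\<delta>. 0 < \<delta> \<and> \<delta> < \<delta>0 \<longrightarrow> (\<exists>P\<in>GG. \<forall>x. \<forall>f\<in>FF. \<bar>f (P x) - f x - \<delta> * Y x f\<bar> \<le> \<eta> * \<delta>)"
    using \<delta>0(1) by blast
qed

lemma admissible_zero: "admissible (\<lambda>x f. 0)"
  unfolding admissible_def by (auto intro!: exI[of _ 1] bexI[OF _ GG_id])

lemma cfield_bounded:
  assumes "cfield Y" obtains M where "M > 0" "\<And>x f. f \<in> FF \<Longrightarrow> \<bar>Y x f\<bar> \<le> M"
proof -
  have "bounded (\<Union>f\<in>FF. range (\<lambda>x. Y x f))"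
    using FF(1) assms unfolding cfield_def
    by (intro bounded_UN ballI compact_imp_bounded compact_continuous_image compact_UNIV) auto
  then obtain M where "M > 0" "\<forall>y\<in>(\<Union>f\<in>FF. range (\<lambda>x. Y x f)). norm y \<le> M" unfolding bounded_pos by blast
  then show ?thesis using that[of M] by auto
qed

lemma cfield_uniform:
  assumes Y: "cfield Y" and e: "e > 0"
  obtains \<epsilon> where "\<epsilon> > 0" "\<And>x y f. f \<in> FF \<Longrightarrow> d x y < \<epsilon> \<Longrightarrow> \<bar>Y x f - Y y f\<bar> < e"
proof -
  let ?\<rho> = "\<lambda>z. \<Sum>f\<in>FF. \<bar>Y (fst z) f - Y (snd z) f\<bar>"
  have c: "continuous_on UNIV (\<lambda>x. Y x f)" if "f \<in> FF" for f using Y that by (simp add: cfield_def)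
  have "continuous_on UNIV ?\<rho>"
    by (intro continuous_on_sum continuous_on_rabs continuous_on_diff
        continuous_on_compose2[OF c continuous_on_fst[OF continuous_on_id]]
        continuous_on_compose2[OF c continuous_on_snd[OF continuous_on_id]]) auto
  then obtain \<epsilon> where \<epsilon>: "\<epsilon> > 0" "\<And>x y. d x y < \<epsilon> \<Longrightarrow> ?\<rho> (x, y) < e"
    by (rule d_uniform[OF _ _ e]) auto
  have "\<bar>Y x f - Y y f\<bar> < e" if f: "f \<in> FF" and "d x y < \<epsilon>" for x y f
  proof -
    have "\<bar>Y x f - Y y f\<bar> \<le> ?\<rho> (x, y)"
      using member_le_sum[OF f _ FF(1), of "\<lambda>f. \<bar>Y x f - Y y f\<bar>"] by simp
    then show ?thesis using \<epsilon>(2)[OF that(2)] by simp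
  qed
  then show ?thesis using that \<epsilon>(1) by blast
qed

text \<open>Compose the two displacements. The second field is evaluated at \<open>P x\<close>
  instead of \<open>x\<close>, and uniform continuity makes the difference a third small
  error.\<close>

lemma admissible_add:
  assumes Y: "admissible Y" "cfield Y" and Z: "admissible Z" "cfield Z"
  shows "admissible (\<lambda>x f. Y x f + Z x f)"
  unfolding admissible_def
proof (intro allI impI)
  fix \<eta> :: real assume "\<eta> > 0"
  define e where "e = \<eta> / 3"
  have e: "e > 0" using \<open>\<eta> > 0\<close> by (simp add: e_def)
  obtain M where M: "M > 0" "\<And>x f. f \<in> FF \<Longrightarrow> \<bar>Y x f\<bar> \<le> M" by (rule cfield_bounded[OF Y(2)]) blast
  obtain \<epsilon> where \<epsilon>: "\<epsilon> > 0" "\<And>x y f. f \<in> FF \<Longrightarrow> d x y < \<epsilon> \<Longrightarrow> \<bar>Z x f - Z y f\<bar> < e"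
    by (rule cfield_uniform[OF Z(2) e]) blast
  obtain \<delta>1 where \<delta>1: "\<delta>1 > 0" "\<And>\<delta>. 0 < \<delta> \<and> \<delta> < \<delta>1 \<Longrightarrow> \<exists>P\<in>GG. \<forall>x. \<forall>f\<in>FF. \<bar>f (P x) - f x - \<delta> * Y x f\<bar> \<le> e * \<delta>"
    by (rule admissibleD[OF Y(1) e]) blast
  obtain \<delta>2 where \<delta>2: "\<delta>2 > 0" "\<And>\<delta>. 0 < \<delta> \<and> \<delta> < \<delta>2 \<Longrightarrow> \<exists>P\<in>GG. \<forall>x. \<forall>f\<in>FF. \<bar>f (P x) - f x - \<delta> * Z x f\<bar> \<le> e * \<delta>"
    by (rule admissibleD[OF Z(1) e]) blast
  \<comment> \<open>Bounds \<open>d (P x) x\<close> by \<open>\<delta> * N\<close>; the added 1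
    keeps \<open>N\<close> positive even for an empty \<open>FF\<close>.\<close>
  define N where "N = (real (card FF) + 1) * (M + e)"
  have N: "N > 0" using M(1) e by (simp add: N_def add_nonneg_pos)
  define \<delta>0 where "\<delta>0 = min (min \<delta>1 \<delta>2) (\<epsilon> / N)"
  have "\<delta>0 > 0" using \<delta>1 \<delta>2 \<epsilon> N by (simp add: \<delta>0_def)
  moreover have "\<exists>P\<in>GG. \<forall>x. \<forall>f\<in>FF. \<bar>f (P x) - f x - \<delta> * (Y x f + Z x f)\<bar> \<le> \<eta> * \<delta>" if \<delta>: "0 < \<delta> \<and> \<delta> < \<delta>0" for \<delta>
  proof -
    obtain P where P: "P \<in> GG" "\<And>x f. f \<in> FF \<Longrightarrow> \<bar>f (P x) - f x - \<delta> * Y x f\<bar> \<le> e * \<delta>"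
      using \<delta>1(2)[of \<delta>] \<delta> by (auto simp: \<delta>0_def)
    obtain Q where Q: "Q \<in> GG" "\<And>x f. f \<in> FF \<Longrightarrow> \<bar>f (Q x) - f x - \<delta> * Z x f\<bar> \<le> e * \<delta>"
      using \<delta>2(2)[of \<delta>] \<delta> by (auto simp: \<delta>0_def)
    have close: "d (P x) x < \<epsilon>" for x
    proof -
      have "d (P x) x \<le> (\<Sum>f\<in>FF. \<delta> * (M + e))"
        unfolding d_def
      proof (rule sum_mono)
        fix f assume f: "f \<in> FF"
        have "\<bar>\<delta> * Y x f\<bar> \<le> \<delta> * M" unfolding abs_mult using \<delta> M(2)[OF f, of x] by (intro mult_mono) auto
        then show "\<bar>f (P x) - f x\<bar> \<le> \<delta> * (M + e)" using P(2)[OF f, of x] by (simp add: algebra_simps)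
      qed
      also have "\<dots> = real (card FF) * (\<delta> * (M + e))" by simp
      also have "\<dots> \<le> \<delta> * N" using \<delta> M(1) e by (simp add: N_def algebra_simps)
      also have "\<dots> < \<epsilon>" using \<delta> N by (auto simp: \<delta>0_def field_simps)
      finally show ?thesis .
    qed
    have "\<bar>f ((Q \<circ> P) x) - f x - \<delta> * (Y x f + Z x f)\<bar> \<le> \<eta> * \<delta>" if f: "f \<in> FF" for x f
    proof -
      have "\<bar>\<delta> * (Z (P x) f - Z x f)\<bar> \<le> \<delta> * e" unfolding abs_mult using \<delta> \<epsilon>(2)[OF f close[of x]] by (intro mult_mono) auto
      moreover have "f ((Q \<circ> P) x) - f x - \<delta> * (Y x f + Z x f) = (f (Q (P x)) - f (P x) - \<delta> * Z (P x) f)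
          + (f (P x) - f x - \<delta> * Y x f) + \<delta> * (Z (P x) f - Z x f)" by (simp add: algebra_simps)
      moreover have "\<eta> * \<delta> = e * \<delta> + e * \<delta> + \<delta> * e" by (simp add: e_def)
      ultimately show ?thesis using P(2)[OF f, of x] Q(2)[OF f, of "P x"] by linarith
    qed
    then show ?thesis using GG_comp[OF Q(1) P(1)] by blast
  qed
  ultimately show "\<exists>\<delta>0>0. \<forall>\<delta>. 0 < \<delta> \<and> \<delta> < \<delta>0 \<longrightarrow>
      (\<exists>P\<in>GG. \<forall>x. \<forall>f\<in>FF. \<bar>f (P x) - f x - \<delta> * (Y x f + Z x f)\<bar> \<le> \<eta> * \<delta>)" by blast
qed

lemma admissible_sum:
  assumes "finite I" "\<And>i. i \<in> I \<Longrightarrow> admissible (Y i)" "\<And>i. i \<in> I \<Longrightarrow> cfield (Y i)"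
  shows "admissible (\<lambda>x f. \<Sum>i\<in>I. Y i x f)"
  using assms
proof (induction I rule: finite_induct)
  case empty then show ?case using admissible_zero by simp
next
  case (insert i I)
  have "cfield (\<lambda>x f. \<Sum>i\<in>I. Y i x f)" using insert.prems(2) unfolding cfield_def by (auto intro: continuous_on_sum)
  then have "admissible (\<lambda>x f. Y i x f + (\<Sum>i\<in>I. Y i x f))" using insert by (intro admissible_add) auto
  then show ?case using insert.hyps by simp
qed

text \<open>The commutator at time \<open>sqrt \<delta>\<close> moves points by
  \<open>\<delta>\<close> times the bracket, with an error of order
  \<open>\<delta> * sqrt \<delta>\<close>.\<close>

lemma admissible_bracket:
  assumes f: "f \<in> smooth_functions A" and k: "k \<in> smooth_functions A"
  shows "admissible (\<lambda>x h. \<Gamma> k (\<Gamma> f h) x - \<Gamma> f (\<Gamma> k h) x)"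
  unfolding admissible_def
proof (intro allI impI)
  fix \<eta> :: real assume \<eta>: "\<eta> > 0"
  let ?nf = "\<lambda>y. -1 * f y" and ?nk = "\<lambda>y. -1 * k y"
  let ?P = "\<lambda>s. flow A (gradient A g f) s \<circ> (flow A (gradient A g k) s \<circ> (flow A (gradient A g ?nf) s \<circ> flow A (gradient A g ?nk) s))"
  let ?B = "\<lambda>h x. \<Gamma> k (\<Gamma> f h) x - \<Gamma> f (\<Gamma> k h) x"
  have "\<exists>C. \<forall>s\<in>{0..1}. \<forall>x. \<bar>h (?P s x) - (h x + s * 0 + s ^ 2 * ?B h x)\<bar> \<le> C * s ^ 3" if "h \<in> FF" for h
    using bracket_expansion[OF f k, of h] that FF(2) unfolding expands_def by auto
  then have "\<forall>h\<in>FF. \<exists>C. \<forall>s\<in>{0..1}. \<forall>x. \<bar>h (?P s x) - (h x + s * 0 + s ^ 2 * ?B h x)\<bar> \<le> C * s ^ 3" by blast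
  from bchoice[OF this] obtain C where C: "\<forall>h\<in>FF. \<forall>s\<in>{0..1}. \<forall>x. \<bar>h (?P s x) - (h x + s * 0 + s ^ 2 * ?B h x)\<bar> \<le> C h * s ^ 3" ..
  define K where "K = (\<Sum>h\<in>FF. \<bar>C h\<bar>) + 1"
  have K: "K > 0" "\<And>h. h \<in> FF \<Longrightarrow> C h \<le> K"
  proof -
    show "K > 0" by (simp add: K_def sum_nonneg add_nonneg_pos)
    fix h assume h: "h \<in> FF"
    have "\<bar>C h\<bar> \<le> (\<Sum>h\<in>FF. \<bar>C h\<bar>)" by (rule member_le_sum[OF h _ FF(1)]) simp
    then show "C h \<le> K" by (simp add: K_def)
  qed
  \<comment> \<open>The bound 1 keeps the time in the range of the expansion; the square makes
    \<open>K * sqrt \<delta>\<close> at most \<open>\<eta>\<close>.\<close>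
  define \<delta>0 where "\<delta>0 = min 1 ((\<eta> / K) ^ 2)"
  have "\<delta>0 > 0" using \<eta> K by (simp add: \<delta>0_def)
  moreover have "\<exists>P\<in>GG. \<forall>x. \<forall>h\<in>FF. \<bar>h (P x) - h x - \<delta> * ?B h x\<bar> \<le> \<eta> * \<delta>" if \<delta>: "0 < \<delta> \<and> \<delta> < \<delta>0" for \<delta>
  proof (intro bexI[of _ "?P (sqrt \<delta>)"] allI ballI)
    show "?P (sqrt \<delta>) \<in> GG"
      by (intro GG_comp GG_flow f k smooth_functions_cmult[OF A])
    fix x h assume h: "h \<in> FF"
    define s where "s = sqrt \<delta>"
    have s: "s \<in> {0..1}" "s ^ 2 = \<delta>" using \<delta> by (auto simp: s_def \<delta>0_def)
    have "s < \<eta> / K"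
    proof -
      have "s < sqrt ((\<eta> / K) ^ 2)" unfolding s_def using \<delta> by (intro real_sqrt_less_mono) (simp add: \<delta>0_def)
      then show ?thesis using \<eta> K by simp
    qed
    then have sK: "K * s \<le> \<eta>" using K by (simp add: field_simps)
    have "\<bar>h (?P s x) - h x - s ^ 2 * ?B h x\<bar> = \<bar>h (?P s x) - (h x + s * 0 + s ^ 2 * ?B h x)\<bar>" by simp
    also have "\<dots> \<le> C h * s ^ 3" using C h s by blast
    also have "\<dots> \<le> K * s ^ 3" using K(2)[OF h] s by (intro mult_right_mono) auto
    also have "\<dots> = (K * s) * s ^ 2" by (simp add: eval_nat_numeral)
    also have "\<dots> \<le> \<eta> * s ^ 2" using sK by (intro mult_right_mono) auto
    finally show "\<bar>h (?P (sqrt \<delta>) x) - h x - \<delta> * ?B h x\<bar> \<le> \<eta> * \<delta>" unfolding s(2) s_def[symmetric] .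
  qed
  ultimately show "\<exists>\<delta>0>0. \<forall>\<delta>. 0 < \<delta> \<and> \<delta> < \<delta>0 \<longrightarrow> (\<exists>P\<in>GG. \<forall>x. \<forall>h\<in>FF. \<bar>h (P x) - h x - \<delta> * ?B h x\<bar> \<le> \<eta> * \<delta>)"
    by blast
qed

lemma FF_bounded:
  assumes "\<And>h. h \<in> smooth_functions A \<Longrightarrow> k h \<in> smooth_functions A"
  obtains M where "M > 0" "\<And>x h. h \<in> FF \<Longrightarrow> \<bar>k h x\<bar> \<le> M"
proof -
  have "cfield (\<lambda>x h. k h x)" unfolding cfield_def using assms FF(2) smooth_functions_continuous[OF A] by blast
  then show ?thesis by (rule cfield_bounded) (rule that)
qed

text \<open>The weight \<open>b\<close> stands outside the gradient, which no single potential
  achieves in general. For given tolerance one frequency \<open>n\<close> is chosen and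
  \<open>admissible_bracket\<close> is used for that fixed pair of potentials, so the growth of its
  constants with \<open>n\<close> is harmless.\<close>

lemma admissible_weighted_gradient:
  assumes b: "b \<in> smooth_functions A" and \<xi>: "\<xi> \<in> smooth_functions A"
  shows "admissible (\<lambda>x h. b x * \<Gamma> \<xi> \<xi> x * \<Gamma> \<xi> h x)"
proof (rule admissible_limit)
  fix \<eta> :: real assume \<eta>: "\<eta> > 0"
  note G = \<Gamma>_smooth
  obtain M1 where M1: "M1 > 0" "\<And>x h. h \<in> FF \<Longrightarrow> \<bar>\<Gamma> \<xi> \<xi> x * \<Gamma> b h x\<bar> \<le> M1"
    by (rule FF_bounded[of "\<lambda>h x. \<Gamma> \<xi> \<xi> x * \<Gamma> b h x"]) (use smooth_functions_mult[OF A G[OF \<xi> \<xi>] G[OF b]] in blast)+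
  have sub: "(\<lambda>x. u x - v x) \<in> smooth_functions A" if "u \<in> smooth_functions A" "v \<in> smooth_functions A" for u v
    using smooth_functions_add[OF A that(1) smooth_functions_cmult[OF A that(2), of "-1"]] by simp
  obtain M2 where M2: "M2 > 0" "\<And>x h. h \<in> FF \<Longrightarrow> \<bar>\<Gamma> \<xi> (\<Gamma> b h) x - \<Gamma> b (\<Gamma> \<xi> h) x\<bar> \<le> M2"
    by (rule FF_bounded[of "\<lambda>h x. \<Gamma> \<xi> (\<Gamma> b h) x - \<Gamma> b (\<Gamma> \<xi> h) x"]) (use sub[OF G[OF \<xi> G[OF b]] G[OF b G[OF \<xi>]]] in blast)+
  obtain m :: nat where m: "(M1 + M2) / \<eta> < real m" using reals_Archimedean2 by blast
  \<comment> \<open>After division by \<open>n ^ 3\<close> the remainders are at most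
    \<open>M1 / n\<close> and \<open>M2 / n ^ 2\<close>; the latter is at most \<open>M2 / n\<close>
    because \<open>n \<ge> 1\<close>.\<close>
  define n where "n = real m + 1"
  have n: "n \<ge> 1" "M1 + M2 \<le> \<eta> * n" using m \<eta> by (auto simp: n_def field_simps)
  define s where "s = (\<lambda>y. sin (n * \<xi> y))"
  define c where "c = (\<lambda>y. cos (n * \<xi> y))"
  have sc: "s \<in> smooth_functions A" "c \<in> smooth_functions A" unfolding s_def c_def by (rule smooth_sin_cos[OF \<xi>])+
  let ?f = "\<lambda>y. b y * s y"
  have f: "?f \<in> smooth_functions A" by (rule smooth_functions_mult[OF A b sc(1)])
  let ?f' = "\<lambda>y. (1 / n ^ 3) * ?f y"
  have f': "?f' \<in> smooth_functions A" by (rule smooth_functions_cmult[OF A f])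
  let ?Z = "\<lambda>x h. \<Gamma> c (\<Gamma> ?f' h) x - \<Gamma> ?f' (\<Gamma> c h) x"
  have "\<bar>b x * \<Gamma> \<xi> \<xi> x * \<Gamma> \<xi> h x - ?Z x h\<bar> \<le> \<eta>" if h: "h \<in> FF" for x h
  proof -
    have hs: "h \<in> smooth_functions A" using h FF(2) by blast
    have e1: "\<Gamma> ?f' u = (\<lambda>x. (1 / n ^ 3) * \<Gamma> ?f u x)" for u
      using \<Gamma>_cmult_left[OF f, of "1 / n ^ 3" u] by (simp add: fun_eq_iff)
    let ?a = "s x * c x * \<Gamma> \<xi> \<xi> x * \<Gamma> b h x" and ?b = "s x * s x * (\<Gamma> \<xi> (\<Gamma> b h) x - \<Gamma> b (\<Gamma> \<xi> h) x)"
    have "?Z x h = (1 / n ^ 3) * (\<Gamma> c (\<Gamma> ?f h) x - \<Gamma> ?f (\<Gamma> c h) x)"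
      unfolding e1 \<Gamma>_cmult[OF sc(2) G[OF f hs]] by (simp add: algebra_simps)
    also have "\<Gamma> c (\<Gamma> ?f h) x - \<Gamma> ?f (\<Gamma> c h) x = n ^ 3 * (b x * \<Gamma> \<xi> \<xi> x * \<Gamma> \<xi> h x) - n ^ 2 * ?a - n * ?b"
      unfolding s_def c_def by (rule bracket_oscillating[OF b \<xi> hs])
    also have "(1 / n ^ 3) * \<dots> = b x * \<Gamma> \<xi> \<xi> x * \<Gamma> \<xi> h x - ?a / n - ?b / n ^ 2"
      using n by (simp add: field_simps eval_nat_numeral)
    finally have E: "b x * \<Gamma> \<xi> \<xi> x * \<Gamma> \<xi> h x - ?Z x h = ?a / n + ?b / n ^ 2" by simp
    have sc1: "\<bar>s x\<bar> \<le> 1" "\<bar>c x\<bar> \<le> 1" by (simp_all add: s_def c_def)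
    have "\<bar>s x * c x\<bar> \<le> 1 * 1" "\<bar>s x * s x\<bar> \<le> 1 * 1" unfolding abs_mult using sc1 by (intro mult_mono; simp)+
    then have "\<bar>?a\<bar> \<le> 1 * M1" "\<bar>?b\<bar> \<le> 1 * M2"
      using M1(2)[OF h, of x] M2(2)[OF h, of x] unfolding abs_mult[of "s x * s x"] abs_mult[of "s x * c x", symmetric] mult.assoc[of "s x * c x"]
      by (subst abs_mult, intro mult_mono; simp)+
    then have "\<bar>?a / n\<bar> \<le> M1 / n" "\<bar>?b / n ^ 2\<bar> \<le> M2 / n"
      using n M2(1) by (auto simp: abs_mult divide_right_mono power2_eq_square intro!: frac_le)
    moreover have "M1 / n + M2 / n \<le> \<eta>" using n by (simp add: field_simps flip: add_divide_distrib)
    ultimately show ?thesis unfolding E using abs_triangle_ineq[of "?a / n" "?b / n ^ 2"] by linarith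
  qed
  then show "\<exists>Z. admissible Z \<and> (\<forall>x. \<forall>h\<in>FF. \<bar>b x * \<Gamma> \<xi> \<xi> x * \<Gamma> \<xi> h x - Z x h\<bar> \<le> \<eta>)"
    using admissible_bracket[OF f' sc(2)] by blast
qed

text \<open>Polarization: the vectors \<open>g(w,w) w\<close> span the tangent space.\<close>

lemma tangent_span:
  assumes v: "v \<in> tangent_space A x"
  obtains c :: "nat \<Rightarrow> real" and \<xi> :: "nat \<Rightarrow> 'm \<Rightarrow> real" where "\<And>i. \<xi> i \<in> smooth_functions A"
    "\<And>h. (\<Sum>i<4. c i * \<Gamma> (\<xi> i) (\<xi> i) x * \<Gamma> (\<xi> i) h x) = v h"
proof (cases "\<exists>w0\<in>tangent_space A x. g x w0 w0 \<noteq> 0")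
  case False
  \<comment> \<open>If every vector is null, polarization makes the form vanish, and nondegeneracy
    leaves only the zero vector.\<close>
  have "v = (\<lambda>f. 0)"
  proof (rule g_nondeg[OF v])
    fix w assume w: "w \<in> tangent_space A x"
    have vw: "(\<lambda>f. 1 * v f + 1 * w f) \<in> tangent_space A x" by (rule tangent_lincomb[OF A v w])
    have "g x (\<lambda>f. 1 * v f + 1 * w f) (\<lambda>f. 1 * v f + 1 * w f) = g x v v + 2 * g x v w + g x w w"
      unfolding g_lin[OF v w vw] g_lin_right[OF v w v] g_lin_right[OF v w w] using g_sym[OF v w] by simp
    then show "g x v w = 0" using False v w vw by auto
  qed
  then show ?thesis using smooth_functions_const[OF A, of 0] by (intro that[of "\<lambda>i. \<lambda>y. 0" "\<lambda>i. 0"]) auto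
next
  case True
  then obtain w0 where w0: "w0 \<in> tangent_space A x" "g x w0 w0 \<noteq> 0" by blast
  define p where "p = (\<lambda>f. 1 * v f + 1 * w0 f)"
  define m where "m = (\<lambda>f. 1 * v f + (-1) * w0 f)"
  have pm: "p \<in> tangent_space A x" "m \<in> tangent_space A x" unfolding p_def m_def by (intro tangent_lincomb[OF A] v w0)+
  have ph: "p h = v h + w0 h" and mh: "m h = v h - w0 h" for h by (simp_all add: p_def m_def)
  let ?q = "\<lambda>w. g x w w"
  have qp: "?q p = ?q v + 2 * g x v w0 + ?q w0"
    unfolding p_def g_lin[OF v w0(1) pm(1)[unfolded p_def]] g_lin_right[OF v w0(1) v] g_lin_right[OF v w0(1) w0(1)]
    using g_sym[OF v w0(1)] by simp
  have qm: "?q m = ?q v - 2 * g x v w0 + ?q w0"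
    unfolding m_def g_lin[OF v w0(1) pm(2)[unfolded m_def]] g_lin_right[OF v w0(1) v] g_lin_right[OF v w0(1) w0(1)]
    using g_sym[OF v w0(1)] by simp
  define w where "w i = (if i = 0 then p else if i = 1 then m else if i = 2 then v else w0)" for i :: nat
  \<comment> \<open>With q(w) = g(w, w), expanding gives q(p) p + q(m) m = 2 (q(v) + q(w0)) v + 4
    g(v, w0) w0. Removing 2 q(v) v and the multiple of w0 leaves 2 q(w0) v. The last coefficient is
    divided by q(w0) once more, since w0 enters only as q(w0) w0.\<close>
  define c where "c i = (if i = 0 then 1 / (2 * ?q w0) else if i = 1 then 1 / (2 * ?q w0) else if i = 2 then - 2 / (2 * ?q w0)
    else - (4 * g x v w0 / ?q w0) / (2 * ?q w0))" for i :: nat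
  have "w i \<in> tangent_space A x" for i using pm v w0 by (simp add: w_def)
  then have "\<exists>\<xi>. \<xi> \<in> smooth_functions A \<and> gradient A g \<xi> x = w i" for i by (rule tangent_is_gradient) blast
  then have "\<forall>i. \<exists>\<xi>. \<xi> \<in> smooth_functions A \<and> gradient A g \<xi> x = w i" by blast
  from choice[OF this] obtain \<xi> where \<xi>: "\<And>i. \<xi> i \<in> smooth_functions A" "\<And>i. gradient A g (\<xi> i) x = w i" by blast
  have "(\<Sum>i<4. c i * \<Gamma> (\<xi> i) (\<xi> i) x * \<Gamma> (\<xi> i) h x) = v h" for h
  proof -
    have 1: "\<Gamma> (\<xi> i) (\<xi> i) x = ?q (w i)" "\<Gamma> (\<xi> i) h x = w i h" for i
      using \<Gamma>_g[OF \<xi>(1) \<xi>(1), of i i x] \<xi>(2) by (simp_all add: \<Gamma>_def)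
    have 2: "{..<4} = {0, 1, 2, 3::nat}" by auto
    have "(\<Sum>i<4. c i * \<Gamma> (\<xi> i) (\<xi> i) x * \<Gamma> (\<xi> i) h x)
        = (?q p * p h + ?q m * m h - 2 * ?q v * v h - 4 * g x v w0 * w0 h) / (2 * ?q w0)"
      unfolding 1 2 using w0(2) by (simp add: w_def c_def field_simps)
    also have "\<dots> = v h"
      unfolding qp qm using w0(2) by (simp add: ph mh field_simps)
    finally show ?thesis .
  qed
  then show ?thesis using that[of \<xi> c] \<xi>(1) by blast
qed

text \<open>The representation of \<open>tangent_span\<close> is exact at one point
  \<open>p\<close>. With its potentials and coefficients frozen it stays within
  \<open>\<eta>\<close> of \<open>Y\<close> near \<open>p\<close> by continuity, and a convex
  combination of such local approximations keeps the error.\<close>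

theorem admissible_tangent_field:
  assumes Y: "\<And>x. Y x \<in> tangent_space A x" and cY: "cfield Y"
  shows "admissible Y"
proof (rule admissible_limit)
  fix \<eta> :: real assume \<eta>: "\<eta> > 0"
  let ?Z = "\<lambda>c \<xi> x h. \<Sum>i<4::nat. c i * \<Gamma> (\<xi> i) (\<xi> i) x * \<Gamma> (\<xi> i) h x"
  let ?P = "\<lambda>p \<beta> V c \<xi>. \<beta> \<in> smooth_functions A \<and> open V \<and> p \<in> V \<and> (\<forall>y\<in>V. \<beta> y = 1) \<and> (\<forall>y. \<beta> y \<ge> 0) \<and>
    (\<forall>i. \<xi> i \<in> smooth_functions A) \<and> (\<forall>y h. h \<in> FF \<longrightarrow> \<beta> y \<noteq> 0 \<longrightarrow> \<bar>Y y h - ?Z c \<xi> y h\<bar> \<le> \<eta>)"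
  have "\<exists>\<beta> V c \<xi>. ?P p \<beta> V c \<xi>" for p
  proof -
    obtain c :: "nat \<Rightarrow> real" and \<xi> :: "nat \<Rightarrow> 'm \<Rightarrow> real" where \<xi>: "\<And>i. \<xi> i \<in> smooth_functions A" "\<And>h. ?Z c \<xi> p h = Y p h"
      by (rule tangent_span[OF Y]) blast
    have cont: "continuous_on UNIV (\<lambda>y. \<bar>Y y h - ?Z c \<xi> y h\<bar>)" if "h \<in> FF" for h
    proof -
      have "(\<lambda>x. \<Sum>i<4. c i * (\<Gamma> (\<xi> i) (\<xi> i) x * \<Gamma> (\<xi> i) h x)) \<in> smooth_functions A"
        using that FF(2) by (intro smooth_functions_sum[OF A] smooth_functions_cmult[OF A] smooth_functions_mult[OF A] \<Gamma>_smooth \<xi>(1)) blast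
      from smooth_functions_continuous[OF A this] have "continuous_on UNIV (\<lambda>y. ?Z c \<xi> y h)" by (simp add: mult.assoc)
      then show ?thesis using cY that by (auto simp: cfield_def intro!: continuous_on_rabs continuous_on_diff)
    qed
    define N where "N = (\<Inter>h\<in>FF. (\<lambda>y. \<bar>Y y h - ?Z c \<xi> y h\<bar>) -` {..<\<eta>})"
    have N: "open N" "p \<in> N"
      unfolding N_def using FF(1) \<eta> \<xi>(2) by (auto intro!: open_INT open_vimage[OF open_lessThan] cont)
    obtain U \<phi> where U: "(U, \<phi>) \<in> A" "p \<in> U" using atlas_cover[OF A] by metis
    have W: "open (N \<inter> U)" "p \<in> N \<inter> U" "N \<inter> U \<subseteq> U" using N U chart_open[OF atlas_chart[OF A U(1)]] by auto
    obtain \<beta> :: "'m \<Rightarrow> real" and V K where b: "smooth_map_on UNIV A std_atlas \<beta>" "open V" "p \<in> V" "V \<subseteq> K" "closed K" "K \<subseteq> N \<inter> U"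
      "\<And>y. y \<in> V \<Longrightarrow> \<beta> y = 1" "\<And>y. y \<notin> K \<Longrightarrow> \<beta> y = 0" "\<And>y. \<beta> y \<ge> 0"
      by (rule manifold_bump[OF A U(1) W]) blast
    have "\<bar>Y y h - ?Z c \<xi> y h\<bar> \<le> \<eta>" if "h \<in> FF" "\<beta> y \<noteq> 0" for y h
    proof -
      have "y \<in> N" using b(6) b(8)[of y] that(2) by auto
      then show ?thesis using that(1) by (auto simp: N_def less_imp_le)
    qed
    then show ?thesis
      by (intro exI[of _ \<beta>] exI[of _ V] exI[of _ c] exI[of _ \<xi>]) (use b \<xi>(1) in \<open>auto simp: smooth_functions_iff\<close>)
  qed
  then have "\<forall>p. \<exists>\<beta> V c \<xi>. ?P p \<beta> V c \<xi>" by blast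
  from choice[OF this] obtain \<beta> where "\<forall>p. \<exists>V c \<xi>. ?P p (\<beta> p) V c \<xi>" ..
  from choice[OF this] obtain V where "\<forall>p. \<exists>c \<xi>. ?P p (\<beta> p) (V p) c \<xi>" ..
  from choice[OF this] obtain c where "\<forall>p. \<exists>\<xi>. ?P p (\<beta> p) (V p) (c p) \<xi>" ..
  from choice[OF this] obtain \<xi> where *: "\<forall>p. ?P p (\<beta> p) (V p) (c p) (\<xi> p)" ..
  have P: "\<beta> p \<in> smooth_functions A" "open (V p)" "p \<in> V p" "y \<in> V p \<Longrightarrow> \<beta> p y = 1" "\<beta> p y \<ge> 0" "\<xi> p i \<in> smooth_functions A"
    "h \<in> FF \<Longrightarrow> \<beta> p y \<noteq> 0 \<Longrightarrow> \<bar>Y y h - ?Z (c p) (\<xi> p) y h\<bar> \<le> \<eta>" for p y i h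
    using *[rule_format, of p] by simp_all
  obtain D where D: "finite D" "UNIV \<subseteq> (\<Union>p\<in>D. V p)"
    by (rule compactE_image[OF compact_UNIV, of UNIV V]) (use P in auto)
  define S where "S y = (\<Sum>p\<in>D. \<beta> p y)" for y
  have Spos: "S y > 0" for y
  proof -
    obtain p where p: "p \<in> D" "y \<in> V p" using D(2) by auto
    have "\<beta> p y \<le> S y" unfolding S_def by (rule member_le_sum[OF p(1) _ D(1)]) (rule P(5))
    then show ?thesis using P(4)[OF p(2)] by simp
  qed
  have S: "S \<in> smooth_functions A" unfolding S_def by (rule smooth_functions_sum[OF A P(1)])
  have "smooth_map_on UNIV A std_atlas (\<lambda>y. inverse (S y))"
    by (rule smooth_fun_compose[OF A open_UNIV S[unfolded smooth_functions_iff] smooth_on_inverse])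
      (use Spos in \<open>auto simp: less_imp_neq[symmetric]\<close>)
  then have iS: "(\<lambda>y. inverse (S y)) \<in> smooth_functions A" by (simp add: smooth_functions_iff)
  define \<theta> where "\<theta> p y = \<beta> p y * inverse (S y)" for p y
  have \<theta>: "\<theta> p \<in> smooth_functions A" for p unfolding \<theta>_def by (rule smooth_functions_mult[OF A P(1) iS])
  have \<theta>1: "(\<Sum>p\<in>D. \<theta> p y) = 1" for y
    using Spos[of y] by (simp add: \<theta>_def S_def flip: sum_distrib_right)
  have \<theta>0: "\<theta> p y \<ge> 0" for p y using Spos[of y] P(5) by (simp add: \<theta>_def)
  let ?W = "\<lambda>x h. \<Sum>j\<in>D \<times> {..<4::nat}. (\<theta> (fst j) x * c (fst j) (snd j)) * \<Gamma> (\<xi> (fst j) (snd j)) (\<xi> (fst j) (snd j)) x * \<Gamma> (\<xi> (fst j) (snd j)) h x"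
  have bs: "(\<lambda>x. \<theta> p x * c p i) \<in> smooth_functions A" for p i
    by (rule smooth_functions_mult[OF A \<theta> smooth_functions_const[OF A]])
  have "admissible ?W"
  proof (rule admissible_sum)
    fix j
    show "admissible (\<lambda>x h. (\<theta> (fst j) x * c (fst j) (snd j)) * \<Gamma> (\<xi> (fst j) (snd j)) (\<xi> (fst j) (snd j)) x * \<Gamma> (\<xi> (fst j) (snd j)) h x)"
      by (rule admissible_weighted_gradient[OF bs P(6)])
    show "cfield (\<lambda>x h. (\<theta> (fst j) x * c (fst j) (snd j)) * \<Gamma> (\<xi> (fst j) (snd j)) (\<xi> (fst j) (snd j)) x * \<Gamma> (\<xi> (fst j) (snd j)) h x)"
      unfolding cfield_def
    proof
      fix h assume "h \<in> FF"
      then have "h \<in> smooth_functions A" using FF(2) by blast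
      then show "continuous_on UNIV (\<lambda>x. (\<theta> (fst j) x * c (fst j) (snd j)) * \<Gamma> (\<xi> (fst j) (snd j)) (\<xi> (fst j) (snd j)) x * \<Gamma> (\<xi> (fst j) (snd j)) h x)"
        by (intro smooth_functions_continuous[OF A] smooth_functions_mult[OF A] \<Gamma>_smooth P(6) \<theta> smooth_functions_const[OF A])
    qed
  qed (use D(1) in auto)
  moreover have "\<bar>Y x h - ?W x h\<bar> \<le> \<eta>" if h: "h \<in> FF" for x h
  proof -
    have "?W x h = (\<Sum>p\<in>D. \<theta> p x * ?Z (c p) (\<xi> p) x h)"
      by (simp add: sum.cartesian_product case_prod_unfold sum_distrib_left mult.assoc)
    moreover have "Y x h = (\<Sum>p\<in>D. \<theta> p x * Y x h)" using \<theta>1[of x] by (simp flip: sum_distrib_right)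
    ultimately have E: "Y x h - ?W x h = (\<Sum>p\<in>D. \<theta> p x * (Y x h - ?Z (c p) (\<xi> p) x h))"
      by (simp add: right_diff_distrib sum_subtractf)
    have "\<bar>\<Sum>p\<in>D. \<theta> p x * (Y x h - ?Z (c p) (\<xi> p) x h)\<bar> \<le> (\<Sum>p\<in>D. \<bar>\<theta> p x * (Y x h - ?Z (c p) (\<xi> p) x h)\<bar>)" by (rule sum_abs)
    also have "\<dots> \<le> (\<Sum>p\<in>D. \<theta> p x * \<eta>)"
    proof (rule sum_mono)
      fix p
      show "\<bar>\<theta> p x * (Y x h - ?Z (c p) (\<xi> p) x h)\<bar> \<le> \<theta> p x * \<eta>"
      proof (cases "\<beta> p x = 0")
        case True
        then have "\<theta> p x = 0" by (simp add: \<theta>_def)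
        then show ?thesis by (simp only: mult_zero_left abs_zero order_refl)
      next
        case False
        show ?thesis
          unfolding abs_mult abs_of_nonneg[OF \<theta>0] by (rule mult_left_mono[OF P(7)[OF h False] \<theta>0])
      qed
    qed
    also have "\<dots> = \<eta>" using \<theta>1[of x] by (simp flip: sum_distrib_right)
    finally show ?thesis unfolding E .
  qed
  ultimately show "\<exists>Z. admissible Z \<and> (\<forall>x. \<forall>h\<in>FF. \<bar>Y x h - Z x h\<bar> \<le> \<eta>)"
    by (intro exI[of _ ?W] conjI allI ballI)
qed

end

end

subsection \<open>Lipschitz estimates for smooth maps\<close>

lemma onorm_le_sum_Basis:
  fixes D :: "'a::euclidean_space \<Rightarrow> 'b::real_normed_vector"
  assumes "linear D"
  shows "onorm D \<le> (\<Sum>b\<in>Basis. norm (D b))"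
proof (rule onorm_bound)
  fix v
  have "norm (D v) = norm (\<Sum>b\<in>Basis. (v \<bullet> b) *\<^sub>R D b)" using linear_euclidean_sum[OF assms, of v] by metis
  also have "\<dots> \<le> (\<Sum>b\<in>Basis. norm ((v \<bullet> b) *\<^sub>R D b))" by (rule norm_sum)
  also have "\<dots> \<le> (\<Sum>b\<in>Basis. norm v * norm (D b))"
    unfolding norm_scaleR by (intro sum_mono mult_right_mono) (auto intro: Basis_le_norm)
  also have "\<dots> = (\<Sum>b\<in>Basis. norm (D b)) * norm v" by (simp add: sum_distrib_left mult.commute)
  finally show "norm (D v) \<le> (\<Sum>b\<in>Basis. norm (D b)) * norm v" .
qed (auto intro: sum_nonneg)

lemma smooth_locally_Lipschitz:
  fixes f :: "'a::euclidean_space \<Rightarrow> 'b::real_normed_vector"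
  assumes f: "smooth_on S f" and S: "open S" "x \<in> S"
  obtains r L where "r > 0" "L > 0" "ball x r \<subseteq> S" "\<And>y z. y \<in> ball x r \<Longrightarrow> z \<in> ball x r \<Longrightarrow> norm (f y - f z) \<le> L * norm (y - z)"
proof -
  obtain r where r: "r > 0" "cball x r \<subseteq> S" using S open_contains_cball by blast
  let ?N = "\<lambda>y. \<Sum>b\<in>Basis. norm (frechet_derivative f (at y) b)"
  have "continuous_on (cball x r) ?N"
    by (intro continuous_intros continuous_on_subset[OF smooth_on_continuous[OF smooth_on_frechet[OF f]] r(2)])
  then have "bounded (?N ` cball x r)" by (intro compact_imp_bounded compact_continuous_image) auto
  then obtain L where L: "L > 0" "\<And>y. y \<in> cball x r \<Longrightarrow> norm (?N y) \<le> L" unfolding bounded_pos by blast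
  have B: "norm (f y - f z) \<le> L * norm (y - z)" if "y \<in> ball x r" "z \<in> ball x r" for y z
  proof (rule differentiable_bound[OF convex_ball _ _ that])
    fix w assume w: "w \<in> ball x r"
    then have wS: "w \<in> S" using r(2) by auto
    note D = smooth_on_has_derivative[OF f wS]
    show "(f has_derivative frechet_derivative f (at w)) (at w within ball x r)" by (rule has_derivative_at_withinI[OF D])
    have "onorm (frechet_derivative f (at w)) \<le> ?N w"
      using D by (intro onorm_le_sum_Basis) (simp add: has_derivative_def bounded_linear.linear)
    also have "\<dots> \<le> L" using L(2)[of w] w by auto
    finally show "onorm (frechet_derivative f (at w)) \<le> L" .
  qed
  have rS: "ball x r \<subseteq> S" using r(2) by auto
  show ?thesis by (rule that[OF r(1) L(1) rS B])
qed

text \<open>The injectivity half of the inverse function theorem, uniform in the time variable: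
  subtracting the linear map \<open>L\<close> leaves a function with Lipschitz constant
  \<open>B / 2\<close>, while \<open>L\<close> stretches by at least \<open>B\<close>.\<close>

lemma smooth_lower_bound:
  fixes h :: "real \<times> 'a::euclidean_space \<Rightarrow> 'b::euclidean_space"
  assumes h: "smooth_on W h" and W: "open W" "(t, x) \<in> W" and inj: "inj (\<lambda>v. frechet_derivative h (at (t, x)) (0, v))"
  obtains r c where "r > 0" "c > 0" "ball t r \<times> ball x r \<subseteq> W"
    "\<And>s u u'. s \<in> ball t r \<Longrightarrow> u \<in> ball x r \<Longrightarrow> u' \<in> ball x r \<Longrightarrow> c * norm (u - u') \<le> norm (h (s, u) - h (s, u'))"
proof -
  let ?D = "\<lambda>z v. frechet_derivative h (at z) (0, v)"
  define L where "L = ?D (t, x)"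
  have lin: "linear (?D z)" if "z \<in> W" for z
  proof -
    have "linear (frechet_derivative h (at z))"
      using smooth_on_has_derivative[OF h that] by (simp add: has_derivative_def bounded_linear.linear)
    then have "linear (frechet_derivative h (at z) \<circ> (\<lambda>v. (0, v)))"
      by (intro linear_compose[rotated]) (auto intro!: linearI)
    then show ?thesis by (simp add: o_def)
  qed
  have linL: "linear L" unfolding L_def by (rule lin[OF W(2)])
  obtain B where B: "B > 0" "\<And>w. B * norm w \<le> norm (L w)"
    using linear_inj_bounded_below_pos[OF linL] inj unfolding L_def by metis
  define E where "E z = (\<Sum>b\<in>Basis. norm (?D z b - L b))" for z
  have "continuous_on W E"
    unfolding E_def by (intro continuous_intros smooth_on_continuous[OF smooth_on_frechet[OF h]])
  then have "open (W \<inter> E -` {..<B / 2})" by (rule continuous_open_preimage[OF _ W(1) open_lessThan])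
  moreover have "(t, x) \<in> W \<inter> E -` {..<B / 2}" using W(2) B(1) by (simp add: E_def L_def)
  ultimately obtain I X where IX: "open I" "open X" "(t, x) \<in> I \<times> X" "I \<times> X \<subseteq> W \<inter> E -` {..<B / 2}"
    by (rule open_prod_elim) blast
  obtain r1 r2 where r12: "r1 > 0" "ball t r1 \<subseteq> I" "r2 > 0" "ball x r2 \<subseteq> X"
    using IX open_contains_ball by (metis mem_Sigma_iff)
  define r where "r = min r1 r2"
  have r: "r > 0" "ball t r \<times> ball x r \<subseteq> W \<inter> E -` {..<B / 2}"
    using r12 IX(4) unfolding r_def by (auto simp: subset_iff)
  have low: "B / 2 * norm (u - u') \<le> norm (h (s, u) - h (s, u'))" if s: "s \<in> ball t r" and u: "u \<in> ball x r" "u' \<in> ball x r" for s u u'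
  proof -
    have "norm ((h (s, u) - L u) - (h (s, u') - L u')) \<le> B / 2 * norm (u - u')"
    proof (rule differentiable_bound[OF convex_ball _ _ u, where f'="\<lambda>w v. ?D (s, w) v - L v"])
      fix w assume w: "w \<in> ball x r"
      have "(s, w) \<in> W \<inter> E -` {..<B / 2}" using subsetD[OF r(2)] s w by blast
      then have sw: "(s, w) \<in> W" "E (s, w) < B / 2" by simp_all
      have "((\<lambda>w. (s, w)) has_derivative (\<lambda>v. (0, v))) (at w)" by (auto intro!: derivative_eq_intros)
      from has_derivative_compose[OF this smooth_on_has_derivative[OF h sw(1)]]
      have "((\<lambda>w. h (s, w)) has_derivative ?D (s, w)) (at w)" .
      then show "((\<lambda>w. h (s, w) - L w) has_derivative (\<lambda>v. ?D (s, w) v - L v)) (at w within ball x r)"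
        by (rule has_derivative_at_withinI[OF has_derivative_diff[OF _ linear_imp_has_derivative[OF linL]]])
      have "onorm (\<lambda>v. ?D (s, w) v - L v) \<le> E (s, w)"
        unfolding E_def by (rule onorm_le_sum_Basis[OF linear_compose_sub[OF lin[OF sw(1)] linL]])
      then show "onorm (\<lambda>v. ?D (s, w) v - L v) \<le> B / 2" using sw(2) by simp
    qed
    moreover have "(h (s, u) - L u) - (h (s, u') - L u') = (h (s, u) - h (s, u')) - L (u - u')" by (simp add: linear_diff[OF linL])
    ultimately have "norm (L (u - u')) - norm (h (s, u) - h (s, u')) \<le> B / 2 * norm (u - u')"
      using norm_triangle_ineq2[of "L (u - u')" "h (s, u) - h (s, u')"] by (simp add: norm_minus_commute)
    then show ?thesis using B(2)[of "u - u'"] by simp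
  qed
  have W': "ball t r \<times> ball x r \<subseteq> W" and B2: "B / 2 > 0" using r(2) B(1) by auto
  show ?thesis by (rule that[OF r(1) B2 W' low])
qed

subsection \<open>Isotopies\<close>

context pseudo_riemannian
begin

context
  fixes FF :: "('m \<Rightarrow> real) set" and H :: "real \<Rightarrow> 'm \<Rightarrow> 'm" and J :: "real set"
  assumes FF: "finite FF" "FF \<subseteq> smooth_functions A" "\<forall>x y. (\<forall>f\<in>FF. f x = f y) \<longrightarrow> x = y"
    and FF_chart: "\<And>x. \<exists>U \<phi> V. (U, \<phi>) \<in> A \<and> open V \<and> x \<in> V \<and> V \<subseteq> U \<and>
      (\<forall>y\<in>V. \<forall>z\<in>V. norm (\<phi> y - \<phi> z) \<le> real DIM('e) * (\<Sum>f\<in>FF. \<bar>f y - f z\<bar>))"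
    and J: "open J" "{0..1} \<subseteq> J"
    and H: "smooth_map_on (J \<times> UNIV) (prod_atlas std_atlas A) A (\<lambda>(t, x). H t x)"
    and H_diff: "\<forall>t\<in>{0..1}. diffeomorphism A (H t)"
begin

abbreviation "dF \<equiv> d FF"

lemma dF_eq: "dF x y = (\<Sum>f\<in>FF. \<bar>f x - f y\<bar>)"
  by (rule d_def[OF FF])

lemma cfield_FF: "cfield FF Y \<longleftrightarrow> (\<forall>f\<in>FF. continuous_on UNIV (\<lambda>x. Y x f))"
  by (rule cfield_def[OF FF])

lemmas AP = smooth_atlas_prod[OF smooth_atlas_std A]

lemma H_smooth: "smooth_map_on (J \<times> UNIV) (prod_atlas std_atlas A) A (\<lambda>z. H (fst z) (snd z))"
  using H by (simp add: case_prod_unfold)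

lemma H_continuous: "continuous_on (J \<times> UNIV) (\<lambda>z. H (fst z) (snd z))"
  by (rule smooth_map_on_continuous[OF H_smooth])

lemma open_J_UNIV: "open (J \<times> (UNIV :: 'm set))" using J(1) by (intro open_Times) auto

lemma H_inverse:
  assumes "t \<in> {0..1}"
  obtains G where "smooth_map_on UNIV A A G" "\<And>x. G (H t x) = x" "\<And>x. H t (G x) = x"
  using bspec[OF H_diff assms] unfolding diffeomorphism_def by (metis comp_apply id_apply)

text \<open>The comparison opposite to \<open>FF_chart\<close>: smooth functions are locally
  Lipschitz in a chart.\<close>

lemma d_upper:
  assumes U: "(U, \<phi>) \<in> A" "p \<in> U"
  obtains V L where "open V" "p \<in> V" "V \<subseteq> U" "L > 0" "\<And>y z. y \<in> V \<Longrightarrow> z \<in> V \<Longrightarrow> dF y z \<le> L * norm (\<phi> y - \<phi> z)"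
proof -
  note cU = atlas_chart[OF A U(1)]
  let ?P = "\<lambda>f r L. r > 0 \<and> L > 0 \<and> (\<forall>y\<in>ball (\<phi> p) r. \<forall>z\<in>ball (\<phi> p) r. norm (f (inv_into U \<phi> y) - f (inv_into U \<phi> z)) \<le> L * norm (y - z))"
  have "\<forall>f\<in>FF. \<exists>r L. ?P f r L"
  proof
    fix f assume "f \<in> FF"
    then have "smooth_on (\<phi> ` U) (\<lambda>y. f (inv_into U \<phi> y))" using smooth_functions_chart[OF A _ U(1)] FF(2) by blast
    then show "\<exists>r L. ?P f r L"
      by (rule smooth_locally_Lipschitz[OF _ chart_image_open[OF cU], of _ "\<phi> p"]) (use U(2) in blast)+
  qed
  from bchoice[OF this] obtain r where "\<forall>f\<in>FF. \<exists>L. ?P f (r f) L" ..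
  from bchoice[OF this] obtain L where rL: "\<forall>f\<in>FF. ?P f (r f) (L f)" ..
  define R where "R = Min (insert 1 (r ` FF))"
  have R: "R > 0" "\<And>f. f \<in> FF \<Longrightarrow> R \<le> r f" using FF(1) rL by (auto simp: R_def)
  define V where "V = U \<inter> \<phi> -` ball (\<phi> p) R"
  have "open V" unfolding V_def by (rule continuous_open_preimage[OF chart_continuous[OF cU] chart_open[OF cU] open_ball])
  moreover have "dF y z \<le> ((\<Sum>f\<in>FF. L f) + 1) * norm (\<phi> y - \<phi> z)" if "y \<in> V" "z \<in> V" for y z
  proof -
    have "dF y z \<le> (\<Sum>f\<in>FF. L f * norm (\<phi> y - \<phi> z))"
      unfolding dF_eq
    proof (rule sum_mono)
      fix f assume f: "f \<in> FF"
      have "\<phi> y \<in> ball (\<phi> p) (r f)" "\<phi> z \<in> ball (\<phi> p) (r f)" using that R(2)[OF f] by (auto simp: V_def)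
      then have "norm (f (inv_into U \<phi> (\<phi> y)) - f (inv_into U \<phi> (\<phi> z))) \<le> L f * norm (\<phi> y - \<phi> z)" using rL f by blast
      then show "\<bar>f y - f z\<bar> \<le> L f * norm (\<phi> y - \<phi> z)" using that by (simp add: V_def chart_inv[OF cU])
    qed
    also have "\<dots> \<le> ((\<Sum>f\<in>FF. L f) + 1) * norm (\<phi> y - \<phi> z)" by (simp add: distrib_right sum_distrib_right)
    finally show ?thesis .
  qed
  moreover have "(\<Sum>f\<in>FF. L f) + 1 > 0" using rL by (intro add_nonneg_pos sum_nonneg) (auto simp: less_imp_le)
  ultimately show ?thesis using that[of V "(\<Sum>f\<in>FF. L f) + 1"] U R(1) by (auto simp: V_def)
qed

text \<open>Close pairs of points cannot be squeezed by compactness alone, as both sides tend to 0;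
  here the invertible derivative of \<open>H t\<close> in charts bounds the contraction, for all
  times near \<open>t\<close> at once.\<close>

lemma H_lower_near_diagonal:
  assumes t: "t \<in> {0..1}"
  obtains I V C where "open I" "t \<in> I" "open V" "p \<in> V" "C > 0"
    "\<And>s y z. s \<in> I \<Longrightarrow> y \<in> V \<Longrightarrow> z \<in> V \<Longrightarrow> dF y z \<le> C * dF (H s y) (H s z)"
proof -
  let ?F = "\<lambda>z. H (fst z) (snd z)"
  obtain U \<phi> where U: "(U, \<phi>) \<in> A" "p \<in> U" using atlas_cover[OF A] by metis
  note cU = atlas_chart[OF A U(1)]
  obtain U' \<psi> V' where V': "(U', \<psi>) \<in> A" "open V'" "H t p \<in> V'" "V' \<subseteq> U'"
    "\<forall>y\<in>V'. \<forall>z\<in>V'. norm (\<psi> y - \<psi> z) \<le> real DIM('e) * (\<Sum>f\<in>FF. \<bar>f y - f z\<bar>)" using FF_chart[of "H t p"] by blast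
  note cU' = atlas_chart[OF A V'(1)]
  have std: "(UNIV, id :: real \<Rightarrow> real) \<in> std_atlas" by (simp add: std_atlas_def)
  note cid = atlas_chart[OF smooth_atlas_std std]
  note pc = prod_chart[OF cid cU]
  let ?m = "map_prod (id :: real \<Rightarrow> real) \<phi>"
  have tp: "(t, p) \<in> J \<times> UNIV" "(t, p) \<in> UNIV \<times> U" "?F (t, p) \<in> U'" using t J(2) U(2) V'(3,4) by auto
  obtain W where W: "open W" "(t, p) \<in> W" "W \<subseteq> UNIV \<times> U" "W \<subseteq> J \<times> UNIV" "?F ` W \<subseteq> U'"
    "smooth_on (?m ` W) (\<psi> \<circ> ?F \<circ> inv_into (UNIV \<times> U) ?m)"
    by (rule smooth_map_on_nbhd[OF AP A H_smooth open_J_UNIV tp(1) prod_atlasI[OF std U(1)] tp(2) V'(1) tp(3)]) blast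
  have cW: "continuous_on W ?F" by (rule continuous_on_subset[OF H_continuous W(4)])
  define W' where "W' = W \<inter> ?F -` V'"
  have W': "open W'" "(t, p) \<in> W'" "W' \<subseteq> UNIV \<times> U" "W' \<subseteq> W"
    unfolding W'_def using continuous_open_preimage[OF cW W(1) V'(2)] W(2,3) V'(3) by auto
  define h where "h = \<psi> \<circ> ?F \<circ> inv_into (UNIV \<times> U) ?m"
  have h_eq: "h (s, \<phi> y) = \<psi> (H s y)" if "y \<in> U" for s y
    using that pc(2)[of "(s, \<phi> y)"] chart_inv[OF cU that] chart_inv[OF cid, of s] by (simp add: h_def)
  have oW: "open (?m ` W')" by (rule chart_open_image[OF pc(1) W'(1,3)])
  have sh: "smooth_on (?m ` W') h" unfolding h_def by (rule smooth_on_subset[OF W(6)]) (use W'(4) in auto)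
  have tpW: "(t, \<phi> p) \<in> ?m ` W'" using W'(2) by (force simp: image_iff)
  obtain G where G: "smooth_map_on UNIV A A G" "\<And>x. G (H t x) = x" "\<And>x. H t (G x) = x" using H_inverse[OF t] by metis
  have GU: "H t p \<in> U'" "G (H t p) \<in> U" using V'(3,4) U(2) G(2) by auto
  obtain X where X: "open X" "H t p \<in> X" "X \<subseteq> U'" "X \<subseteq> UNIV" "G ` X \<subseteq> U" "smooth_on (\<psi> ` X) (\<phi> \<circ> G \<circ> inv_into U' \<psi>)"
    by (rule smooth_map_on_nbhd[OF A A G(1) open_UNIV UNIV_I V'(1) GU(1) U(1) GU(2)]) blast
  define Q where "Q = (\<lambda>y. (t, y)) -` (W' \<inter> ?F -` X)"
  have "open (W' \<inter> ?F -` X)" by (rule continuous_open_preimage[OF continuous_on_subset[OF cW W'(4)] W'(1) X(1)])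
  then have "open Q" unfolding Q_def by (rule open_vimage) (intro continuous_intros)
  moreover have "p \<in> Q" using W'(2) X(2) by (simp add: Q_def)
  moreover have "Q \<subseteq> U" using W'(3) by (auto simp: Q_def)
  ultimately have Q: "open Q" "p \<in> Q" "Q \<subseteq> U" .
  \<comment> \<open>The chain rule for the smooth inverse \<open>G\<close> after \<open>H t\<close>
    provides a left inverse of the derivative. \<open>Q\<close> consists of points where this
    composition can be read in the chosen charts.\<close>
  have "inj (\<lambda>v. frechet_derivative h (at (t, \<phi> p)) (0, v))"
  proof -
    let ?k = "\<phi> \<circ> G \<circ> inv_into U' \<psi>"
    have "((\<lambda>w. (t, w)) has_derivative (\<lambda>v. (0, v))) (at (\<phi> p))" by (auto intro!: derivative_eq_intros)
    from has_derivative_compose[OF this smooth_on_has_derivative[OF sh tpW]]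
    have d1: "((\<lambda>w. h (t, w)) has_derivative (\<lambda>v. frechet_derivative h (at (t, \<phi> p)) (0, v))) (at (\<phi> p))" .
    have "h (t, \<phi> p) \<in> \<psi> ` X" using X(2) by (simp add: h_eq U(2))
    from has_derivative_compose[OF d1 smooth_on_has_derivative[OF X(6) this]]
    have d2: "((\<lambda>w. ?k (h (t, w))) has_derivative (\<lambda>v. frechet_derivative ?k (at (h (t, \<phi> p))) (frechet_derivative h (at (t, \<phi> p)) (0, v)))) (at (\<phi> p))" .
    have "((\<lambda>w. w) has_derivative (\<lambda>v. frechet_derivative ?k (at (h (t, \<phi> p))) (frechet_derivative h (at (t, \<phi> p)) (0, v)))) (at (\<phi> p))"
    proof (rule has_derivative_transform_within_open[OF d2 chart_open_image[OF cU Q(1,3)]])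
      show "\<phi> p \<in> \<phi> ` Q" using Q(2) by simp
      fix w assume "w \<in> \<phi> ` Q"
      then obtain y where y: "y \<in> Q" "w = \<phi> y" by blast
      then have "y \<in> U" "H t y \<in> U'" using Q(3) X(3) by (auto simp: Q_def)
      then show "?k (h (t, w)) = w" using y(2) by (simp add: h_eq chart_inv[OF cU'] G(2))
    qed
    from has_derivative_unique[OF this has_derivative_ident]
    have "frechet_derivative ?k (at (h (t, \<phi> p))) (frechet_derivative h (at (t, \<phi> p)) (0, v)) = v" for v
      by (simp add: fun_eq_iff)
    then show ?thesis by (rule inj_on_inverseI)
  qed
  then obtain r c where rc: "r > 0" "c > 0" "ball t r \<times> ball (\<phi> p) r \<subseteq> ?m ` W'"
    "\<And>s u u'. s \<in> ball t r \<Longrightarrow> u \<in> ball (\<phi> p) r \<Longrightarrow> u' \<in> ball (\<phi> p) r \<Longrightarrow> c * norm (u - u') \<le> norm (h (s, u) - h (s, u'))"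
    by (rule smooth_lower_bound[OF sh oW tpW]) blast
  obtain V1 L where V1: "open V1" "p \<in> V1" "V1 \<subseteq> U" "L > 0" "\<And>y z. y \<in> V1 \<Longrightarrow> z \<in> V1 \<Longrightarrow> dF y z \<le> L * norm (\<phi> y - \<phi> z)"
    by (rule d_upper[OF U]) blast
  define V where "V = V1 \<inter> \<phi> -` ball (\<phi> p) r"
  have V: "open V" "p \<in> V"
    unfolding V_def using continuous_open_preimage[OF continuous_on_subset[OF chart_continuous[OF cU] V1(3)] V1(1) open_ball] V1(2) rc(1) by auto
  \<comment> \<open>The chart estimate of \<open>FF_chart\<close> is valid in \<open>V'\<close>
    only; that the image points lie there is part of the construction of \<open>W'\<close>.\<close>
  have HV: "H s y \<in> V'" if "s \<in> ball t r" "y \<in> V" for s y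
  proof -
    have "(s, \<phi> y) \<in> ball t r \<times> ball (\<phi> p) r" using that by (auto simp: V_def)
    from subsetD[OF rc(3) this] obtain w where w: "(s, \<phi> y) = ?m w" "w \<in> W'" by (rule imageE)
    have "snd w \<in> U" "y \<in> U" using w(2) W'(3) that(2) V1(3) by (auto simp: V_def)
    then have "w = (s, y)" using w(1) chart_inj[OF cU] by (cases w) (auto simp: inj_on_def)
    then show ?thesis using w(2) by (simp add: W'_def)
  qed
  have "dF y z \<le> (L / c * real DIM('e)) * dF (H s y) (H s z)" if s: "s \<in> ball t r" and y: "y \<in> V" and z: "z \<in> V" for s y z
  proof -
    have yz: "y \<in> V1" "z \<in> V1" "\<phi> y \<in> ball (\<phi> p) r" "\<phi> z \<in> ball (\<phi> p) r" using y z by (auto simp: V_def)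
    have "c * norm (\<phi> y - \<phi> z) \<le> norm (\<psi> (H s y) - \<psi> (H s z))"
      using rc(4)[OF s yz(3,4)] yz(1,2) V1(3) by (simp add: h_eq subset_iff)
    also have "\<dots> \<le> real DIM('e) * dF (H s y) (H s z)" using V'(5) HV[OF s y] HV[OF s z] unfolding dF_eq by blast
    finally have "norm (\<phi> y - \<phi> z) \<le> real DIM('e) * dF (H s y) (H s z) / c" using rc(2) by (simp add: field_simps)
    then have "L * norm (\<phi> y - \<phi> z) \<le> L * (real DIM('e) * dF (H s y) (H s z) / c)" using V1(4) by (intro mult_left_mono) auto
    then show ?thesis using V1(5)[OF yz(1,2)] by (simp add: mult_ac)
  qed
  moreover have "L / c * real DIM('e) > 0" using V1(4) rc(2) by simp
  ultimately show ?thesis using that[of "ball t r" V "L / c * real DIM('e)"] V rc(1) by simp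
qed

text \<open>Compactness of time and of the space of pairs. Near the diagonal the derivative decides;
  away from it the images stay apart while \<open>dF\<close> is bounded.\<close>

lemma H_lower_bound:
  obtains C where "C > 0" "\<And>t x y. t \<in> {0..1} \<Longrightarrow> dF x y \<le> C * dF (H t x) (H t y)"
proof -
  have "compact (UNIV :: ('m \<times> 'm) set)" using compact_Times[OF compact_UNIV compact_UNIV] by simp
  moreover have "continuous_on (UNIV :: ('m \<times> 'm) set) (\<lambda>z. dF (fst z) (snd z))"
    by (intro d_continuous[OF FF] continuous_intros)
  ultimately have "bounded (range (\<lambda>z::'m \<times> 'm. dF (fst z) (snd z)))" by (intro compact_imp_bounded compact_continuous_image)
  then obtain M where M: "M > 0" "\<And>x y. dF x y \<le> M" unfolding bounded_pos by (metis abs_le_D1 fst_conv rangeI real_norm_def snd_conv)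
  let ?K = "{0..1::real} \<times> (UNIV :: ('m \<times> 'm) set)"
  let ?P = "\<lambda>w N C. open N \<and> w \<in> N \<and> C > 0 \<and> (\<forall>s y z. (s, y, z) \<in> N \<longrightarrow> dF y z \<le> C * dF (H s y) (H s z))"
  have "\<exists>N C. ?P w N C" if "w \<in> ?K" for w
  proof -
    obtain t x y where w: "w = (t, x, y)" "t \<in> {0..1}" using \<open>w \<in> ?K\<close> by auto
    show ?thesis
    proof (cases "x = y")
      case True
      obtain I V C where "open I" "t \<in> I" "open V" "x \<in> V" "C > 0"
        "\<And>s y z. s \<in> I \<Longrightarrow> y \<in> V \<Longrightarrow> z \<in> V \<Longrightarrow> dF y z \<le> C * dF (H s y) (H s z)"
        by (rule H_lower_near_diagonal[OF w(2), of x]) blast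
      then show ?thesis using True w(1) by (intro exI[of _ "I \<times> V \<times> V"] exI[of _ C]) (auto intro: open_Times)
    next
      case False
      \<comment> \<open>Nearby triples keep image distance above \<open>e / 2\<close>, and
        \<open>dF\<close> never exceeds \<open>M\<close>, which gives the constant
        \<open>2 * M / e\<close>.\<close>
      define e where "e = dF (H t x) (H t y)"
      have "H t x \<noteq> H t y" using False H_inverse[OF w(2)] by metis
      then have "e \<noteq> 0" using d_zero[OF FF] unfolding e_def by blast
      then have e: "e > 0" using d_nonneg[OF FF, of "H t x" "H t y"] unfolding e_def by linarith
      let ?S = "J \<times> (UNIV :: ('m \<times> 'm) set)"
      have oS: "open ?S" using J(1) by (intro open_Times) auto
      have "continuous_on ?S (\<lambda>w. dF (H (fst w) (fst (snd w))) (H (fst w) (snd (snd w))))"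
      proof (rule d_continuous[OF FF])
        have 1: "continuous_on ?S (\<lambda>w. (fst w, fst (snd w)))" "continuous_on ?S (\<lambda>w. (fst w, snd (snd w)))" by (intro continuous_intros)+
        have 2: "(\<lambda>w. (fst w, fst (snd w))) ` ?S \<subseteq> J \<times> UNIV" "(\<lambda>w. (fst w, snd (snd w))) ` ?S \<subseteq> J \<times> UNIV" by auto
        from continuous_on_compose2[OF H_continuous 1(1) 2(1)] show "continuous_on ?S (\<lambda>w. H (fst w) (fst (snd w)))" by simp
        from continuous_on_compose2[OF H_continuous 1(2) 2(2)] show "continuous_on ?S (\<lambda>w. H (fst w) (snd (snd w)))" by simp
      qed
      from continuous_open_preimage[OF this oS open_greaterThan, of "e / 2"]
      have o: "open (?S \<inter> (\<lambda>w. dF (H (fst w) (fst (snd w))) (H (fst w) (snd (snd w)))) -` {e / 2<..})" (is "open ?N") .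
      have "dF y z \<le> (2 * M / e) * dF (H s y) (H s z)" if "(s, y, z) \<in> ?N" for s y z
      proof -
        have "M = (2 * M / e) * (e / 2)" using e by simp
        also have "\<dots> \<le> (2 * M / e) * dF (H s y) (H s z)" using that M(1) e by (intro mult_left_mono) auto
        finally show ?thesis using M(2)[of y z] by simp
      qed
      moreover have "w \<in> ?N" using w e J(2) by (auto simp: e_def)
      ultimately show ?thesis using o M(1) e by (intro exI[of _ ?N] exI[of _ "2 * M / e"]) simp
    qed
  qed
  then have "\<forall>w\<in>?K. \<exists>N C. ?P w N C" by blast
  from bchoice[OF this] obtain N where "\<forall>w\<in>?K. \<exists>C. ?P w (N w) C" ..
  from bchoice[OF this] obtain C where NC: "\<forall>w\<in>?K. ?P w (N w) (C w)" ..
  have "compact ?K" by (intro compact_Times) (simp_all add: \<open>compact (UNIV :: ('m \<times> 'm) set)\<close>)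
  then obtain D where D: "D \<subseteq> ?K" "finite D" "?K \<subseteq> (\<Union>w\<in>D. N w)"
    by (rule compactE_image[of ?K ?K N]) (use NC in auto)
  define C0 where "C0 = (\<Sum>w\<in>D. C w) + 1"
  have Cpos: "C w \<ge> 0" if "w \<in> D" for w using NC D(1) that by (auto simp: less_imp_le)
  have "dF x y \<le> C0 * dF (H t x) (H t y)" if t: "t \<in> {0..1}" for t x y
  proof -
    obtain w where w: "w \<in> D" "(t, x, y) \<in> N w" using D(3) t by blast
    have "dF x y \<le> C w * dF (H t x) (H t y)" using NC D(1) w by blast
    also have "\<dots> \<le> C0 * dF (H t x) (H t y)"
      unfolding C0_def using member_le_sum[OF w(1) _ D(2), of C] Cpos d_nonneg[OF FF] by (intro mult_right_mono) (auto simp: add_increasing2)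
    finally show ?thesis .
  qed
  moreover have "C0 > 0" unfolding C0_def using Cpos by (intro add_nonneg_pos sum_nonneg) auto
  ultimately show ?thesis using that by blast
qed

section \<open>Velocity of the isotopy and approximation by small steps\<close>

definition D :: "('m \<Rightarrow> real) \<Rightarrow> real \<Rightarrow> 'm \<Rightarrow> real" where
  "D f t x = deriv (\<lambda>s. f (H s x)) t"

text \<open>In a product chart the time derivative is a directional derivative of a smooth function;
  uniqueness of derivatives shows that the local formulas fit together.\<close>

lemma D_props:
  assumes f: "f \<in> smooth_functions A"
  shows "t \<in> J \<Longrightarrow> ((\<lambda>s. f (H s x)) has_real_derivative D f t x) (at t)"
    and "continuous_on (J \<times> UNIV) (\<lambda>z. D f (fst z) (snd z))"
proof -
  have sK: "smooth_map_on (J \<times> UNIV) (prod_atlas std_atlas A) std_atlas (\<lambda>z. f (H (fst z) (snd z)))"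
    by (rule smooth_map_on_compose[OF AP A smooth_atlas_std H_smooth f[unfolded smooth_functions_iff] open_J_UNIV open_UNIV]) auto
  have std: "(UNIV, id :: real \<Rightarrow> real) \<in> std_atlas" by (simp add: std_atlas_def)
  note cid = atlas_chart[OF smooth_atlas_std std]
  have *: "\<exists>V K. open V \<and> x \<in> V \<and> continuous_on (J \<times> V) K \<and> (\<forall>t\<in>J. \<forall>y\<in>V. ((\<lambda>s. f (H s y)) has_real_derivative K (t, y)) (at t))" for x
  proof -
    obtain U \<phi> where U: "(U, \<phi>) \<in> A" "x \<in> U" using atlas_cover[OF A] by metis
    note cU = atlas_chart[OF A U(1)]
    note pc = prod_chart[OF cid cU]
    let ?m = "map_prod (id :: real \<Rightarrow> real) \<phi>"
    define k where "k w = f (H (fst (inv_into (UNIV \<times> U) ?m w)) (snd (inv_into (UNIV \<times> U) ?m w)))" for w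
    have "(J \<times> UNIV) \<inter> (UNIV \<times> U) = J \<times> U" "?m ` (J \<times> U) = J \<times> \<phi> ` U" by (auto simp: map_prod_def image_iff split_beta)
    then have sk: "smooth_on (J \<times> \<phi> ` U) k"
      using smooth_fun_chart[OF sK prod_atlasI[OF std U(1)]] by (simp add: k_def[abs_def])
    have k_eq: "k (s, \<phi> y) = f (H s y)" if "y \<in> U" for s y
      using that pc(2)[of "(s, \<phi> y)"] chart_inv[OF cU that] chart_inv[OF cid, of s] by (simp add: k_def)
    define K where "K z = frechet_derivative k (at (fst z, \<phi> (snd z))) (1, 0)" for z
    have "continuous_on (J \<times> U) K"
      unfolding K_def
      by (rule continuous_on_compose2[OF smooth_on_continuous[OF smooth_on_frechet[OF sk]]])
        (auto intro!: continuous_intros continuous_on_compose2[OF chart_continuous[OF cU]])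
    moreover have "((\<lambda>s. f (H s y)) has_real_derivative K (t, y)) (at t)" if "t \<in> J" "y \<in> U" for t y
    proof -
      have "(t, \<phi> y) \<in> J \<times> \<phi> ` U" using that by simp
      note d = smooth_on_has_derivative[OF sk this]
      have "((\<lambda>s. (s, \<phi> y)) has_vector_derivative (1, 0)) (at t)"
        by (intro has_vector_derivative_Pair has_vector_derivative_const) (rule has_vector_derivative_id)
      from has_vector_derivative_chain[where p="\<lambda>s. (s, \<phi> y)", OF d this]
      show ?thesis by (simp add: k_eq[OF that(2)] K_def has_real_derivative_iff_has_vector_derivative)
    qed
    ultimately show ?thesis using U(2) chart_open[OF cU] by (intro exI[of _ U] exI[of _ K]) auto
  qed
  have D_eq: "D f t y = K (t, y)" if "((\<lambda>s. f (H s y)) has_real_derivative K (t, y)) (at t)" for K t y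
    unfolding D_def by (rule DERIV_imp_deriv[OF that])
  show "((\<lambda>s. f (H s x)) has_real_derivative D f t x) (at t)" if "t \<in> J" for t x
  proof -
    obtain V K where "x \<in> V" "\<forall>t\<in>J. \<forall>y\<in>V. ((\<lambda>s. f (H s y)) has_real_derivative K (t, y)) (at t)" using *[of x] by blast
    then show ?thesis using D_eq[of x K t] that by simp
  qed
  show "continuous_on (J \<times> UNIV) (\<lambda>z. D f (fst z) (snd z))"
  proof (rule continuous_at_imp_continuous_on, intro ballI)
    fix z assume z: "z \<in> J \<times> (UNIV :: 'm set)"
    obtain V K where V: "open V" "snd z \<in> V" "continuous_on (J \<times> V) K"
      "\<forall>t\<in>J. \<forall>y\<in>V. ((\<lambda>s. f (H s y)) has_real_derivative K (t, y)) (at t)" using *[of "snd z"] by blast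
    have o: "open (J \<times> V)" using J(1) V(1) by (rule open_Times)
    have "continuous_on (J \<times> V) (\<lambda>z. D f (fst z) (snd z))"
    proof (rule continuous_on_cong[THEN iffD1, OF refl _ V(3)])
      fix w assume "w \<in> J \<times> V"
      then have "((\<lambda>s. f (H s (snd w))) has_real_derivative K (fst w, snd w)) (at (fst w))" using V(4) by (metis mem_Times_iff)
      from D_eq[where K=K and t="fst w" and y="snd w", OF this] show "K w = D f (fst w) (snd w)" by simp
    qed
    moreover have "z \<in> J \<times> V" using z V(2) by (simp add: mem_Times_iff)
    ultimately show "isCont (\<lambda>z. D f (fst z) (snd z)) z" by (rule continuous_on_interior[OF _ subsetD[OF interior_open[OF o, THEN equalityD2]]])
  qed
qed

text \<open>The velocity field of the isotopy is frozen at time \<open>t\<close>, so that one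
  admissibility threshold serves all starting times \<open>s\<close> near \<open>t\<close>.\<close>

lemma step_local:
  assumes t: "t \<in> {0..1}" and \<eta>: "\<eta> > 0"
  obtains \<rho> \<delta>0 where "\<rho> > 0" "\<delta>0 > 0"
    "\<And>s \<delta>. \<bar>s - t\<bar> < \<rho> \<Longrightarrow> 0 < \<delta> \<Longrightarrow> \<delta> < \<delta>0 \<Longrightarrow> \<exists>P\<in>GG. \<forall>x. dF (P (H s x)) (H (s + \<delta>) x) \<le> \<eta> * \<delta>"
proof -
  have tJ: "t \<in> J" using t J(2) by auto
  obtain G where G: "smooth_map_on UNIV A A G" "\<And>x. G (H t x) = x" "\<And>x. H t (G x) = x" using H_inverse[OF t] by metis
  have cG: "continuous_on UNIV G" by (rule smooth_map_on_continuous[OF G(1)])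
  \<comment> \<open>The velocity at the point \<open>y\<close> that the isotopy occupies at time
    \<open>t\<close>, hence \<open>G\<close>; the value 0 on non-smooth functions is the convention
    of \<open>tangent_space\<close>.\<close>
  define X where "X y = (\<lambda>f. if f \<in> smooth_functions A then D f t (G y) else 0)" for y
  note dD = D_props(1)[OF _ tJ]
  have X: "X y \<in> tangent_space A y" for y
    unfolding tangent_space_def mem_Collect_eq
  proof (intro conjI ballI allI impI)
    fix f h assume f: "f \<in> smooth_functions A" and h: "h \<in> smooth_functions A"
    note df = dD[OF f, of "G y"] and dh = dD[OF h, of "G y"]
    show "X y (\<lambda>y. f y + h y) = X y f + X y h"
      using DERIV_unique[OF dD[OF smooth_functions_add[OF A f h]] DERIV_add[OF df dh]] by (simp add: X_def f h smooth_functions_add[OF A])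
    show "X y (\<lambda>y. f y * h y) = f y * X y h + X y f * h y"
      using DERIV_unique[OF dD[OF smooth_functions_mult[OF A f h]] DERIV_mult[OF df dh]]
      by (simp add: X_def f h smooth_functions_mult[OF A] G(3))
  next
    fix a f assume f: "f \<in> smooth_functions A"
    show "X y (\<lambda>y. a * f y) = a * X y f"
      using DERIV_unique[OF dD[OF smooth_functions_cmult[OF A f]] DERIV_cmult[OF dD[OF f, of "G y"]]]
      by (simp add: X_def f smooth_functions_cmult[OF A])
  qed (simp add: X_def)
  have fs: "f \<in> smooth_functions A" if "f \<in> FF" for f using that FF(2) by blast
  have cD: "continuous_on S (\<lambda>z. D f (a z) (b z))" if "f \<in> FF" "continuous_on S a" "continuous_on S b" "a ` S \<subseteq> J"
    for S :: "'z::topological_space set" and f a b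
    using continuous_on_compose2[OF D_props(2)[OF fs[OF that(1)]] continuous_on_Pair[OF that(2,3)]] that(4) by auto
  have cX: "cfield FF X"
    unfolding cfield_FF X_def using fs tJ by (auto intro!: cD cG)
  have adm: "admissible FF X" by (rule admissible_tangent_field[OF FF X cX])
  \<comment> \<open>Three errors per test function: the admissibility error, the base point
    \<open>H s x\<close> in place of \<open>H t x\<close>, and the intermediate time in place of
    \<open>t\<close>. The added 1 avoids division by zero.\<close>
  define e where "e = \<eta> / (3 * (real (card FF) + 1))"
  have e: "e > 0" using \<eta> by (simp add: e_def)
  obtain \<delta>1 where \<delta>1: "\<delta>1 > 0" "\<And>\<delta>. 0 < \<delta> \<and> \<delta> < \<delta>1 \<Longrightarrow> \<exists>P\<in>GG. \<forall>x. \<forall>f\<in>FF. \<bar>f (P x) - f x - \<delta> * X x f\<bar> \<le> e * \<delta>"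
    by (rule admissibleD[OF FF adm e]) blast
  define E1 where "E1 z = (\<Sum>f\<in>FF. \<bar>D f t (G (H (fst z) (snd z))) - D f t (snd z)\<bar>)" for z
  define E2 where "E2 z = (\<Sum>f\<in>FF. \<bar>D f (fst z) (snd z) - D f t (snd z)\<bar>)" for z
  have "continuous_on (J \<times> UNIV) E1" "continuous_on (J \<times> UNIV) E2"
    unfolding E1_def E2_def using tJ
    by (intro continuous_on_sum continuous_on_rabs continuous_on_diff cD continuous_on_compose2[OF cG H_continuous] continuous_intros; auto)+
  note cE = this
  \<comment> \<open>\<open>E1\<close> and \<open>E2\<close> vanish at time \<open>t\<close>;
    compactness of the manifold makes them small for all points simultaneously.\<close>
  obtain X1 where X1: "t \<in> X1" "open X1" "\<forall>s\<in>X1 \<inter> J. \<forall>x\<in>UNIV. dist (E1 (s, x)) (E1 (t, x)) \<le> e"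
    by (rule continuous_on_prod_compactE[OF cE(1) compact_UNIV tJ e]) blast
  obtain X2 where X2: "t \<in> X2" "open X2" "\<forall>s\<in>X2 \<inter> J. \<forall>x\<in>UNIV. dist (E2 (s, x)) (E2 (t, x)) \<le> e"
    by (rule continuous_on_prod_compactE[OF cE(2) compact_UNIV tJ e]) blast
  have "open (X1 \<inter> X2 \<inter> J)" "t \<in> X1 \<inter> X2 \<inter> J" using X1 X2 J(1) tJ by auto
  then obtain r where r: "r > 0" "ball t r \<subseteq> X1 \<inter> X2 \<inter> J" using open_contains_ball by blast
  have E0: "E1 (t, x) = 0" "E2 (t, x) = 0" for x by (simp_all add: E1_def E2_def G(2))
  have small: "s \<in> J" "f \<in> FF \<Longrightarrow> \<bar>D f t (G (H s x)) - D f t x\<bar> \<le> e" "f \<in> FF \<Longrightarrow> \<bar>D f s x - D f t x\<bar> \<le> e"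
    if s: "\<bar>s - t\<bar> < r" for s f x
  proof -
    have sX: "s \<in> X1 \<inter> X2 \<inter> J" using r(2) s by (auto simp: dist_real_def abs_minus_commute subset_iff)
    then show "s \<in> J" by simp
    have "dist (E1 (s, x)) (E1 (t, x)) \<le> e" "dist (E2 (s, x)) (E2 (t, x)) \<le> e" using X1(3) X2(3) sX by blast+
    then have "E1 (s, x) \<le> e" "E2 (s, x) \<le> e" unfolding E0 by (simp_all add: dist_real_def)
    moreover have "\<bar>D f t (G (H s x)) - D f t x\<bar> \<le> E1 (s, x)" "\<bar>D f s x - D f t x\<bar> \<le> E2 (s, x)" if f: "f \<in> FF"
      using member_le_sum[OF f _ FF(1), of "\<lambda>f. \<bar>D f t (G (H s x)) - D f t x\<bar>"]
        member_le_sum[OF f _ FF(1), of "\<lambda>f. \<bar>D f s x - D f t x\<bar>"] by (simp_all add: E1_def E2_def)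
    ultimately show "f \<in> FF \<Longrightarrow> \<bar>D f t (G (H s x)) - D f t x\<bar> \<le> e" "f \<in> FF \<Longrightarrow> \<bar>D f s x - D f t x\<bar> \<le> e" by force+
  qed
  have "\<exists>P\<in>GG. \<forall>x. dF (P (H s x)) (H (s + \<delta>) x) \<le> \<eta> * \<delta>" if s: "\<bar>s - t\<bar> < r / 2" and \<delta>: "0 < \<delta>" "\<delta> < min \<delta>1 (r / 2)" for s \<delta>
  proof -
    obtain P where P: "P \<in> GG" "\<And>x f. f \<in> FF \<Longrightarrow> \<bar>f (P x) - f x - \<delta> * X x f\<bar> \<le> e * \<delta>" using \<delta>1(2)[of \<delta>] \<delta> by auto
    have "dF (P (H s x)) (H (s + \<delta>) x) \<le> \<eta> * \<delta>" for x
    proof -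
      have "dF (P (H s x)) (H (s + \<delta>) x) \<le> (\<Sum>f\<in>FF. 3 * e * \<delta>)"
        unfolding dF_eq
      proof (rule sum_mono)
        fix f assume f: "f \<in> FF"
        let ?z = "H s x"
        have near: "\<bar>r' - t\<bar> < r" if "s \<le> r'" "r' \<le> s + \<delta>" for r'
        proof -
          have "\<delta> < r / 2" "s - t < r / 2" "t - s < r / 2" using s \<delta> abs_ge_self[of "s - t"] abs_ge_minus_self[of "s - t"] by linarith+
          then have "r' - t < r" "t - r' < r" using that r(1) by linarith+
          then show ?thesis by (simp add: abs_less_iff)
        qed
        have "\<exists>z>s. z < s + \<delta> \<and> f (H (s + \<delta>) x) - f (H s x) = (s + \<delta> - s) * D f z x"
          by (rule MVT2) (use \<delta> in \<open>auto intro!: D_props(1)[OF fs[OF f]] small(1) near\<close>)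
        then obtain z where z: "s < z" "z < s + \<delta>" "f (H (s + \<delta>) x) - f ?z = \<delta> * D f z x" by auto
        have "\<bar>\<delta> * (D f t (G ?z) - D f t x)\<bar> \<le> \<delta> * e" "\<bar>\<delta> * (D f z x - D f t x)\<bar> \<le> \<delta> * e"
          unfolding abs_mult using small(2)[of s f x] small(3)[of z f x] f near[of s] near[of z] z \<delta> by (intro mult_mono; simp)+
        moreover have "\<bar>f (P ?z) - f ?z - \<delta> * D f t (G ?z)\<bar> \<le> e * \<delta>" using P(2)[OF f, of ?z] fs[OF f] by (simp add: X_def)
        moreover have "f (P ?z) - f (H (s + \<delta>) x) = (f (P ?z) - f ?z - \<delta> * D f t (G ?z)) + \<delta> * (D f t (G ?z) - D f t x) - \<delta> * (D f z x - D f t x)"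
          using z(3) by (simp add: algebra_simps)
        moreover have "\<bar>a + b - c\<bar> \<le> 3 * m" if "\<bar>a\<bar> \<le> m" "\<bar>b\<bar> \<le> m" "\<bar>c\<bar> \<le> m" for a b c m :: real using that by linarith
        ultimately show "\<bar>f (P ?z) - f (H (s + \<delta>) x)\<bar> \<le> 3 * e * \<delta>" by (simp only: mult.assoc mult.commute[of \<delta> e])
      qed
      also have "\<dots> = real (card FF) * (3 * e) * \<delta>" by simp
      also have "\<dots> \<le> \<eta> * \<delta>" using \<delta> \<eta> by (intro mult_right_mono) (auto simp: e_def field_simps)
      finally show ?thesis .
    qed
    then show ?thesis using P(1) by blast
  qed
  then show ?thesis using that[of "r / 2" "min \<delta>1 (r / 2)"] r(1) \<delta>1(1) by simp
qed

text \<open>The threshold found so far depends on the time at which the field is frozen; finitely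
  many frozen times cover the unit interval.\<close>

lemma step_uniform:
  assumes \<eta>: "\<eta> > 0"
  obtains \<delta>0 where "\<delta>0 > 0"
    "\<And>s \<delta>. s \<in> {0..1} \<Longrightarrow> 0 < \<delta> \<Longrightarrow> \<delta> < \<delta>0 \<Longrightarrow> \<exists>P\<in>GG. \<forall>x. dF (P (H s x)) (H (s + \<delta>) x) \<le> \<eta> * \<delta>"
proof -
  let ?Q = "\<lambda>s \<delta>. \<exists>P\<in>GG. \<forall>x. dF (P (H s x)) (H (s + \<delta>) x) \<le> \<eta> * \<delta>"
  let ?P = "\<lambda>t \<rho> \<delta>0. \<rho> > 0 \<and> \<delta>0 > 0 \<and> (\<forall>s \<delta>. \<bar>s - t\<bar> < \<rho> \<longrightarrow> 0 < \<delta> \<longrightarrow> \<delta> < \<delta>0 \<longrightarrow> ?Q s \<delta>)"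
  have "\<forall>t\<in>{0..1}. \<exists>\<rho> \<delta>0. ?P t \<rho> \<delta>0"
  proof
    fix t :: real assume "t \<in> {0..1}"
    then show "\<exists>\<rho> \<delta>0. ?P t \<rho> \<delta>0" by (rule step_local[OF _ \<eta>]) blast
  qed
  from bchoice[OF this] obtain \<rho> where "\<forall>t\<in>{0..1}. \<exists>\<delta>0. ?P t (\<rho> t) \<delta>0" ..
  from bchoice[OF this] obtain \<delta> where \<rho>: "\<forall>t\<in>{0..1}. ?P t (\<rho> t) (\<delta> t)" ..
  obtain F where F: "F \<subseteq> {0..1}" "finite F" "{0..1} \<subseteq> (\<Union>t\<in>F. ball t (\<rho> t))"
    by (rule compactE_image[of "{0..1::real}" "{0..1}" "\<lambda>t. ball t (\<rho> t)"]) (use \<rho> in auto)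
  define \<delta>0 where "\<delta>0 = Min (insert 1 (\<delta> ` F))"
  have "\<delta>0 > 0" using F \<rho> by (auto simp: \<delta>0_def)
  moreover have "?Q s d" if s: "s \<in> {0..1}" and d: "0 < d" "d < \<delta>0" for s d
  proof -
    obtain t where t: "t \<in> F" "s \<in> ball t (\<rho> t)" using F(3) s by blast
    have "\<delta>0 \<le> \<delta> t" unfolding \<delta>0_def using F(2) t(1) by simp
    then show ?thesis using \<rho> t F(1) d by (auto simp: dist_real_def abs_minus_commute)
  qed
  ultimately show ?thesis by (rule that)
qed

text \<open>Errors are measured in the pulled-back points \<open>H\<^sub>t\<^sup>-\<^sup>1(P x)\<close>, where they simply add up.\<close>

lemma isotopy_approx:
  assumes H0: "H 0 = id" and \<epsilon>: "\<epsilon> > 0"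
  obtains P where "P \<in> GG" "\<And>x. dF (H 1 x) (P x) < \<epsilon>"
proof -
  have one: "(1::real) \<in> {0..1}" by simp
  have c1: "continuous_on UNIV (H 1)"
    using bspec[OF H_diff one]  smooth_map_on_continuous unfolding diffeomorphism_def by blast
  \<comment> \<open>The accumulated error is known for pulled-back points; uniform continuity of
    \<open>H 1\<close> alone converts it into an error of the final images.\<close>
  let ?\<rho> = "\<lambda>z. dF (H 1 (fst z)) (H 1 (snd z))"
  have c\<rho>: "continuous_on UNIV ?\<rho>"
    by (intro d_continuous[OF FF] continuous_on_compose2[OF c1] continuous_intros) auto
  have \<rho>0: "?\<rho> (x, x) = 0" for x by (simp add: dF_eq)
  obtain \<epsilon>' where \<epsilon>': "\<epsilon>' > 0" "\<And>x y. dF x y < \<epsilon>' \<Longrightarrow> dF (H 1 x) (H 1 y) < \<epsilon>"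
    by (rule d_uniform[OF FF c\<rho> \<rho>0 \<epsilon>]) simp_all
  obtain C where C: "C > 0" "\<And>t x y. t \<in> {0..1} \<Longrightarrow> dF x y \<le> C * dF (H t x) (H t y)" by (rule H_lower_bound) blast
  \<comment> \<open>The \<open>n\<close> steps of length \<open>1 / n\<close> contribute
    \<open>C * \<eta>\<close> in total, which is half of \<open>\<epsilon>'\<close>.\<close>
  define \<eta> where "\<eta> = \<epsilon>' / (2 * C)"
  have \<eta>: "\<eta> > 0" using \<epsilon>' C by (simp add: \<eta>_def)
  obtain \<delta>0 where \<delta>0: "\<delta>0 > 0"
    "\<And>s \<delta>. s \<in> {0..1} \<Longrightarrow> 0 < \<delta> \<Longrightarrow> \<delta> < \<delta>0 \<Longrightarrow> \<exists>P\<in>GG. \<forall>x. dF (P (H s x)) (H (s + \<delta>) x) \<le> \<eta> * \<delta>"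
    by (rule step_uniform[OF \<eta>]) blast
  obtain n :: nat where n: "1 / \<delta>0 < real n" using reals_Archimedean2 by blast
  have n0: "real n > 0" using n \<delta>0(1) by (smt (verit) divide_pos_pos)
  define \<delta> where "\<delta> = 1 / real n"
  have \<delta>: "0 < \<delta>" "\<delta> < \<delta>0" using n n0 \<delta>0(1) by (auto simp: \<delta>_def field_simps)
  have "\<exists>Q\<in>GG. \<forall>x. \<exists>z. Q x = H (real k * \<delta>) z \<and> dF z x \<le> C * \<eta> * (real k * \<delta>)" if "k \<le> n" for k
    using that
  proof (induction k)
    case 0
    have "\<forall>x. \<exists>z. id x = H (real 0 * \<delta>) z \<and> dF z x \<le> C * \<eta> * (real 0 * \<delta>)" by (simp add: H0 dF_eq)
    then show ?case using GG_id by blast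
  next
    case (Suc k)
    then obtain Q where Q: "Q \<in> GG" "\<And>x. \<exists>z. Q x = H (real k * \<delta>) z \<and> dF z x \<le> C * \<eta> * (real k * \<delta>)" by auto
    have kk: "real k * \<delta> \<in> {0..1}" "real (Suc k) * \<delta> \<in> {0..1}" using Suc.prems n0 by (auto simp: \<delta>_def field_simps)
    obtain P where P: "P \<in> GG" "\<And>x. dF (P (H (real k * \<delta>) x)) (H (real k * \<delta> + \<delta>) x) \<le> \<eta> * \<delta>" using \<delta>0(2)[OF kk(1) \<delta>] by blast
    obtain G where G: "\<And>x. H (real (Suc k) * \<delta>) (G x) = x" using H_inverse[OF kk(2)] by metis
    have "\<exists>z. (P \<circ> Q) x = H (real (Suc k) * \<delta>) z \<and> dF z x \<le> C * \<eta> * (real (Suc k) * \<delta>)" for x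
    proof -
      obtain z where z: "Q x = H (real k * \<delta>) z" "dF z x \<le> C * \<eta> * (real k * \<delta>)" using Q(2) by blast
      \<comment> \<open>The step error is made at time \<open>(k + 1) * \<delta>\<close> and pulled
        back there, at the cost of the factor \<open>C\<close>. The old discrepancy
        \<open>dF z x\<close> is carried over unchanged, so no Lipschitz constant of
        \<open>P\<close> or \<open>Q\<close> enters.\<close>
      let ?y = "G (P (Q x))"
      have "dF ?y z \<le> C * dF (H (real (Suc k) * \<delta>) ?y) (H (real (Suc k) * \<delta>) z)" by (rule C(2)[OF kk(2)])
      also have "\<dots> \<le> C * (\<eta> * \<delta>)" using P(2)[of z] C(1) unfolding G z(1) by (intro mult_left_mono) (simp_all add: algebra_simps)
      finally have "dF ?y x \<le> C * \<eta> * (real (Suc k) * \<delta>)" using d_triangle[OF FF, of ?y x z] z(2) by (simp add: algebra_simps)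
      then show ?thesis using G by (intro exI[of _ ?y]) simp
    qed
    then show ?case using GG_comp[OF P(1) Q(1)] by blast
  qed
  from this[of n] obtain Q where Q: "Q \<in> GG" "\<And>x. \<exists>z. Q x = H 1 z \<and> dF z x \<le> C * \<eta>" using n0 by (auto simp: \<delta>_def)
  have "dF (H 1 x) (Q x) < \<epsilon>" for x
  proof -
    obtain z where z: "Q x = H 1 z" "dF z x \<le> C * \<eta>" using Q(2) by blast
    have "C * \<eta> < \<epsilon>'" using C(1) \<epsilon>'(1) by (simp add: \<eta>_def)
    then have "dF x z < \<epsilon>'" using z(2) d_commute[OF FF, of z x] by simp
    then show ?thesis using \<epsilon>'(2) z(1) by simp
  qed
  then show ?thesis using that[OF Q(1)] by blast
qed

end

subsection \<open>The compact-open topology\<close>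

text \<open>Uniform closeness in \<open>d\<close> is finer than the compact-open topology. The
  induction follows the generation of open sets from the subbasis; finite intersections take the
  smaller radius.\<close>

lemma compact_open_nbhd:
  assumes FF: "finite FF" "FF \<subseteq> smooth_functions A" "\<forall>x y. (\<forall>f\<in>FF. f x = f y) \<longrightarrow> x = y"
    and F: "continuous_on UNIV F" and W: "openin compact_open_topology W" "F \<in> W"
  obtains \<epsilon> where "\<epsilon> > 0" "\<And>P :: 'm \<Rightarrow> 'm. continuous_on UNIV P \<Longrightarrow> \<forall>x. d FF (F x) (P x) < \<epsilon> \<Longrightarrow> P \<in> W"
proof -
  let ?S = "{{f::'m \<Rightarrow> 'm. continuous_on UNIV f \<and> f ` K \<subseteq> U} | K U. compact K \<and> open U}"
  let ?Q = "\<lambda>W \<epsilon>. \<epsilon> > 0 \<and> (\<forall>P. continuous_on UNIV P \<longrightarrow> (\<forall>x. d FF (F x) (P x) < \<epsilon>) \<longrightarrow> P \<in> W)"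
  have "generate_topology_on ?S W" using W(1) unfolding compact_open_topology_def openin_topology_generated_by_iff .
  then have "F \<in> W \<longrightarrow> (\<exists>\<epsilon>. ?Q W \<epsilon>)"
  proof (induction W rule: generate_topology_on.induct)
    case (Int a b)
    show ?case
    proof
      assume "F \<in> a \<inter> b"
      then obtain e1 e2 where e: "?Q a e1" "?Q b e2" using Int by auto
      show "\<exists>\<epsilon>. ?Q (a \<inter> b) \<epsilon>" by (rule exI[of _ "min e1 e2"]) (use e in auto)
    qed
  next
    case (UN K)
    show ?case
    proof
      assume "F \<in> \<Union>K"
      then obtain k where k: "k \<in> K" "F \<in> k" by blast
      from mp[OF UN.IH[OF k(1)] k(2)] obtain e where "?Q k e" ..
      then show "\<exists>\<epsilon>. ?Q (\<Union>K) \<epsilon>" using k(1) by (intro exI[of _ e]) auto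
    qed
  next
    case (Basis s)
    then obtain K U where s: "s = {f. continuous_on UNIV f \<and> f ` K \<subseteq> U}" "compact K" "open U" by blast
    show ?case
    proof
      assume "F \<in> s"
      then have FK: "F ` K \<subseteq> U" by (simp add: s(1))
      \<comment> \<open>The compact product of the image of \<open>K\<close> and the complement of
        \<open>U\<close> misses the diagonal, so \<open>d\<close> is bounded below on it; a map
        closer than that cannot leave \<open>U\<close> on \<open>K\<close>.\<close>
      have "compact (- U)" using compact_Int_closed[OF compact_UNIV, of "- U"] s(3) by auto
      then have "compact (F ` K \<times> - U)"
        by (intro compact_Times compact_continuous_image continuous_on_subset[OF F] s(2)) auto
      then obtain e where e: "e > 0" "\<And>x y. (x, y) \<in> F ` K \<times> - U \<Longrightarrow> e \<le> d FF x y"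
        by (rule d_lower_bound[OF FF]) (use FK in auto)
      have "P \<in> s" if P: "continuous_on UNIV P" "\<forall>x. d FF (F x) (P x) < e" for P
      proof -
        have "P x \<in> U" if "x \<in> K" for x
        proof (rule ccontr)
          assume "P x \<notin> U"
          then have "e \<le> d FF (F x) (P x)" using that by (intro e(2)) auto
          then show False using P(2) by (meson not_le)
        qed
        then show ?thesis using P(1) by (auto simp: s(1))
      qed
      then show "\<exists>\<epsilon>. ?Q s \<epsilon>" using e(1) by blast
    qed
  qed simp
  then show ?thesis using W(2) that by blast
qed

lemma Diff0_continuous: "F \<in> Diff0 A \<Longrightarrow> continuous_on UNIV F"
  unfolding Diff0_def diffeomorphism_def using smooth_map_on_continuous by blast

theorem GG_dense: "subtopology compact_open_topology (Diff0 A) closure_of GG = Diff0 A"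
proof
  show "subtopology compact_open_topology (Diff0 A) closure_of GG \<subseteq> Diff0 A"
    using closure_of_subset_topspace[of "subtopology compact_open_topology (Diff0 A)" GG] by simp
  show "Diff0 A \<subseteq> subtopology compact_open_topology (Diff0 A) closure_of GG"
  proof
    fix F assume F: "F \<in> Diff0 A"
    note cF = Diff0_continuous[OF F]
    \<comment> \<open>For the empty compact set the subbasic open set consists of all continuous
      maps.\<close>
    have "F \<in> topspace compact_open_topology"
      unfolding compact_open_topology_def topology_generated_by_topspace using cF
      by (intro UnionI[of "{f. continuous_on UNIV f \<and> f ` {} \<subseteq> UNIV}"]) auto
    moreover have "\<exists>P\<in>GG. P \<in> W" if W: "F \<in> W" "openin (subtopology compact_open_topology (Diff0 A)) W" for W
    proof -
      obtain W' where W': "openin compact_open_topology W'" "W = W' \<inter> Diff0 A" using W(2) unfolding openin_subtopology by blast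
      obtain FF where FF: "finite FF" "FF \<subseteq> smooth_functions A" "\<forall>x y. (\<forall>f\<in>FF. f x = f y) \<longrightarrow> x = y"
        "\<And>x. \<exists>U \<phi> V. (U, \<phi>) \<in> A \<and> open V \<and> x \<in> V \<and> V \<subseteq> U \<and>
          (\<forall>y\<in>V. \<forall>z\<in>V. norm (\<phi> y - \<phi> z) \<le> real DIM('e) * (\<Sum>f\<in>FF. \<bar>f y - f z\<bar>))"
        by (rule separating_family) blast
      have FW: "F \<in> W'" using W(1) W'(2) by simp
      obtain \<epsilon> where \<epsilon>: "\<epsilon> > 0" "\<And>P :: 'm \<Rightarrow> 'm. continuous_on UNIV P \<Longrightarrow> \<forall>x. d FF (F x) (P x) < \<epsilon> \<Longrightarrow> P \<in> W'"
        by (rule compact_open_nbhd[OF FF(1-3) cF W'(1) FW]) blast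
      have "isotopic_to_id A F" using F by (simp add: Diff0_def)
      then obtain H :: "real \<Rightarrow> 'm \<Rightarrow> 'm" and J where J: "open J" "{0..1} \<subseteq> J"
        and H: "smooth_map_on (J \<times> UNIV) (prod_atlas std_atlas A) A (\<lambda>(t, x). H t x)"
          "\<forall>t\<in>{0..1}. diffeomorphism A (H t)" "H 0 = id" "H 1 = F"
        unfolding isotopic_to_id_def by blast
      obtain P where P: "P \<in> GG" "\<And>x. d FF (H 1 x) (P x) < \<epsilon>"
        by (rule isotopy_approx[OF FF J H(1,2,3) \<epsilon>(1)]) blast
      have "P \<in> Diff0 A" using P(1) GG_Diff0 by blast
      then have "P \<in> W" using \<epsilon>(2)[OF Diff0_continuous] P(2) H(4) W'(2) by simp
      then show ?thesis using P(1) by blast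
    qed
    ultimately show "F \<in> subtopology compact_open_topology (Diff0 A) closure_of GG"
      unfolding in_closure_of using F by auto
  qed
qed

end

theorem corollary1:
  fixes A :: "('m::{t2_space,second_countable_topology}, 'e::euclidean_space) chart set"
    and g :: "'m \<Rightarrow> 'm tvector \<Rightarrow> 'm tvector \<Rightarrow> real"
  assumes "smooth_atlas A"
    and "compact (UNIV :: 'm set)"
    and "nondegenerate_form A g"
  shows "subgroup (gradient_flow_compositions A g) (Diff0_group A) \<and>
    subtopology compact_open_topology (Diff0 A) closure_of gradient_flow_compositions A g = Diff0 A"
proof -
  interpret pseudo_riemannian A g using assms by unfold_locales
  show ?thesis by (intro conjI GG_subgroup GG_dense)
qed

end
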